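(* Let $X_\tau$ be a site with a final object $X$, $G$ a finite group, and $A$ an abelian sheaf on $X_\tau$ with a left action of $G$ by automorphisms $\{\phi_g\}_{g\in G}$. Let $i: A^G \to A$ be the inclusion of the sheaf of invariants. (I) Let $y$ be an $A$-torsor that admits a lift of the action on $A$ whose obstruction class in $H^2(G,A(X))$ is zero. If the first group cohomology classes locally vanish for $A$, then $y$ is induced from the invariants. (II) Let $\mathscr{Y}$ be an abelian gerbe banded by $A$ that admits a lift of the action on $A$ whose obstruction class in $H^3(G,A(X))$ is zero. If the first two group cohomology classes locally vanish for $A$, then $\mathscr{Y}$ is induced from the invariants. More concretely: (1) Assume the first group cohomology classes locally vanish for $A$. Let $y$ be an $A$-torsor and let $\{\lambda_g\}_{g\in G}$ be automorphisms of $y$ lifting the $G$-action such that $\chi_\lambda$ is identically zero. Then there exists an $A^G$-torsor $\overline y$ with an $i$-equivariant morphism $f:\overline y\to y$ such that $\lambda_g\circ f=f$ for all $g\in G$; and such an $A^G$-torsor $\overline y$ is unique up to $A^G$-equivariant isomorphism. (2) Assume the first two group cohomology classes locally vanish for $A$. Let $\mathscr Y$ be a gerbe banded by $A$ and let $\{F_g\}_{g\in G}$ be automorphisms of $\mathscr Y$ lifting the $G$-action such that the cohomology class $\kappa_F$ is zero. Then there exists a gerbe $\overline{\mathscr Y}$ banded by $A^G$ with an $i$-equivariant morphism $\Theta:\overline{\mathscr Y}\to\mathscr Y$ such that $\Theta$ and $F_g\circ\Theta$ are $2$-isomorphic for every $g\in G$; and for any such gerbe $\overline{\mathscr Y}$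 there is an $A^G$-equivariant isomorphism $\overline{\mathscr Y}\cong\mathscr Y_{(F,\alpha')}$ for some choice of connecting $2$-isomorphisms $\{\alpha'_{g,h}\}_{g,h\in G}$.
   Context: Abelian sheaves are written additively. A left action of $G$ on $A$ is a family of automorphisms $\phi_g:A\to A$ of abelian sheaves with $\phi_{gh}=\phi_g\circ\phi_h$; write $g\cdot a=\phi_g(a)$. $A^G$ is the sheaf $U\mapsto A(U)^G$. Local vanishing. The $j$-th group cohomology classes locally vanish (for $A$) if for every object $U$ of $X_\tau$ and every class $c\in H^j(G,A(U))$ there is a cover $\{U_k\to U\}$ such that the restriction of $c$ to each $H^j(G,A(U_k))$ is zero. "The first two" means $j=1$ and $j=2$. Torsors. An $A$-torsor is a sheaf of sets $y$ on $X_\tau$ with an action $A\times y\to y$ such that $A(U)$ acts simply transitively on $y(U)$ whenever $y(U)\neq\emptyset$, and every object $U$ has a cover $\{U_k\to U\}$ with all $y(U_k)\ne\emptyset$. For a homomorphism $f:A_1\to A_2$, a morphism $\lambda:y_1\to y_2$ from an $A_1$-torsor to an $A_2$-torsor is $f$-equivariant if $\lambda(a\cdot x)=f(a)\cdot\lambda(x)$; $A^G$-equivariant means $\mathrm{id}_{A^G}$-equivariant. A lift of the action $\{\phi_g\}$ to an $A$-torsor $y$ is a family of morphisms $\lambda_g:y\to y$, with $\lambda_g$ being $\phi_g$-equivariant (no condition $\lambda_{gh}=\lambda_g\lambda_h$ is imposed). Its $2$-cochain $\chi_\lambda$ is defined by $\lambda_g\circ\lambda_h=\chi_\lambda(g,h)\cdot\lambda_{gh}$,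 $\chi_\lambda(g,h)\in A(X)$; it is a $2$-cocycle, and its class in $H^2(G,A(X))$ is the obstruction class. $y$ is induced from the invariants if there are an $A^G$-torsor $\overline y$ and an $i$-equivariant morphism $\overline y\to y$. Gerbes. An abelian gerbe over $X$ is a stack in groupoids over $X_\tau$ in which objects exist locally over every $U$, any two objects over the same $U$ are locally isomorphic, and all automorphism sheaves are abelian. It is banded by $A$ if it is given with isomorphisms $A|_U\cong\mathrm{Aut}(x)$ for all objects $x$ over $U$, compatible with isomorphisms of objects and with restriction. A morphism of gerbes is a morphism of fibered categories over $X_\tau$; it induces a homomorphism of bands, and is $f$-equivariant if this homomorphism is $f$. $2$-morphisms are base-preserving natural transformations. For a morphism $F:\mathscr Y_1\to\mathscr Y_2$ with $\mathscr Y_2$ banded by $A_2$, the group of $2$-automorphisms of $F$ is identified with $A_2(X)$ (a section acts on each $F(x)$ through $A_2|_U\cong\mathrm{Aut}(F(x))$). An action of $G$ on a gerbe $\mathscr Y$ banded by $A$ is a family of morphisms $F_g:\mathscr Y\to\mathscr Y$ such that $F_1$ is $A$-equivariant and $F_{gh}$ is $2$-isomorphic to $F_g\circ F_h$ for all $g,h$. It is a lift of the given action on $A$ if $F_g$ is $\phi_g$-equivariant for all $g$. Choosing connecting $2$-morphisms $\alpha_{g,h}:F_{gh}\to F_g\circ F_h$, the $3$-cochain $\kappa_{(F,\alpha)}$ with values in $A(X)$ is defined by $$(\alpha_{g_1,g_2}\star \mathrm{id}_{F_{g_3}})\circ\alpha_{g_1g_2,g_3}\circ\kappa_{(F,\alpha)}(g_1,g_2,g_3)=(\mathrm{id}_{F_{g_1}}\star\alpha_{g_2,g_3})\circ\alpha_{g_1,g_2g_3}.$$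 It is a $3$-cocycle whose class $\kappa_F\in H^3(G,A(X))$ does not depend on $\alpha$; this is the obstruction class. $\mathscr Y$ is induced from the invariants if there are a gerbe $\overline{\mathscr Y}$ banded by $A^G$ and an $i$-equivariant morphism $\overline{\mathscr Y}\to\mathscr Y$. The category $\mathscr Y_{(F,\alpha)}$: objects are tuples $(U,y,\{\phi_g\}_{g\in G})$ with $U$ an object of $X_\tau$, $y$ an object of $\mathscr Y_U$, and morphisms $\phi_g:y\to F_g(y)$ in $\mathscr Y_U$ (these $\phi_g$ are part of the object, not the action on $A$) with $\alpha_{g,h}(y)\circ\phi_{gh}=F_g(\phi_h)\circ\phi_g$ for all $g,h$; a morphism $(U_1,y_1,\{\phi^1_g\})\to(U_2,y_2,\{\phi^2_g\})$ is a morphism $f:U_1\to U_2$ together with $\lambda:y_1\to y_2$ over $f$ with $\phi^2_g\circ\lambda=F_g(\lambda)\circ\phi^1_g$ for all $g$. It is a stack in groupoids over $X_\tau$. *)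

theory Defs
  imports "HOL-Algebra.Coset" "HOL-Algebra.FiniteProduct"
begin

section \<open>Sites\<close>

record ('o, 'm) category =
  objs :: "'o set"
  arrs :: "'m set"
  src :: "'m \<Rightarrow> 'o"
  tgt :: "'m \<Rightarrow> 'o"
  idt :: "'o \<Rightarrow> 'm"
  cmp :: "'m \<Rightarrow> 'm \<Rightarrow> 'm"  (infixl \<open>\<cdot>\<index>\<close> 70)

definition arrows :: "('o, 'm, 'z) category_scheme \<Rightarrow> 'o \<Rightarrow> 'o \<Rightarrow> 'm set" where
  "arrows C U V = {f \<in> arrs C. src C f = U \<and> tgt C f = V}"

text \<open>Composition is written in the usual order: \<open>g \<cdot> f\<close> is ``first \<open>f\<close>, then \<open>g\<close>''.\<close>

locale category =
  fixes C :: "('o, 'm, 'z) category_scheme" (structure)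
  assumes src_tgt: "f \<in> arrs C \<Longrightarrow> src C f \<in> objs C \<and> tgt C f \<in> objs C"
    and idt: "U \<in> objs C \<Longrightarrow> idt C U \<in> arrows C U U"
    and cmp: "\<lbrakk>f \<in> arrows C U V; g \<in> arrows C V W\<rbrakk> \<Longrightarrow> g \<cdot> f \<in> arrows C U W"
    and idt_left: "f \<in> arrows C U V \<Longrightarrow> idt C V \<cdot> f = f"
    and idt_right: "f \<in> arrows C U V \<Longrightarrow> f \<cdot> idt C U = f"
    and assoc: "\<lbrakk>f \<in> arrows C U V; g \<in> arrows C V W; h \<in> arrows C W Z\<rbrakk>
      \<Longrightarrow> (h \<cdot> g) \<cdot> f = h \<cdot> (g \<cdot> f)"

definition isomorphism :: "('o, 'm, 'z) category_scheme \<Rightarrow> 'm \<Rightarrow> bool" where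
  "isomorphism C f \<longleftrightarrow> f \<in> arrs C \<and>
    (\<exists>g \<in> arrows C (tgt C f) (src C f).
      g \<cdot>\<^bsub>C\<^esub> f = idt C (src C f) \<and> f \<cdot>\<^bsub>C\<^esub> g = idt C (tgt C f))"

definition final_object :: "('o, 'm, 'z) category_scheme \<Rightarrow> 'o \<Rightarrow> bool" where
  "final_object C T \<longleftrightarrow> T \<in> objs C \<and> (\<forall>U \<in> objs C. \<exists>!f. f \<in> arrows C U T)"

definition to_final :: "('o, 'm, 'z) category_scheme \<Rightarrow> 'o \<Rightarrow> 'o \<Rightarrow> 'm" where
  "to_final C T U = (THE f. f \<in> arrows C U T)"

definition commuting_square ::
  "('o, 'm, 'z) category_scheme \<Rightarrow> 'm \<Rightarrow> 'm \<Rightarrow> 'm \<Rightarrow> 'm \<Rightarrow> bool" where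
  "commuting_square C f u p q \<longleftrightarrow>
    f \<in> arrs C \<and> u \<in> arrs C \<and> p \<in> arrs C \<and> q \<in> arrs C \<and> tgt C f = tgt C u \<and>
    src C p = src C q \<and> tgt C p = src C f \<and> tgt C q = src C u \<and> f \<cdot>\<^bsub>C\<^esub> p = u \<cdot>\<^bsub>C\<^esub> q"

text \<open>\<open>p\<close> and \<open>q\<close> are the two projections of a fibre product of \<open>f\<close> and \<open>u\<close>.\<close>

definition fibre_product ::
  "('o, 'm, 'z) category_scheme \<Rightarrow> 'm \<Rightarrow> 'm \<Rightarrow> 'm \<Rightarrow> 'm \<Rightarrow> bool" where
  "fibre_product C f u p q \<longleftrightarrow> commuting_square C f u p q \<and>
    (\<forall>p' q'. commuting_square C f u p' q' \<longrightarrow>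
      (\<exists>!h. h \<in> arrows C (src C p') (src C p) \<and> p \<cdot>\<^bsub>C\<^esub> h = p' \<and> q \<cdot>\<^bsub>C\<^esub> h = q'))"

record ('o, 'm) site = "('o, 'm) category" +
  cov :: "'o \<Rightarrow> 'm set set"

text \<open>
  A category with a Grothendieck (pre)topology. A cover of \<open>U\<close> is a set of arrows with target \<open>U\<close>.
\<close>

locale site = category X for X :: "('o, 'm) site" (structure) +
  assumes cov_arrows: "\<lbrakk>U \<in> objs X; S \<in> cov X U; u \<in> S\<rbrakk> \<Longrightarrow> u \<in> arrs X \<and> tgt X u = U"
    and cov_iso: "isomorphism X f \<Longrightarrow> {f} \<in> cov X (tgt X f)"
    and cov_fibre_product: "\<lbrakk>f \<in> arrs X; S \<in> cov X (tgt X f); u \<in> S\<rbrakk>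
      \<Longrightarrow> \<exists>p q. fibre_product X f u p q"
    and cov_base_change: "\<lbrakk>f \<in> arrs X; S \<in> cov X (tgt X f);
        \<And>u. u \<in> S \<Longrightarrow> \<exists>q. fibre_product X f u (pr u) q\<rbrakk>
      \<Longrightarrow> pr ` S \<in> cov X (src X f)"
    and cov_compose: "\<lbrakk>U \<in> objs X; S \<in> cov X U; \<And>u. u \<in> S \<Longrightarrow> R u \<in> cov X (src X u)\<rbrakk>
      \<Longrightarrow> {u \<cdot> v | u v. u \<in> S \<and> v \<in> R u} \<in> cov X U"

definition sieve :: "('o, 'm, 'z) category_scheme \<Rightarrow> 'm set \<Rightarrow> 'm set" where
  "sieve C S = {u \<cdot>\<^bsub>C\<^esub> p | u p. u \<in> S \<and> p \<in> arrs C \<and> tgt C p = src C u}"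


section \<open>Sheaves\<close>

record ('o, 'm, 's) presheaf =
  sec :: "'o \<Rightarrow> 's set"
  res :: "'m \<Rightarrow> 's \<Rightarrow> 's"

locale presheaf = site X for X :: "('o, 'm) site" (structure) +
  fixes P :: "('o, 'm, 's, 'z) presheaf_scheme"
  assumes res_closed: "\<lbrakk>f \<in> arrows X U V; s \<in> sec P V\<rbrakk> \<Longrightarrow> res P f s \<in> sec P U"
    and res_idt: "\<lbrakk>U \<in> objs X; s \<in> sec P U\<rbrakk> \<Longrightarrow> res P (idt X U) s = s"
    and res_cmp: "\<lbrakk>f \<in> arrows X U V; g \<in> arrows X V W; s \<in> sec P W\<rbrakk>
      \<Longrightarrow> res P (g \<cdot> f) s = res P f (res P g s)"

definition matching_family ::
  "('o, 'm) site \<Rightarrow> ('o, 'm, 's, 'z) presheaf_scheme \<Rightarrow> 'm set \<Rightarrow> ('m \<Rightarrow> 's) \<Rightarrow> bool" where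
  "matching_family X P S s \<longleftrightarrow> (\<forall>u \<in> S. s u \<in> sec P (src X u)) \<and>
    (\<forall>u \<in> S. \<forall>v \<in> S. \<forall>p q. fibre_product X u v p q \<longrightarrow> res P p (s u) = res P q (s v))"

locale sheaf = presheaf +
  assumes glue: "\<lbrakk>U \<in> objs X; S \<in> cov X U; matching_family X P S s\<rbrakk>
      \<Longrightarrow> \<exists>!t. t \<in> sec P U \<and> (\<forall>u \<in> S. res P u t = s u)"

definition sheaf_morphism ::
  "('o, 'm) site \<Rightarrow> ('o, 'm, 's, 'y) presheaf_scheme \<Rightarrow> ('o, 'm, 't, 'z) presheaf_scheme
    \<Rightarrow> ('o \<Rightarrow> 's \<Rightarrow> 't) \<Rightarrow> bool" where
  "sheaf_morphism X P Q l \<longleftrightarrow>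
    (\<forall>U \<in> objs X. \<forall>s \<in> sec P U. l U s \<in> sec Q U) \<and>
    (\<forall>f \<in> arrs X. \<forall>s \<in> sec P (tgt X f). l (src X f) (res P f s) = res Q f (l (tgt X f) s))"

text \<open>
  Groups of sections are groups in the sense of HOL-Algebra, hence written multiplicatively.
\<close>

record ('o, 'm, 'a) abelian_sheaf =
  grp :: "'o \<Rightarrow> 'a monoid"
  gres :: "'m \<Rightarrow> 'a \<Rightarrow> 'a"

definition sets_of :: "('o, 'm, 'a) abelian_sheaf \<Rightarrow> ('o, 'm, 'a) presheaf" where
  "sets_of A = \<lparr>sec = \<lambda>U. carrier (grp A U), res = gres A\<rparr>"

locale abelian_sheaf = sheaf X "sets_of A"
  for X :: "('o, 'm) site" (structure) and A :: "('o, 'm, 'a) abelian_sheaf" +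
  assumes grp: "U \<in> objs X \<Longrightarrow> comm_group (grp A U)"
    and gres_hom: "f \<in> arrows X U V \<Longrightarrow> gres A f \<in> hom (grp A V) (grp A U)"

locale sheaf_action = group G + abelian_sheaf X A
  for X :: "('o, 'm) site" and G :: "'g monoid" and A :: "('o, 'm, 'a) abelian_sheaf" +
  fixes \<phi> :: "'g \<Rightarrow> 'o \<Rightarrow> 'a \<Rightarrow> 'a"
  assumes action_iso: "\<lbrakk>g \<in> carrier G; U \<in> objs X\<rbrakk> \<Longrightarrow> \<phi> g U \<in> iso (grp A U) (grp A U)"
    and action_morphism: "g \<in> carrier G \<Longrightarrow> sheaf_morphism X (sets_of A) (sets_of A) (\<phi> g)"
    and action_mult: "\<lbrakk>g \<in> carrier G; h \<in> carrier G; U \<in> objs X; a \<in> carrier (grp A U)\<rbrakk>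
      \<Longrightarrow> \<phi> (g \<otimes>\<^bsub>G\<^esub> h) U a = \<phi> g U (\<phi> h U a)"

definition invariants ::
  "'g monoid \<Rightarrow> ('o, 'm, 'a) abelian_sheaf \<Rightarrow> ('g \<Rightarrow> 'o \<Rightarrow> 'a \<Rightarrow> 'a) \<Rightarrow> ('o, 'm, 'a) abelian_sheaf" where
  "invariants G A \<phi> =
    \<lparr>grp = \<lambda>U. (grp A U)\<lparr>carrier := {a \<in> carrier (grp A U). \<forall>g \<in> carrier G. \<phi> g U a = a}\<rparr>,
     gres = gres A\<rparr>"

text \<open>Both the inclusion of the invariants and the identity of a sheaf.\<close>

definition inclusion :: "'o \<Rightarrow> 'a \<Rightarrow> 'a" where
  "inclusion U a = a"


section \<open>Group cohomology\<close>

text \<open>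
  Inhomogeneous cochains of \<open>G\<close> with values in an abelian group \<open>M\<close> on which \<open>g\<close> acts by \<open>act g\<close>.
  An \<open>n\<close>-tuple of group elements is a list of length \<open>n\<close>.
\<close>

definition tuples :: "'g monoid \<Rightarrow> nat \<Rightarrow> 'g list set" where
  "tuples G n = {gs. length gs = n \<and> set gs \<subseteq> carrier G}"

definition cochain_group :: "'g monoid \<Rightarrow> 'a monoid \<Rightarrow> nat \<Rightarrow> ('g list \<Rightarrow> 'a) monoid" where
  "cochain_group G M n =
    \<lparr>carrier = tuples G n \<rightarrow>\<^sub>E carrier M,
     mult = \<lambda>c d. \<lambda>gs \<in> tuples G n. c gs \<otimes>\<^bsub>M\<^esub> d gs,
     one = \<lambda>gs \<in> tuples G n. \<one>\<^bsub>M\<^esub>\<rparr>"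

text \<open>Replaces the neighbours \<open>gs ! i\<close> and \<open>gs ! (i + 1)\<close> by their product.\<close>

definition contract :: "'g monoid \<Rightarrow> nat \<Rightarrow> 'g list \<Rightarrow> 'g list" where
  "contract G i gs = take i gs @ (gs ! i \<otimes>\<^bsub>G\<^esub> gs ! (i + 1)) # drop (i + 2) gs"

text \<open>
  Additively, and with indices starting at 1:
  \<open>(dc)(g\<^sub>1,\<dots>,g\<^sub>n\<^sub>+\<^sub>1) = g\<^sub>1 c(g\<^sub>2,\<dots>,g\<^sub>n\<^sub>+\<^sub>1)
    + \<Sum>\<^sub>i (-1)\<^sup>i c(g\<^sub>1,\<dots>,g\<^sub>i g\<^sub>i\<^sub>+\<^sub>1,\<dots>,g\<^sub>n\<^sub>+\<^sub>1) + (-1)\<^sup>n\<^sup>+\<^sup>1 c(g\<^sub>1,\<dots>,g\<^sub>n)\<close>.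
\<close>

definition differential ::
  "'g monoid \<Rightarrow> 'a monoid \<Rightarrow> ('g \<Rightarrow> 'a \<Rightarrow> 'a) \<Rightarrow> nat \<Rightarrow> ('g list \<Rightarrow> 'a) \<Rightarrow> 'g list \<Rightarrow> 'a" where
  "differential G M act n c = (\<lambda>gs \<in> tuples G (n + 1).
    act (hd gs) (c (tl gs)) \<otimes>\<^bsub>M\<^esub>
    (\<Otimes>\<^bsub>M\<^esub>i\<in>{..<n}. c (contract G i gs) [^]\<^bsub>M\<^esub> ((- 1) ^ (i + 1) :: int)) \<otimes>\<^bsub>M\<^esub>
    c (butlast gs) [^]\<^bsub>M\<^esub> ((- 1) ^ (n + 1) :: int))"

definition cocycle_group ::
  "'g monoid \<Rightarrow> 'a monoid \<Rightarrow> ('g \<Rightarrow> 'a \<Rightarrow> 'a) \<Rightarrow> nat \<Rightarrow> ('g list \<Rightarrow> 'a) monoid" where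
  "cocycle_group G M act n = (cochain_group G M n)
    \<lparr>carrier := {c \<in> carrier (cochain_group G M n).
      differential G M act n c = \<one>\<^bsub>cochain_group G M (n + 1)\<^esub>}\<rparr>"

definition coboundaries ::
  "'g monoid \<Rightarrow> 'a monoid \<Rightarrow> ('g \<Rightarrow> 'a \<Rightarrow> 'a) \<Rightarrow> nat \<Rightarrow> ('g list \<Rightarrow> 'a) set" where
  "coboundaries G M act n = (case n of
      0 \<Rightarrow> {\<one>\<^bsub>cochain_group G M 0\<^esub>}
    | Suc k \<Rightarrow> differential G M act k ` carrier (cochain_group G M k))"

definition cohomology ::
  "'g monoid \<Rightarrow> 'a monoid \<Rightarrow> ('g \<Rightarrow> 'a \<Rightarrow> 'a) \<Rightarrow> nat \<Rightarrow> ('g list \<Rightarrow> 'a) set monoid" where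
  "cohomology G M act n = cocycle_group G M act n Mod coboundaries G M act n"

definition cohomology_class ::
  "'g monoid \<Rightarrow> 'a monoid \<Rightarrow> ('g \<Rightarrow> 'a \<Rightarrow> 'a) \<Rightarrow> nat \<Rightarrow> ('g list \<Rightarrow> 'a) \<Rightarrow> ('g list \<Rightarrow> 'a) set" where
  "cohomology_class G M act n c = coboundaries G M act n #>\<^bsub>cocycle_group G M act n\<^esub> c"

text \<open>
  The map on cohomology induced by an equivariant homomorphism \<open>r\<close> into \<open>M\<close>; the cosets in the
  union are all equal.
\<close>

definition induced_map ::
  "'g monoid \<Rightarrow> 'a monoid \<Rightarrow> ('g \<Rightarrow> 'a \<Rightarrow> 'a) \<Rightarrow> nat \<Rightarrow> ('b \<Rightarrow> 'a)
    \<Rightarrow> ('g list \<Rightarrow> 'b) set \<Rightarrow> ('g list \<Rightarrow> 'a) set" where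
  "induced_map G M act n r K =
    (\<Union>c \<in> K. cohomology_class G M act n (\<lambda>gs \<in> tuples G n. r (c gs)))"

text \<open>The group cohomology \<open>H\<^sup>n(G, A(U))\<close>.\<close>

abbreviation section_cohomology ::
  "'g monoid \<Rightarrow> ('o, 'm, 'a) abelian_sheaf \<Rightarrow> ('g \<Rightarrow> 'o \<Rightarrow> 'a \<Rightarrow> 'a) \<Rightarrow> nat \<Rightarrow> 'o
    \<Rightarrow> ('g list \<Rightarrow> 'a) set monoid" where
  "section_cohomology G A \<phi> n U \<equiv> cohomology G (grp A U) (\<lambda>g. \<phi> g U) n"

definition classes_locally_vanish ::
  "('o, 'm) site \<Rightarrow> 'g monoid \<Rightarrow> ('o, 'm, 'a) abelian_sheaf \<Rightarrow> ('g \<Rightarrow> 'o \<Rightarrow> 'a \<Rightarrow> 'a) \<Rightarrow> nat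
    \<Rightarrow> bool" where
  "classes_locally_vanish X G A \<phi> j \<longleftrightarrow>
    (\<forall>U \<in> objs X. \<forall>K \<in> carrier (section_cohomology G A \<phi> j U). \<exists>S \<in> cov X U. \<forall>u \<in> S.
      induced_map G (grp A (src X u)) (\<lambda>g. \<phi> g (src X u)) j (gres A u) K
        = \<one>\<^bsub>section_cohomology G A \<phi> j (src X u)\<^esub>)"


section \<open>Torsors\<close>

record ('o, 'm, 's, 'a) torsor = "('o, 'm, 's) presheaf" +
  smul :: "'o \<Rightarrow> 'a \<Rightarrow> 's \<Rightarrow> 's"

locale torsor = sheaf X y
  for X :: "('o, 'm) site" (structure) and A :: "('o, 'm, 'a) abelian_sheaf"
    and y :: "('o, 'm, 's, 'a) torsor" +
  assumes smul_closed: "\<lbrakk>U \<in> objs X; a \<in> carrier (grp A U); s \<in> sec y U\<rbrakk>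
      \<Longrightarrow> smul y U a s \<in> sec y U"
    and smul_res: "\<lbrakk>f \<in> arrows X U V; a \<in> carrier (grp A V); s \<in> sec y V\<rbrakk>
      \<Longrightarrow> res y f (smul y V a s) = smul y U (gres A f a) (res y f s)"
    and smul_one: "\<lbrakk>U \<in> objs X; s \<in> sec y U\<rbrakk> \<Longrightarrow> smul y U \<one>\<^bsub>grp A U\<^esub> s = s"
    and smul_mult: "\<lbrakk>U \<in> objs X; a \<in> carrier (grp A U); b \<in> carrier (grp A U); s \<in> sec y U\<rbrakk>
      \<Longrightarrow> smul y U (a \<otimes>\<^bsub>grp A U\<^esub> b) s = smul y U a (smul y U b s)"
    and simply_transitive: "\<lbrakk>U \<in> objs X; s \<in> sec y U; t \<in> sec y U\<rbrakk>
      \<Longrightarrow> \<exists>!a. a \<in> carrier (grp A U) \<and> smul y U a s = t"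
    and locally_nonempty: "U \<in> objs X \<Longrightarrow> \<exists>S \<in> cov X U. \<forall>u \<in> S. sec y (src X u) \<noteq> {}"

definition equivariant_torsor_morphism ::
  "('o, 'm) site \<Rightarrow> ('o, 'm, 'a) abelian_sheaf \<Rightarrow> ('o \<Rightarrow> 'a \<Rightarrow> 'b)
    \<Rightarrow> ('o, 'm, 's, 'a) torsor \<Rightarrow> ('o, 'm, 't, 'b) torsor \<Rightarrow> ('o \<Rightarrow> 's \<Rightarrow> 't) \<Rightarrow> bool" where
  "equivariant_torsor_morphism X A\<^sub>1 f y\<^sub>1 y\<^sub>2 l \<longleftrightarrow> sheaf_morphism X y\<^sub>1 y\<^sub>2 l \<and>
    (\<forall>U \<in> objs X. \<forall>a \<in> carrier (grp A\<^sub>1 U). \<forall>s \<in> sec y\<^sub>1 U.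
      l U (smul y\<^sub>1 U a s) = smul y\<^sub>2 U (f U a) (l U s))"

definition equivariant_torsor_isomorphism ::
  "('o, 'm) site \<Rightarrow> ('o, 'm, 'a) abelian_sheaf
    \<Rightarrow> ('o, 'm, 's, 'a) torsor \<Rightarrow> ('o, 'm, 't, 'a) torsor \<Rightarrow> ('o \<Rightarrow> 's \<Rightarrow> 't) \<Rightarrow> bool" where
  "equivariant_torsor_isomorphism X A y\<^sub>1 y\<^sub>2 l \<longleftrightarrow>
    equivariant_torsor_morphism X A inclusion y\<^sub>1 y\<^sub>2 l \<and>
    (\<forall>U \<in> objs X. bij_betw (l U) (sec y\<^sub>1 U) (sec y\<^sub>2 U))"

definition torsor_lift ::
  "('o, 'm) site \<Rightarrow> 'g monoid \<Rightarrow> ('o, 'm, 'a) abelian_sheaf \<Rightarrow> ('g \<Rightarrow> 'o \<Rightarrow> 'a \<Rightarrow> 'a)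
    \<Rightarrow> ('o, 'm, 's, 'a) torsor \<Rightarrow> ('g \<Rightarrow> 'o \<Rightarrow> 's \<Rightarrow> 's) \<Rightarrow> bool" where
  "torsor_lift X G A \<phi> y l \<longleftrightarrow>
    (\<forall>g \<in> carrier G. equivariant_torsor_morphism X A (\<phi> g) y y (l g))"

text \<open>The cochain \<open>\<chi>\<close>; a section over the final object \<open>T\<close> acts on all sections by restriction.\<close>

definition torsor_cocycle ::
  "('o, 'm) site \<Rightarrow> 'o \<Rightarrow> 'g monoid \<Rightarrow> ('o, 'm, 'a) abelian_sheaf
    \<Rightarrow> ('o, 'm, 's, 'a) torsor \<Rightarrow> ('g \<Rightarrow> 'o \<Rightarrow> 's \<Rightarrow> 's) \<Rightarrow> 'g \<Rightarrow> 'g \<Rightarrow> 'a" where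
  "torsor_cocycle X T G A y l g h = (THE a. a \<in> carrier (grp A T) \<and>
    (\<forall>U \<in> objs X. \<forall>s \<in> sec y U.
      l g U (l h U s) = smul y U (gres A (to_final X T U) a) (l (g \<otimes>\<^bsub>G\<^esub> h) U s)))"

definition torsor_obstruction ::
  "('o, 'm) site \<Rightarrow> 'o \<Rightarrow> 'g monoid \<Rightarrow> ('o, 'm, 'a) abelian_sheaf \<Rightarrow> ('g \<Rightarrow> 'o \<Rightarrow> 'a \<Rightarrow> 'a)
    \<Rightarrow> ('o, 'm, 's, 'a) torsor \<Rightarrow> ('g \<Rightarrow> 'o \<Rightarrow> 's \<Rightarrow> 's) \<Rightarrow> ('g list \<Rightarrow> 'a) set" where
  "torsor_obstruction X T G A \<phi> y l = cohomology_class G (grp A T) (\<lambda>g. \<phi> g T) 2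
    (\<lambda>gs \<in> tuples G 2. torsor_cocycle X T G A y l (gs ! 0) (gs ! 1))"

text \<open>
  Allowing only the section type of \<open>y\<close> for the torsor \<open>z\<close> under the invariants is no restriction:
  an equivariant morphism \<open>z \<rightarrow> y\<close> is injective on sections, so \<open>z\<close> is isomorphic to a subsheaf.
\<close>

definition torsor_induced_from_invariants ::
  "('o, 'm) site \<Rightarrow> 'g monoid \<Rightarrow> ('o, 'm, 'a) abelian_sheaf \<Rightarrow> ('g \<Rightarrow> 'o \<Rightarrow> 'a \<Rightarrow> 'a)
    \<Rightarrow> ('o, 'm, 's, 'a) torsor \<Rightarrow> bool" where
  "torsor_induced_from_invariants X G A \<phi> y \<longleftrightarrow>
    (\<exists>(z :: ('o, 'm, 's, 'a) torsor) f. torsor X (invariants G A \<phi>) z \<and>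
      equivariant_torsor_morphism X (invariants G A \<phi>) inclusion z y f)"


section \<open>Gerbes\<close>

text \<open>A category together with a projection to another category with arrow type \<open>'m\<close>.\<close>

record ('p, 'q, 'o, 'm) category_over = "('p, 'q) category" +
  pobj :: "'p \<Rightarrow> 'o"
  parr :: "'q \<Rightarrow> 'm"

definition arrows_over ::
  "('p, 'q, 'o, 'm, 'z) category_over_scheme \<Rightarrow> 'm \<Rightarrow> 'p \<Rightarrow> 'p \<Rightarrow> 'q set" where
  "arrows_over Y f x y = {a \<in> arrows Y x y. parr Y a = f}"

definition objs_over :: "('p, 'q, 'o, 'm, 'z) category_over_scheme \<Rightarrow> 'o \<Rightarrow> 'p set" where
  "objs_over Y U = {x \<in> objs Y. pobj Y x = U}"

text \<open>Arrows over an identity are then automatically invertible.\<close>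

locale fibred_in_groupoids = site X + Y: category Y
  for X :: "('o, 'm) site" and Y :: "('p, 'q, 'o, 'm, 'z) category_over_scheme" +
  assumes pobj: "x \<in> objs Y \<Longrightarrow> pobj Y x \<in> objs X"
    and parr: "a \<in> arrows Y x y \<Longrightarrow> parr Y a \<in> arrows X (pobj Y x) (pobj Y y)"
    and parr_idt: "x \<in> objs Y \<Longrightarrow> parr Y (idt Y x) = idt X (pobj Y x)"
    and parr_cmp: "\<lbrakk>a \<in> arrows Y x y; b \<in> arrows Y y z\<rbrakk>
      \<Longrightarrow> parr Y (b \<cdot>\<^bsub>Y\<^esub> a) = parr Y b \<cdot>\<^bsub>X\<^esub> parr Y a"
    and pullback_exists: "\<lbrakk>f \<in> arrows X U V; y \<in> objs_over Y V\<rbrakk>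
      \<Longrightarrow> \<exists>x \<in> objs_over Y U. arrows_over Y f x y \<noteq> {}"
    and all_cartesian: "\<lbrakk>a \<in> arrows Y x z; b \<in> arrows Y y z; f \<in> arrows X (pobj Y x) (pobj Y y);
        parr Y b \<cdot>\<^bsub>X\<^esub> f = parr Y a\<rbrakk>
      \<Longrightarrow> \<exists>!c. c \<in> arrows_over Y f x y \<and> b \<cdot>\<^bsub>Y\<^esub> c = a"

text \<open>
  Compatible local morphisms between two objects \<open>x\<close>, \<open>y\<close> over the same object of the site, i.e. a
  matching family of the presheaf of morphisms from \<open>x\<close> to \<open>y\<close> on a sieve \<open>R\<close>. No choice of pullbacks
  is made: for every arrow \<open>p\<close> into \<open>x\<close> over a member \<open>f\<close> of \<open>R\<close>, its source is a pullback of \<open>x\<close>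
  along \<open>f\<close>, and \<open>a p\<close> corresponds to the local morphism from that pullback to the pullback of \<open>y\<close>.
\<close>

definition compatible_morphisms ::
  "('p, 'q, 'o, 'm, 'z) category_over_scheme \<Rightarrow> 'm set \<Rightarrow> 'p \<Rightarrow> 'p \<Rightarrow> ('q \<Rightarrow> 'q) \<Rightarrow> bool" where
  "compatible_morphisms Y R x y a \<longleftrightarrow>
    (\<forall>p \<in> arrs Y. tgt Y p = x \<and> parr Y p \<in> R \<longrightarrow>
      a p \<in> arrows_over Y (parr Y p) (src Y p) y \<and>
      (\<forall>q \<in> arrs Y. tgt Y q = src Y p \<longrightarrow> a (p \<cdot>\<^bsub>Y\<^esub> q) = a p \<cdot>\<^bsub>Y\<^esub> q))"

text \<open>
  A descent datum on a sieve \<open>R\<close>, after Giraud: a functor over the site from \<open>R\<close>, viewed as a full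
  subcategory of a slice of the site, to \<open>Y\<close>. The arrow \<open>g : f \<cdot> g \<rightarrow> f\<close> of that subcategory is sent
  to \<open>dar f g\<close>.
\<close>

definition descent_datum ::
  "('o, 'm) site \<Rightarrow> ('p, 'q, 'o, 'm, 'z) category_over_scheme \<Rightarrow> 'm set
    \<Rightarrow> ('m \<Rightarrow> 'p) \<Rightarrow> ('m \<Rightarrow> 'm \<Rightarrow> 'q) \<Rightarrow> bool" where
  "descent_datum X Y R dob dar \<longleftrightarrow>
    (\<forall>f \<in> R. dob f \<in> objs_over Y (src X f) \<and> dar f (idt X (src X f)) = idt Y (dob f) \<and>
      (\<forall>g \<in> arrs X. tgt X g = src X f \<longrightarrow>
        dar f g \<in> arrows_over Y g (dob (f \<cdot>\<^bsub>X\<^esub> g)) (dob f) \<and>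
        (\<forall>h \<in> arrs X. tgt X h = src X g \<longrightarrow>
          dar f (g \<cdot>\<^bsub>X\<^esub> h) = dar f g \<cdot>\<^bsub>Y\<^esub> dar (f \<cdot>\<^bsub>X\<^esub> g) h)))"

definition effective ::
  "('o, 'm) site \<Rightarrow> ('p, 'q, 'o, 'm, 'z) category_over_scheme \<Rightarrow> 'o \<Rightarrow> 'm set
    \<Rightarrow> ('m \<Rightarrow> 'p) \<Rightarrow> ('m \<Rightarrow> 'm \<Rightarrow> 'q) \<Rightarrow> bool" where
  "effective X Y U R dob dar \<longleftrightarrow>
    (\<exists>y \<in> objs_over Y U. \<exists>k. \<forall>f \<in> R. k f \<in> arrows_over Y f (dob f) y \<and>
      (\<forall>g \<in> arrs X. tgt X g = src X f \<longrightarrow> k f \<cdot>\<^bsub>Y\<^esub> dar f g = k (f \<cdot>\<^bsub>X\<^esub> g)))"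

locale stack_in_groupoids = fibred_in_groupoids +
  assumes morphisms_glue: "\<lbrakk>U \<in> objs X; S \<in> cov X U; x \<in> objs_over Y U; y \<in> objs_over Y U;
        compatible_morphisms Y (sieve X S) x y a\<rbrakk>
      \<Longrightarrow> \<exists>!t. t \<in> arrows_over Y (idt X U) x y \<and>
            (\<forall>p \<in> arrs Y. tgt Y p = x \<and> parr Y p \<in> sieve X S \<longrightarrow> t \<cdot>\<^bsub>Y\<^esub> p = a p)"
    and objects_glue: "\<lbrakk>U \<in> objs X; S \<in> cov X U; descent_datum X Y (sieve X S) dob dar\<rbrakk>
      \<Longrightarrow> effective X Y U (sieve X S) dob dar"

text \<open>
  The group \<open>Aut(x)(U)\<close> for \<open>x\<close> over \<open>U\<close>. The sections of the sheaf \<open>Aut(x)\<close> over \<open>f : V \<rightarrow> U\<close> are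
  \<open>aut_group X Y x'\<close> for a pullback \<open>x'\<close> of \<open>x\<close> along \<open>f\<close>, so statements about all automorphism
  sheaves are statements about \<open>aut_group\<close> of all objects.
\<close>

definition aut_group ::
  "('o, 'm) site \<Rightarrow> ('p, 'q, 'o, 'm, 'z) category_over_scheme \<Rightarrow> 'p \<Rightarrow> 'q monoid" where
  "aut_group X Y x = \<lparr>carrier = arrows_over Y (idt X (pobj Y x)) x x, mult = cmp Y, one = idt Y x\<rparr>"

locale abelian_gerbe = stack_in_groupoids +
  assumes objects_exist_locally: "U \<in> objs X \<Longrightarrow> \<exists>S \<in> cov X U. \<forall>u \<in> S. objs_over Y (src X u) \<noteq> {}"
    and objects_locally_isomorphic: "\<lbrakk>U \<in> objs X; x \<in> objs_over Y U; y \<in> objs_over Y U\<rbrakk>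
      \<Longrightarrow> \<exists>S \<in> cov X U. \<forall>u \<in> S. \<exists>x' y'. arrows_over Y u x' x \<noteq> {} \<and> arrows_over Y u y' y \<noteq> {} \<and>
            arrows_over Y (idt X (src X u)) x' y' \<noteq> {}"
    and aut_abelian: "x \<in> objs Y \<Longrightarrow> comm_group (aut_group X Y x)"

record ('p, 'q, 'o, 'm, 'a) gerbe = "('p, 'q, 'o, 'm) category_over" +
  band :: "'p \<Rightarrow> 'a \<Rightarrow> 'q"

text \<open>
  \<open>band_compatible\<close> says both that the isomorphisms commute with restriction and that they commute
  with isomorphisms of objects (the case where \<open>p\<close> lies over an identity).
\<close>

locale banded_gerbe = abelian_gerbe X Y
  for X :: "('o, 'm) site" and A :: "('o, 'm, 'a) abelian_sheaf"
    and Y :: "('p, 'q, 'o, 'm, 'a) gerbe" +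
  assumes band_iso: "x \<in> objs Y \<Longrightarrow> band Y x \<in> iso (grp A (pobj Y x)) (aut_group X Y x)"
    and band_compatible: "\<lbrakk>p \<in> arrows Y x' x; a \<in> carrier (grp A (pobj Y x))\<rbrakk>
      \<Longrightarrow> p \<cdot>\<^bsub>Y\<^esub> band Y x' (gres A (parr Y p) a) = band Y x a \<cdot>\<^bsub>Y\<^esub> p"

record ('p, 'q, 'r, 's) functor_data =
  fob :: "'p \<Rightarrow> 'r"
  far :: "'q \<Rightarrow> 's"

definition functor_comp ::
  "('r, 's, 'v, 'w) functor_data \<Rightarrow> ('p, 'q, 'r, 's) functor_data \<Rightarrow> ('p, 'q, 'v, 'w) functor_data"
  (infixr \<open>\<odot>\<close> 75) where
  "F \<odot> H = \<lparr>fob = fob F \<circ> fob H, far = far F \<circ> far H\<rparr>"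

definition identity_functor :: "('p, 'q, 'p, 'q) functor_data" where
  "identity_functor = \<lparr>fob = id, far = id\<rparr>"

text \<open>
  A functor commuting with the projections. It preserves cartesian arrows automatically, because in
  a category fibred in groupoids all arrows are cartesian.
\<close>

definition gerbe_morphism ::
  "('p, 'q, 'o, 'm, 'a) gerbe \<Rightarrow> ('r, 's, 'o, 'm, 'b) gerbe \<Rightarrow> ('p, 'q, 'r, 's) functor_data
    \<Rightarrow> bool" where
  "gerbe_morphism Y\<^sub>1 Y\<^sub>2 F \<longleftrightarrow>
    (\<forall>x \<in> objs Y\<^sub>1. fob F x \<in> objs_over Y\<^sub>2 (pobj Y\<^sub>1 x) \<and> far F (idt Y\<^sub>1 x) = idt Y\<^sub>2 (fob F x)) \<and>
    (\<forall>a \<in> arrs Y\<^sub>1. far F a \<in> arrows_over Y\<^sub>2 (parr Y\<^sub>1 a) (fob F (src Y\<^sub>1 a)) (fob F (tgt Y\<^sub>1 a))) \<and>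
    (\<forall>a \<in> arrs Y\<^sub>1. \<forall>b \<in> arrs Y\<^sub>1. src Y\<^sub>1 b = tgt Y\<^sub>1 a \<longrightarrow>
      far F (b \<cdot>\<^bsub>Y\<^sub>1\<^esub> a) = far F b \<cdot>\<^bsub>Y\<^sub>2\<^esub> far F a)"

text \<open>The homomorphism of bands induced by the morphism \<open>F\<close> is \<open>f\<close>.\<close>

definition equivariant_gerbe_morphism ::
  "('o, 'm, 'a) abelian_sheaf \<Rightarrow> ('o \<Rightarrow> 'a \<Rightarrow> 'b)
    \<Rightarrow> ('p, 'q, 'o, 'm, 'a) gerbe \<Rightarrow> ('r, 's, 'o, 'm, 'b) gerbe
    \<Rightarrow> ('p, 'q, 'r, 's) functor_data \<Rightarrow> bool" where
  "equivariant_gerbe_morphism A\<^sub>1 f Y\<^sub>1 Y\<^sub>2 F \<longleftrightarrow> gerbe_morphism Y\<^sub>1 Y\<^sub>2 F \<and>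
    (\<forall>x \<in> objs Y\<^sub>1. \<forall>a \<in> carrier (grp A\<^sub>1 (pobj Y\<^sub>1 x)).
      far F (band Y\<^sub>1 x a) = band Y\<^sub>2 (fob F x) (f (pobj Y\<^sub>1 x) a))"

text \<open>
  Base-preserving natural transformations. Their components lie over identities, so they are
  invertible, and \<open>two_isomorphic\<close> only has to ask for the existence of one.
\<close>

definition two_morphism ::
  "('o, 'm) site \<Rightarrow> ('p, 'q, 'o, 'm, 'a) gerbe \<Rightarrow> ('r, 's, 'o, 'm, 'b) gerbe
    \<Rightarrow> ('p, 'q, 'r, 's) functor_data \<Rightarrow> ('p, 'q, 'r, 's) functor_data \<Rightarrow> ('p \<Rightarrow> 's) \<Rightarrow> bool" where
  "two_morphism X Y\<^sub>1 Y\<^sub>2 F H \<eta> \<longleftrightarrow>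
    (\<forall>x \<in> objs Y\<^sub>1. \<eta> x \<in> arrows_over Y\<^sub>2 (idt X (pobj Y\<^sub>1 x)) (fob F x) (fob H x)) \<and>
    (\<forall>a \<in> arrs Y\<^sub>1. \<eta> (tgt Y\<^sub>1 a) \<cdot>\<^bsub>Y\<^sub>2\<^esub> far F a = far H a \<cdot>\<^bsub>Y\<^sub>2\<^esub> \<eta> (src Y\<^sub>1 a))"

definition two_isomorphic ::
  "('o, 'm) site \<Rightarrow> ('p, 'q, 'o, 'm, 'a) gerbe \<Rightarrow> ('r, 's, 'o, 'm, 'b) gerbe
    \<Rightarrow> ('p, 'q, 'r, 's) functor_data \<Rightarrow> ('p, 'q, 'r, 's) functor_data \<Rightarrow> bool" where
  "two_isomorphic X Y\<^sub>1 Y\<^sub>2 F H \<longleftrightarrow> (\<exists>\<eta>. two_morphism X Y\<^sub>1 Y\<^sub>2 F H \<eta>)"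

text \<open>
  Isomorphisms of gerbes are understood in the 2-categorical sense: the morphism has an inverse up
  to 2-isomorphism.
\<close>

definition equivariant_gerbe_isomorphism ::
  "('o, 'm) site \<Rightarrow> ('o, 'm, 'a) abelian_sheaf
    \<Rightarrow> ('p, 'q, 'o, 'm, 'a) gerbe \<Rightarrow> ('r, 's, 'o, 'm, 'a) gerbe
    \<Rightarrow> ('p, 'q, 'r, 's) functor_data \<Rightarrow> bool" where
  "equivariant_gerbe_isomorphism X A Y\<^sub>1 Y\<^sub>2 F \<longleftrightarrow>
    equivariant_gerbe_morphism A inclusion Y\<^sub>1 Y\<^sub>2 F \<and>
    (\<exists>H. gerbe_morphism Y\<^sub>2 Y\<^sub>1 H \<and>
      two_isomorphic X Y\<^sub>1 Y\<^sub>1 (H \<odot> F) identity_functor \<and>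
      two_isomorphic X Y\<^sub>2 Y\<^sub>2 (F \<odot> H) identity_functor)"

definition gerbe_action ::
  "('o, 'm) site \<Rightarrow> 'g monoid \<Rightarrow> ('o, 'm, 'a) abelian_sheaf \<Rightarrow> ('p, 'q, 'o, 'm, 'a) gerbe
    \<Rightarrow> ('g \<Rightarrow> ('p, 'q, 'p, 'q) functor_data) \<Rightarrow> bool" where
  "gerbe_action X G A Y F \<longleftrightarrow>
    (\<forall>g \<in> carrier G. gerbe_morphism Y Y (F g)) \<and>
    equivariant_gerbe_morphism A inclusion Y Y (F \<one>\<^bsub>G\<^esub>) \<and>
    (\<forall>g \<in> carrier G. \<forall>h \<in> carrier G. two_isomorphic X Y Y (F (g \<otimes>\<^bsub>G\<^esub> h)) (F g \<odot> F h))"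

definition gerbe_lift ::
  "('o, 'm) site \<Rightarrow> 'g monoid \<Rightarrow> ('o, 'm, 'a) abelian_sheaf \<Rightarrow> ('g \<Rightarrow> 'o \<Rightarrow> 'a \<Rightarrow> 'a)
    \<Rightarrow> ('p, 'q, 'o, 'm, 'a) gerbe \<Rightarrow> ('g \<Rightarrow> ('p, 'q, 'p, 'q) functor_data) \<Rightarrow> bool" where
  "gerbe_lift X G A \<phi> Y F \<longleftrightarrow> gerbe_action X G A Y F \<and>
    (\<forall>g \<in> carrier G. equivariant_gerbe_morphism A (\<phi> g) Y Y (F g))"

definition connecting ::
  "('o, 'm) site \<Rightarrow> 'g monoid \<Rightarrow> ('p, 'q, 'o, 'm, 'a) gerbe
    \<Rightarrow> ('g \<Rightarrow> ('p, 'q, 'p, 'q) functor_data) \<Rightarrow> ('g \<Rightarrow> 'g \<Rightarrow> 'p \<Rightarrow> 'q) \<Rightarrow> bool" where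
  "connecting X G Y F \<alpha> \<longleftrightarrow>
    (\<forall>g \<in> carrier G. \<forall>h \<in> carrier G.
      two_morphism X Y Y (F (g \<otimes>\<^bsub>G\<^esub> h)) (F g \<odot> F h) (\<alpha> g h))"

text \<open>
  The cochain \<open>\<kappa>\<close>: the defining equation of 2-morphisms is written out at each object \<open>x\<close>, where a
  section \<open>k\<close> over the final object \<open>T\<close> acts on \<open>F\<^sub>g x\<close> through the band.
\<close>

definition gerbe_cocycle ::
  "('o, 'm) site \<Rightarrow> 'o \<Rightarrow> 'g monoid \<Rightarrow> ('o, 'm, 'a) abelian_sheaf
    \<Rightarrow> ('p, 'q, 'o, 'm, 'a) gerbe \<Rightarrow> ('g \<Rightarrow> ('p, 'q, 'p, 'q) functor_data)
    \<Rightarrow> ('g \<Rightarrow> 'g \<Rightarrow> 'p \<Rightarrow> 'q) \<Rightarrow> 'g \<Rightarrow> 'g \<Rightarrow> 'g \<Rightarrow> 'a" where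
  "gerbe_cocycle X T G A Y F \<alpha> g\<^sub>1 g\<^sub>2 g\<^sub>3 = (THE k. k \<in> carrier (grp A T) \<and>
    (\<forall>x \<in> objs Y.
      \<alpha> g\<^sub>1 g\<^sub>2 (fob (F g\<^sub>3) x) \<cdot>\<^bsub>Y\<^esub> \<alpha> (g\<^sub>1 \<otimes>\<^bsub>G\<^esub> g\<^sub>2) g\<^sub>3 x \<cdot>\<^bsub>Y\<^esub>
        band Y (fob (F (g\<^sub>1 \<otimes>\<^bsub>G\<^esub> g\<^sub>2 \<otimes>\<^bsub>G\<^esub> g\<^sub>3)) x) (gres A (to_final X T (pobj Y x)) k)
      = far (F g\<^sub>1) (\<alpha> g\<^sub>2 g\<^sub>3 x) \<cdot>\<^bsub>Y\<^esub> \<alpha> g\<^sub>1 (g\<^sub>2 \<otimes>\<^bsub>G\<^esub> g\<^sub>3) x))"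

text \<open>The class of \<open>\<kappa>\<close> does not depend on the choice of connecting 2-morphisms.\<close>

definition gerbe_obstruction ::
  "('o, 'm) site \<Rightarrow> 'o \<Rightarrow> 'g monoid \<Rightarrow> ('o, 'm, 'a) abelian_sheaf \<Rightarrow> ('g \<Rightarrow> 'o \<Rightarrow> 'a \<Rightarrow> 'a)
    \<Rightarrow> ('p, 'q, 'o, 'm, 'a) gerbe \<Rightarrow> ('g \<Rightarrow> ('p, 'q, 'p, 'q) functor_data)
    \<Rightarrow> ('g list \<Rightarrow> 'a) set" where
  "gerbe_obstruction X T G A \<phi> Y F =
    (let \<alpha> = SOME \<alpha>. connecting X G Y F \<alpha>
     in cohomology_class G (grp A T) (\<lambda>g. \<phi> g T) 3
       (\<lambda>gs \<in> tuples G 3. gerbe_cocycle X T G A Y F \<alpha> (gs ! 0) (gs ! 1) (gs ! 2)))"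


section \<open>The gerbe of equivariant objects\<close>

text \<open>
  Objects are triples of an object of the site, an object of the gerbe over it, and a family of
  arrows indexed by \<open>G\<close> (undefined outside \<open>G\<close>). Arrows carry their source and target.
\<close>

type_synonym ('p, 'q, 'o, 'g) eq_obj = "'o \<times> 'p \<times> ('g \<Rightarrow> 'q)"

type_synonym ('p, 'q, 'o, 'm, 'g) eq_arr =
  "('p, 'q, 'o, 'g) eq_obj \<times> 'm \<times> 'q \<times> ('p, 'q, 'o, 'g) eq_obj"

type_synonym ('p, 'q, 'o, 'm, 'g, 'a) eq_gerbe =
  "(('p, 'q, 'o, 'g) eq_obj, ('p, 'q, 'o, 'm, 'g) eq_arr, 'o, 'm, 'a) gerbe"

definition eq_objs ::
  "('o, 'm) site \<Rightarrow> 'g monoid \<Rightarrow> ('p, 'q, 'o, 'm, 'a) gerbe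
    \<Rightarrow> ('g \<Rightarrow> ('p, 'q, 'p, 'q) functor_data) \<Rightarrow> ('g \<Rightarrow> 'g \<Rightarrow> 'p \<Rightarrow> 'q)
    \<Rightarrow> ('p, 'q, 'o, 'g) eq_obj set" where
  "eq_objs X G Y F \<alpha> = {(U, y, \<psi>). U \<in> objs X \<and> y \<in> objs_over Y U \<and>
    \<psi> \<in> (\<Pi>\<^sub>E g \<in> carrier G. arrows_over Y (idt X U) y (fob (F g) y)) \<and>
    (\<forall>g \<in> carrier G. \<forall>h \<in> carrier G.
      \<alpha> g h y \<cdot>\<^bsub>Y\<^esub> \<psi> (g \<otimes>\<^bsub>G\<^esub> h) = far (F g) (\<psi> h) \<cdot>\<^bsub>Y\<^esub> \<psi> g)}"

definition eq_arrs ::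
  "('o, 'm) site \<Rightarrow> 'g monoid \<Rightarrow> ('p, 'q, 'o, 'm, 'a) gerbe
    \<Rightarrow> ('g \<Rightarrow> ('p, 'q, 'p, 'q) functor_data) \<Rightarrow> ('g \<Rightarrow> 'g \<Rightarrow> 'p \<Rightarrow> 'q)
    \<Rightarrow> ('p, 'q, 'o, 'm, 'g) eq_arr set" where
  "eq_arrs X G Y F \<alpha> = {((U\<^sub>1, y\<^sub>1, \<psi>\<^sub>1), f, l, (U\<^sub>2, y\<^sub>2, \<psi>\<^sub>2)) | U\<^sub>1 y\<^sub>1 \<psi>\<^sub>1 f l U\<^sub>2 y\<^sub>2 \<psi>\<^sub>2.
    (U\<^sub>1, y\<^sub>1, \<psi>\<^sub>1) \<in> eq_objs X G Y F \<alpha> \<and> (U\<^sub>2, y\<^sub>2, \<psi>\<^sub>2) \<in> eq_objs X G Y F \<alpha> \<and>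
    f \<in> arrows X U\<^sub>1 U\<^sub>2 \<and> l \<in> arrows_over Y f y\<^sub>1 y\<^sub>2 \<and>
    (\<forall>g \<in> carrier G. \<psi>\<^sub>2 g \<cdot>\<^bsub>Y\<^esub> l = far (F g) l \<cdot>\<^bsub>Y\<^esub> \<psi>\<^sub>1 g)}"

text \<open>
  Sections of the invariants act on \<open>(U, y, \<psi>)\<close> through the band of the underlying object \<open>y\<close>.
\<close>

definition equivariant_objects ::
  "('o, 'm) site \<Rightarrow> 'g monoid \<Rightarrow> ('p, 'q, 'o, 'm, 'a) gerbe
    \<Rightarrow> ('g \<Rightarrow> ('p, 'q, 'p, 'q) functor_data) \<Rightarrow> ('g \<Rightarrow> 'g \<Rightarrow> 'p \<Rightarrow> 'q)
    \<Rightarrow> ('p, 'q, 'o, 'm, 'g, 'a) eq_gerbe" where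
  "equivariant_objects X G Y F \<alpha> =
    \<lparr>objs = eq_objs X G Y F \<alpha>,
     arrs = eq_arrs X G Y F \<alpha>,
     src = \<lambda>(z\<^sub>1, f, l, z\<^sub>2). z\<^sub>1,
     tgt = \<lambda>(z\<^sub>1, f, l, z\<^sub>2). z\<^sub>2,
     idt = \<lambda>(U, y, \<psi>). ((U, y, \<psi>), idt X U, idt Y y, (U, y, \<psi>)),
     cmp = \<lambda>(_, f', l', z\<^sub>3) (z\<^sub>1, f, l, _). (z\<^sub>1, f' \<cdot>\<^bsub>X\<^esub> f, l' \<cdot>\<^bsub>Y\<^esub> l, z\<^sub>3),
     pobj = \<lambda>(U, y, \<psi>). U,
     parr = \<lambda>(z\<^sub>1, f, l, z\<^sub>2). f,
     band = \<lambda>(U, y, \<psi>) a. ((U, y, \<psi>), idt X U, band Y y a, (U, y, \<psi>))\<rparr>"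

text \<open>
  HOL cannot quantify over the types of the objects and arrows of the gerbe \<open>Z\<close> here; the types chosen
  are those of \<open>equivariant_objects\<close>. (Asking for a witness on these types is at least as strong as
  asking for one on some types.)
\<close>

definition gerbe_induced_from_invariants ::
  "('o, 'm) site \<Rightarrow> 'g monoid \<Rightarrow> ('o, 'm, 'a) abelian_sheaf \<Rightarrow> ('g \<Rightarrow> 'o \<Rightarrow> 'a \<Rightarrow> 'a)
    \<Rightarrow> ('p, 'q, 'o, 'm, 'a) gerbe \<Rightarrow> bool" where
  "gerbe_induced_from_invariants X G A \<phi> Y \<longleftrightarrow>
    (\<exists>(Z :: ('p, 'q, 'o, 'm, 'g, 'a) eq_gerbe) \<Theta>. banded_gerbe X (invariants G A \<phi>) Z \<and>
      equivariant_gerbe_morphism (invariants G A \<phi>) inclusion Z Y \<Theta>)"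

end

theory Submission
  imports Defs
begin

text \<open>
  For a torsor \<open>y\<close> with a multiplicative lift \<open>\<lambda>\<close>, a section \<open>s\<close> satisfies
  \<open>\<lambda>\<^sub>g s = c(g) s\<close> for a 1-cocycle \<open>c\<close>; where \<open>c\<close> is the coboundary of \<open>a\<close>, the section \<open>a\<^sup>-\<^sup>1 s\<close> is
  fixed, so the subsheaf of fixed sections is an \<open>A\<^sup>G\<close>-torsor, and it is the image of every
  equivariant \<open>A\<^sup>G\<close>-torsor with values in the fixed sections. For a gerbe the same argument is applied
  one level higher. Two 2-morphisms between the same functors differ by a unique section over the
  final object, so the connecting 2-morphisms \<open>\<alpha>\<close> can be corrected until \<open>\<kappa> = 0\<close>. Then the failure of
  locally chosen arrows \<open>\<psi>\<^sub>g : y \<rightarrow> F\<^sub>g y\<close> to be compatible with \<open>\<alpha>\<close> is a 2-cocycle, which gives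
  local equivariant objects, and the failure of a local isomorphism to be compatible with the \<open>\<psi>\<^sub>g\<close>
  is a 1-cocycle, which makes any two of them locally isomorphic. Given another gerbe \<open>Z\<close> with
  2-isomorphisms \<open>\<eta>\<^sub>g : \<Theta> \<rightarrow> F\<^sub>g \<Theta>\<close>, the connecting 2-morphisms are corrected instead so that the pairs
  \<open>(\<Theta> z, \<eta>(z))\<close> become equivariant objects; the resulting morphism from \<open>Z\<close> is an equivalence because
  every banded morphism inducing the identity on bands is one.
\<close>


section \<open>Categories, sites and sheaves\<close>

text \<open>Neither a torsor nor a gerbe need have anything over the final object T, so no element
  of A(T) can be read off there. Differences and cochain values with values in A(T) are found over
  those U that carry sections or objects, shown not to depend on the choice made, and glued by
  \<open>global_section\<close>. For torsors this independence comes from commutativity of A; for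
  gerbes it comes from the local isomorphism of objects and from the fact that band elements pass
  through every arrow at the price of a restriction. No pullbacks are chosen in a gerbe: an arrow p
  over f stands for the pullback of its target along f, and equations are checked after composition
  with such arrows, where cartesianness permits cancellation. Finiteness of G provides one cover
  over which isomorphisms from y to F_g y exist for all g at once. A cochain that is the coboundary
  of b is removed by dividing by b, whence the inverses in the corrected lifts, connecting
  2-morphisms and structure arrows.\<close>

context category begin

lemma arrs_in_arrows: "f \<in> arrs C \<Longrightarrow> f \<in> arrows C (src C f) (tgt C f)"
  by (simp add: arrows_def)

lemma src_objs [simp]: "f \<in> arrs C \<Longrightarrow> src C f \<in> objs C"
  and tgt_objs [simp]: "f \<in> arrs C \<Longrightarrow> tgt C f \<in> objs C"
  using src_tgt by auto

lemma idt_arrs [simp]: "U \<in> objs C \<Longrightarrow> idt C U \<in> arrs C"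
  and src_idt [simp]: "U \<in> objs C \<Longrightarrow> src C (idt C U) = U"
  and tgt_idt [simp]: "U \<in> objs C \<Longrightarrow> tgt C (idt C U) = U"
  using idt[of U] by (auto simp: arrows_def)

lemma cmp_arrows:
  assumes "f \<in> arrs C" "g \<in> arrs C" "src C g = tgt C f"
  shows "g \<cdot> f \<in> arrows C (src C f) (tgt C g)"
  using assms by (auto simp: arrows_def intro!: cmp[unfolded arrows_def, simplified])

lemma cmp_arrs [simp]: "\<lbrakk>f \<in> arrs C; g \<in> arrs C; src C g = tgt C f\<rbrakk> \<Longrightarrow> g \<cdot> f \<in> arrs C"
  and src_cmp [simp]: "\<lbrakk>f \<in> arrs C; g \<in> arrs C; src C g = tgt C f\<rbrakk> \<Longrightarrow> src C (g \<cdot> f) = src C f"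
  and tgt_cmp [simp]: "\<lbrakk>f \<in> arrs C; g \<in> arrs C; src C g = tgt C f\<rbrakk> \<Longrightarrow> tgt C (g \<cdot> f) = tgt C g"
  using cmp_arrows by (auto simp: arrows_def)

lemma cmp_idt_left [simp]: "\<lbrakk>f \<in> arrs C; tgt C f = V\<rbrakk> \<Longrightarrow> idt C V \<cdot> f = f"
  and cmp_idt_right [simp]: "\<lbrakk>f \<in> arrs C; src C f = U\<rbrakk> \<Longrightarrow> f \<cdot> idt C U = f"
  using idt_left idt_right arrs_in_arrows by blast+

lemma cmp_assoc [simp]:
  assumes "f \<in> arrs C" "g \<in> arrs C" "h \<in> arrs C" "src C g = tgt C f" "src C h = tgt C g"
  shows "(h \<cdot> g) \<cdot> f = h \<cdot> (g \<cdot> f)"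
  by (rule assoc) (use assms in \<open>auto simp: arrows_def\<close>)

end

context site begin

lemma cov_arrs:
  assumes "U \<in> objs X" "S \<in> cov X U" "u \<in> S"
  shows "u \<in> arrs X" "tgt X u = U" "src X u \<in> objs X"
  using cov_arrows[OF assms] by auto

lemma isomorphism_idt: "U \<in> objs X \<Longrightarrow> isomorphism X (idt X U)"
  unfolding isomorphism_def by (auto simp: arrows_def intro!: bexI[of _ "idt X U"])

lemma local_trivial:
  assumes "U \<in> objs X" "P (idt X U)"
  shows "\<exists>S \<in> cov X U. \<forall>u \<in> S. P u"
  using cov_iso[OF isomorphism_idt] assms by force

text \<open>Locality is expressed by predicates on the arrows of a cover rather than on their
  sources, so a second refinement takes the form \<open>P (u \<cdot> v)\<close>. Arguments that pass
  to finer covers several times go through this rule.\<close>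

lemma local_compose:
  assumes U: "U \<in> objs X" and S: "S \<in> cov X U"
    and loc: "\<And>u. u \<in> S \<Longrightarrow> \<exists>R \<in> cov X (src X u). \<forall>v \<in> R. P (u \<cdot> v)"
  shows "\<exists>S' \<in> cov X U. \<forall>w \<in> S'. P w"
proof -
  obtain R where "\<And>u. u \<in> S \<Longrightarrow> R u \<in> cov X (src X u) \<and> (\<forall>v \<in> R u. P (u \<cdot> v))"
    using loc by metis
  then show ?thesis
    by (intro bexI[OF _ cov_compose[OF U S, of R]]) auto
qed

text \<open>Stability under base change with the universal property forgotten: the arrows w are
  first projections of fibre products with the members of S, and only the commuting squares are
  kept.\<close>

lemma cov_pullback:
  assumes f: "f \<in> arrs X" and S: "S \<in> cov X (tgt X f)"
  shows "\<exists>S' \<in> cov X (src X f). \<forall>w \<in> S'. w \<in> arrs X \<and> tgt X w = src X f \<and>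
    (\<exists>u \<in> S. \<exists>q \<in> arrs X. src X q = src X w \<and> tgt X q = src X u \<and> f \<cdot> w = u \<cdot> q)"
proof -
  obtain pr where pr: "\<And>u. u \<in> S \<Longrightarrow> \<exists>q. fibre_product X f u (pr u) q"
    using cov_fibre_product[OF f S] by metis
  have pr': "pr u \<in> arrs X \<and> tgt X (pr u) = src X f \<and>
    (\<exists>q \<in> arrs X. src X q = src X (pr u) \<and> tgt X q = src X u \<and> f \<cdot> pr u = u \<cdot> q)" if "u \<in> S" for u
    using pr[OF that] unfolding fibre_product_def commuting_square_def by auto
  show ?thesis
  proof (intro bexI[of _ "pr ` S"] ballI)
    show "pr ` S \<in> cov X (src X f)"
      by (rule cov_base_change[OF f S]) (rule pr)
  next
    fix w assume "w \<in> pr ` S"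
    then obtain u where "u \<in> S" "w = pr u"
      by blast
    then show "w \<in> arrs X \<and> tgt X w = src X f \<and>
      (\<exists>u \<in> S. \<exists>q \<in> arrs X. src X q = src X w \<and> tgt X q = src X u \<and> f \<cdot> w = u \<cdot> q)"
      using pr'[of u] by blast
  qed
qed

lemma sieve_arrs:
  assumes "U \<in> objs X" "S \<in> cov X U" "f \<in> sieve X S"
  shows "f \<in> arrs X" "tgt X f = U" "src X f \<in> objs X"
  using assms cov_arrs[OF assms(1,2)] by (auto simp: sieve_def)

lemma cov_in_sieve:
  assumes "U \<in> objs X" "S \<in> cov X U" "u \<in> S"
  shows "u \<in> sieve X S"
  unfolding sieve_def using assms cov_arrs[OF assms]
  by (intro CollectI exI[of _ u] exI[of _ "idt X (src X u)"]) simp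

lemma sieve_cmp:
  assumes "U \<in> objs X" "S \<in> cov X U" "f \<in> sieve X S" "g \<in> arrs X" "tgt X g = src X f"
  shows "f \<cdot> g \<in> sieve X S"
proof -
  obtain u p where "u \<in> S" "p \<in> arrs X" "tgt X p = src X u" "f = u \<cdot> p"
    using assms(3) by (auto simp: sieve_def)
  then show ?thesis
    using cov_arrs[OF assms(1,2), of u] assms(4,5)
    unfolding sieve_def by (intro CollectI exI[of _ u] exI[of _ "p \<cdot> g"]) simp
qed

end

section \<open>Final objects, separatedness and sections over the final object\<close>

lemma final_arr:
  assumes "final_object X T" "U \<in> objs X"
  shows "to_final X T U \<in> arrs X" "src X (to_final X T U) = U" "tgt X (to_final X T U) = T"
  using assms theI'[of "\<lambda>f. f \<in> arrows X U T"]
  unfolding to_final_def final_object_def by (auto simp: arrows_def)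

lemma final_unique:
  assumes "final_object X T" "f \<in> arrs X" "tgt X f = T" "src X f \<in> objs X"
  shows "f = to_final X T (src X f)"
  using assms the1_equality[of "\<lambda>f'. f' \<in> arrows X (src X f) T" f]
  unfolding to_final_def final_object_def by (auto simp: arrows_def)

lemma (in presheaf) res_sec [simp]:
    "\<lbrakk>f \<in> arrs X; s \<in> sec P (tgt X f)\<rbrakk> \<Longrightarrow> res P f s \<in> sec P (src X f)"
  and res_idt_sec [simp]: "\<lbrakk>U \<in> objs X; s \<in> sec P U\<rbrakk> \<Longrightarrow> res P (idt X U) s = s"
  and res_res: "\<lbrakk>f \<in> arrs X; g \<in> arrs X; src X g = tgt X f; s \<in> sec P (tgt X g)\<rbrakk>
    \<Longrightarrow> res P f (res P g s) = res P (g \<cdot> f) s"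
  using res_closed res_idt res_cmp arrs_in_arrows by metis+

context sheaf begin

text \<open>The restrictions of s form a matching family of which both s and t are
  amalgamations.\<close>

lemma separation:
  assumes U: "U \<in> objs X" and S: "S \<in> cov X U" and s: "s \<in> sec P U" and t: "t \<in> sec P U"
    and eq: "\<And>u. u \<in> S \<Longrightarrow> res P u s = res P u t"
  shows "s = t"
proof -
  have "matching_family X P S (\<lambda>u. res P u s)"
    unfolding matching_family_def
    using cov_arrs[OF U S] s
    by (auto simp: fibre_product_def commuting_square_def res_res)
  then show ?thesis
    using glue[OF U S] s t eq by metis
qed

text \<open>
  The members of \<^term>\<open>K U\<close> are pairwise equal, but \<^term>\<open>K U\<close> may be empty: a partially defined
  section that is defined locally.
\<close>

lemma global_section:
  assumes T: "final_object X T"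
    and K: "\<And>U. U \<in> objs X \<Longrightarrow> K U \<subseteq> sec P U"
    and K_res: "\<And>f k. \<lbrakk>f \<in> arrs X; k \<in> K (tgt X f)\<rbrakk> \<Longrightarrow> res P f k \<in> K (src X f)"
    and K_unique: "\<And>U k k'. \<lbrakk>U \<in> objs X; k \<in> K U; k' \<in> K U\<rbrakk> \<Longrightarrow> k = k'"
    and K_local: "\<And>U. U \<in> objs X \<Longrightarrow> \<exists>S \<in> cov X U. \<forall>u \<in> S. K (src X u) \<noteq> {}"
  shows "\<exists>!t. t \<in> sec P T \<and> (\<forall>U \<in> objs X. \<forall>k \<in> K U. res P (to_final X T U) t = k)"
proof -
  have To: "T \<in> objs X"
    using T by (auto simp: final_object_def)
  obtain S where S: "S \<in> cov X T" and "\<forall>u \<in> S. \<exists>k. k \<in> K (src X u)"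
    using K_local[OF To] by blast
  then obtain k where k: "\<And>u. u \<in> S \<Longrightarrow> k u \<in> K (src X u)"
    using bchoice[of S "\<lambda>u k. k \<in> K (src X u)"] by blast
  note cov = cov_arrs[OF To S]
  \<comment> \<open>Both restrictions to a fibre product lie in K there, so uniqueness makes the
    arbitrarily chosen \<open>k u\<close> compatible.\<close>
  have "matching_family X P S k"
    unfolding matching_family_def
  proof (intro conjI ballI allI impI)
    fix u assume "u \<in> S"
    then show "k u \<in> sec P (src X u)"
      using k K cov by blast
  next
    fix u v p q assume uv: "u \<in> S" "v \<in> S" and "fibre_product X u v p q"
    then have pq: "p \<in> arrs X" "q \<in> arrs X" "src X p = src X q" "tgt X p = src X u" "tgt X q = src X v"
      by (auto simp: fibre_product_def commuting_square_def)
    have "res P p (k u) \<in> K (src X p)" "res P q (k v) \<in> K (src X p)"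
      using K_res[of p "k u"] K_res[of q "k v"] k uv pq by auto
    then show "res P p (k u) = res P q (k v)"
      using K_unique[of "src X p"] pq by simp
  qed
  then obtain t where t: "t \<in> sec P T" "\<And>u. u \<in> S \<Longrightarrow> res P u t = k u"
    using glue[OF To S] by metis
  show ?thesis
  proof (rule ex1I[of _ t], intro conjI ballI)
    show "t \<in> sec P T" by fact
  next
    fix U k' assume U: "U \<in> objs X" and k': "k' \<in> K U"
    let ?f = "to_final X T U"
    note f = final_arr[OF T U]
    \<comment> \<open>The arrow from U to T need not factor through a member of S, so S is pulled
      back along it. On the new cover t becomes a restriction of some \<open>k u\<close>, which
      again lies in K.\<close>
    obtain S' where S': "S' \<in> cov X U" and w: "\<And>w. w \<in> S' \<Longrightarrow> w \<in> arrs X \<and> tgt X w = U \<and>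
        (\<exists>u \<in> S. \<exists>q \<in> arrs X. src X q = src X w \<and> tgt X q = src X u \<and> ?f \<cdot> w = u \<cdot> q)"
      using cov_pullback[of ?f S] S f by auto
    show "res P ?f t = k'"
    proof (rule separation[OF U S'])
      show "res P ?f t \<in> sec P U" "k' \<in> sec P U"
        using f t res_sec[of ?f t] K[OF U] k' by auto
    next
      fix v assume v: "v \<in> S'"
      obtain u q where q: "u \<in> S" "q \<in> arrs X" "src X q = src X v" "tgt X q = src X u" "?f \<cdot> v = u \<cdot> q"
        and v': "v \<in> arrs X" "tgt X v = U"
        using w[OF v] by auto
      have "res P v (res P ?f t) = res P q (k u)"
        using q v' f t(1) t(2)[OF q(1)] cov[of u] res_res[of v ?f t] res_res[of q u t] by simp
      also have "\<dots> \<in> K (src X v)"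
        using K_res[of q "k u"] q k by simp
      finally show "res P v (res P ?f t) = res P v k'"
        using K_unique[of "src X v"] K_res[OF v'(1)] k' v' by simp
    qed
  next
    fix t' assume t': "t' \<in> sec P T \<and> (\<forall>U \<in> objs X. \<forall>k \<in> K U. res P (to_final X T U) t' = k)"
    show "t' = t"
    proof (rule separation[OF To S])
      fix u assume u: "u \<in> S"
      \<comment> \<open>A member of a cover of T is itself the arrow to the final object, so the
        property assumed of t' determines its restriction along u.\<close>
      have "u = to_final X T (src X u)"
        using final_unique[OF T] cov[OF u] by simp
      then have "res P u t' = k u"
        using t' cov[OF u] k[OF u] by metis
      then show "res P u t' = res P u t"
        using t(2)[OF u] by simp
    qed (use t t' in auto)
  qed
qed

end

section \<open>Group cohomology\<close>

lemma tuples_0: "tuples G 0 = {[]}"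
  and tuples_1: "tuples G 1 = {[g] | g. g \<in> carrier G}"
  and tuples_2: "tuples G 2 = {[g, h] | g h. g \<in> carrier G \<and> h \<in> carrier G}"
  and tuples_3: "tuples G 3 = {[g, h, k] | g h k. g \<in> carrier G \<and> h \<in> carrier G \<and> k \<in> carrier G}"
  by (auto simp: tuples_def numeral_eq_Suc length_Suc_conv)

lemma contract_tuples:
  assumes "group G" "gs \<in> tuples G (n + 1)" "i < n"
  shows "contract G i gs \<in> tuples G n"
proof -
  have "gs ! i \<in> carrier G" "gs ! (i + 1) \<in> carrier G"
    using assms by (auto simp: tuples_def subset_iff)
  then show ?thesis
    using assms group.is_monoid[OF assms(1)] set_take_subset[of i gs] set_drop_subset[of "i + 2" gs]
    by (auto simp: tuples_def contract_def monoid.m_closed)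
qed

context
  fixes G :: "'g monoid" and M :: "'a monoid" and act :: "'g \<Rightarrow> 'a \<Rightarrow> 'a"
  assumes G: "group G" and M: "comm_group M"
    and act_closed: "\<And>g a. \<lbrakk>g \<in> carrier G; a \<in> carrier M\<rbrakk> \<Longrightarrow> act g a \<in> carrier M"
    and act_one: "\<And>g. g \<in> carrier G \<Longrightarrow> act g \<one>\<^bsub>M\<^esub> = \<one>\<^bsub>M\<^esub>"
begin

interpretation M: comm_group M by (rule M)

text \<open>The differential sends the trivial cochain to the trivial one, since the action fixes
  the unit. This element of the coboundaries is what places a cochain in its own coset.\<close>

lemma one_coboundaries: "\<one>\<^bsub>cochain_group G M n\<^esub> \<in> coboundaries G M act n"
proof (cases n)
  case (Suc k)
  have "\<one>\<^bsub>cochain_group G M (Suc k)\<^esub> = differential G M act k \<one>\<^bsub>cochain_group G M k\<^esub>"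
  proof
    fix gs :: "'g list"
    have "(\<Otimes>\<^bsub>M\<^esub>i\<in>{..<k}. \<one>\<^bsub>cochain_group G M k\<^esub> (contract G i gs) [^]\<^bsub>M\<^esub> ((- 1) ^ (i + 1) :: int)) = \<one>\<^bsub>M\<^esub>"
      if "gs \<in> tuples G (k + 1)"
      by (rule M.finprod_one_eqI)
        (use contract_tuples[OF G that] in \<open>simp add: cochain_group_def M.int_pow_one\<close>)
    moreover have "tl gs \<in> tuples G k" "butlast gs \<in> tuples G k" "hd gs \<in> carrier G"
      if "gs \<in> tuples G (k + 1)"
      using that by (cases gs; auto simp: tuples_def dest: in_set_butlastD split: if_splits)+
    ultimately show "\<one>\<^bsub>cochain_group G M (Suc k)\<^esub> gs = differential G M act k \<one>\<^bsub>cochain_group G M k\<^esub> gs"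
      by (simp add: differential_def, simp add: cochain_group_def act_one)
  qed
  then show ?thesis
    using Suc by (auto simp: coboundaries_def cochain_group_def)
qed (simp add: coboundaries_def)

lemma one_mult_cochain:
  "c \<in> carrier (cochain_group G M n) \<Longrightarrow> \<one>\<^bsub>cochain_group G M n\<^esub> \<otimes>\<^bsub>cochain_group G M n\<^esub> c = c"
  by (auto simp: cochain_group_def PiE_iff extensional_def fun_eq_iff)

lemma in_cohomology_class:
  "c \<in> carrier (cochain_group G M n) \<Longrightarrow> c \<in> cohomology_class G M act n c"
  using one_coboundaries[of n] one_mult_cochain[of c n]
  by (auto simp: cohomology_class_def r_coset_def cocycle_group_def intro!: bexI)

text \<open>The unit of the factor group is the set of coboundaries itself, and c lies in its own
  coset.\<close>

lemma trivial_class_coboundary: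
  "\<lbrakk>c \<in> carrier (cochain_group G M n); cohomology_class G M act n c = \<one>\<^bsub>cohomology G M act n\<^esub>\<rbrakk>
    \<Longrightarrow> c \<in> coboundaries G M act n"
  using in_cohomology_class by (fastforce simp: cohomology_def FactGroup_def)

text \<open>In this and the next two formulas the exponents +1 and -1 are resolved. The last term
  has sign (-1)^(n+1), so it is inverted for n = 0 and n = 2 and plain for n = 1.\<close>

lemma differential_0:
  "\<lbrakk>b \<in> carrier (cochain_group G M 0); g \<in> carrier G\<rbrakk>
    \<Longrightarrow> differential G M act 0 b [g] = act g (b []) \<otimes>\<^bsub>M\<^esub> inv\<^bsub>M\<^esub> (b [])"
  by (auto simp: differential_def cochain_group_def tuples_def PiE_iff act_closed M.int_pow_neg M.int_pow_1)

lemma differential_1: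
  "\<lbrakk>b \<in> carrier (cochain_group G M 1); g \<in> carrier G; h \<in> carrier G\<rbrakk>
    \<Longrightarrow> differential G M act 1 b [g, h] = act g (b [h]) \<otimes>\<^bsub>M\<^esub> inv\<^bsub>M\<^esub> (b [g \<otimes>\<^bsub>G\<^esub> h]) \<otimes>\<^bsub>M\<^esub> b [g]"
  using G by (auto simp: differential_def cochain_group_def tuples_def PiE_iff act_closed contract_def
     M.int_pow_neg M.int_pow_1 group.subgroup_self subgroup.m_closed lessThan_Suc Pi_iff)

lemma differential_2:
  "\<lbrakk>b \<in> carrier (cochain_group G M 2); g \<in> carrier G; h \<in> carrier G; k \<in> carrier G\<rbrakk>
    \<Longrightarrow> differential G M act 2 b [g, h, k] =
      act g (b [h, k]) \<otimes>\<^bsub>M\<^esub> (inv\<^bsub>M\<^esub> (b [g \<otimes>\<^bsub>G\<^esub> h, k]) \<otimes>\<^bsub>M\<^esub> b [g, h \<otimes>\<^bsub>G\<^esub> k]) \<otimes>\<^bsub>M\<^esub> inv\<^bsub>M\<^esub> (b [g, h])"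
  using G by (auto simp: differential_def cochain_group_def tuples_def PiE_iff act_closed contract_def
     M.int_pow_neg M.int_pow_1 group.subgroup_self subgroup.m_closed numeral_2_eq_2 lessThan_Suc
     Pi_iff M.m_ac)

end

section \<open>Sheaves with a group action\<close>

lemma sec_sets_of [simp]: "sec (sets_of A) U = carrier (grp A U)"
  and res_sets_of [simp]: "res (sets_of A) = gres A"
  by (simp_all add: sets_of_def)

lemma (in group) inv_mult_cancel [simp]:
    "\<lbrakk>x \<in> carrier G; y \<in> carrier G\<rbrakk> \<Longrightarrow> inv x \<otimes> (x \<otimes> y) = y"
  and mult_inv_cancel [simp]: "\<lbrakk>x \<in> carrier G; y \<in> carrier G\<rbrakk> \<Longrightarrow> x \<otimes> (inv x \<otimes> y) = y"
  by (simp_all flip: m_assoc)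

context abelian_sheaf begin

lemma comm_group_sections [simp]: "U \<in> objs X \<Longrightarrow> comm_group (grp A U)"
  by (rule grp)

lemma group_sections [simp]: "U \<in> objs X \<Longrightarrow> Group.group (grp A U)"
  by (simp add: comm_group.axioms(2))

lemma mult_sections [simp]: "\<lbrakk>U \<in> objs X; a \<in> carrier (grp A U); b \<in> carrier (grp A U)\<rbrakk>
    \<Longrightarrow> a \<otimes>\<^bsub>grp A U\<^esub> b \<in> carrier (grp A U)"
  and one_sections [simp]: "U \<in> objs X \<Longrightarrow> \<one>\<^bsub>grp A U\<^esub> \<in> carrier (grp A U)"
  and inv_sections [simp]: "\<lbrakk>U \<in> objs X; a \<in> carrier (grp A U)\<rbrakk> \<Longrightarrow> inv\<^bsub>grp A U\<^esub> a \<in> carrier (grp A U)"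
  by (meson group_sections group.inv_closed group.is_monoid monoid.m_closed monoid.one_closed)+

lemma gres_is_hom: "f \<in> arrs X \<Longrightarrow> gres A f \<in> hom (grp A (tgt X f)) (grp A (src X f))"
  using gres_hom arrs_in_arrows by blast

lemma gres_closed [simp]:
    "\<lbrakk>f \<in> arrs X; tgt X f = V; src X f = U; a \<in> carrier (grp A V)\<rbrakk> \<Longrightarrow> gres A f a \<in> carrier (grp A U)"
  and gres_mult: "\<lbrakk>f \<in> arrs X; a \<in> carrier (grp A V); b \<in> carrier (grp A V); tgt X f = V; src X f = U\<rbrakk>
    \<Longrightarrow> gres A f (a \<otimes>\<^bsub>grp A V\<^esub> b) = gres A f a \<otimes>\<^bsub>grp A U\<^esub> gres A f b"
  using gres_is_hom by (auto simp: hom_def)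

lemma gres_one: "\<lbrakk>f \<in> arrs X; tgt X f = V; src X f = U\<rbrakk> \<Longrightarrow> gres A f \<one>\<^bsub>grp A V\<^esub> = \<one>\<^bsub>grp A U\<^esub>"
  and gres_inv: "\<lbrakk>f \<in> arrs X; a \<in> carrier (grp A V); tgt X f = V; src X f = U\<rbrakk>
    \<Longrightarrow> gres A f (inv\<^bsub>grp A V\<^esub> a) = inv\<^bsub>grp A U\<^esub> (gres A f a)"
  using gres_is_hom group_hom.hom_one[of "grp A V" "grp A U" "gres A f"]
    group_hom.hom_inv[of "grp A V" "grp A U" "gres A f" a]
  by (auto simp: group_hom_def group_hom_axioms_def)

lemma gres_idt [simp]: "\<lbrakk>U \<in> objs X; a \<in> carrier (grp A U)\<rbrakk> \<Longrightarrow> gres A (idt X U) a = a"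
  using res_idt_sec by simp

lemma gres_gres: "\<lbrakk>f \<in> arrs X; g \<in> arrs X; src X g = tgt X f; tgt X g = W; a \<in> carrier (grp A W)\<rbrakk>
    \<Longrightarrow> gres A f (gres A g a) = gres A (g \<cdot> f) a"
  using res_res[of f g a] by simp

end

context sheaf_action begin

lemma action_hom: "\<lbrakk>g \<in> carrier G; U \<in> objs X\<rbrakk> \<Longrightarrow> \<phi> g U \<in> hom (grp A U) (grp A U)"
  using action_iso by (auto simp: iso_def)

lemma action_closed [simp]:
    "\<lbrakk>g \<in> carrier G; U \<in> objs X; a \<in> carrier (grp A U)\<rbrakk> \<Longrightarrow> \<phi> g U a \<in> carrier (grp A U)"
  and action_prod: "\<lbrakk>g \<in> carrier G; U \<in> objs X; a \<in> carrier (grp A U); b \<in> carrier (grp A U)\<rbrakk>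
    \<Longrightarrow> \<phi> g U (a \<otimes>\<^bsub>grp A U\<^esub> b) = \<phi> g U a \<otimes>\<^bsub>grp A U\<^esub> \<phi> g U b"
  using action_hom by (auto simp: hom_def Pi_iff)

lemma action_one: "\<lbrakk>g \<in> carrier G; U \<in> objs X\<rbrakk> \<Longrightarrow> \<phi> g U \<one>\<^bsub>grp A U\<^esub> = \<one>\<^bsub>grp A U\<^esub>"
  and action_inv: "\<lbrakk>g \<in> carrier G; U \<in> objs X; a \<in> carrier (grp A U)\<rbrakk>
    \<Longrightarrow> \<phi> g U (inv\<^bsub>grp A U\<^esub> a) = inv\<^bsub>grp A U\<^esub> (\<phi> g U a)"
  using action_hom group_hom.hom_one[of "grp A U" "grp A U" "\<phi> g U"]
    group_hom.hom_inv[of "grp A U" "grp A U" "\<phi> g U" a]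
  by (auto simp: group_hom_def group_hom_axioms_def)

lemma action_gres: "\<lbrakk>g \<in> carrier G; f \<in> arrs X; src X f = U; tgt X f = V; a \<in> carrier (grp A V)\<rbrakk>
    \<Longrightarrow> gres A f (\<phi> g V a) = \<phi> g U (gres A f a)"
  using action_morphism[of g] by (auto simp: sheaf_morphism_def)

text \<open>Vanishing is assumed for cosets but needed for cochains. The induced map sends a class
  to a union of cosets, one of which contains the restricted cocycle; as this union is the unit of
  the cohomology group, that is, the set of coboundaries, the restricted cocycle is a
  coboundary.\<close>

lemma vanish_locally_coboundary:
  assumes van: "classes_locally_vanish X G A \<phi> n" and U: "U \<in> objs X"
    and c: "c \<in> carrier (cochain_group G (grp A U) n)"
    and cocycle: "differential G (grp A U) (\<lambda>g. \<phi> g U) n c = \<one>\<^bsub>cochain_group G (grp A U) (n + 1)\<^esub>"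
  shows "\<exists>S \<in> cov X U. \<forall>u \<in> S. (\<lambda>gs \<in> tuples G n. gres A u (c gs)) \<in>
    coboundaries G (grp A (src X u)) (\<lambda>g. \<phi> g (src X u)) n"
proof -
  let ?act = "\<lambda>U g. \<phi> g U"
  have in_class: "c \<in> cohomology_class G (grp A U) (?act U) n c"
    if "U \<in> objs X" "c \<in> carrier (cochain_group G (grp A U) n)" for U c
    by (rule in_cohomology_class) (use that in \<open>simp_all add: action_one group_axioms\<close>)
  let ?K = "cohomology_class G (grp A U) (?act U) n c"
  have "?K \<in> carrier (section_cohomology G A \<phi> n U)"
    using c cocycle
    by (auto simp: cohomology_def FactGroup_def RCOSETS_def cohomology_class_def cocycle_group_def)
  then obtain S where S: "S \<in> cov X U" and trivial: "\<And>u. u \<in> S \<Longrightarrow>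
      induced_map G (grp A (src X u)) (?act (src X u)) n (gres A u) ?K
        = \<one>\<^bsub>section_cohomology G A \<phi> n (src X u)\<^esub>"
    using van U unfolding classes_locally_vanish_def by blast
  have "(\<lambda>gs \<in> tuples G n. gres A u (c gs)) \<in> coboundaries G (grp A (src X u)) (?act (src X u)) n"
    if u: "u \<in> S" for u
  proof -
    let ?r = "\<lambda>gs \<in> tuples G n. gres A u (c gs)"
    note cov = cov_arrs[OF U S u]
    have "?r \<in> carrier (cochain_group G (grp A (src X u)) n)"
      using c cov by (auto simp: cochain_group_def PiE_iff)
    then have "?r \<in> cohomology_class G (grp A (src X u)) (?act (src X u)) n ?r"
      using in_class cov by blast
    moreover have "c \<in> ?K"
      using in_class U c by blast
    ultimately have "?r \<in> induced_map G (grp A (src X u)) (?act (src X u)) n (gres A u) ?K"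
      unfolding induced_map_def by blast
    then show ?thesis
      using trivial[OF u] by (simp add: cohomology_def FactGroup_def)
  qed
  then show ?thesis
    using S by blast
qed

text \<open>The cocycle condition is taken in the form solved for c(gh), which is what comparing two
  sections or two structure arrows produces. Lists as arguments of cochains stay inside the
  proof.\<close>

lemma vanish_1:
  assumes van: "classes_locally_vanish X G A \<phi> 1" and U: "U \<in> objs X"
    and c: "\<And>g. g \<in> carrier G \<Longrightarrow> c g \<in> carrier (grp A U)"
    and cocycle: "\<And>g h. \<lbrakk>g \<in> carrier G; h \<in> carrier G\<rbrakk> \<Longrightarrow> c (g \<otimes>\<^bsub>G\<^esub> h) = \<phi> g U (c h) \<otimes>\<^bsub>grp A U\<^esub> c g"
  shows "\<exists>S \<in> cov X U. \<forall>u \<in> S. \<exists>a \<in> carrier (grp A (src X u)).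
    \<forall>g \<in> carrier G. gres A u (c g) = \<phi> g (src X u) a \<otimes>\<^bsub>grp A (src X u)\<^esub> inv\<^bsub>grp A (src X u)\<^esub> a"
proof -
  interpret M: comm_group "grp A U" by (simp add: U)
  have right_commute: "x \<otimes>\<^bsub>grp A U\<^esub> y \<otimes>\<^bsub>grp A U\<^esub> z = x \<otimes>\<^bsub>grp A U\<^esub> z \<otimes>\<^bsub>grp A U\<^esub> y"
    if "x \<in> carrier (grp A U)" "y \<in> carrier (grp A U)" "z \<in> carrier (grp A U)" for x y z
    using that by (simp add: M.m_ac)
  let ?c = "\<lambda>gs \<in> tuples G 1. c (hd gs)"
  have cc: "?c \<in> carrier (cochain_group G (grp A U) 1)"
    using c by (auto simp: cochain_group_def tuples_1 simp del: One_nat_def)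
  have c_simp: "?c [g] = c g" if "g \<in> carrier G" for g
    using that by (simp add: tuples_1[unfolded One_nat_def])
  have "differential G (grp A U) (\<lambda>g. \<phi> g U) 1 ?c gs = \<one>\<^bsub>cochain_group G (grp A U) (1 + 1)\<^esub> gs" for gs
  proof (cases "gs \<in> tuples G 2")
    case True
    then obtain g h where gh: "gs = [g, h]" "g \<in> carrier G" "h \<in> carrier G"
      by (auto simp: tuples_2)
    have "differential G (grp A U) (\<lambda>g. \<phi> g U) 1 ?c gs =
        \<phi> g U (c h) \<otimes>\<^bsub>grp A U\<^esub> inv\<^bsub>grp A U\<^esub> (\<phi> g U (c h) \<otimes>\<^bsub>grp A U\<^esub> c g) \<otimes>\<^bsub>grp A U\<^esub> c g"
      unfolding gh using gh
      by (subst differential_1[OF group_axioms])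
        (use U cc in \<open>auto simp: action_one c_simp cocycle simp del: One_nat_def restrict_apply\<close>)
    also have "\<dots> = (\<phi> g U (c h) \<otimes>\<^bsub>grp A U\<^esub> c g) \<otimes>\<^bsub>grp A U\<^esub> inv\<^bsub>grp A U\<^esub> (\<phi> g U (c h) \<otimes>\<^bsub>grp A U\<^esub> c g)"
      by (rule right_commute) (use gh c U in simp_all)
    also have "\<dots> = \<one>\<^bsub>grp A U\<^esub>"
      by (rule M.r_inv) (use gh c U in simp)
    finally show ?thesis
      using True by (simp add: cochain_group_def numeral_2_eq_2)
  next
    case False
    then show ?thesis
      by (simp add: cochain_group_def differential_def numeral_2_eq_2)
  qed
  then obtain S where S: "S \<in> cov X U" "\<And>u. u \<in> S \<Longrightarrow> (\<lambda>gs \<in> tuples G 1. gres A u (?c gs)) \<in>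
      coboundaries G (grp A (src X u)) (\<lambda>g. \<phi> g (src X u)) 1"
    using vanish_locally_coboundary[OF van U cc] by blast
  have "\<exists>a \<in> carrier (grp A (src X u)).
    \<forall>g \<in> carrier G. gres A u (c g) = \<phi> g (src X u) a \<otimes>\<^bsub>grp A (src X u)\<^esub> inv\<^bsub>grp A (src X u)\<^esub> a"
    if u: "u \<in> S" for u
  proof -
    note cov = cov_arrs[OF U S(1) u]
    obtain b where b: "b \<in> carrier (cochain_group G (grp A (src X u)) 0)"
      "(\<lambda>gs \<in> tuples G 1. gres A u (?c gs)) = differential G (grp A (src X u)) (\<lambda>g. \<phi> g (src X u)) 0 b"
      using S(2)[OF u] by (auto simp: coboundaries_def)
    have "gres A u (c g) = \<phi> g (src X u) (b []) \<otimes>\<^bsub>grp A (src X u)\<^esub> inv\<^bsub>grp A (src X u)\<^esub> (b [])"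
      if g: "g \<in> carrier G" for g
    proof -
      have "gres A u (c g) = differential G (grp A (src X u)) (\<lambda>g. \<phi> g (src X u)) 0 b [g]"
        using fun_cong[OF b(2), of "[g]"] g c_simp[OF g] by (simp add: tuples_1[unfolded One_nat_def])
      also have "\<dots> = \<phi> g (src X u) (b []) \<otimes>\<^bsub>grp A (src X u)\<^esub> inv\<^bsub>grp A (src X u)\<^esub> (b [])"
        by (rule differential_0[OF group_axioms]) (use cov b g in \<open>auto simp: action_one\<close>)
      finally show ?thesis .
    qed
    moreover have "b [] \<in> carrier (grp A (src X u))"
      using b(1) by (auto simp: cochain_group_def tuples_0)
    ultimately show ?thesis
      by blast
  qed
  then show ?thesis
    using S(1) by blast
qed

text \<open>The 2-cocycle condition is taken without inverses: the two positive terms of the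
  differential stand on the left, the two negative ones on the right. The cochain b may depend on
  the member u of the cover.\<close>

lemma vanish_2:
  assumes van: "classes_locally_vanish X G A \<phi> 2" and U: "U \<in> objs X"
    and c: "\<And>g h. \<lbrakk>g \<in> carrier G; h \<in> carrier G\<rbrakk> \<Longrightarrow> c g h \<in> carrier (grp A U)"
    and cocycle: "\<And>g h k. \<lbrakk>g \<in> carrier G; h \<in> carrier G; k \<in> carrier G\<rbrakk>
      \<Longrightarrow> c g (h \<otimes>\<^bsub>G\<^esub> k) \<otimes>\<^bsub>grp A U\<^esub> \<phi> g U (c h k) = c (g \<otimes>\<^bsub>G\<^esub> h) k \<otimes>\<^bsub>grp A U\<^esub> c g h"
  shows "\<exists>S \<in> cov X U. \<forall>u \<in> S. \<exists>b. (\<forall>g \<in> carrier G. b g \<in> carrier (grp A (src X u))) \<and>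
    (\<forall>g \<in> carrier G. \<forall>h \<in> carrier G. gres A u (c g h) =
      \<phi> g (src X u) (b h) \<otimes>\<^bsub>grp A (src X u)\<^esub> inv\<^bsub>grp A (src X u)\<^esub> (b (g \<otimes>\<^bsub>G\<^esub> h)) \<otimes>\<^bsub>grp A (src X u)\<^esub> b g)"
proof -
  interpret M: comm_group "grp A U" by (simp add: U)
  let ?c = "\<lambda>gs \<in> tuples G 2. c (hd gs) (hd (tl gs))"
  have cc: "?c \<in> carrier (cochain_group G (grp A U) 2)"
    using c by (auto simp: cochain_group_def tuples_2)
  have c_simp: "?c [g, h] = c g h" if "g \<in> carrier G" "h \<in> carrier G" for g h
    using that by (simp add: tuples_2)
  have "differential G (grp A U) (\<lambda>g. \<phi> g U) 2 ?c gs = \<one>\<^bsub>cochain_group G (grp A U) (2 + 1)\<^esub> gs" for gs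
  proof (cases "gs \<in> tuples G 3")
    case True
    then obtain g h k where ghk: "gs = [g, h, k]" "g \<in> carrier G" "h \<in> carrier G" "k \<in> carrier G"
      by (auto simp: tuples_3)
    let ?r = "c (g \<otimes>\<^bsub>G\<^esub> h) k" and ?s = "c g h" and ?t = "c g (h \<otimes>\<^bsub>G\<^esub> k)" and ?w = "\<phi> g U (c h k)"
    have cl: "?r \<in> carrier (grp A U)" "?s \<in> carrier (grp A U)" "?t \<in> carrier (grp A U)"
        "?w \<in> carrier (grp A U)"
      using ghk c U by simp_all
    have "differential G (grp A U) (\<lambda>g. \<phi> g U) 2 ?c gs =
        ?w \<otimes>\<^bsub>grp A U\<^esub> (inv\<^bsub>grp A U\<^esub> ?r \<otimes>\<^bsub>grp A U\<^esub> ?t) \<otimes>\<^bsub>grp A U\<^esub> inv\<^bsub>grp A U\<^esub> ?s"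
      unfolding ghk(1) using ghk
      by (subst differential_2[OF group_axioms])
        (use U cc in \<open>auto simp: action_one c_simp simp del: restrict_apply\<close>)
    also have "\<dots> = (?t \<otimes>\<^bsub>grp A U\<^esub> ?w) \<otimes>\<^bsub>grp A U\<^esub> inv\<^bsub>grp A U\<^esub> (?r \<otimes>\<^bsub>grp A U\<^esub> ?s)"
      using cl by (simp add: M.inv_mult_group M.m_ac)
    also have "\<dots> = \<one>\<^bsub>grp A U\<^esub>"
      using cocycle[OF ghk(2-4)] cl by simp
    finally show ?thesis
      using True by (simp add: cochain_group_def numeral_3_eq_3 numeral_2_eq_2)
  next
    case False
    then show ?thesis
      by (simp add: cochain_group_def differential_def numeral_3_eq_3 numeral_2_eq_2)
  qed
  then obtain S where S: "S \<in> cov X U" "\<And>u. u \<in> S \<Longrightarrow> (\<lambda>gs \<in> tuples G 2. gres A u (?c gs)) \<in>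
      coboundaries G (grp A (src X u)) (\<lambda>g. \<phi> g (src X u)) 2"
    using vanish_locally_coboundary[OF van U cc] by blast
  have "\<exists>b. (\<forall>g \<in> carrier G. b g \<in> carrier (grp A (src X u))) \<and>
    (\<forall>g \<in> carrier G. \<forall>h \<in> carrier G. gres A u (c g h) =
      \<phi> g (src X u) (b h) \<otimes>\<^bsub>grp A (src X u)\<^esub> inv\<^bsub>grp A (src X u)\<^esub> (b (g \<otimes>\<^bsub>G\<^esub> h)) \<otimes>\<^bsub>grp A (src X u)\<^esub> b g)"
    if u: "u \<in> S" for u
  proof -
    note cov = cov_arrs[OF U S(1) u]
    obtain b where b: "b \<in> carrier (cochain_group G (grp A (src X u)) 1)"
      "(\<lambda>gs \<in> tuples G 2. gres A u (?c gs)) = differential G (grp A (src X u)) (\<lambda>g. \<phi> g (src X u)) 1 b"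
      using S(2)[OF u] by (auto simp: coboundaries_def numeral_2_eq_2)
    have "gres A u (c g h) = \<phi> g (src X u) (b [h]) \<otimes>\<^bsub>grp A (src X u)\<^esub>
        inv\<^bsub>grp A (src X u)\<^esub> (b [g \<otimes>\<^bsub>G\<^esub> h]) \<otimes>\<^bsub>grp A (src X u)\<^esub> b [g]"
      if g: "g \<in> carrier G" "h \<in> carrier G" for g h
    proof -
      have "gres A u (c g h) = differential G (grp A (src X u)) (\<lambda>g. \<phi> g (src X u)) 1 b [g, h]"
        using fun_cong[OF b(2), of "[g, h]"] g c_simp[OF g] by (simp add: tuples_2)
      also have "\<dots> = \<phi> g (src X u) (b [h]) \<otimes>\<^bsub>grp A (src X u)\<^esub>
          inv\<^bsub>grp A (src X u)\<^esub> (b [g \<otimes>\<^bsub>G\<^esub> h]) \<otimes>\<^bsub>grp A (src X u)\<^esub> b [g]"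
        by (rule differential_1[OF group_axioms]) (use cov b g in \<open>auto simp: action_one\<close>)
      finally show ?thesis .
    qed
    moreover have "b [g] \<in> carrier (grp A (src X u))" if "g \<in> carrier G" for g
      using b(1) that by (auto simp: cochain_group_def tuples_1[unfolded One_nat_def])
    ultimately show ?thesis
      by (intro exI[of _ "\<lambda>g. b [g]"]) blast
  qed
  then show ?thesis
    using S(1) by blast
qed

text \<open>Meant for the final object: a class that is trivial there, not just locally, provides
  one cochain b for the whole site.\<close>

lemma trivial_class_2:
  assumes U: "U \<in> objs X"
    and c: "\<And>g h. \<lbrakk>g \<in> carrier G; h \<in> carrier G\<rbrakk> \<Longrightarrow> c g h \<in> carrier (grp A U)"
    and trivial: "cohomology_class G (grp A U) (\<lambda>g. \<phi> g U) 2 (\<lambda>gs \<in> tuples G 2. c (gs ! 0) (gs ! 1))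
      = \<one>\<^bsub>section_cohomology G A \<phi> 2 U\<^esub>"
  obtains b where "\<And>g. g \<in> carrier G \<Longrightarrow> b g \<in> carrier (grp A U)"
    "\<And>g h. \<lbrakk>g \<in> carrier G; h \<in> carrier G\<rbrakk> \<Longrightarrow>
      c g h = \<phi> g U (b h) \<otimes>\<^bsub>grp A U\<^esub> inv\<^bsub>grp A U\<^esub> (b (g \<otimes>\<^bsub>G\<^esub> h)) \<otimes>\<^bsub>grp A U\<^esub> b g"
proof -
  let ?c = "\<lambda>gs \<in> tuples G 2. c (gs ! 0) (gs ! 1)"
  have "?c \<in> coboundaries G (grp A U) (\<lambda>g. \<phi> g U) 2"
    by (rule trivial_class_coboundary[OF group_axioms _ _ _ _ trivial])
      (use U c in \<open>auto simp: cochain_group_def tuples_2 action_one\<close>)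
  then obtain b where b: "b \<in> carrier (cochain_group G (grp A U) 1)"
      "?c = differential G (grp A U) (\<lambda>g. \<phi> g U) 1 b"
    by (auto simp: coboundaries_def numeral_2_eq_2)
  show ?thesis
  proof (rule that[of "\<lambda>g. b [g]"])
    show "b [g] \<in> carrier (grp A U)" if "g \<in> carrier G" for g
      using b(1) that by (auto simp: cochain_group_def tuples_1[unfolded One_nat_def])
    show "c g h = \<phi> g U (b [h]) \<otimes>\<^bsub>grp A U\<^esub> inv\<^bsub>grp A U\<^esub> (b [g \<otimes>\<^bsub>G\<^esub> h]) \<otimes>\<^bsub>grp A U\<^esub> b [g]"
      if g: "g \<in> carrier G" "h \<in> carrier G" for g h
    proof -
      have "c g h = differential G (grp A U) (\<lambda>g. \<phi> g U) 1 b [g, h]"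
        using fun_cong[OF b(2), of "[g, h]"] g by (simp add: tuples_2)
      then show ?thesis
        by (subst (asm) differential_1[OF group_axioms]) (use U b g in \<open>auto simp: action_one\<close>)
    qed
  qed
qed

lemma trivial_class_3:
  assumes U: "U \<in> objs X"
    and c: "\<And>g h k. \<lbrakk>g \<in> carrier G; h \<in> carrier G; k \<in> carrier G\<rbrakk> \<Longrightarrow> c g h k \<in> carrier (grp A U)"
    and trivial: "cohomology_class G (grp A U) (\<lambda>g. \<phi> g U) 3
      (\<lambda>gs \<in> tuples G 3. c (gs ! 0) (gs ! 1) (gs ! 2)) = \<one>\<^bsub>section_cohomology G A \<phi> 3 U\<^esub>"
  obtains b where "\<And>g h. \<lbrakk>g \<in> carrier G; h \<in> carrier G\<rbrakk> \<Longrightarrow> b g h \<in> carrier (grp A U)"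
    "\<And>g h k. \<lbrakk>g \<in> carrier G; h \<in> carrier G; k \<in> carrier G\<rbrakk> \<Longrightarrow>
      c g h k = \<phi> g U (b h k) \<otimes>\<^bsub>grp A U\<^esub> (inv\<^bsub>grp A U\<^esub> (b (g \<otimes>\<^bsub>G\<^esub> h) k) \<otimes>\<^bsub>grp A U\<^esub> b g (h \<otimes>\<^bsub>G\<^esub> k))
        \<otimes>\<^bsub>grp A U\<^esub> inv\<^bsub>grp A U\<^esub> (b g h)"
proof -
  let ?c = "\<lambda>gs \<in> tuples G 3. c (gs ! 0) (gs ! 1) (gs ! 2)"
  have "?c \<in> coboundaries G (grp A U) (\<lambda>g. \<phi> g U) 3"
    by (rule trivial_class_coboundary[OF group_axioms _ _ _ _ trivial])
      (use U c in \<open>auto simp: cochain_group_def tuples_3 action_one\<close>)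
  then obtain b where b: "b \<in> carrier (cochain_group G (grp A U) 2)"
      "?c = differential G (grp A U) (\<lambda>g. \<phi> g U) 2 b"
    by (auto simp: coboundaries_def numeral_3_eq_3 numeral_2_eq_2)
  show ?thesis
  proof (rule that[of "\<lambda>g h. b [g, h]"])
    show "b [g, h] \<in> carrier (grp A U)" if "g \<in> carrier G" "h \<in> carrier G" for g h
      using b(1) that by (auto simp: cochain_group_def tuples_2)
    show "c g h k = \<phi> g U (b [h, k]) \<otimes>\<^bsub>grp A U\<^esub> (inv\<^bsub>grp A U\<^esub> (b [g \<otimes>\<^bsub>G\<^esub> h, k]) \<otimes>\<^bsub>grp A U\<^esub> b [g, h \<otimes>\<^bsub>G\<^esub> k])
        \<otimes>\<^bsub>grp A U\<^esub> inv\<^bsub>grp A U\<^esub> (b [g, h])"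
      if g: "g \<in> carrier G" "h \<in> carrier G" "k \<in> carrier G" for g h k
    proof -
      have "c g h k = differential G (grp A U) (\<lambda>g. \<phi> g U) 2 b [g, h, k]"
        using fun_cong[OF b(2), of "[g, h, k]"] g by (simp add: tuples_3)
      then show ?thesis
        by (subst (asm) differential_2[OF group_axioms]) (use U b g in \<open>auto simp: action_one\<close>)
    qed
  qed
qed

end

section \<open>Torsors\<close>

lemma carrier_invariants [simp]:
    "carrier (grp (invariants G A \<phi>) U) = {a \<in> carrier (grp A U). \<forall>g \<in> carrier G. \<phi> g U a = a}"
  and mult_invariants [simp]: "mult (grp (invariants G A \<phi>) U) = mult (grp A U)"
  and one_invariants [simp]: "one (grp (invariants G A \<phi>) U) = one (grp A U)"
  and gres_invariants [simp]: "gres (invariants G A \<phi>) = gres A"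
  by (simp_all add: invariants_def)

context torsor begin

lemma difference:
  assumes "U \<in> objs X" "s \<in> sec y U" "t \<in> sec y U"
  obtains a where "a \<in> carrier (grp A U)" "smul y U a s = t"
  using simply_transitive[OF assms] by blast

lemma smul_cancel:
  assumes "U \<in> objs X" "s \<in> sec y U" "a \<in> carrier (grp A U)" "b \<in> carrier (grp A U)"
    "smul y U a s = smul y U b s"
  shows "a = b"
  using simply_transitive[OF assms(1,2) smul_closed[OF assms(1,3,2)]] assms by metis

lemma smul_sec [simp]: "\<lbrakk>U \<in> objs X; a \<in> carrier (grp A U); s \<in> sec y U\<rbrakk> \<Longrightarrow> smul y U a s \<in> sec y U"
  by (rule smul_closed)

lemma res_smul:
  "\<lbrakk>f \<in> arrs X; a \<in> carrier (grp A V); s \<in> sec y V; tgt X f = V; src X f = U\<rbrakk>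
    \<Longrightarrow> res y f (smul y V a s) = smul y U (gres A f a) (res y f s)"
  using smul_res arrs_in_arrows by blast

lemma res_sec' [simp]: "\<lbrakk>f \<in> arrs X; tgt X f = V; src X f = U; s \<in> sec y V\<rbrakk> \<Longrightarrow> res y f s \<in> sec y U"
  using res_sec by blast

end

context sheaf_action begin

lemma torsor_lift_simps:
  assumes "torsor_lift X G A \<phi> y l" "g \<in> carrier G"
  shows "\<lbrakk>U \<in> objs X; s \<in> sec y U\<rbrakk> \<Longrightarrow> l g U s \<in> sec y U"
    and "\<lbrakk>f \<in> arrs X; s \<in> sec y V; tgt X f = V; src X f = U\<rbrakk> \<Longrightarrow> res y f (l g V s) = l g U (res y f s)"
    and "\<lbrakk>U \<in> objs X; a \<in> carrier (grp A U); s \<in> sec y U\<rbrakk>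
      \<Longrightarrow> l g U (smul y U a s) = smul y U (\<phi> g U a) (l g U s)"
  using assms by (auto simp: torsor_lift_def equivariant_torsor_morphism_def sheaf_morphism_def)

text \<open>Justifies the definite description behind \<chi>. Where y has a section s, its images
  under \<lambda>_g \<lambda>_h and under \<lambda>_gh differ by a unique element; this element is
  independent of s and compatible with restriction, hence comes from a unique section over
  T.\<close>

lemma torsor_cocycle:
  assumes T: "final_object X T" and y: "torsor X A y" and lift: "torsor_lift X G A \<phi> y l"
    and g: "g \<in> carrier G" and h: "h \<in> carrier G"
  shows "torsor_cocycle X T G A y l g h \<in> carrier (grp A T)"
    and "\<lbrakk>U \<in> objs X; s \<in> sec y U\<rbrakk> \<Longrightarrow> l g U (l h U s) =
      smul y U (gres A (to_final X T U) (torsor_cocycle X T G A y l g h)) (l (g \<otimes>\<^bsub>G\<^esub> h) U s)"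
proof -
  interpret y: torsor X A y by (rule y)
  note l = torsor_lift_simps[OF lift]
  have gh: "g \<otimes>\<^bsub>G\<^esub> h \<in> carrier G"
    using g h by simp
  \<comment> \<open>Empty where y has no sections, a singleton elsewhere.\<close>
  define K where "K U = {a \<in> carrier (grp A U). \<exists>s \<in> sec y U.
    l g U (l h U s) = smul y U a (l (g \<otimes>\<^bsub>G\<^esub> h) U s)}" for U
  \<comment> \<open>Replacing s' by b s' multiplies both sides by \<phi>_gh(b), and A is
    commutative, so one section decides for all.\<close>
  have all: "l g U (l h U s) = smul y U a (l (g \<otimes>\<^bsub>G\<^esub> h) U s)"
    if U: "U \<in> objs X" and s: "s \<in> sec y U" and a: "a \<in> K U" for U s a
  proof -
    interpret M: comm_group "grp A U" by (simp add: U)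
    obtain s' where s': "s' \<in> sec y U" "l g U (l h U s') = smul y U a (l (g \<otimes>\<^bsub>G\<^esub> h) U s')"
      using a by (auto simp: K_def)
    obtain b where b: "b \<in> carrier (grp A U)" "smul y U b s' = s"
      using y.difference[OF U s'(1) s] .
    have a': "a \<in> carrier (grp A U)"
      using a by (simp add: K_def)
    let ?b = "\<phi> (g \<otimes>\<^bsub>G\<^esub> h) U b"
    have b': "?b \<in> carrier (grp A U)"
      using b U gh by simp
    have "l g U (l h U s) = smul y U ?b (smul y U a (l (g \<otimes>\<^bsub>G\<^esub> h) U s'))"
      using U b s' l(1,3)[OF g] l(1,3)[OF h] g h action_mult by (simp flip: b(2) s'(2))
    also have "\<dots> = smul y U a (smul y U ?b (l (g \<otimes>\<^bsub>G\<^esub> h) U s'))"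
      using y.smul_mult[OF U a' b'] y.smul_mult[OF U b' a'] M.m_comm[OF a' b']
        l(1)[OF gh U s'(1)] by metis
    also have "smul y U ?b (l (g \<otimes>\<^bsub>G\<^esub> h) U s') = l (g \<otimes>\<^bsub>G\<^esub> h) U s"
      using l(3)[OF gh U b(1) s'(1)] b(2) by simp
    finally show ?thesis .
  qed
  have ex: "\<exists>a \<in> K U. l g U (l h U s) = smul y U a (l (g \<otimes>\<^bsub>G\<^esub> h) U s)"
    if U: "U \<in> objs X" and s: "s \<in> sec y U" for U s
  proof -
    obtain a where "a \<in> carrier (grp A U)" "smul y U a (l (g \<otimes>\<^bsub>G\<^esub> h) U s) = l g U (l h U s)"
      using y.difference[OF U l(1)[OF gh U s] l(1)[OF g U l(1)[OF h U s]]] .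
    then show ?thesis
      using s by (intro bexI[of _ a]) (auto simp: K_def intro!: bexI[of _ s])
  qed
  have "\<exists>!t. t \<in> sec (sets_of A) T \<and> (\<forall>U \<in> objs X. \<forall>k \<in> K U. res (sets_of A) (to_final X T U) t = k)"
  proof (rule global_section[OF T])
    show "K U \<subseteq> sec (sets_of A) U" for U
      by (auto simp: K_def)
  next
    fix f k assume f: "f \<in> arrs X" and k: "k \<in> K (tgt X f)"
    obtain s where s: "s \<in> sec y (tgt X f)"
        "l g (tgt X f) (l h (tgt X f) s) = smul y (tgt X f) k (l (g \<otimes>\<^bsub>G\<^esub> h) (tgt X f) s)"
      and k': "k \<in> carrier (grp A (tgt X f))"
      using k by (auto simp: K_def)
    have "l g (src X f) (l h (src X f) (res y f s)) = res y f (l g (tgt X f) (l h (tgt X f) s))"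
      using f s(1) l(1,2)[OF g] l(1,2)[OF h] by simp
    also have "\<dots> = smul y (src X f) (gres A f k) (l (g \<otimes>\<^bsub>G\<^esub> h) (src X f) (res y f s))"
      using f s k' l(1,2)[OF gh] by (simp add: y.res_smul)
    finally show "res (sets_of A) f k \<in> K (src X f)"
      using f s(1) k' y.res_sec[OF f s(1)] by (auto simp: K_def)
  next
    fix U k k' assume U: "U \<in> objs X" and k: "k \<in> K U" and k': "k' \<in> K U"
    obtain s where s: "s \<in> sec y U"
      using k by (auto simp: K_def)
    show "k = k'"
      using all[OF U s k] all[OF U s k'] y.smul_cancel[OF U l(1)[OF gh U s]] k k'
      by (auto simp: K_def)
  next
    fix U assume U: "U \<in> objs X"
    obtain S where S: "S \<in> cov X U" "\<forall>u \<in> S. sec y (src X u) \<noteq> {}"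
      using y.locally_nonempty[OF U] by blast
    have "K (src X u) \<noteq> {}" if "u \<in> S" for u
      using S that ex cov_arrs[OF U S(1) that] by fast
    then show "\<exists>S \<in> cov X U. \<forall>u \<in> S. K (src X u) \<noteq> {}"
      using S(1) by blast
  qed
  \<comment> \<open>Turns the property obtained from gluing into the one by which \<chi> is
    defined.\<close>
  moreover have "(\<forall>U \<in> objs X. \<forall>k \<in> K U. res (sets_of A) (to_final X T U) t = k) \<longleftrightarrow>
      (\<forall>U \<in> objs X. \<forall>s \<in> sec y U.
        l g U (l h U s) = smul y U (gres A (to_final X T U) t) (l (g \<otimes>\<^bsub>G\<^esub> h) U s))"
    if t: "t \<in> sec (sets_of A) T" for t
  proof (intro iffI ballI)
    fix U s assume "\<forall>U \<in> objs X. \<forall>k \<in> K U. res (sets_of A) (to_final X T U) t = k"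
      "U \<in> objs X" "s \<in> sec y U"
    then show "l g U (l h U s) = smul y U (gres A (to_final X T U) t) (l (g \<otimes>\<^bsub>G\<^esub> h) U s)"
      using ex[of U s] by auto
  next
    fix U k assume eq: "\<forall>U \<in> objs X. \<forall>s \<in> sec y U.
        l g U (l h U s) = smul y U (gres A (to_final X T U) t) (l (g \<otimes>\<^bsub>G\<^esub> h) U s)"
      and U: "U \<in> objs X" and k: "k \<in> K U"
    obtain s where s: "s \<in> sec y U"
      using k by (auto simp: K_def)
    have t': "gres A (to_final X T U) t \<in> carrier (grp A U)"
      using t final_arr[OF T U] by simp
    show "res (sets_of A) (to_final X T U) t = k"
      using all[OF U s k] eq U s y.smul_cancel[OF U l(1)[OF gh U s] t'] k by (auto simp: K_def)
  qed
  ultimately have "\<exists>!t. t \<in> carrier (grp A T) \<and> (\<forall>U \<in> objs X. \<forall>s \<in> sec y U.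
        l g U (l h U s) = smul y U (gres A (to_final X T U) t) (l (g \<otimes>\<^bsub>G\<^esub> h) U s))"
    by (auto simp: Ex1_def)
  from theI'[OF this] show "torsor_cocycle X T G A y l g h \<in> carrier (grp A T)"
    and "\<lbrakk>U \<in> objs X; s \<in> sec y U\<rbrakk> \<Longrightarrow> l g U (l h U s) =
      smul y U (gres A (to_final X T U) (torsor_cocycle X T G A y l g h)) (l (g \<otimes>\<^bsub>G\<^esub> h) U s)"
    by (auto simp: torsor_cocycle_def)
qed

definition fixed_subsheaf ::
  "('o, 'm, 's, 'a) torsor \<Rightarrow> ('g \<Rightarrow> 'o \<Rightarrow> 's \<Rightarrow> 's) \<Rightarrow> ('o, 'm, 's, 'a) torsor" where
  "fixed_subsheaf y l =
    \<lparr>sec = \<lambda>U. {s \<in> sec y U. \<forall>g \<in> carrier G. l g U s = s}, res = res y, smul = smul y\<rparr>"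

lemma fixed_subsheaf_simps [simp]:
  "sec (fixed_subsheaf y l) U = {s \<in> sec y U. \<forall>g \<in> carrier G. l g U s = s}"
  "res (fixed_subsheaf y l) = res y" "smul (fixed_subsheaf y l) = smul y"
  by (simp_all add: fixed_subsheaf_def)

text \<open>Being fixed is a local condition, so the subsheaf inherits gluing. If s and a s are both
  fixed, applying \<lambda>_g gives \<phi>_g(a) s = a s, so a is invariant; this is why the
  structure group shrinks to the invariants.\<close>

lemma fixed_subsheaf_torsor:
  assumes van: "classes_locally_vanish X G A \<phi> 1"
    and y: "torsor X A y" and lift: "torsor_lift X G A \<phi> y l"
    and strict: "\<And>g h U s. \<lbrakk>g \<in> carrier G; h \<in> carrier G; U \<in> objs X; s \<in> sec y U\<rbrakk>
      \<Longrightarrow> l g U (l h U s) = l (g \<otimes>\<^bsub>G\<^esub> h) U s"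
  shows "torsor X (invariants G A \<phi>) (fixed_subsheaf y l)"
proof -
  interpret y: torsor X A y by (rule y)
  note l = torsor_lift_simps[OF lift]
  let ?z = "fixed_subsheaf y l"
  have presheaf: "presheaf X ?z"
  proof unfold_locales
    fix f U V s assume f: "f \<in> arrows X U V" and s: "s \<in> sec ?z V"
    have "l g U (res y f s) = res y f s" if g: "g \<in> carrier G" for g
      using l(2)[OF g, of f s V U] f s g by (auto simp: arrows_def)
    then show "res ?z f s \<in> sec ?z U"
      using f s by (auto simp: arrows_def)
  qed (auto simp: arrows_def y.res_res)
  have sheaf: "sheaf X ?z"
  proof (intro sheaf.intro presheaf sheaf_axioms.intro)
    fix U S s assume U: "U \<in> objs X" and S: "S \<in> cov X U" and s: "matching_family X ?z S s"
    have s': "matching_family X y S s" and fixed: "\<And>u g. \<lbrakk>u \<in> S; g \<in> carrier G\<rbrakk> \<Longrightarrow> l g (src X u) (s u) = s u"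
      using s by (auto simp: matching_family_def)
    obtain t where t: "t \<in> sec y U" "\<forall>u \<in> S. res y u t = s u"
      using y.glue[OF U S s'] by blast
    have "l g U t = t" if g: "g \<in> carrier G" for g
      by (rule y.separation[OF U S])
        (use cov_arrs[OF U S] t U l(1,2)[OF g] fixed[OF _ g] in auto)
    then show "\<exists>!t. t \<in> sec ?z U \<and> (\<forall>u \<in> S. res ?z u t = s u)"
      using t y.separation[OF U S] by (intro ex1I[of _ t]) auto
  qed
  show ?thesis
  proof (intro torsor.intro sheaf torsor_axioms.intro)
    fix U s t assume U: "U \<in> objs X" and s: "s \<in> sec ?z U" and t: "t \<in> sec ?z U"
    obtain a where a: "a \<in> carrier (grp A U)" "smul y U a s = t"
      using y.difference[OF U, of s t] s t by auto
    have "\<phi> g U a = a" if g: "g \<in> carrier G" for g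
    proof (rule y.smul_cancel[OF U, of s])
      have "smul y U (\<phi> g U a) s = l g U (smul y U a s)"
        using l(3)[OF g U a(1), of s] s g by simp
      then show "smul y U (\<phi> g U a) s = smul y U a s"
        using a(2) t g by simp
    qed (use g U a s in auto)
    then show "\<exists>!a. a \<in> carrier (grp (invariants G A \<phi>) U) \<and> smul ?z U a s = t"
      using a y.smul_cancel[OF U, of s] s by (intro ex1I[of _ a]) auto
  next
    fix U assume U: "U \<in> objs X"
    obtain S where S: "S \<in> cov X U" "\<forall>u \<in> S. sec y (src X u) \<noteq> {}"
      using y.locally_nonempty[OF U] by blast
    show "\<exists>S \<in> cov X U. \<forall>u \<in> S. sec ?z (src X u) \<noteq> {}"
    proof (rule local_compose[OF U S(1)])
      fix u assume u: "u \<in> S"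
      note cov = cov_arrs[OF U S(1) u]
      let ?V = "src X u"
      interpret M: comm_group "grp A ?V" by (simp add: cov)
      obtain s where s: "s \<in> sec y ?V"
        using S(2) u by blast
      have "\<exists>a. g \<in> carrier G \<longrightarrow> a \<in> carrier (grp A ?V) \<and> smul y ?V a s = l g ?V s" for g
        using y.difference[OF cov(3) s l(1)[OF _ cov(3) s]] by metis
      then obtain c where c: "\<And>g. g \<in> carrier G \<Longrightarrow> c g \<in> carrier (grp A ?V)"
          "\<And>g. g \<in> carrier G \<Longrightarrow> smul y ?V (c g) s = l g ?V s"
        by metis
      \<comment> \<open>Multiplicativity of the lift read on s: applying \<lambda>_g to c(h) s
        produces the coefficient \<phi>_g(c(h)) c(g).\<close>
      have "c (g \<otimes>\<^bsub>G\<^esub> h) = \<phi> g ?V (c h) \<otimes>\<^bsub>grp A ?V\<^esub> c g" if gh: "g \<in> carrier G" "h \<in> carrier G" for g h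
      proof (rule y.smul_cancel[OF cov(3) s])
        have "smul y ?V (c (g \<otimes>\<^bsub>G\<^esub> h)) s = l g ?V (smul y ?V (c h) s)"
          using gh strict[OF gh cov(3) s] c by simp
        also have "\<dots> = smul y ?V (\<phi> g ?V (c h)) (smul y ?V (c g) s)"
          using gh l(3)[OF gh(1) cov(3) c(1)[OF gh(2)] s] c by simp
        finally show "smul y ?V (c (g \<otimes>\<^bsub>G\<^esub> h)) s = smul y ?V (\<phi> g ?V (c h) \<otimes>\<^bsub>grp A ?V\<^esub> c g) s"
          using gh c cov s by (simp add: y.smul_mult)
      qed (use gh c cov in simp_all)
      from vanish_1[OF van cov(3) c(1) this]
      obtain R where R: "R \<in> cov X ?V" and loc: "\<And>v. v \<in> R \<Longrightarrow> \<exists>a \<in> carrier (grp A (src X v)).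
          \<forall>g \<in> carrier G. gres A v (c g) = \<phi> g (src X v) a \<otimes>\<^bsub>grp A (src X v)\<^esub> inv\<^bsub>grp A (src X v)\<^esub> a"
        by blast
      have "sec ?z (src X (u \<cdot>\<^bsub>X\<^esub> v)) \<noteq> {}" if v: "v \<in> R" for v
      proof -
        note cv = cov_arrs[OF cov(3) R v]
        let ?W = "src X v"
        interpret N: comm_group "grp A ?W" by (simp add: cv)
        obtain a where a: "a \<in> carrier (grp A ?W)" "\<And>g. g \<in> carrier G \<Longrightarrow>
            gres A v (c g) = \<phi> g ?W a \<otimes>\<^bsub>grp A ?W\<^esub> inv\<^bsub>grp A ?W\<^esub> a"
          using loc[OF v] by blast
        let ?t = "smul y ?W (inv\<^bsub>grp A ?W\<^esub> a) (res y v s)"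
        have "l g ?W ?t = ?t" if g: "g \<in> carrier G" for g
        proof -
          have "l g ?W ?t = smul y ?W (inv\<^bsub>grp A ?W\<^esub> (\<phi> g ?W a)) (res y v (l g ?V s))"
            using l[OF g] g a cv s by (simp add: action_inv)
          also have "res y v (l g ?V s) = smul y ?W (\<phi> g ?W a \<otimes>\<^bsub>grp A ?W\<^esub> inv\<^bsub>grp A ?W\<^esub> a) (res y v s)"
            using g s cv c(1)[OF g] a(2)[OF g] by (simp add: y.res_smul flip: c(2))
          also have "smul y ?W (inv\<^bsub>grp A ?W\<^esub> (\<phi> g ?W a)) \<dots> = ?t"
            using g a(1) s cv
            by (simp add: N.inv_solve_left' flip: y.smul_mult N.m_assoc)
          finally show ?thesis .
        qed
        then have "?t \<in> sec ?z ?W"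
          using a s cv by simp
        then show ?thesis
          using cv cov by auto
      qed
      then show "\<exists>R \<in> cov X (src X u). \<forall>v \<in> R. sec ?z (src X (u \<cdot>\<^bsub>X\<^esub> v)) \<noteq> {}"
        using R by blast
    qed
  qed (auto simp: y.smul_one y.smul_mult l y.res_smul arrows_def)
qed

lemma fixed_subsheaf_inclusion:
  "equivariant_torsor_morphism X (invariants G A \<phi>) inclusion (fixed_subsheaf y l) y inclusion"
  by (simp add: equivariant_torsor_morphism_def sheaf_morphism_def inclusion_def)

text \<open>If t = a s has the same image as s, then a fixes that image, and simple transitivity in
  y forces a = 1.\<close>

lemma equivariant_inclusion_injective:
  assumes y: "torsor X A y" and z: "torsor X (invariants G A \<phi>) z"
    and f: "equivariant_torsor_morphism X (invariants G A \<phi>) inclusion z y f"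
    and U: "U \<in> objs X"
  shows "inj_on (f U) (sec z U)"
proof (rule inj_onI)
  interpret y: torsor X A y by (rule y)
  interpret z: torsor X "invariants G A \<phi>" z by (rule z)
  fix s t assume s: "s \<in> sec z U" and t: "t \<in> sec z U" and eq: "f U s = f U t"
  obtain a where a: "a \<in> carrier (grp (invariants G A \<phi>) U)" "smul z U a s = t"
    using z.difference[OF U s t] .
  have "f U s \<in> sec y U"
    using f U s by (auto simp: equivariant_torsor_morphism_def sheaf_morphism_def)
  moreover have "smul y U a (f U s) = f U s"
    using f U s a eq by (auto simp: equivariant_torsor_morphism_def inclusion_def)
  ultimately have "a = \<one>\<^bsub>grp A U\<^esub>"
    using y.smul_cancel[OF U, of "f U s" a "\<one>\<^bsub>grp A U\<^esub>"] a U by (simp add: y.smul_one)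
  then show "s = t"
    using a(2) z.smul_one[OF U s] by simp
qed

text \<open>Locally a fixed section t and an image under f differ by some a; as both are fixed, a is
  invariant and can be moved inside f. The local preimages glue because f is injective.\<close>

lemma equivariant_inclusion_image:
  assumes y: "torsor X A y" and lift: "torsor_lift X G A \<phi> y l"
    and z: "torsor X (invariants G A \<phi>) z"
    and f: "equivariant_torsor_morphism X (invariants G A \<phi>) inclusion z y f"
    and fixed: "\<forall>g \<in> carrier G. \<forall>U \<in> objs X. \<forall>s \<in> sec z U. l g U (f U s) = f U s"
    and U: "U \<in> objs X"
  shows "f U ` sec z U = sec (fixed_subsheaf y l) U"
proof (intro equalityI subsetI)
  interpret y: torsor X A y by (rule y)
  interpret z: torsor X "invariants G A \<phi>" z by (rule z)
  note l = torsor_lift_simps[OF lift]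
  have f_sec: "f U s \<in> sec y U" if "U \<in> objs X" "s \<in> sec z U" for U s
    using f that by (auto simp: equivariant_torsor_morphism_def sheaf_morphism_def)
  have f_res: "f (src X u) (res z u s) = res y u (f (tgt X u) s)" if "u \<in> arrs X" "s \<in> sec z (tgt X u)" for u s
    using f that by (auto simp: equivariant_torsor_morphism_def sheaf_morphism_def)
  have f_smul: "f U (smul z U a s) = smul y U a (f U s)"
    if "U \<in> objs X" "s \<in> sec z U" "a \<in> carrier (grp (invariants G A \<phi>) U)" for U s a
    using f that by (auto simp: equivariant_torsor_morphism_def inclusion_def)
  note inj = equivariant_inclusion_injective[OF y z f]
  {
    fix t assume "t \<in> f U ` sec z U"
    then show "t \<in> sec (fixed_subsheaf y l) U"
      using f_sec U fixed by auto
  next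
    fix t assume t: "t \<in> sec (fixed_subsheaf y l) U"
    obtain S where S: "S \<in> cov X U" "\<forall>u \<in> S. sec z (src X u) \<noteq> {}"
      using z.locally_nonempty[OF U] by blast
    note cov = cov_arrs[OF U S(1)]
    have "\<exists>s \<in> sec z (src X u). f (src X u) s = res y u t" if u: "u \<in> S" for u
    proof -
      let ?V = "src X u"
      note V = cov[OF u]
      obtain s where s: "s \<in> sec z ?V"
        using S(2) u by blast
      have tu: "res y u t \<in> sec y ?V"
        using t V by simp
      obtain a where a: "a \<in> carrier (grp A ?V)" "smul y ?V a (f ?V s) = res y u t"
        using y.difference[OF V(3) f_sec[OF V(3) s] tu] .
      have "\<phi> g ?V a = a" if g: "g \<in> carrier G" for g
      proof (rule y.smul_cancel[OF V(3) f_sec[OF V(3) s]])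
        have "smul y ?V (\<phi> g ?V a) (f ?V s) = l g ?V (smul y ?V a (f ?V s))"
          using l(3)[OF g V(3) a(1) f_sec[OF V(3) s]] fixed g V(3) s by simp
        also have "\<dots> = smul y ?V a (f ?V s)"
          using a(2) l(2)[OF g, of u t U ?V] V t g by simp
        finally show "smul y ?V (\<phi> g ?V a) (f ?V s) = smul y ?V a (f ?V s)" .
      qed (use g a V in auto)
      then have "a \<in> carrier (grp (invariants G A \<phi>) ?V)"
        using a by simp
      then show ?thesis
        using f_smul[OF V(3) s] a(2) z.smul_sec[OF V(3) _ s] by metis
    qed
    then obtain s where s: "\<And>u. u \<in> S \<Longrightarrow> s u \<in> sec z (src X u)" "\<And>u. u \<in> S \<Longrightarrow> f (src X u) (s u) = res y u t"
      by metis
    have "matching_family X z S s"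
      unfolding matching_family_def
    proof (intro conjI ballI allI impI s)
      fix u v p q assume uv: "u \<in> S" "v \<in> S" and "fibre_product X u v p q"
      then have pq: "p \<in> arrs X" "q \<in> arrs X" "src X p = src X q" "tgt X p = src X u"
          "tgt X q = src X v" "u \<cdot>\<^bsub>X\<^esub> p = v \<cdot>\<^bsub>X\<^esub> q"
        by (auto simp: fibre_product_def commuting_square_def)
      \<comment> \<open>Both sides are the restriction of t to the fibre product.\<close>
      have "f (src X q) (res z p (s u)) = f (src X q) (res z q (s v))"
        using f_res[of p "s u"] f_res[of q "s v"] s uv pq cov t
          y.res_res[of p u t] y.res_res[of q v t] by simp
      then show "res z p (s u) = res z q (s v)"
        by (rule inj_onD[OF inj[of "src X q"], rotated]) (use s uv pq in auto)
    qed
    then obtain s' where s': "s' \<in> sec z U" "\<forall>u \<in> S. res z u s' = s u"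
      using z.glue[OF U S(1)] by blast
    have "f U s' = t"
    proof (rule y.separation[OF U S(1)])
      fix u assume u: "u \<in> S"
      show "res y u (f U s') = res y u t"
        using f_res[of u s'] cov[OF u] s' s(2)[OF u] u by simp
    qed (use f_sec U s' t in auto)
    then show "t \<in> f U ` sec z U"
      using s' by blast
  }
qed

text \<open>\<open>f1\<close> and \<open>f2\<close> are bijections onto the same fixed subsheaf. The
  isomorphism is \<open>f1\<close> followed by the inverse of \<open>f2\<close>, and its properties
  are checked after applying the injective \<open>f2\<close>.\<close>

lemma equivariant_inclusion_unique:
  assumes y: "torsor X A y" and lift: "torsor_lift X G A \<phi> y l"
    and z1: "torsor X (invariants G A \<phi>) z1"
    and f1: "equivariant_torsor_morphism X (invariants G A \<phi>) inclusion z1 y f1"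
    and fixed1: "\<forall>g \<in> carrier G. \<forall>U \<in> objs X. \<forall>s \<in> sec z1 U. l g U (f1 U s) = f1 U s"
    and z2: "torsor X (invariants G A \<phi>) z2"
    and f2: "equivariant_torsor_morphism X (invariants G A \<phi>) inclusion z2 y f2"
    and fixed2: "\<forall>g \<in> carrier G. \<forall>U \<in> objs X. \<forall>s \<in> sec z2 U. l g U (f2 U s) = f2 U s"
  shows "\<exists>k. equivariant_torsor_isomorphism X (invariants G A \<phi>) z1 z2 k"
proof -
  interpret z1: torsor X "invariants G A \<phi>" z1 by (rule z1)
  interpret z2: torsor X "invariants G A \<phi>" z2 by (rule z2)
  have bij: "bij_betw (f1 U) (sec z1 U) (sec (fixed_subsheaf y l) U)"
      "bij_betw (f2 U) (sec z2 U) (sec (fixed_subsheaf y l) U)" if "U \<in> objs X" for U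
    using equivariant_inclusion_injective[OF y z1 f1 that] equivariant_inclusion_injective[OF y z2 f2 that]
      equivariant_inclusion_image[OF y lift z1 f1 fixed1 that]
      equivariant_inclusion_image[OF y lift z2 f2 fixed2 that]
    by (simp_all add: bij_betw_def)
  define k where "k U s = inv_into (sec z2 U) (f2 U) (f1 U s)" for U s
  have k_bij: "bij_betw (k U) (sec z1 U) (sec z2 U)" if "U \<in> objs X" for U
    using bij_betw_trans[OF bij(1)[OF that] bij_betw_inv_into[OF bij(2)[OF that]]]
    by (simp add: k_def[abs_def] comp_def)
  have k_sec: "k U s \<in> sec z2 U" if "U \<in> objs X" "s \<in> sec z1 U" for U s
    using k_bij that bij_betwE by blast
  have f2_k: "f2 U (k U s) = f1 U s" if "U \<in> objs X" "s \<in> sec z1 U" for U s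
    using bij_betw_inv_into_right[OF bij(2)[OF that(1)]] bij_betwE[OF bij(1)[OF that(1)]] that(2)
    by (auto simp: k_def)
  have k_eqI: "k U s = t" if "U \<in> objs X" "s \<in> sec z1 U" "t \<in> sec z2 U" "f2 U t = f1 U s" for U s t
    using bij_betw_imp_inj_on[OF bij(2)[OF that(1)]] k_sec f2_k that by (metis inj_onD)
  have "equivariant_torsor_morphism X (invariants G A \<phi>) inclusion z1 z2 k"
    unfolding equivariant_torsor_morphism_def sheaf_morphism_def
  proof (intro conjI ballI)
    fix u s assume u: "u \<in> arrs X" and s: "s \<in> sec z1 (tgt X u)"
    have "f2 (src X u) (res z2 u (k (tgt X u) s)) = res y u (f2 (tgt X u) (k (tgt X u) s))"
      using f2 u k_sec[OF tgt_objs[OF u] s]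
      by (auto simp: equivariant_torsor_morphism_def sheaf_morphism_def)
    also have "\<dots> = f1 (src X u) (res z1 u s)"
      using f2_k[OF tgt_objs[OF u] s] f1 u s
      by (auto simp: equivariant_torsor_morphism_def sheaf_morphism_def)
    finally show "k (src X u) (res z1 u s) = res z2 u (k (tgt X u) s)"
      using u s k_sec by (intro k_eqI) auto
  next
    fix U a s assume U: "U \<in> objs X" and a: "a \<in> carrier (grp (invariants G A \<phi>) U)"
      and s: "s \<in> sec z1 U"
    have "f2 U (smul z2 U a (k U s)) = f1 U (smul z1 U a s)"
      using f1 f2 U a s k_sec[OF U s] f2_k[OF U s]
      by (auto simp: equivariant_torsor_morphism_def inclusion_def)
    then show "k U (smul z1 U a s) = smul z2 U (inclusion U a) (k U s)"
      using U a s k_sec z1.smul_sec[OF U a s] z2.smul_sec[OF U a] by (intro k_eqI) (auto simp: inclusion_def)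
  qed (rule k_sec)
  then show ?thesis
    using k_bij by (auto simp: equivariant_torsor_isomorphism_def)
qed

text \<open>If \<open>\<chi>\<close> is the coboundary of \<open>b\<close>, dividing \<open>l g\<close> by \<open>b g\<close> makes the lift multiplicative.\<close>

lemma strict_lift:
  assumes T: "final_object X T" and y: "torsor X A y" and lift: "torsor_lift X G A \<phi> y l"
    and trivial: "torsor_obstruction X T G A \<phi> y l = \<one>\<^bsub>section_cohomology G A \<phi> 2 T\<^esub>"
  obtains l' where "torsor_lift X G A \<phi> y l'"
    "\<And>g h U s. \<lbrakk>g \<in> carrier G; h \<in> carrier G; U \<in> objs X; s \<in> sec y U\<rbrakk>
      \<Longrightarrow> l' g U (l' h U s) = l' (g \<otimes>\<^bsub>G\<^esub> h) U s"
proof -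
  interpret y: torsor X A y by (rule y)
  note l = torsor_lift_simps[OF lift]
  note \<chi> = torsor_cocycle[OF T y lift]
  have To: "T \<in> objs X"
    using T by (auto simp: final_object_def)
  obtain b where b: "\<And>g. g \<in> carrier G \<Longrightarrow> b g \<in> carrier (grp A T)"
    "\<And>g h. \<lbrakk>g \<in> carrier G; h \<in> carrier G\<rbrakk> \<Longrightarrow> torsor_cocycle X T G A y l g h =
      \<phi> g T (b h) \<otimes>\<^bsub>grp A T\<^esub> inv\<^bsub>grp A T\<^esub> (b (g \<otimes>\<^bsub>G\<^esub> h)) \<otimes>\<^bsub>grp A T\<^esub> b g"
    by (rule trivial_class_2[OF To \<chi>(1) trivial[unfolded torsor_obstruction_def]]) (assumption+, rule that)
  \<comment> \<open>The cochain b lives over the final object; \<open>r U\<close> is its restriction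
    to U, so that \<open>l'\<close> is defined over every U and commutes with restriction.\<close>
  define r where "r U g = gres A (to_final X T U) (b g)" for U g
  define l' where "l' g U s = smul y U (inv\<^bsub>grp A U\<^esub> (r U g)) (l g U s)" for g U s
  note fin = final_arr[OF T]
  have r: "r U g \<in> carrier (grp A U)" if "U \<in> objs X" "g \<in> carrier G" for U g
    using that b fin by (simp add: r_def)
  have r_res: "gres A f (r (tgt X f) g) = r (src X f) g" if f: "f \<in> arrs X" and g: "g \<in> carrier G" for f g
    unfolding r_def using f g b fin[of "tgt X f"] final_unique[OF T, of "to_final X T (tgt X f) \<cdot>\<^bsub>X\<^esub> f"]
    by (subst gres_gres[of _ _ T]) auto
  have "torsor_lift X G A \<phi> y l'"
    unfolding torsor_lift_def equivariant_torsor_morphism_def sheaf_morphism_def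
  proof (intro ballI conjI)
    fix g U s assume "g \<in> carrier G" "U \<in> objs X" "s \<in> sec y U"
    then show "l' g U s \<in> sec y U"
      using l r by (simp add: l'_def)
  next
    fix g f s assume "g \<in> carrier G" "f \<in> arrs X" "s \<in> sec y (tgt X f)"
    then show "l' g (src X f) (res y f s) = res y f (l' g (tgt X f) s)"
      using l r by (simp add: l'_def y.res_smul gres_inv r_res)
  next
    fix g U a s assume g: "g \<in> carrier G" and U: "U \<in> objs X" and a: "a \<in> carrier (grp A U)"
      and s: "s \<in> sec y U"
    interpret M: comm_group "grp A U" by (simp add: U)
    \<comment> \<open>Commutativity of A keeps the corrected maps \<phi>_g-equivariant.\<close>
    have "inv\<^bsub>grp A U\<^esub> (r U g) \<otimes>\<^bsub>grp A U\<^esub> \<phi> g U a = \<phi> g U a \<otimes>\<^bsub>grp A U\<^esub> inv\<^bsub>grp A U\<^esub> (r U g)"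
      using g U a r by (simp add: M.m_comm)
    then show "l' g U (smul y U a s) = smul y U (\<phi> g U a) (l' g U s)"
      using g U a s l r by (simp add: l'_def flip: y.smul_mult)
  qed
  moreover have "l' g U (l' h U s) = l' (g \<otimes>\<^bsub>G\<^esub> h) U s"
    if gh: "g \<in> carrier G" "h \<in> carrier G" and U: "U \<in> objs X" and s: "s \<in> sec y U" for g h U s
  proof -
    interpret M: comm_group "grp A U" by (simp add: U)
    interpret N: comm_group "grp A T" by (simp add: To)
    let ?x = "\<phi> g U (r U h)" and ?y = "r U g" and ?z = "r U (g \<otimes>\<^bsub>G\<^esub> h)"
    have cl: "?x \<in> carrier (grp A U)" "?y \<in> carrier (grp A U)" "?z \<in> carrier (grp A U)"
      using gh U r by auto
    have \<chi>': "gres A (to_final X T U) (torsor_cocycle X T G A y l g h) = ?x \<otimes>\<^bsub>grp A U\<^esub> inv\<^bsub>grp A U\<^esub> ?z \<otimes>\<^bsub>grp A U\<^esub> ?y"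
      using gh b To fin[OF U] U by (simp add: b(2) r_def gres_mult gres_inv action_gres)
    \<comment> \<open>The total coefficient of \<lambda>_gh is b(g)^-1 \<phi>_g(b(h))^-1
      \<chi>(g,h), and inserting \<chi> = d b leaves b(gh)^-1.\<close>
    have "l' g U (l' h U s) = smul y U (inv\<^bsub>grp A U\<^esub> ?y) (smul y U (inv\<^bsub>grp A U\<^esub> ?x) (l g U (l h U s)))"
      using gh U s l r by (simp add: l'_def action_inv)
    also have "\<dots> = smul y U (inv\<^bsub>grp A U\<^esub> ?y \<otimes>\<^bsub>grp A U\<^esub> (inv\<^bsub>grp A U\<^esub> ?x \<otimes>\<^bsub>grp A U\<^esub>
        (?x \<otimes>\<^bsub>grp A U\<^esub> inv\<^bsub>grp A U\<^esub> ?z \<otimes>\<^bsub>grp A U\<^esub> ?y))) (l (g \<otimes>\<^bsub>G\<^esub> h) U s)"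
      using gh U s l cl by (simp add: \<chi>(2) \<chi>' y.smul_mult)
    also have "inv\<^bsub>grp A U\<^esub> ?y \<otimes>\<^bsub>grp A U\<^esub> (inv\<^bsub>grp A U\<^esub> ?x \<otimes>\<^bsub>grp A U\<^esub>
        (?x \<otimes>\<^bsub>grp A U\<^esub> inv\<^bsub>grp A U\<^esub> ?z \<otimes>\<^bsub>grp A U\<^esub> ?y)) = inv\<^bsub>grp A U\<^esub> ?z"
      using cl by (simp add: M.m_assoc M.m_comm[of "inv\<^bsub>grp A U\<^esub> ?z" ?y])
    finally show ?thesis
      by (simp add: l'_def)
  qed
  ultimately show ?thesis
    using that by blast
qed

end

section \<open>Stacks and gerbes\<close>

lemma arrows_over_iff:
  "a \<in> arrows_over Y f x y \<longleftrightarrow> a \<in> arrs Y \<and> src Y a = x \<and> tgt Y a = y \<and> parr Y a = f"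
  by (auto simp: arrows_over_def arrows_def)

lemma objs_over_iff: "x \<in> objs_over Y U \<longleftrightarrow> x \<in> objs Y \<and> pobj Y x = U"
  by (auto simp: objs_over_def)

context fibred_in_groupoids begin

lemma pobj_objs [simp]: "x \<in> objs Y \<Longrightarrow> pobj Y x \<in> objs X"
  by (rule pobj)

lemma parr_arrs [simp]: "a \<in> arrs Y \<Longrightarrow> parr Y a \<in> arrs X"
  and src_parr [simp]: "a \<in> arrs Y \<Longrightarrow> src X (parr Y a) = pobj Y (src Y a)"
  and tgt_parr [simp]: "a \<in> arrs Y \<Longrightarrow> tgt X (parr Y a) = pobj Y (tgt Y a)"
  using parr[of a "src Y a" "tgt Y a"] by (auto simp: arrows_def)

lemma parr_of_idt [simp]: "x \<in> objs Y \<Longrightarrow> parr Y (idt Y x) = idt X (pobj Y x)"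
  by (rule parr_idt)

lemma parr_of_cmp [simp]:
  "\<lbrakk>a \<in> arrs Y; b \<in> arrs Y; src Y b = tgt Y a\<rbrakk> \<Longrightarrow> parr Y (b \<cdot>\<^bsub>Y\<^esub> a) = parr Y b \<cdot>\<^bsub>X\<^esub> parr Y a"
  using parr_cmp[of a "src Y a" "tgt Y a" b "tgt Y b"] by (auto simp: arrows_def)

lemma pullback:
  assumes "f \<in> arrs X" "y \<in> objs Y" "tgt X f = pobj Y y"
  obtains p where "p \<in> arrs Y" "tgt Y p = y" "parr Y p = f" "pobj Y (src Y p) = src X f"
proof -
  have "y \<in> objs_over Y (tgt X f)"
    using assms by (simp add: objs_over_iff)
  from pullback_exists[OF arrs_in_arrows[OF assms(1)] this]
  obtain x p where "x \<in> objs_over Y (src X f)" "p \<in> arrows_over Y f x y"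
    by blast
  then show ?thesis
    using that[of p] by (simp add: arrows_over_iff objs_over_iff)
qed

lemma factor_ex1:
  assumes "a \<in> arrs Y" "b \<in> arrs Y" "tgt Y a = tgt Y b" "f \<in> arrs X"
    "src X f = pobj Y (src Y a)" "tgt X f = pobj Y (src Y b)" "parr Y b \<cdot>\<^bsub>X\<^esub> f = parr Y a"
  shows "\<exists>!c. c \<in> arrs Y \<and> src Y c = src Y a \<and> tgt Y c = src Y b \<and> parr Y c = f \<and> b \<cdot>\<^bsub>Y\<^esub> c = a"
  using all_cartesian[of a "src Y a" "tgt Y a" b "src Y b" f] assms
  by (simp add: arrows_over_iff arrows_def conj_assoc)

lemma factor:
  assumes "a \<in> arrs Y" "b \<in> arrs Y" "tgt Y a = tgt Y b" "f \<in> arrs X"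
    "src X f = pobj Y (src Y a)" "tgt X f = pobj Y (src Y b)" "parr Y b \<cdot>\<^bsub>X\<^esub> f = parr Y a"
  obtains c where "c \<in> arrs Y" "src Y c = src Y a" "tgt Y c = src Y b" "parr Y c = f" "b \<cdot>\<^bsub>Y\<^esub> c = a"
  using factor_ex1[OF assms] by blast

text \<open>Two arrows into the same object over the same base arrow are both pullbacks along it, so
  their sources are compared by a vertical arrow.\<close>

lemma factor_vertical:
  assumes "a \<in> arrs Y" "b \<in> arrs Y" "tgt Y a = tgt Y b" "parr Y a = parr Y b"
  obtains c where "c \<in> arrs Y" "src Y c = src Y a" "tgt Y c = src Y b"
    "parr Y c = idt X (pobj Y (src Y a))" "b \<cdot>\<^bsub>Y\<^esub> c = a"
proof -
  have "pobj Y (src Y b) = pobj Y (src Y a)"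
    using assms src_parr by metis
  then have f: "idt X (pobj Y (src Y a)) \<in> arrs X" "src X (idt X (pobj Y (src Y a))) = pobj Y (src Y a)"
      "tgt X (idt X (pobj Y (src Y a))) = pobj Y (src Y b)"
      "parr Y b \<cdot>\<^bsub>X\<^esub> idt X (pobj Y (src Y a)) = parr Y a"
    using assms by simp_all
  show ?thesis
    by (rule factor[OF assms(1-3) f]) (rule that)
qed

text \<open>The uniqueness half of cartesianness: b can be cancelled once both factors are known to
  lie over the same base arrow. Many equations in gerbes are proved by composing with a suitable
  arrow and cancelling it again.\<close>

lemma cancel_left:
  assumes "b \<cdot>\<^bsub>Y\<^esub> c = b \<cdot>\<^bsub>Y\<^esub> d" "b \<in> arrs Y" "c \<in> arrs Y" "d \<in> arrs Y"
    "tgt Y c = src Y b" "tgt Y d = src Y b" "src Y c = src Y d" "parr Y c = parr Y d"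
  shows "c = d"
  using factor_ex1[of "b \<cdot>\<^bsub>Y\<^esub> c" b "parr Y c"] assms by auto

end

section \<open>Descent of arrows in a stack\<close>

context stack_in_groupoids begin

text \<open>One pullback arrow for each member of the cover is enough: an arbitrary p over the sieve
  factors through a given one, because that is cartesian. Hence t and t' glue the same compatible
  family.\<close>

lemma arrow_separation:
  assumes U: "U \<in> objs X" and S: "S \<in> cov X U"
    and t: "t \<in> arrs Y" "parr Y t = idt X U" and t': "t' \<in> arrs Y" "parr Y t' = idt X U"
    and eq: "src Y t' = src Y t" "tgt Y t' = tgt Y t"
    and loc: "\<And>u. u \<in> S \<Longrightarrow> \<exists>p \<in> arrs Y. tgt Y p = src Y t \<and> parr Y p = u \<and> t \<cdot>\<^bsub>Y\<^esub> p = t' \<cdot>\<^bsub>Y\<^esub> p"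
  shows "t = t'"
proof -
  have pobj: "pobj Y (src Y t) = U" "pobj Y (tgt Y t) = U"
    using t U src_parr[of t] tgt_parr[of t] by simp_all
  have agree: "t \<cdot>\<^bsub>Y\<^esub> p = t' \<cdot>\<^bsub>Y\<^esub> p" if p: "p \<in> arrs Y" "tgt Y p = src Y t" "parr Y p \<in> sieve X S" for p
  proof -
    obtain u q where uq: "u \<in> S" "q \<in> arrs X" "tgt X q = src X u" "parr Y p = u \<cdot>\<^bsub>X\<^esub> q"
      using p(3) by (auto simp: sieve_def)
    obtain p0 where p0: "p0 \<in> arrs Y" "tgt Y p0 = src Y t" "parr Y p0 = u" "t \<cdot>\<^bsub>Y\<^esub> p0 = t' \<cdot>\<^bsub>Y\<^esub> p0"
      using loc[OF uq(1)] by blast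
    have f: "p \<in> arrs Y" "p0 \<in> arrs Y" "tgt Y p = tgt Y p0" "q \<in> arrs X" "src X q = pobj Y (src Y p)"
        "tgt X q = pobj Y (src Y p0)" "parr Y p0 \<cdot>\<^bsub>X\<^esub> q = parr Y p"
      using uq p p0 cov_arrs[OF U S uq(1)] src_parr[of p] src_parr[of p0] by simp_all
    obtain c where c: "c \<in> arrs Y" "src Y c = src Y p" "tgt Y c = src Y p0" "parr Y c = q" "p0 \<cdot>\<^bsub>Y\<^esub> c = p"
      by (rule factor[OF f])
    have "(t \<cdot>\<^bsub>Y\<^esub> p0) \<cdot>\<^bsub>Y\<^esub> c = t \<cdot>\<^bsub>Y\<^esub> p" "(t' \<cdot>\<^bsub>Y\<^esub> p0) \<cdot>\<^bsub>Y\<^esub> c = t' \<cdot>\<^bsub>Y\<^esub> p"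
      using c(1,3,5) p0(1,2) t t' eq by simp_all
    then show ?thesis
      using p0(4) by simp
  qed
  have "compatible_morphisms Y (sieve X S) (src Y t) (tgt Y t) (\<lambda>p. t \<cdot>\<^bsub>Y\<^esub> p)"
    unfolding compatible_morphisms_def using t pobj by (auto simp: arrows_over_iff)
  from morphisms_glue[OF U S _ _ this]
  have "\<exists>!s. s \<in> arrows_over Y (idt X U) (src Y t) (tgt Y t) \<and>
      (\<forall>p \<in> arrs Y. tgt Y p = src Y t \<and> parr Y p \<in> sieve X S \<longrightarrow> s \<cdot>\<^bsub>Y\<^esub> p = t \<cdot>\<^bsub>Y\<^esub> p)" (is "\<exists>!s. ?P s")
    using t pobj by (simp add: objs_over_iff)
  moreover have "?P t" "?P t'"
    using agree t t' eq by (simp_all add: arrows_over_iff)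
  ultimately show ?thesis
    by (elim ex1E) metis
qed

text \<open>
  Local arrows given by a property \<open>Q\<close> that determines them are glued. \<open>Q p r\<close> says that \<open>r\<close> is to be
  the composite of the arrow to be found with the pullback arrow \<open>p\<close>.
\<close>

lemma arrow_glue:
  assumes U: "U \<in> objs X" and S: "S \<in> cov X U"
    and x: "x \<in> objs Y" "pobj Y x = U" and y: "y \<in> objs Y" "pobj Y y = U"
    and ex: "\<And>u. u \<in> S \<Longrightarrow> \<exists>p \<in> arrs Y. \<exists>r \<in> arrs Y. tgt Y p = x \<and> parr Y p = u \<and>
      src Y r = src Y p \<and> tgt Y r = y \<and> parr Y r = u \<and> Q p r"
    and stable: "\<And>p r q. \<lbrakk>p \<in> arrs Y; r \<in> arrs Y; q \<in> arrs Y; tgt Y p = x; tgt Y r = y;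
      src Y r = src Y p; parr Y r = parr Y p; parr Y p \<in> sieve X S; tgt Y q = src Y p; Q p r\<rbrakk>
      \<Longrightarrow> Q (p \<cdot>\<^bsub>Y\<^esub> q) (r \<cdot>\<^bsub>Y\<^esub> q)"
    and unique: "\<And>p r r'. \<lbrakk>p \<in> arrs Y; tgt Y p = x; parr Y p \<in> sieve X S; r \<in> arrs Y; tgt Y r = y;
      src Y r = src Y p; parr Y r = parr Y p; r' \<in> arrs Y; tgt Y r' = y; src Y r' = src Y p;
      parr Y r' = parr Y p; Q p r; Q p r'\<rbrakk> \<Longrightarrow> r = r'"
  obtains t where "t \<in> arrs Y" "src Y t = x" "tgt Y t = y" "parr Y t = idt X U"
    "\<And>p. \<lbrakk>p \<in> arrs Y; tgt Y p = x; parr Y p \<in> sieve X S\<rbrakk> \<Longrightarrow> Q p (t \<cdot>\<^bsub>Y\<^esub> p)"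
proof -
  note cov = cov_arrs[OF U S]
  let ?P = "\<lambda>p r. r \<in> arrs Y \<and> tgt Y r = y \<and> src Y r = src Y p \<and> parr Y r = parr Y p \<and> Q p r"
  \<comment> \<open>The values given on one pullback for each member of the cover are carried to all
    arrows p over the sieve by factoring p through the given \<open>p0\<close>.\<close>
  have ex': "\<exists>r. ?P p r" if p: "p \<in> arrs Y" "tgt Y p = x" "parr Y p \<in> sieve X S" for p
  proof -
    obtain u q where uq: "u \<in> S" "q \<in> arrs X" "tgt X q = src X u" "parr Y p = u \<cdot>\<^bsub>X\<^esub> q"
      using p(3) by (auto simp: sieve_def)
    obtain p0 r0 where p0: "p0 \<in> arrs Y" "r0 \<in> arrs Y" "tgt Y p0 = x" "parr Y p0 = u"
        "src Y r0 = src Y p0" "tgt Y r0 = y" "parr Y r0 = u" "Q p0 r0"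
      using ex[OF uq(1)] by blast
    have f: "p \<in> arrs Y" "p0 \<in> arrs Y" "tgt Y p = tgt Y p0" "q \<in> arrs X" "src X q = pobj Y (src Y p)"
        "tgt X q = pobj Y (src Y p0)" "parr Y p0 \<cdot>\<^bsub>X\<^esub> q = parr Y p"
      using uq p p0 cov_arrs[OF U S uq(1)] src_parr[of p] src_parr[of p0] by simp_all
    obtain c where c: "c \<in> arrs Y" "src Y c = src Y p" "tgt Y c = src Y p0" "parr Y c = q" "p0 \<cdot>\<^bsub>Y\<^esub> c = p"
      by (rule factor[OF f])
    have "Q p (r0 \<cdot>\<^bsub>Y\<^esub> c)"
      using stable[of p0 r0 c] c p0 cov_in_sieve[OF U S uq(1)] by simp
    then show ?thesis
      using c p0 uq by (intro exI[of _ "r0 \<cdot>\<^bsub>Y\<^esub> c"]) auto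
  qed
  \<comment> \<open>An arbitrary choice will do: \<open>stable\<close> and \<open>unique\<close>
    together make it compatible with composition.\<close>
  define a where "a p = (SOME r. ?P p r)" for p
  have a: "?P p (a p)" if "p \<in> arrs Y" "tgt Y p = x" "parr Y p \<in> sieve X S" for p
    unfolding a_def by (rule someI_ex[OF ex'[OF that]])
  have "compatible_morphisms Y (sieve X S) x y a"
    unfolding compatible_morphisms_def
  proof (intro ballI impI conjI)
    fix p assume p: "p \<in> arrs Y" "tgt Y p = x \<and> parr Y p \<in> sieve X S"
    then show "a p \<in> arrows_over Y (parr Y p) (src Y p) y"
      using a[of p] by (simp add: arrows_over_iff)
    fix q assume q: "q \<in> arrs Y" "tgt Y q = src Y p"
    have pq: "p \<cdot>\<^bsub>Y\<^esub> q \<in> arrs Y" "tgt Y (p \<cdot>\<^bsub>Y\<^esub> q) = x" "parr Y (p \<cdot>\<^bsub>Y\<^esub> q) \<in> sieve X S"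
      using p q sieve_cmp[OF U S, of "parr Y p" "parr Y q"] by auto
    show "a (p \<cdot>\<^bsub>Y\<^esub> q) = a p \<cdot>\<^bsub>Y\<^esub> q"
      by (rule unique[OF pq]) (use a[OF pq] a[of p] stable[of p "a p" q] p q in auto)
  qed
  from morphisms_glue[OF U S _ _ this] x y
  obtain t where t: "t \<in> arrows_over Y (idt X U) x y"
      "\<forall>p \<in> arrs Y. tgt Y p = x \<and> parr Y p \<in> sieve X S \<longrightarrow> t \<cdot>\<^bsub>Y\<^esub> p = a p"
    by (auto simp: objs_over_iff)
  then show ?thesis
    using that[of t] a by (simp add: arrows_over_iff)
qed

text \<open>The existence half of the universal property of a glued object: the legs
  \<open>k f\<close> present x as glued along the transitions \<open>d f g\<close>, and arrows
  \<open>r f\<close> respecting the same transitions induce an arrow out of x.\<close>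

lemma arrow_glue_descent:
  assumes U: "U \<in> objs X" and S: "S \<in> cov X U"
    and x: "x \<in> objs Y" "pobj Y x = U" and y: "y \<in> objs Y" "pobj Y y = U"
    and k: "\<And>f. f \<in> sieve X S \<Longrightarrow> k f \<in> arrs Y" "\<And>f. f \<in> sieve X S \<Longrightarrow> tgt Y (k f) = x"
      "\<And>f. f \<in> sieve X S \<Longrightarrow> parr Y (k f) = f"
    and d: "\<And>f g. \<lbrakk>f \<in> sieve X S; g \<in> arrs X; tgt X g = src X f\<rbrakk> \<Longrightarrow> d f g \<in> arrs Y"
      "\<And>f g. \<lbrakk>f \<in> sieve X S; g \<in> arrs X; tgt X g = src X f\<rbrakk> \<Longrightarrow> tgt Y (d f g) = src Y (k f)"
      "\<And>f g. \<lbrakk>f \<in> sieve X S; g \<in> arrs X; tgt X g = src X f\<rbrakk> \<Longrightarrow> parr Y (d f g) = g"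
      "\<And>f g. \<lbrakk>f \<in> sieve X S; g \<in> arrs X; tgt X g = src X f\<rbrakk> \<Longrightarrow> k f \<cdot>\<^bsub>Y\<^esub> d f g = k (f \<cdot>\<^bsub>X\<^esub> g)"
    and r: "\<And>f. f \<in> sieve X S \<Longrightarrow> r f \<in> arrs Y" "\<And>f. f \<in> sieve X S \<Longrightarrow> src Y (r f) = src Y (k f)"
      "\<And>f. f \<in> sieve X S \<Longrightarrow> tgt Y (r f) = y" "\<And>f. f \<in> sieve X S \<Longrightarrow> parr Y (r f) = f"
    and rd: "\<And>f g. \<lbrakk>f \<in> sieve X S; g \<in> arrs X; tgt X g = src X f\<rbrakk> \<Longrightarrow> r f \<cdot>\<^bsub>Y\<^esub> d f g = r (f \<cdot>\<^bsub>X\<^esub> g)"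
  obtains t where "t \<in> arrs Y" "src Y t = x" "tgt Y t = y" "parr Y t = idt X U"
    "\<And>f. f \<in> sieve X S \<Longrightarrow> t \<cdot>\<^bsub>Y\<^esub> k f = r f"
proof -
  \<comment> \<open>An arrow p into x over f is \<open>k f\<close> preceded by a vertical c; the
    wanted composite is then \<open>r f\<close> preceded by the same c.\<close>
  define Q where "Q p q \<longleftrightarrow> (\<exists>c \<in> arrs Y. src Y c = src Y p \<and> tgt Y c = src Y (k (parr Y p)) \<and>
    parr Y c = idt X (pobj Y (src Y p)) \<and> p = k (parr Y p) \<cdot>\<^bsub>Y\<^esub> c \<and> q = r (parr Y p) \<cdot>\<^bsub>Y\<^esub> c)" for p q
  have stable: "Q (p \<cdot>\<^bsub>Y\<^esub> q) (s \<cdot>\<^bsub>Y\<^esub> q)"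
    if p: "p \<in> arrs Y" "parr Y p \<in> sieve X S" and q: "q \<in> arrs Y" "tgt Y q = src Y p" and Q: "Q p s"
    for p s q
  proof -
    let ?f = "parr Y p" and ?g = "parr Y q"
    obtain c where c: "c \<in> arrs Y" "src Y c = src Y p" "tgt Y c = src Y (k ?f)"
        "parr Y c = idt X (pobj Y (src Y p))" "p = k ?f \<cdot>\<^bsub>Y\<^esub> c" "s = r ?f \<cdot>\<^bsub>Y\<^esub> c"
      using Q unfolding Q_def by blast
    have g: "?g \<in> arrs X" "tgt X ?g = src X ?f"
      using p q by simp_all
    note kf = k[OF p(2)] and dfg = d[OF p(2) g] and rf = r[OF p(2)]
    have src_d: "src Y (d ?f ?g) = src Y (k (?f \<cdot>\<^bsub>X\<^esub> ?g))"
      using dfg kf by (simp flip: dfg(4))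
    have 1: "c \<cdot>\<^bsub>Y\<^esub> q \<in> arrs Y" "d ?f ?g \<in> arrs Y" "tgt Y (c \<cdot>\<^bsub>Y\<^esub> q) = tgt Y (d ?f ?g)"
        "parr Y (c \<cdot>\<^bsub>Y\<^esub> q) = parr Y (d ?f ?g)"
      using c(1-4) q dfg by simp_all
    \<comment> \<open>The restriction of c along q: the vertical arrow that compares
      \<open>p \<cdot> q\<close> with the leg at the composed base arrow.\<close>
    obtain c' where c': "c' \<in> arrs Y" "src Y c' = src Y (c \<cdot>\<^bsub>Y\<^esub> q)" "tgt Y c' = src Y (d ?f ?g)"
        "parr Y c' = idt X (pobj Y (src Y (c \<cdot>\<^bsub>Y\<^esub> q)))" "d ?f ?g \<cdot>\<^bsub>Y\<^esub> c' = c \<cdot>\<^bsub>Y\<^esub> q"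
      by (rule factor_vertical[OF 1])
    have "k ?f \<cdot>\<^bsub>Y\<^esub> (d ?f ?g \<cdot>\<^bsub>Y\<^esub> c') = (k ?f \<cdot>\<^bsub>Y\<^esub> d ?f ?g) \<cdot>\<^bsub>Y\<^esub> c'"
      using c'(1-4) dfg(1-3) kf by simp
    moreover have "r ?f \<cdot>\<^bsub>Y\<^esub> (d ?f ?g \<cdot>\<^bsub>Y\<^esub> c') = (r ?f \<cdot>\<^bsub>Y\<^esub> d ?f ?g) \<cdot>\<^bsub>Y\<^esub> c'"
      using c'(1-4) dfg(1-3) rf by simp
    moreover have "p \<cdot>\<^bsub>Y\<^esub> q = k ?f \<cdot>\<^bsub>Y\<^esub> (c \<cdot>\<^bsub>Y\<^esub> q)"
      using c(1-4) q kf by (subst c(5)) simp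
    moreover have "s \<cdot>\<^bsub>Y\<^esub> q = r ?f \<cdot>\<^bsub>Y\<^esub> (c \<cdot>\<^bsub>Y\<^esub> q)"
      using c(1-4) q rf by (subst c(6)) simp
    ultimately have "p \<cdot>\<^bsub>Y\<^esub> q = k (?f \<cdot>\<^bsub>X\<^esub> ?g) \<cdot>\<^bsub>Y\<^esub> c'" "s \<cdot>\<^bsub>Y\<^esub> q = r (?f \<cdot>\<^bsub>X\<^esub> ?g) \<cdot>\<^bsub>Y\<^esub> c'"
      using c'(5) dfg(4) rd[OF p(2) g] by simp_all
    moreover have "src Y c' = src Y q" "tgt Y c' = src Y (k (?f \<cdot>\<^bsub>X\<^esub> ?g))"
        "parr Y c' = idt X (pobj Y (src Y q))"
      using c'(1-4) c(1,2,3) p q src_d by simp_all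
    moreover have "parr Y (p \<cdot>\<^bsub>Y\<^esub> q) = ?f \<cdot>\<^bsub>X\<^esub> ?g" "src Y (p \<cdot>\<^bsub>Y\<^esub> q) = src Y q"
      using p q by simp_all
    ultimately show ?thesis
      unfolding Q_def using c'(1) by metis
  qed
  have unique: "q = q'" if p: "p \<in> arrs Y" "parr Y p \<in> sieve X S" and Q: "Q p q" "Q p q'" for p q q'
  proof -
    let ?f = "parr Y p"
    obtain c where c: "c \<in> arrs Y" "src Y c = src Y p" "tgt Y c = src Y (k ?f)"
        "parr Y c = idt X (pobj Y (src Y p))" "p = k ?f \<cdot>\<^bsub>Y\<^esub> c" "q = r ?f \<cdot>\<^bsub>Y\<^esub> c"
      using Q(1) unfolding Q_def by blast
    obtain c' where c': "c' \<in> arrs Y" "src Y c' = src Y p" "tgt Y c' = src Y (k ?f)"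
        "parr Y c' = idt X (pobj Y (src Y p))" "p = k ?f \<cdot>\<^bsub>Y\<^esub> c'" "q' = r ?f \<cdot>\<^bsub>Y\<^esub> c'"
      using Q(2) unfolding Q_def by blast
    have "k ?f \<cdot>\<^bsub>Y\<^esub> c = k ?f \<cdot>\<^bsub>Y\<^esub> c'"
      using c(5) c'(5) by simp
    then have "c = c'"
      by (rule cancel_left) (use c(1-4) c'(1-4) k[OF p(2)] in simp_all)
    then show ?thesis
      using c(6) c'(6) by simp
  qed
  have Q_k: "Q (k f) (r f)" if f: "f \<in> sieve X S" for f
    unfolding Q_def using k[OF f] r[OF f] by (intro bexI[of _ "idt Y (src Y (k f))"]) simp_all
  have ex: "\<exists>p \<in> arrs Y. \<exists>q \<in> arrs Y. tgt Y p = x \<and> parr Y p = u \<and>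
      src Y q = src Y p \<and> tgt Y q = y \<and> parr Y q = u \<and> Q p q" if u: "u \<in> S" for u
    using Q_k k r cov_in_sieve[OF U S u] by - (rule bexI[of _ "k u"], rule bexI[of _ "r u"], simp_all)
  obtain t where t: "t \<in> arrs Y" "src Y t = x" "tgt Y t = y" "parr Y t = idt X U"
      and Qt: "\<And>p. \<lbrakk>p \<in> arrs Y; tgt Y p = x; parr Y p \<in> sieve X S\<rbrakk> \<Longrightarrow> Q p (t \<cdot>\<^bsub>Y\<^esub> p)"
    by (rule arrow_glue[OF U S x y, of Q, OF ex stable unique]) (assumption+, rule that)
  have "t \<cdot>\<^bsub>Y\<^esub> k f = r f" if f: "f \<in> sieve X S" for f
    using unique[of "k f" "t \<cdot>\<^bsub>Y\<^esub> k f" "r f"] Qt[of "k f"] Q_k[OF f] k f by simp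
  then show ?thesis
    using that t by blast
qed

end

section \<open>Calculus of band elements\<close>

locale sheaf_banded_gerbe = abelian_sheaf X A + banded_gerbe X A Y
  for X :: "('o, 'm) site" and A :: "('o, 'm, 'a) abelian_sheaf"
    and Y :: "('p, 'q, 'o, 'm, 'a) gerbe" (structure)
begin

lemma band_in_aut:
  "\<lbrakk>x \<in> objs Y; a \<in> carrier (grp A (pobj Y x))\<rbrakk> \<Longrightarrow> band Y x a \<in> carrier (aut_group X Y x)"
  using band_iso[of x] by (auto simp: iso_def hom_def)

lemma band_arrs [simp]: "\<lbrakk>x \<in> objs Y; a \<in> carrier (grp A (pobj Y x))\<rbrakk> \<Longrightarrow> band Y x a \<in> arrs Y"
  and src_band [simp]: "\<lbrakk>x \<in> objs Y; a \<in> carrier (grp A (pobj Y x))\<rbrakk> \<Longrightarrow> src Y (band Y x a) = x"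
  and tgt_band [simp]: "\<lbrakk>x \<in> objs Y; a \<in> carrier (grp A (pobj Y x))\<rbrakk> \<Longrightarrow> tgt Y (band Y x a) = x"
  and parr_band [simp]:
    "\<lbrakk>x \<in> objs Y; a \<in> carrier (grp A (pobj Y x))\<rbrakk> \<Longrightarrow> parr Y (band Y x a) = idt X (pobj Y x)"
  using band_in_aut[of x a] by (auto simp: aut_group_def arrows_over_iff)

lemma band_mult: "\<lbrakk>x \<in> objs Y; pobj Y x = U; a \<in> carrier (grp A U); b \<in> carrier (grp A U)\<rbrakk>
    \<Longrightarrow> band Y x (a \<otimes>\<^bsub>grp A U\<^esub> b) = band Y x a \<cdot> band Y x b"
  using band_iso[of x] by (auto simp: iso_def hom_def aut_group_def)

lemma band_inj:
  "\<lbrakk>band Y x a = band Y x b; x \<in> objs Y; a \<in> carrier (grp A (pobj Y x)); b \<in> carrier (grp A (pobj Y x))\<rbrakk>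
    \<Longrightarrow> a = b"
  using band_iso[of x] by (auto simp: iso_def bij_betw_def dest: inj_onD)

lemma band_surj:
  assumes "p \<in> arrs Y" "src Y p = x" "tgt Y p = x" "parr Y p = idt X (pobj Y x)"
  obtains a where "a \<in> carrier (grp A (pobj Y x))" "p = band Y x a"
proof -
  have "p \<in> carrier (aut_group X Y x)"
    using assms by (auto simp: aut_group_def arrows_over_iff)
  then show ?thesis
    using band_iso[of x] Y.src_objs assms(1,2) that unfolding iso_def bij_betw_def by blast
qed

lemma band_one [simp]:
  assumes "x \<in> objs Y" "pobj Y x = U"
  shows "band Y x \<one>\<^bsub>grp A U\<^esub> = idt Y x"
proof -
  have "group_hom (grp A U) (aut_group X Y x) (band Y x)"
    using assms band_iso[of x] aut_abelian[of x]
    by (auto simp: group_hom_def group_hom_axioms_def iso_def comm_group.axioms(2))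
  from group_hom.hom_one[OF this] show ?thesis
    by (simp add: aut_group_def)
qed

lemma band_move:
  assumes "p \<in> arrs Y" "tgt Y p = x" "a \<in> carrier (grp A (pobj Y x))"
  shows "band Y x a \<cdot> p = p \<cdot> band Y (src Y p) (gres A (parr Y p) a)"
  using band_compatible[of p "src Y p" x a] assms by (auto simp: arrows_def)

text \<open>Over an identity nothing is restricted, so coefficients pass through vertical arrows
  unchanged. In this form they are collected at one end of a composite and compared there.\<close>

lemma band_move_vertical:
  assumes "p \<in> arrs Y" "tgt Y p = x" "parr Y p = idt X U" "U \<in> objs X" "a \<in> carrier (grp A U)"
  shows "band Y x a \<cdot> p = p \<cdot> band Y (src Y p) a"
proof -
  have "pobj Y x = U"
    using assms tgt_parr[of p] by simp
  then show ?thesis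
    using band_move[of p x a] assms by simp
qed

text \<open>The two arrows differ by a vertical automorphism of their source, hence by a band
  element. Together with \<open>band_cancel\<close> this makes arrows with common ends and base a
  principal homogeneous set, if there are any.\<close>

lemma arrow_difference:
  assumes "p \<in> arrs Y" "q \<in> arrs Y" "src Y q = src Y p" "tgt Y q = tgt Y p" "parr Y q = parr Y p"
    "pobj Y (src Y p) = U"
  obtains a where "a \<in> carrier (grp A U)" "q = p \<cdot> band Y (src Y p) a"
proof -
  obtain c where c: "c \<in> arrs Y" "src Y c = src Y q" "tgt Y c = src Y p"
      "parr Y c = idt X (pobj Y (src Y q))" "p \<cdot> c = q"
    using factor_vertical[of q p] assms by metis
  then show ?thesis
    using band_surj[of c "src Y p"] assms that by auto
qed

lemma band_cancel:
  assumes "p \<cdot> band Y x a = p \<cdot> band Y x b" "p \<in> arrs Y" "src Y p = x"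
    "a \<in> carrier (grp A (pobj Y x))" "b \<in> carrier (grp A (pobj Y x))"
  shows "a = b"
  by (rule band_inj[OF cancel_left[OF assms(1)]]) (use assms in auto)

end

section \<open>Morphisms of gerbes\<close>

locale gerbe_functor = Z: fibred_in_groupoids X Z + Y: fibred_in_groupoids X Y
  for X :: "('o, 'm) site" and Z :: "('r, 's, 'o, 'm, 'b) gerbe" and Y :: "('p, 'q, 'o, 'm, 'a) gerbe" +
  fixes F :: "('r, 's, 'p, 'q) functor_data"
  assumes gerbe_morphism: "gerbe_morphism Z Y F"
begin

lemma fob_objs [simp]: "x \<in> objs Z \<Longrightarrow> fob F x \<in> objs Y"
  and pobj_fob [simp]: "x \<in> objs Z \<Longrightarrow> pobj Y (fob F x) = pobj Z x"
  and far_idt [simp]: "x \<in> objs Z \<Longrightarrow> far F (idt Z x) = idt Y (fob F x)"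
  and far_arrs [simp]: "a \<in> arrs Z \<Longrightarrow> far F a \<in> arrs Y"
  and src_far [simp]: "a \<in> arrs Z \<Longrightarrow> src Y (far F a) = fob F (src Z a)"
  and tgt_far [simp]: "a \<in> arrs Z \<Longrightarrow> tgt Y (far F a) = fob F (tgt Z a)"
  and parr_far [simp]: "a \<in> arrs Z \<Longrightarrow> parr Y (far F a) = parr Z a"
  and far_cmp [simp]: "\<lbrakk>a \<in> arrs Z; b \<in> arrs Z; src Z b = tgt Z a\<rbrakk>
    \<Longrightarrow> far F (b \<cdot>\<^bsub>Z\<^esub> a) = far F b \<cdot>\<^bsub>Y\<^esub> far F a"
  using gerbe_morphism by (auto simp: gerbe_morphism_def objs_over_iff arrows_over_iff)

end

lemma ex1_conj_cong: "\<lbrakk>\<And>t. P t \<Longrightarrow> Q t \<longleftrightarrow> R t; \<exists>!t. P t \<and> Q t\<rbrakk> \<Longrightarrow> \<exists>!t. P t \<and> R t"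
  by (elim ex1E) blast

lemma gerbe_morphism_comp:
  assumes "gerbe_morphism Z Y F" "gerbe_morphism Y W H"
  shows "gerbe_morphism Z W (H \<odot> F)"
  using assms by (auto simp: gerbe_morphism_def functor_comp_def objs_over_iff arrows_over_iff)

lemma gerbe_morphism_simps:
  assumes "gerbe_morphism Z Y F"
  shows "x \<in> objs Z \<Longrightarrow> fob F x \<in> objs Y"
    and "x \<in> objs Z \<Longrightarrow> pobj Y (fob F x) = pobj Z x"
    and "x \<in> objs Z \<Longrightarrow> far F (idt Z x) = idt Y (fob F x)"
    and "a \<in> arrs Z \<Longrightarrow> far F a \<in> arrs Y"
    and "a \<in> arrs Z \<Longrightarrow> src Y (far F a) = fob F (src Z a)"
    and "a \<in> arrs Z \<Longrightarrow> tgt Y (far F a) = fob F (tgt Z a)"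
    and "a \<in> arrs Z \<Longrightarrow> parr Y (far F a) = parr Z a"
    and "\<lbrakk>a \<in> arrs Z; b \<in> arrs Z; src Z b = tgt Z a\<rbrakk> \<Longrightarrow> far F (b \<cdot>\<^bsub>Z\<^esub> a) = far F b \<cdot>\<^bsub>Y\<^esub> far F a"
  using assms by (auto simp: gerbe_morphism_def objs_over_iff arrows_over_iff)

lemma functor_comp_simps [simp]: "fob (H \<odot> F) x = fob H (fob F x)" "far (H \<odot> F) a = far H (far F a)"
  by (simp_all add: functor_comp_def)

lemma two_morphism_simps:
  assumes "two_morphism X Z Y F H \<eta>"
  shows "x \<in> objs Z \<Longrightarrow> \<eta> x \<in> arrs Y"
    and "x \<in> objs Z \<Longrightarrow> src Y (\<eta> x) = fob F x"
    and "x \<in> objs Z \<Longrightarrow> tgt Y (\<eta> x) = fob H x"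
    and "x \<in> objs Z \<Longrightarrow> parr Y (\<eta> x) = idt X (pobj Z x)"
    and "a \<in> arrs Z \<Longrightarrow> \<eta> (tgt Z a) \<cdot>\<^bsub>Y\<^esub> far F a = far H a \<cdot>\<^bsub>Y\<^esub> \<eta> (src Z a)"
  using assms by (auto simp: two_morphism_def arrows_over_iff)

section \<open>2-morphisms and sections over the final object\<close>

context abelian_sheaf begin

definition global_res :: "'o \<Rightarrow> 'o \<Rightarrow> 'a \<Rightarrow> 'a" where
  "global_res T U k = gres A (to_final X T U) k"

lemma global_res_closed [simp]:
  "\<lbrakk>final_object X T; U \<in> objs X; k \<in> carrier (grp A T)\<rbrakk> \<Longrightarrow> global_res T U k \<in> carrier (grp A U)"
  using final_arr[of X T U] by (simp add: global_res_def)

lemma gres_global_res: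
  assumes T: "final_object X T" and f: "f \<in> arrs X" "tgt X f = V" and k: "k \<in> carrier (grp A T)"
  shows "gres A f (global_res T V k) = global_res T (src X f) k"
  unfolding global_res_def
  using f k final_arr[OF T, of V] final_unique[OF T, of "to_final X T V \<cdot>\<^bsub>X\<^esub> f"]
  by (subst gres_gres[of _ _ T]) auto

lemma global_res_mult:
  "\<lbrakk>final_object X T; U \<in> objs X; k \<in> carrier (grp A T); k' \<in> carrier (grp A T)\<rbrakk>
    \<Longrightarrow> global_res T U (k \<otimes>\<^bsub>grp A T\<^esub> k') = global_res T U k \<otimes>\<^bsub>grp A U\<^esub> global_res T U k'"
  using final_arr[of X T U] by (simp add: global_res_def gres_mult)

end

context sheaf_banded_gerbe begin

text \<open>Naturality survives because passing through \<open>far F a\<close> restricts the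
  coefficient, and the restriction of a section over T depends only on the object to which it is
  restricted.\<close>

lemma band_two_morphism:
  assumes T: "final_object X T" and F: "gerbe_morphism Z Y F" and H: "gerbe_morphism Z Y H"
    and Z: "fibred_in_groupoids X Z"
    and \<eta>: "two_morphism X Z Y F H \<eta>" and k: "k \<in> carrier (grp A T)"
  shows "two_morphism X Z Y F H (\<lambda>x. \<eta> x \<cdot> band Y (fob F x) (global_res T (pobj Z x) k))"
proof -
  interpret Z: fibred_in_groupoids X Z by (rule Z)
  note s1 = gerbe_morphism_simps[OF F] gerbe_morphism_simps[OF H] two_morphism_simps(1-4)[OF \<eta>]
  note s = s1 two_morphism_simps(5)[OF \<eta>]
  show ?thesis
    unfolding two_morphism_def
  proof (intro conjI ballI)
    fix x assume "x \<in> objs Z"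
    then show "\<eta> x \<cdot> band Y (fob F x) (global_res T (pobj Z x) k)
        \<in> arrows_over Y (idt X (pobj Z x)) (fob F x) (fob H x)"
      using T k by (simp add: arrows_over_iff s)
  next
    fix a assume a: "a \<in> arrs Z"
    let ?x = "src Z a" and ?y = "tgt Z a"
    let ?k = "\<lambda>x. global_res T (pobj Z x) k"
    have "(\<eta> ?y \<cdot> band Y (fob F ?y) (?k ?y)) \<cdot> far F a = \<eta> ?y \<cdot> (band Y (fob F ?y) (?k ?y) \<cdot> far F a)"
      using a T k by (simp add: s)
    also have "band Y (fob F ?y) (?k ?y) \<cdot> far F a = far F a \<cdot> band Y (fob F ?x) (?k ?x)"
      using a T k by (simp add: s band_move gres_global_res)
    also have "\<eta> ?y \<cdot> \<dots> = (\<eta> ?y \<cdot> far F a) \<cdot> band Y (fob F ?x) (?k ?x)"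
      using a T k by (simp add: s1)
    also have "\<dots> = far H a \<cdot> (\<eta> ?x \<cdot> band Y (fob F ?x) (?k ?x))"
      using a T k by (simp add: s)
    finally show "(\<eta> ?y \<cdot> band Y (fob F ?y) (?k ?y)) \<cdot> far F a
      = far H a \<cdot> (\<eta> ?x \<cdot> band Y (fob F ?x) (?k ?x))" .
  qed
qed

text \<open>At each object the components differ by a band element. Naturality makes these elements
  compatible with pullback, local isomorphism of the objects of \<open>Z\<close> makes them depend
  on the base object only, and local existence of objects suffices to glue them.\<close>

lemma two_morphism_difference:
  assumes T: "final_object X T" and F: "gerbe_morphism Z Y F" and H: "gerbe_morphism Z Y H"
    and Z: "abelian_gerbe X Z"
    and \<eta>: "two_morphism X Z Y F H \<eta>" and \<eta>': "two_morphism X Z Y F H \<eta>'"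
  shows "\<exists>!k. k \<in> carrier (grp A T) \<and>
    (\<forall>x \<in> objs Z. \<eta> x \<cdot> band Y (fob F x) (global_res T (pobj Z x) k) = \<eta>' x)"
proof -
  interpret Z: abelian_gerbe X Z by (rule Z)
  note s = gerbe_morphism_simps[OF F] gerbe_morphism_simps[OF H] two_morphism_simps(1-4)[OF \<eta>]
    two_morphism_simps(1-4)[OF \<eta>']
  define valid where "valid x k \<longleftrightarrow> k \<in> carrier (grp A (pobj Z x)) \<and> \<eta> x \<cdot> band Y (fob F x) k = \<eta>' x"
    for x k
  have valid_unique: "k = k'" if "x \<in> objs Z" "valid x k" "valid x k'" for x k k'
    using that by (intro band_cancel[of "\<eta> x" "fob F x"]) (simp_all add: s valid_def)
  have valid_ex: "\<exists>k. valid x k" if x: "x \<in> objs Z" for x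
    by (rule arrow_difference[of "\<eta> x" "\<eta>' x" "pobj Z x"]) (use x in \<open>simp_all add: s valid_def, metis\<close>)
  \<comment> \<open>Checked after composition with \<open>far H p\<close>: naturality of \<eta> and
    of \<eta>' moves the comparison from the source of p to its target.\<close>
  have valid_res: "valid (src Z p) (gres A (parr Z p) k)"
    if p: "p \<in> arrs Z" "tgt Z p = x" and k: "valid x k" for p x k
  proof -
    let ?y = "src Z p" and ?k = "gres A (parr Z p) k"
    have k': "k \<in> carrier (grp A (pobj Z x))" "\<eta> x \<cdot> band Y (fob F x) k = \<eta>' x" and x: "x \<in> objs Z"
      using k p by (auto simp: valid_def)
    have "\<eta> ?y \<cdot> band Y (fob F ?y) ?k = \<eta>' ?y"
    proof (rule cancel_left[of "far H p"])
      have "far H p \<cdot> (\<eta> ?y \<cdot> band Y (fob F ?y) ?k) = (far H p \<cdot> \<eta> ?y) \<cdot> band Y (fob F ?y) ?k"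
        using p k' by (simp add: s)
      also have "far H p \<cdot> \<eta> ?y = \<eta> x \<cdot> far F p"
        using two_morphism_simps(5)[OF \<eta> p(1)] p by simp
      also have "\<dots> \<cdot> band Y (fob F ?y) ?k = \<eta> x \<cdot> (far F p \<cdot> band Y (fob F ?y) ?k)"
        using p k' x by (simp add: s)
      also have "far F p \<cdot> band Y (fob F ?y) ?k = band Y (fob F x) k \<cdot> far F p"
        using p k' x by (simp add: s band_move)
      also have "\<eta> x \<cdot> \<dots> = (\<eta> x \<cdot> band Y (fob F x) k) \<cdot> far F p"
        using p k'(1) x by (simp add: s)
      also have "\<dots> = far H p \<cdot> \<eta>' ?y"
        using two_morphism_simps(5)[OF \<eta>' p(1)] p k'(2) by simp
      finally show "far H p \<cdot> (\<eta> ?y \<cdot> band Y (fob F ?y) ?k) = far H p \<cdot> \<eta>' ?y" .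
    qed (use p k' in \<open>simp_all add: s\<close>)
    then show ?thesis
      using p k' by (simp add: valid_def)
  qed
  define K where "K U = {k. \<exists>x \<in> objs Z. pobj Z x = U \<and> valid x k}" for U
  have ex1: "\<exists>!t. t \<in> sec (sets_of A) T \<and> (\<forall>U \<in> objs X. \<forall>k \<in> K U. res (sets_of A) (to_final X T U) t = k)"
  proof (rule global_section[OF T])
    show "K U \<subseteq> sec (sets_of A) U" for U
      by (auto simp: K_def valid_def)
  next
    fix f k assume f: "f \<in> arrs X" and "k \<in> K (tgt X f)"
    then obtain x where x: "x \<in> objs Z" "tgt X f = pobj Z x" "valid x k"
      by (auto simp: K_def)
    obtain p where p: "p \<in> arrs Z" "tgt Z p = x" "parr Z p = f" "pobj Z (src Z p) = src X f"
      by (rule Z.pullback[OF f x(1,2)])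
    then show "res (sets_of A) f k \<in> K (src X f)"
      using valid_res[OF p(1,2) x(3)] by (auto simp: K_def)
  next
    fix U k k' assume U: "U \<in> objs X" and "k \<in> K U" "k' \<in> K U"
    then obtain x x' where x: "x \<in> objs Z" "pobj Z x = U" "valid x k"
      and x': "x' \<in> objs Z" "pobj Z x' = U" "valid x' k'"
      by (auto simp: K_def)
    obtain S where S: "S \<in> cov X U" and loc: "\<forall>u \<in> S. \<exists>y y'. arrows_over Z u y x \<noteq> {} \<and>
        arrows_over Z u y' x' \<noteq> {} \<and> arrows_over Z (idt X (src X u)) y y' \<noteq> {}"
      using Z.objects_locally_isomorphic[OF U, of x x'] x x' by (auto simp: objs_over_iff)
    show "k = k'"
    proof (rule separation[OF U S])
      show "k \<in> sec (sets_of A) U" "k' \<in> sec (sets_of A) U"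
        using x x' by (auto simp: valid_def)
    next
      fix u assume u: "u \<in> S"
      obtain y y' p p' c where p: "p \<in> arrows_over Z u y x" "p' \<in> arrows_over Z u y' x'"
          "c \<in> arrows_over Z (idt X (src X u)) y y'"
        using loc u by blast
      have "valid y (gres A u k)"
        using valid_res[of p x k] p x by (simp add: arrows_over_iff)
      \<comment> \<open>Through the local isomorphism c, y is also a pullback of x', so both
        restrictions are valid at the same object.\<close>
      moreover have "valid y (gres A u k')"
        using valid_res[of "p' \<cdot>\<^bsub>Z\<^esub> c" x' k'] p x' cov_arrs[OF U S u] by (simp add: arrows_over_iff)
      moreover have "y \<in> objs Z"
        using p(1) by (auto simp: arrows_over_iff)
      ultimately show "res (sets_of A) u k = res (sets_of A) u k'"
        using valid_unique by simp
    qed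
  next
    fix U assume U: "U \<in> objs X"
    obtain S where S: "S \<in> cov X U" "\<forall>u \<in> S. objs_over Z (src X u) \<noteq> {}"
      using Z.objects_exist_locally[OF U] by blast
    have "K (src X u) \<noteq> {}" if u: "u \<in> S" for u
    proof -
      obtain x where "x \<in> objs Z" "pobj Z x = src X u"
        using S(2) u by (auto simp: objs_over_def)
      then show ?thesis
        using valid_ex[of x] by (auto simp: K_def)
    qed
    then show "\<exists>S \<in> cov X U. \<forall>u \<in> S. K (src X u) \<noteq> {}"
      using S(1) by blast
  qed
  have iff: "(\<forall>U \<in> objs X. \<forall>k \<in> K U. res (sets_of A) (to_final X T U) t = k) \<longleftrightarrow>
      (\<forall>x \<in> objs Z. \<eta> x \<cdot> band Y (fob F x) (global_res T (pobj Z x) t) = \<eta>' x)"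
    (is "?l \<longleftrightarrow> ?r") if t: "t \<in> sec (sets_of A) T" for t
  proof
    assume l: ?l
    show ?r
    proof
      fix x assume x: "x \<in> objs Z"
      obtain k where k: "valid x k"
        using valid_ex[OF x] by blast
      then have "k \<in> K (pobj Z x)"
        using x by (auto simp: K_def)
      then have "global_res T (pobj Z x) t = k"
        using l x by (simp add: global_res_def)
      then show "\<eta> x \<cdot> band Y (fob F x) (global_res T (pobj Z x) t) = \<eta>' x"
        using k by (simp add: valid_def)
    qed
  next
    assume r: ?r
    show ?l
    proof (intro ballI)
      fix U k assume U: "U \<in> objs X" and "k \<in> K U"
      then obtain x where x: "x \<in> objs Z" "pobj Z x = U" "valid x k"
        by (auto simp: K_def)
      have "valid x (global_res T U t)"
        using r x t T U by (auto simp: valid_def)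
      then show "res (sets_of A) (to_final X T U) t = k"
        using valid_unique[OF x(1) _ x(3)] by (simp add: global_res_def)
    qed
  qed
  show ?thesis
    by (rule ex1_conj_cong[OF iff ex1, unfolded sec_sets_of])
qed

end

section \<open>Connecting 2-morphisms and their 3-cocycle\<close>

locale lifted_gerbe = sheaf_action X G A \<phi> + sheaf_banded_gerbe X A Y
  for X :: "('o, 'm) site" and G :: "'g monoid" and A :: "('o, 'm, 'a) abelian_sheaf" and \<phi>
    and Y :: "('p, 'q, 'o, 'm, 'a) gerbe" (structure) +
  fixes F :: "'g \<Rightarrow> ('p, 'q, 'p, 'q) functor_data" and \<alpha> :: "'g \<Rightarrow> 'g \<Rightarrow> 'p \<Rightarrow> 'q"
  assumes lift: "gerbe_lift X G A \<phi> Y F" and connecting: "connecting X G Y F \<alpha>"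
begin

lemma lift_morphism: "g \<in> carrier G \<Longrightarrow> gerbe_morphism Y Y (F g)"
  using lift by (simp add: gerbe_lift_def gerbe_action_def)

lemma lift_simps [simp]:
  assumes "g \<in> carrier G"
  shows "x \<in> objs Y \<Longrightarrow> fob (F g) x \<in> objs Y"
    and "x \<in> objs Y \<Longrightarrow> pobj Y (fob (F g) x) = pobj Y x"
    and "x \<in> objs Y \<Longrightarrow> far (F g) (idt Y x) = idt Y (fob (F g) x)"
    and "a \<in> arrs Y \<Longrightarrow> far (F g) a \<in> arrs Y"
    and "a \<in> arrs Y \<Longrightarrow> src Y (far (F g) a) = fob (F g) (src Y a)"
    and "a \<in> arrs Y \<Longrightarrow> tgt Y (far (F g) a) = fob (F g) (tgt Y a)"
    and "a \<in> arrs Y \<Longrightarrow> parr Y (far (F g) a) = parr Y a"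
    and "\<lbrakk>a \<in> arrs Y; b \<in> arrs Y; src Y b = tgt Y a\<rbrakk>
      \<Longrightarrow> far (F g) (b \<cdot> a) = far (F g) b \<cdot> far (F g) a"
  using gerbe_morphism_simps[OF lift_morphism[OF assms]] by blast+

lemma far_band [simp]:
  "\<lbrakk>g \<in> carrier G; x \<in> objs Y; a \<in> carrier (grp A (pobj Y x))\<rbrakk>
    \<Longrightarrow> far (F g) (band Y x a) = band Y (fob (F g) x) (\<phi> g (pobj Y x) a)"
  using lift by (auto simp: gerbe_lift_def equivariant_gerbe_morphism_def)

lemma connecting_two_morphism:
  "\<lbrakk>g \<in> carrier G; h \<in> carrier G\<rbrakk> \<Longrightarrow> two_morphism X Y Y (F (g \<otimes>\<^bsub>G\<^esub> h)) (F g \<odot> F h) (\<alpha> g h)"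
  using connecting by (simp add: connecting_def)

lemma connecting_simps [simp]:
  assumes "g \<in> carrier G" "h \<in> carrier G" "x \<in> objs Y"
  shows "\<alpha> g h x \<in> arrs Y" "src Y (\<alpha> g h x) = fob (F (g \<otimes>\<^bsub>G\<^esub> h)) x"
    "tgt Y (\<alpha> g h x) = fob (F g) (fob (F h) x)" "parr Y (\<alpha> g h x) = idt X (pobj Y x)"
  using two_morphism_simps(1-4)[OF connecting_two_morphism[OF assms(1,2)] assms(3)] by simp_all

lemma connecting_natural:
  "\<lbrakk>g \<in> carrier G; h \<in> carrier G; a \<in> arrs Y; src Y a = x; tgt Y a = y\<rbrakk>
    \<Longrightarrow> \<alpha> g h y \<cdot> far (F (g \<otimes>\<^bsub>G\<^esub> h)) a = far (F g) (far (F h) a) \<cdot> \<alpha> g h x"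
  using two_morphism_simps(5)[OF connecting_two_morphism] by force

text \<open>Both composites in the defining equation are 2-morphisms from F_ghk to the composite of
  F_g, F_h and F_k, so they differ by a unique section over T. This justifies the definite
  description.\<close>

lemma gerbe_cocycle:
  assumes T: "final_object X T" and g: "g \<in> carrier G" "h \<in> carrier G" "k \<in> carrier G"
  shows "gerbe_cocycle X T G A Y F \<alpha> g h k \<in> carrier (grp A T)"
    and "x \<in> objs Y \<Longrightarrow> \<alpha> g h (fob (F k) x) \<cdot> \<alpha> (g \<otimes>\<^bsub>G\<^esub> h) k x \<cdot> band Y (fob (F (g \<otimes>\<^bsub>G\<^esub> h \<otimes>\<^bsub>G\<^esub> k)) x)
        (global_res T (pobj Y x) (gerbe_cocycle X T G A Y F \<alpha> g h k))
      = far (F g) (\<alpha> h k x) \<cdot> \<alpha> g (h \<otimes>\<^bsub>G\<^esub> k) x"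
proof -
  let ?F = "F (g \<otimes>\<^bsub>G\<^esub> h \<otimes>\<^bsub>G\<^esub> k)" and ?H = "F g \<odot> (F h \<odot> F k)"
  \<comment> \<open>Associativity in G lets both composites start at the same functor.\<close>
  have gs: "g \<otimes>\<^bsub>G\<^esub> h \<in> carrier G" "h \<otimes>\<^bsub>G\<^esub> k \<in> carrier G" "g \<otimes>\<^bsub>G\<^esub> h \<otimes>\<^bsub>G\<^esub> k \<in> carrier G"
      "g \<otimes>\<^bsub>G\<^esub> (h \<otimes>\<^bsub>G\<^esub> k) = g \<otimes>\<^bsub>G\<^esub> h \<otimes>\<^bsub>G\<^esub> k"
    using g by (simp_all add: m_assoc)
  have "\<exists>!t. t \<in> carrier (grp A T) \<and> (\<forall>x \<in> objs Y.
      \<alpha> g h (fob (F k) x) \<cdot> \<alpha> (g \<otimes>\<^bsub>G\<^esub> h) k x \<cdot> band Y (fob ?F x) (global_res T (pobj Y x) t)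
      = far (F g) (\<alpha> h k x) \<cdot> \<alpha> g (h \<otimes>\<^bsub>G\<^esub> k) x)"
  proof (rule two_morphism_difference[OF T])
    show "gerbe_morphism Y Y ?F" "gerbe_morphism Y Y ?H"
      using g gs by (auto intro!: gerbe_morphism_comp lift_morphism)
    show "abelian_gerbe X Y"
      by unfold_locales
    show "two_morphism X Y Y ?F ?H (\<lambda>x. \<alpha> g h (fob (F k) x) \<cdot> \<alpha> (g \<otimes>\<^bsub>G\<^esub> h) k x)"
      unfolding two_morphism_def
    proof (intro conjI ballI)
      fix x assume x: "x \<in> objs Y"
      then show "\<alpha> g h (fob (F k) x) \<cdot> \<alpha> (g \<otimes>\<^bsub>G\<^esub> h) k x
          \<in> arrows_over Y (idt X (pobj Y x)) (fob ?F x) (fob ?H x)"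
        using g gs by (simp add: arrows_over_iff)
    next
      fix a assume a: "a \<in> arrs Y"
      let ?x = "src Y a" and ?y = "tgt Y a"
      have "(\<alpha> g h (fob (F k) ?y) \<cdot> \<alpha> (g \<otimes>\<^bsub>G\<^esub> h) k ?y) \<cdot> far ?F a
          = \<alpha> g h (fob (F k) ?y) \<cdot> (\<alpha> (g \<otimes>\<^bsub>G\<^esub> h) k ?y \<cdot> far ?F a)"
        using a g gs by simp
      also have "\<dots> = (\<alpha> g h (fob (F k) ?y) \<cdot> far (F (g \<otimes>\<^bsub>G\<^esub> h)) (far (F k) a)) \<cdot> \<alpha> (g \<otimes>\<^bsub>G\<^esub> h) k ?x"
        using a g gs by (simp add: connecting_natural[of "g \<otimes>\<^bsub>G\<^esub> h" k a])
      also have "\<dots> = far ?H a \<cdot> (\<alpha> g h (fob (F k) ?x) \<cdot> \<alpha> (g \<otimes>\<^bsub>G\<^esub> h) k ?x)"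
        using a g gs by (simp add: connecting_natural[of g h "far (F k) a"])
      finally show "(\<alpha> g h (fob (F k) ?y) \<cdot> \<alpha> (g \<otimes>\<^bsub>G\<^esub> h) k ?y) \<cdot> far ?F a
          = far ?H a \<cdot> (\<alpha> g h (fob (F k) ?x) \<cdot> \<alpha> (g \<otimes>\<^bsub>G\<^esub> h) k ?x)" .
    qed
    show "two_morphism X Y Y ?F ?H (\<lambda>x. far (F g) (\<alpha> h k x) \<cdot> \<alpha> g (h \<otimes>\<^bsub>G\<^esub> k) x)"
      unfolding two_morphism_def
    proof (intro conjI ballI)
      fix x assume x: "x \<in> objs Y"
      then show "far (F g) (\<alpha> h k x) \<cdot> \<alpha> g (h \<otimes>\<^bsub>G\<^esub> k) x
          \<in> arrows_over Y (idt X (pobj Y x)) (fob ?F x) (fob ?H x)"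
        using g gs by (simp add: arrows_over_iff)
    next
      fix a assume a: "a \<in> arrs Y"
      let ?x = "src Y a" and ?y = "tgt Y a"
      have "(far (F g) (\<alpha> h k ?y) \<cdot> \<alpha> g (h \<otimes>\<^bsub>G\<^esub> k) ?y) \<cdot> far ?F a
          = far (F g) (\<alpha> h k ?y) \<cdot> (\<alpha> g (h \<otimes>\<^bsub>G\<^esub> k) ?y \<cdot> far (F (g \<otimes>\<^bsub>G\<^esub> (h \<otimes>\<^bsub>G\<^esub> k))) a)"
        using a g gs by simp
      also have "\<alpha> g (h \<otimes>\<^bsub>G\<^esub> k) ?y \<cdot> far (F (g \<otimes>\<^bsub>G\<^esub> (h \<otimes>\<^bsub>G\<^esub> k))) a
          = far (F g) (far (F (h \<otimes>\<^bsub>G\<^esub> k)) a) \<cdot> \<alpha> g (h \<otimes>\<^bsub>G\<^esub> k) ?x"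
        using a g gs connecting_natural[of g "h \<otimes>\<^bsub>G\<^esub> k" a] by simp
      also have "far (F g) (\<alpha> h k ?y) \<cdot> \<dots> = far (F g) (\<alpha> h k ?y \<cdot> far (F (h \<otimes>\<^bsub>G\<^esub> k)) a) \<cdot> \<alpha> g (h \<otimes>\<^bsub>G\<^esub> k) ?x"
        using a g gs by simp
      also have "\<dots> = far ?H a \<cdot> (far (F g) (\<alpha> h k ?x) \<cdot> \<alpha> g (h \<otimes>\<^bsub>G\<^esub> k) ?x)"
        using a g gs by (simp add: connecting_natural[of h k a])
      finally show "(far (F g) (\<alpha> h k ?y) \<cdot> \<alpha> g (h \<otimes>\<^bsub>G\<^esub> k) ?y) \<cdot> far ?F a
          = far ?H a \<cdot> (far (F g) (\<alpha> h k ?x) \<cdot> \<alpha> g (h \<otimes>\<^bsub>G\<^esub> k) ?x)" .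
    qed
  qed
  from theI'[OF this] show "gerbe_cocycle X T G A Y F \<alpha> g h k \<in> carrier (grp A T)"
    and "x \<in> objs Y \<Longrightarrow> \<alpha> g h (fob (F k) x) \<cdot> \<alpha> (g \<otimes>\<^bsub>G\<^esub> h) k x \<cdot> band Y (fob ?F x)
        (global_res T (pobj Y x) (gerbe_cocycle X T G A Y F \<alpha> g h k))
      = far (F g) (\<alpha> h k x) \<cdot> \<alpha> g (h \<otimes>\<^bsub>G\<^esub> k) x"
    by (auto simp: gerbe_cocycle_def global_res_def)
qed

lemma modified_connecting:
  assumes T: "final_object X T" and b: "\<And>g h. \<lbrakk>g \<in> carrier G; h \<in> carrier G\<rbrakk> \<Longrightarrow> b g h \<in> carrier (grp A T)"
  shows "connecting X G Y F (\<lambda>g h x. \<alpha> g h x \<cdot> band Y (fob (F (g \<otimes>\<^bsub>G\<^esub> h)) x) (global_res T (pobj Y x) (b g h)))"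
  unfolding connecting_def
proof (intro ballI)
  fix g h assume gh: "g \<in> carrier G" "h \<in> carrier G"
  show "two_morphism X Y Y (F (g \<otimes>\<^bsub>G\<^esub> h)) (F g \<odot> F h)
      (\<lambda>x. \<alpha> g h x \<cdot> band Y (fob (F (g \<otimes>\<^bsub>G\<^esub> h)) x) (global_res T (pobj Y x) (b g h)))"
    by (rule band_two_morphism[OF T _ _ _ connecting_two_morphism])
      (use gh b in \<open>auto intro!: gerbe_morphism_comp lift_morphism fibred_in_groupoids_axioms\<close>)
qed

text \<open>Correcting \<alpha> by \<beta> multiplies the two sides of the cocycle equation by
  \<beta>(g,h) \<beta>(gh,k) and by \<phi>_g(\<beta>(h,k)) \<beta>(g,hk). For \<kappa> = d b the
  choice \<beta> = b^-1 makes them agree.\<close>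

lemma strict_connecting:
  assumes T: "final_object X T"
    and trivial: "cohomology_class G (grp A T) (\<lambda>g. \<phi> g T) 3
       (\<lambda>gs \<in> tuples G 3. gerbe_cocycle X T G A Y F \<alpha> (gs ! 0) (gs ! 1) (gs ! 2))
       = \<one>\<^bsub>section_cohomology G A \<phi> 3 T\<^esub>"
  obtains \<alpha>' where "connecting X G Y F \<alpha>'"
    "\<And>g h k x. \<lbrakk>g \<in> carrier G; h \<in> carrier G; k \<in> carrier G; x \<in> objs Y\<rbrakk> \<Longrightarrow>
      \<alpha>' g h (fob (F k) x) \<cdot> \<alpha>' (g \<otimes>\<^bsub>G\<^esub> h) k x = far (F g) (\<alpha>' h k x) \<cdot> \<alpha>' g (h \<otimes>\<^bsub>G\<^esub> k) x"
proof -
  have To: "T \<in> objs X"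
    using T by (simp add: final_object_def)
  interpret N: comm_group "grp A T" by (simp add: To)
  obtain b where b: "\<And>g h. \<lbrakk>g \<in> carrier G; h \<in> carrier G\<rbrakk> \<Longrightarrow> b g h \<in> carrier (grp A T)"
    "\<And>g h k. \<lbrakk>g \<in> carrier G; h \<in> carrier G; k \<in> carrier G\<rbrakk> \<Longrightarrow>
      gerbe_cocycle X T G A Y F \<alpha> g h k = \<phi> g T (b h k) \<otimes>\<^bsub>grp A T\<^esub>
        (inv\<^bsub>grp A T\<^esub> (b (g \<otimes>\<^bsub>G\<^esub> h) k) \<otimes>\<^bsub>grp A T\<^esub> b g (h \<otimes>\<^bsub>G\<^esub> k)) \<otimes>\<^bsub>grp A T\<^esub> inv\<^bsub>grp A T\<^esub> (b g h)"
    by (rule trivial_class_3[OF To gerbe_cocycle(1)[OF T] trivial]) (assumption+, rule that)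
  define \<beta> where "\<beta> g h = inv\<^bsub>grp A T\<^esub> (b g h)" for g h
  have \<beta>: "\<beta> g h \<in> carrier (grp A T)" if "g \<in> carrier G" "h \<in> carrier G" for g h
    using that b by (simp add: \<beta>_def)
  define \<alpha>' where "\<alpha>' = (\<lambda>g h x. \<alpha> g h x \<cdot> band Y (fob (F (g \<otimes>\<^bsub>G\<^esub> h)) x) (global_res T (pobj Y x) (\<beta> g h)))"
  have "\<alpha>' g h (fob (F k) x) \<cdot> \<alpha>' (g \<otimes>\<^bsub>G\<^esub> h) k x = far (F g) (\<alpha>' h k x) \<cdot> \<alpha>' g (h \<otimes>\<^bsub>G\<^esub> k) x"
    if g: "g \<in> carrier G" "h \<in> carrier G" "k \<in> carrier G" and x: "x \<in> objs Y" for g h k x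
  proof -
    let ?U = "pobj Y x"
    let ?r = "\<lambda>g h. global_res T ?U (\<beta> g h)" and ?\<kappa> = "global_res T ?U (gerbe_cocycle X T G A Y F \<alpha> g h k)"
    let ?w = "fob (F (g \<otimes>\<^bsub>G\<^esub> h \<otimes>\<^bsub>G\<^esub> k)) x"
    interpret M: comm_group "grp A ?U" by (simp add: x)
    have gs: "g \<otimes>\<^bsub>G\<^esub> h \<in> carrier G" "h \<otimes>\<^bsub>G\<^esub> k \<in> carrier G" "g \<otimes>\<^bsub>G\<^esub> h \<otimes>\<^bsub>G\<^esub> k \<in> carrier G"
        "g \<otimes>\<^bsub>G\<^esub> (h \<otimes>\<^bsub>G\<^esub> k) = g \<otimes>\<^bsub>G\<^esub> h \<otimes>\<^bsub>G\<^esub> k"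
      using g by (simp_all add: m_assoc)
    have r: "?r g' h' \<in> carrier (grp A ?U)" if "g' \<in> carrier G" "h' \<in> carrier G" for g' h'
      using that \<beta> T x by simp
    have \<kappa>: "?\<kappa> \<in> carrier (grp A ?U)"
      using gerbe_cocycle(1)[OF T g] T x by simp
    have \<phi>r: "\<phi> g ?U (?r h k) = global_res T ?U (\<phi> g T (\<beta> h k))"
      using final_arr[OF T, of ?U] x g \<beta> by (simp add: global_res_def action_gres)
    \<comment> \<open>The identity between the coefficients over T; it is then restricted to the
      base of x.\<close>
    have "gerbe_cocycle X T G A Y F \<alpha> g h k \<otimes>\<^bsub>grp A T\<^esub> (\<phi> g T (\<beta> h k) \<otimes>\<^bsub>grp A T\<^esub> \<beta> g (h \<otimes>\<^bsub>G\<^esub> k))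
        = \<beta> g h \<otimes>\<^bsub>grp A T\<^esub> \<beta> (g \<otimes>\<^bsub>G\<^esub> h) k"
    proof -
      let ?a = "\<phi> g T (b h k)" and ?b = "b (g \<otimes>\<^bsub>G\<^esub> h) k" and ?c = "b g (h \<otimes>\<^bsub>G\<^esub> k)" and ?d = "b g h"
      have cl: "?a \<in> carrier (grp A T)" "?b \<in> carrier (grp A T)" "?c \<in> carrier (grp A T)" "?d \<in> carrier (grp A T)"
        using g gs b To by simp_all
      have "?a \<otimes>\<^bsub>grp A T\<^esub> (inv\<^bsub>grp A T\<^esub> ?b \<otimes>\<^bsub>grp A T\<^esub> ?c) \<otimes>\<^bsub>grp A T\<^esub> inv\<^bsub>grp A T\<^esub> ?d
          \<otimes>\<^bsub>grp A T\<^esub> (inv\<^bsub>grp A T\<^esub> ?a \<otimes>\<^bsub>grp A T\<^esub> inv\<^bsub>grp A T\<^esub> ?c)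
        = (?a \<otimes>\<^bsub>grp A T\<^esub> ?c) \<otimes>\<^bsub>grp A T\<^esub> inv\<^bsub>grp A T\<^esub> (?a \<otimes>\<^bsub>grp A T\<^esub> ?c)
          \<otimes>\<^bsub>grp A T\<^esub> (inv\<^bsub>grp A T\<^esub> ?d \<otimes>\<^bsub>grp A T\<^esub> inv\<^bsub>grp A T\<^esub> ?b)"
        using cl by (simp only: N.inv_mult N.m_ac N.m_closed N.inv_closed)
      also have "\<dots> = inv\<^bsub>grp A T\<^esub> ?d \<otimes>\<^bsub>grp A T\<^esub> inv\<^bsub>grp A T\<^esub> ?b"
        using cl by (simp only: N.r_inv N.m_closed N.l_one N.inv_closed)
      finally show ?thesis
        using g gs b To by (simp add: \<beta>_def action_inv b(2))
    qed
    from arg_cong[OF this, of "global_res T ?U"]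
    have eq: "?\<kappa> \<otimes>\<^bsub>grp A ?U\<^esub> (\<phi> g ?U (?r h k) \<otimes>\<^bsub>grp A ?U\<^esub> ?r g (h \<otimes>\<^bsub>G\<^esub> k)) = ?r g h \<otimes>\<^bsub>grp A ?U\<^esub> ?r (g \<otimes>\<^bsub>G\<^esub> h) k"
      using g gs \<beta> T To x gerbe_cocycle(1)[OF T g] by (simp add: global_res_mult \<phi>r)
    let ?A = "\<alpha> g h (fob (F k) x)" and ?B = "\<alpha> (g \<otimes>\<^bsub>G\<^esub> h) k x" and ?C = "far (F g) (\<alpha> h k x)"
      and ?D = "\<alpha> g (h \<otimes>\<^bsub>G\<^esub> k) x"
    \<comment> \<open>All coefficients are moved to the right end, where they act on
      \<open>?w\<close>. The one inside \<alpha>(h,k) is changed by \<phi>_g on the way, since F_g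
      is applied to it.\<close>
    have "\<alpha>' g h (fob (F k) x) \<cdot> \<alpha>' (g \<otimes>\<^bsub>G\<^esub> h) k x
        = ?A \<cdot> ((band Y (fob (F (g \<otimes>\<^bsub>G\<^esub> h)) (fob (F k) x)) (?r g h) \<cdot> ?B) \<cdot> band Y ?w (?r (g \<otimes>\<^bsub>G\<^esub> h) k))"
      using g gs x r by (simp add: \<alpha>'_def)
    also have "band Y (fob (F (g \<otimes>\<^bsub>G\<^esub> h)) (fob (F k) x)) (?r g h) \<cdot> ?B = ?B \<cdot> band Y ?w (?r g h)"
      using g gs x r by (simp add: band_move_vertical[of ?B _ ?U])
    also have "?A \<cdot> (\<dots> \<cdot> band Y ?w (?r (g \<otimes>\<^bsub>G\<^esub> h) k)) = ?A \<cdot> ?B \<cdot> band Y ?w (?r g h \<otimes>\<^bsub>grp A ?U\<^esub> ?r (g \<otimes>\<^bsub>G\<^esub> h) k)"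
      using g gs x r by (simp add: band_mult[of _ ?U])
    also have "\<dots> = (?A \<cdot> ?B \<cdot> band Y ?w ?\<kappa>) \<cdot> band Y ?w (\<phi> g ?U (?r h k) \<otimes>\<^bsub>grp A ?U\<^esub> ?r g (h \<otimes>\<^bsub>G\<^esub> k))"
      using g gs x r \<kappa> by (simp add: band_mult[of _ ?U] flip: eq)
    also have "\<dots> = ?C \<cdot> ?D \<cdot> band Y ?w (\<phi> g ?U (?r h k) \<otimes>\<^bsub>grp A ?U\<^esub> ?r g (h \<otimes>\<^bsub>G\<^esub> k))"
      by (simp only: gerbe_cocycle(2)[OF T g x])
    also have "\<dots> = ?C \<cdot> (?D \<cdot> band Y ?w (\<phi> g ?U (?r h k))) \<cdot> band Y ?w (?r g (h \<otimes>\<^bsub>G\<^esub> k))"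
      using g gs x r by (simp add: band_mult[of _ ?U])
    also have "?D \<cdot> band Y ?w (\<phi> g ?U (?r h k)) = band Y (fob (F g) (fob (F (h \<otimes>\<^bsub>G\<^esub> k)) x)) (\<phi> g ?U (?r h k)) \<cdot> ?D"
      using g gs x r by (simp add: band_move_vertical[of ?D _ ?U])
    also have "?C \<cdot> \<dots> \<cdot> band Y ?w (?r g (h \<otimes>\<^bsub>G\<^esub> k)) = far (F g) (\<alpha>' h k x) \<cdot> \<alpha>' g (h \<otimes>\<^bsub>G\<^esub> k) x"
      using g gs x r by (simp add: \<alpha>'_def)
    finally show ?thesis .
  qed
  moreover have "connecting X G Y F \<alpha>'"
    unfolding \<alpha>'_def by (rule modified_connecting[OF T \<beta>])
  ultimately show ?thesis
    using that by blast
qed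

end

section \<open>Morphisms of gerbes that are bijective on automorphism groups\<close>

locale gerbe_equivalence = gerbe_functor X Z Y F + Z: abelian_gerbe X Z + Y: abelian_gerbe X Y
  for X :: "('o, 'm) site" and Z :: "('r, 's, 'o, 'm, 'b) gerbe" and Y :: "('p, 'q, 'o, 'm, 'a) gerbe"
    and F :: "('r, 's, 'p, 'q) functor_data" +
  assumes aut_injective: "\<lbrakk>a \<in> arrs Z; src Z a = x; tgt Z a = x; parr Z a = idt X (pobj Z x);
      far F a = idt Y (fob F x)\<rbrakk> \<Longrightarrow> a = idt Z x"
    and aut_surjective: "\<lbrakk>x \<in> objs Z; b \<in> arrs Y; src Y b = fob F x; tgt Y b = fob F x;
      parr Y b = idt X (pobj Z x)\<rbrakk> \<Longrightarrow> \<exists>a \<in> arrs Z. src Z a = x \<and> tgt Z a = x \<and> far F a = b"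
begin

text \<open>Arrows with equal images lie over the same base arrow, hence differ by an automorphism
  of the source; its image is trivial, so it is trivial itself.\<close>

lemma faithful:
  assumes a: "a \<in> arrs Z" "src Z a = x" "tgt Z a = y" and b: "b \<in> arrs Z" "src Z b = x" "tgt Z b = y"
    and eq: "far F a = far F b"
  shows "a = b"
proof -
  have "parr Z a = parr Z b"
    using a b eq parr_far by metis
  then have f: "b \<in> arrs Z" "a \<in> arrs Z" "tgt Z b = tgt Z a" "parr Z b = parr Z a"
    using a b by simp_all
  obtain c where c: "c \<in> arrs Z" "src Z c = src Z b" "tgt Z c = src Z a"
      "parr Z c = idt X (pobj Z (src Z b))" "a \<cdot>\<^bsub>Z\<^esub> c = b"
    by (rule Z.factor_vertical[OF f])
  have "far F a \<cdot>\<^bsub>Y\<^esub> far F c = far F b"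
    using c a by (simp flip: far_cmp)
  then have "far F a \<cdot>\<^bsub>Y\<^esub> far F c = far F a \<cdot>\<^bsub>Y\<^esub> idt Y (fob F x)"
    using eq a b by simp
  then have "far F c = idt Y (fob F x)"
    by (rule Y.cancel_left) (use a b c in auto)
  then have "c = idt Z x"
    using c a b by (intro aut_injective) auto
  then show ?thesis
    using a c by simp
qed

text \<open>Locally x and y are isomorphic in \<open>Z\<close>. The image of a local isomorphism
  differs from t by an automorphism, which lifts. The local arrows corrected in this way are unique
  by faithfulness and therefore glue.\<close>

lemma full_vertical:
  assumes x: "x \<in> objs Z" and y: "y \<in> objs Z" and t: "t \<in> arrs Y" "src Y t = fob F x" "tgt Y t = fob F y"
    "parr Y t = idt X (pobj Z x)"
  obtains c where "c \<in> arrs Z" "src Z c = x" "tgt Z c = y" "far F c = t"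
proof -
  let ?U = "pobj Z x"
  have U: "?U \<in> objs X" "pobj Z y = ?U"
    using x y t Y.tgt_parr[of t] by simp_all
  obtain S where S: "S \<in> cov X ?U" and loc: "\<forall>u \<in> S. \<exists>x' y'. arrows_over Z u x' x \<noteq> {} \<and>
        arrows_over Z u y' y \<noteq> {} \<and> arrows_over Z (idt X (src X u)) x' y' \<noteq> {}"
    using Z.objects_locally_isomorphic[OF U(1), of x y] x y U by (auto simp: objs_over_iff)
  note cov = Z.cov_arrs[OF U(1) S]
  have ex: "\<exists>p \<in> arrs Z. \<exists>r \<in> arrs Z. tgt Z p = x \<and> parr Z p = u \<and> src Z r = src Z p \<and> tgt Z r = y \<and>
      parr Z r = u \<and> far F r = t \<cdot>\<^bsub>Y\<^esub> far F p" if u: "u \<in> S" for u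
  proof -
    obtain x' y' p q c where "p \<in> arrows_over Z u x' x" "q \<in> arrows_over Z u y' y"
        "c \<in> arrows_over Z (idt X (src X u)) x' y'"
      using loc u by blast
    then have p: "p \<in> arrs Z" "src Z p = x'" "tgt Z p = x" "parr Z p = u"
      and q: "q \<in> arrs Z" "src Z q = y'" "tgt Z q = y" "parr Z q = u"
      and c: "c \<in> arrs Z" "src Z c = x'" "tgt Z c = y'" "parr Z c = idt X (src X u)"
      by (auto simp: arrows_over_iff)
    have x': "x' \<in> objs Z" "pobj Z x' = src X u"
      using p Z.src_parr[of p] by auto
    let ?r = "q \<cdot>\<^bsub>Z\<^esub> c"
    have f: "t \<cdot>\<^bsub>Y\<^esub> far F p \<in> arrs Y" "far F ?r \<in> arrs Y" "tgt Y (t \<cdot>\<^bsub>Y\<^esub> far F p) = tgt Y (far F ?r)"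
        "parr Y (t \<cdot>\<^bsub>Y\<^esub> far F p) = parr Y (far F ?r)"
      using p q c t x' cov[OF u] by simp_all
    obtain d where d: "d \<in> arrs Y" "src Y d = src Y (t \<cdot>\<^bsub>Y\<^esub> far F p)" "tgt Y d = src Y (far F ?r)"
        "parr Y d = idt X (pobj Y (src Y (t \<cdot>\<^bsub>Y\<^esub> far F p)))" "far F ?r \<cdot>\<^bsub>Y\<^esub> d = t \<cdot>\<^bsub>Y\<^esub> far F p"
      by (rule Y.factor_vertical[OF f])
    obtain e where e: "e \<in> arrs Z" "src Z e = x'" "tgt Z e = x'" "far F e = d"
      using aut_surjective[of x' d] d p q c t x' by auto
    have "parr Z e = idt X (src X u)"
      using e d p q c t x' by (simp flip: parr_far)
    then show ?thesis
      using e d(1,3,5) p q c x' cov[OF u] by - (rule bexI[of _ p], rule bexI[of _ "?r \<cdot>\<^bsub>Z\<^esub> e"], simp_all)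
  qed
  obtain c where c: "c \<in> arrs Z" "src Z c = x" "tgt Z c = y" "parr Z c = idt X ?U"
    and Q: "\<And>p. \<lbrakk>p \<in> arrs Z; tgt Z p = x; parr Z p \<in> sieve X S\<rbrakk> \<Longrightarrow> far F (c \<cdot>\<^bsub>Z\<^esub> p) = t \<cdot>\<^bsub>Y\<^esub> far F p"
  proof (rule Z.arrow_glue[OF U(1) S x refl y U(2), of "\<lambda>p r. far F r = t \<cdot>\<^bsub>Y\<^esub> far F p"])
    show "far F (r \<cdot>\<^bsub>Z\<^esub> q) = t \<cdot>\<^bsub>Y\<^esub> far F (p \<cdot>\<^bsub>Z\<^esub> q)"
      if "p \<in> arrs Z" "r \<in> arrs Z" "q \<in> arrs Z" "tgt Z p = x" "src Z r = src Z p" "tgt Z q = src Z p"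
        "far F r = t \<cdot>\<^bsub>Y\<^esub> far F p" for p r q
      using that t by simp
    show "r = r'" if "r \<in> arrs Z" "tgt Z r = y" "src Z r = src Z p" "r' \<in> arrs Z" "tgt Z r' = y"
        "src Z r' = src Z p" "far F r = t \<cdot>\<^bsub>Y\<^esub> far F p" "far F r' = t \<cdot>\<^bsub>Y\<^esub> far F p" for p r r'
      by (rule faithful[of r "src Z p" y r']) (use that in simp_all)
  qed (use ex in simp_all)
  \<comment> \<open>Only the composites of \<open>far F c\<close> with pullback arrows are known, so
    equality is checked on the cover.\<close>
  have "far F c = t"
  proof (rule Y.arrow_separation[OF U(1) S])
    fix u assume u: "u \<in> S"
    obtain p where p: "p \<in> arrs Z" "tgt Z p = x" "parr Z p = u"
      using ex[OF u] by blast
    then have "far F (c \<cdot>\<^bsub>Z\<^esub> p) = t \<cdot>\<^bsub>Y\<^esub> far F p"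
      using Q Z.cov_in_sieve[OF U(1) S u] by simp
    then show "\<exists>p \<in> arrs Y. tgt Y p = src Y (far F c) \<and> parr Y p = u \<and> far F c \<cdot>\<^bsub>Y\<^esub> p = t \<cdot>\<^bsub>Y\<^esub> p"
      using p c by (intro bexI[of _ "far F p"]) simp_all
  qed (use c t in simp_all)
  then show ?thesis
    using that c by simp
qed

text \<open>Pulling y back along the base arrow of t reduces to the vertical case.\<close>

lemma full:
  assumes x: "x \<in> objs Z" and y: "y \<in> objs Z" and t: "t \<in> arrs Y" "src Y t = fob F x" "tgt Y t = fob F y"
  obtains c where "c \<in> arrs Z" "src Z c = x" "tgt Z c = y" "far F c = t"
proof -
  have f: "parr Y t \<in> arrs X" "y \<in> objs Z" "tgt X (parr Y t) = pobj Z y"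
    using t y by simp_all
  obtain p where p: "p \<in> arrs Z" "tgt Z p = y" "parr Z p = parr Y t" "pobj Z (src Z p) = src X (parr Y t)"
    by (rule Z.pullback[OF f])
  have f: "t \<in> arrs Y" "far F p \<in> arrs Y" "tgt Y t = tgt Y (far F p)" "parr Y t = parr Y (far F p)"
    using p t by simp_all
  obtain d where d: "d \<in> arrs Y" "src Y d = src Y t" "tgt Y d = src Y (far F p)"
      "parr Y d = idt X (pobj Y (src Y t))" "far F p \<cdot>\<^bsub>Y\<^esub> d = t"
    by (rule Y.factor_vertical[OF f])
  have f: "x \<in> objs Z" "src Z p \<in> objs Z" "d \<in> arrs Y" "src Y d = fob F x" "tgt Y d = fob F (src Z p)"
      "parr Y d = idt X (pobj Z x)"
    using x p t d by simp_all
  obtain e where e: "e \<in> arrs Z" "src Z e = x" "tgt Z e = src Z p" "far F e = d"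
    by (rule full_vertical[OF f])
  show ?thesis
    by (rule that[of "p \<cdot>\<^bsub>Z\<^esub> e"]) (use e p d in simp_all)
qed

text \<open>\<open>Z\<close> has objects locally, and their images are locally isomorphic to the
  restrictions of y, as any two objects of \<open>Y\<close> over the same base are.\<close>

lemma locally_in_image:
  assumes y: "y \<in> objs Y"
  shows "\<exists>S \<in> cov X (pobj Y y). \<forall>u \<in> S.
    \<exists>z \<in> objs Z. \<exists>e \<in> arrs Y. src Y e = fob F z \<and> tgt Y e = y \<and> parr Y e = u"
proof -
  let ?U = "pobj Y y"
  have U: "?U \<in> objs X"
    using y by simp
  obtain S where S: "S \<in> cov X ?U" "\<forall>u \<in> S. objs_over Z (src X u) \<noteq> {}"
    using Z.objects_exist_locally[OF U] by blast
  show ?thesis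
  proof (rule Z.local_compose[OF U S(1)])
    fix u assume u: "u \<in> S"
    note cov = Z.cov_arrs[OF U S(1) u]
    obtain z where z: "z \<in> objs Z" "pobj Z z = src X u"
      using S(2) u by (auto simp: objs_over_def)
    obtain p where p: "p \<in> arrs Y" "tgt Y p = y" "parr Y p = u" "pobj Y (src Y p) = src X u"
      by (rule Y.pullback[OF cov(1) y cov(2)])
    obtain R where R: "R \<in> cov X (src X u)" and loc: "\<forall>v \<in> R. \<exists>a b. arrows_over Y v a (fob F z) \<noteq> {} \<and>
        arrows_over Y v b (src Y p) \<noteq> {} \<and> arrows_over Y (idt X (src X v)) a b \<noteq> {}"
      using Y.objects_locally_isomorphic[OF cov(3), of "fob F z" "src Y p"] z p
      by (auto simp: objs_over_iff)
    have "\<exists>z \<in> objs Z. \<exists>e \<in> arrs Y. src Y e = fob F z \<and> tgt Y e = y \<and> parr Y e = u \<cdot>\<^bsub>X\<^esub> v"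
      if v: "v \<in> R" for v
    proof -
      note cv = Z.cov_arrs[OF cov(3) R v]
      obtain a b i j c where "i \<in> arrows_over Y v a (fob F z)" "j \<in> arrows_over Y v b (src Y p)"
          "c \<in> arrows_over Y (idt X (src X v)) a b"
        using loc v by blast
      then have i: "i \<in> arrs Y" "src Y i = a" "tgt Y i = fob F z" "parr Y i = v"
        and j: "j \<in> arrs Y" "src Y j = b" "tgt Y j = src Y p" "parr Y j = v"
        and c: "c \<in> arrs Y" "src Y c = a" "tgt Y c = b" "parr Y c = idt X (src X v)"
        by (auto simp: arrows_over_iff)
      have f: "v \<in> arrs X" "z \<in> objs Z" "tgt X v = pobj Z z"
        using cv z by simp_all
      \<comment> \<open>The local isomorphism starts at some pullback of \<open>fob F z\<close>,
        which need not be an image. The pullback of z formed in \<open>Z\<close> has an image that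
        maps to it vertically.\<close>
      obtain q where q: "q \<in> arrs Z" "tgt Z q = z" "parr Z q = v" "pobj Z (src Z q) = src X v"
        by (rule Z.pullback[OF f])
      have f: "far F q \<in> arrs Y" "i \<in> arrs Y" "tgt Y (far F q) = tgt Y i" "parr Y (far F q) = parr Y i"
        using q i by simp_all
      obtain d where d: "d \<in> arrs Y" "src Y d = src Y (far F q)" "tgt Y d = src Y i"
          "parr Y d = idt X (pobj Y (src Y (far F q)))"
        by (rule Y.factor_vertical[OF f])
      have "parr Y (p \<cdot>\<^bsub>Y\<^esub> (j \<cdot>\<^bsub>Y\<^esub> (c \<cdot>\<^bsub>Y\<^esub> d))) = u \<cdot>\<^bsub>X\<^esub> v"
        using p j c d i q cv cov by simp
      then show ?thesis
        using p j c d i q by (intro bexI[of _ "src Z q"] bexI[of _ "p \<cdot>\<^bsub>Y\<^esub> (j \<cdot>\<^bsub>Y\<^esub> (c \<cdot>\<^bsub>Y\<^esub> d))"]) simp_all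
    qed
    then show "\<exists>R \<in> cov X (src X u). \<forall>v \<in> R.
        \<exists>z \<in> objs Z. \<exists>e \<in> arrs Y. src Y e = fob F z \<and> tgt Y e = y \<and> parr Y e = u \<cdot>\<^bsub>X\<^esub> v"
      using R by blast
  qed
qed

text \<open>
  The preimages \<^term>\<open>dob f\<close> of the pullbacks of \<^term>\<open>y\<close> come with arrows \<open>e f\<close> over \<open>f\<close> into
  \<^term>\<open>y\<close> itself; full faithfulness over \<open>e\<close> turns them into a descent datum.
\<close>

lemma essentially_surjective:
  assumes y: "y \<in> objs Y"
  obtains z \<epsilon> where "z \<in> objs Z" "\<epsilon> \<in> arrs Y" "src Y \<epsilon> = fob F z" "tgt Y \<epsilon> = y"
    "parr Y \<epsilon> = idt X (pobj Y y)"
proof -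
  let ?U = "pobj Y y"
  have U: "?U \<in> objs X"
    using y by simp
  obtain S where S: "S \<in> cov X ?U" and loc: "\<And>u. u \<in> S \<Longrightarrow>
      \<exists>z \<in> objs Z. \<exists>e \<in> arrs Y. src Y e = fob F z \<and> tgt Y e = y \<and> parr Y e = u"
    using locally_in_image[OF y] by blast
  let ?R = "sieve X S"
  note sieve = Z.sieve_arrs[OF U S]
  \<comment> \<open>The choice is extended from the cover to its sieve, because descent data live on
    sieves.\<close>
  have "\<exists>z e. z \<in> objs Z \<and> e \<in> arrs Y \<and> src Y e = fob F z \<and> tgt Y e = y \<and> parr Y e = f"
    if f: "f \<in> ?R" for f
  proof -
    obtain u q where u: "u \<in> S" "q \<in> arrs X" "tgt X q = src X u" "f = u \<cdot>\<^bsub>X\<^esub> q"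
      using f by (auto simp: sieve_def)
    obtain z e where z: "z \<in> objs Z" "e \<in> arrs Y" "src Y e = fob F z" "tgt Y e = y" "parr Y e = u"
      using loc[OF u(1)] by blast
    have g: "q \<in> arrs X" "z \<in> objs Z" "tgt X q = pobj Z z"
      using u z Y.src_parr[of e] by simp_all
    obtain r where r: "r \<in> arrs Z" "tgt Z r = z" "parr Z r = q"
      by (rule Z.pullback[OF g])
    then show ?thesis
      using z u by (intro exI[of _ "src Z r"] exI[of _ "e \<cdot>\<^bsub>Y\<^esub> far F r"]) simp
  qed
  then obtain dob e where "\<And>f. f \<in> ?R \<Longrightarrow> dob f \<in> objs Z \<and> e f \<in> arrs Y \<and> src Y (e f) = fob F (dob f)
      \<and> tgt Y (e f) = y \<and> parr Y (e f) = f"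
    by metis
  then have dob: "\<And>f. f \<in> ?R \<Longrightarrow> dob f \<in> objs Z" and e: "\<And>f. f \<in> ?R \<Longrightarrow> e f \<in> arrs Y"
      "\<And>f. f \<in> ?R \<Longrightarrow> src Y (e f) = fob F (dob f)" "\<And>f. f \<in> ?R \<Longrightarrow> tgt Y (e f) = y"
      "\<And>f. f \<in> ?R \<Longrightarrow> parr Y (e f) = f"
    by auto
  have pobj_dob: "pobj Z (dob f) = src X f" if "f \<in> ?R" for f
    using Y.src_parr[OF e(1)[OF that]] e dob that by simp
  note fg = Z.sieve_cmp[OF U S]
  have "\<exists>d. d \<in> arrs Z \<and> src Z d = dob (f \<cdot>\<^bsub>X\<^esub> g) \<and> tgt Z d = dob f \<and> parr Z d = g \<and>
      e f \<cdot>\<^bsub>Y\<^esub> far F d = e (f \<cdot>\<^bsub>X\<^esub> g)" if f: "f \<in> ?R" and g: "g \<in> arrs X" "tgt X g = src X f" for f g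
  proof -
    note h = fg[OF f g]
    have 1: "e (f \<cdot>\<^bsub>X\<^esub> g) \<in> arrs Y" "e f \<in> arrs Y" "tgt Y (e (f \<cdot>\<^bsub>X\<^esub> g)) = tgt Y (e f)" "g \<in> arrs X"
        "src X g = pobj Y (src Y (e (f \<cdot>\<^bsub>X\<^esub> g)))" "tgt X g = pobj Y (src Y (e f))"
        "parr Y (e f) \<cdot>\<^bsub>X\<^esub> g = parr Y (e (f \<cdot>\<^bsub>X\<^esub> g))"
      using e f g h dob pobj_dob sieve[OF f] by simp_all
    obtain c where c: "c \<in> arrs Y" "src Y c = src Y (e (f \<cdot>\<^bsub>X\<^esub> g))" "tgt Y c = src Y (e f)"
        "parr Y c = g" "e f \<cdot>\<^bsub>Y\<^esub> c = e (f \<cdot>\<^bsub>X\<^esub> g)"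
      by (rule Y.factor[OF 1])
    have 2: "dob (f \<cdot>\<^bsub>X\<^esub> g) \<in> objs Z" "dob f \<in> objs Z" "c \<in> arrs Y" "src Y c = fob F (dob (f \<cdot>\<^bsub>X\<^esub> g))"
        "tgt Y c = fob F (dob f)"
      using c e dob f h by simp_all
    obtain d where d: "d \<in> arrs Z" "src Z d = dob (f \<cdot>\<^bsub>X\<^esub> g)" "tgt Z d = dob f" "far F d = c"
      by (rule full[OF 2])
    then show ?thesis
      using c parr_far[OF d(1)] by auto
  qed
  then obtain dar where "\<And>f g. \<lbrakk>f \<in> ?R; g \<in> arrs X; tgt X g = src X f\<rbrakk> \<Longrightarrow>
      dar f g \<in> arrs Z \<and> src Z (dar f g) = dob (f \<cdot>\<^bsub>X\<^esub> g) \<and> tgt Z (dar f g) = dob f \<and>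
      parr Z (dar f g) = g \<and> e f \<cdot>\<^bsub>Y\<^esub> far F (dar f g) = e (f \<cdot>\<^bsub>X\<^esub> g)"
    by metis
  then have dar: "dar f g \<in> arrs Z" "src Z (dar f g) = dob (f \<cdot>\<^bsub>X\<^esub> g)" "tgt Z (dar f g) = dob f"
      "parr Z (dar f g) = g" "e f \<cdot>\<^bsub>Y\<^esub> far F (dar f g) = e (f \<cdot>\<^bsub>X\<^esub> g)"
    if "f \<in> ?R" "g \<in> arrs X" "tgt X g = src X f" for f g
    using that by auto
  \<comment> \<open>Identities between the transitions may be tested after applying F and composing
    with \<open>e f\<close>; functoriality then reduces to their defining equation.\<close>
  have dar_unique: "d = d'" if f: "f \<in> ?R" and d: "d \<in> arrs Z" "tgt Z d = dob f" "d' \<in> arrs Z"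
      "tgt Z d' = dob f" "src Z d' = src Z d" "parr Z d' = parr Z d" "e f \<cdot>\<^bsub>Y\<^esub> far F d = e f \<cdot>\<^bsub>Y\<^esub> far F d'"
    for f d d'
  proof -
    have "far F d = far F d'"
      by (rule Y.cancel_left[OF d(7)]) (use d f e in simp_all)
    then show ?thesis
      using faithful[OF d(1) refl d(2) d(3,5,4)] by simp
  qed
  have "descent_datum X Z ?R dob dar"
    unfolding descent_datum_def
  proof (intro ballI conjI impI)
    fix f assume f: "f \<in> ?R"
    show "dob f \<in> objs_over Z (src X f)"
      using dob pobj_dob f by (simp add: objs_over_iff)
    show "dar f (idt X (src X f)) = idt Z (dob f)"
      by (rule dar_unique[OF f])
        (use f sieve[OF f] dob e pobj_dob dar[OF f, of "idt X (src X f)"] in simp_all)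
    fix g assume g: "g \<in> arrs X" "tgt X g = src X f"
    show "dar f g \<in> arrows_over Z g (dob (f \<cdot>\<^bsub>X\<^esub> g)) (dob f)"
      using dar[OF f g] by (simp add: arrows_over_iff)
    fix h assume h: "h \<in> arrs X" "tgt X h = src X g"
    have h': "tgt X h = src X (f \<cdot>\<^bsub>X\<^esub> g)" and gh: "g \<cdot>\<^bsub>X\<^esub> h \<in> arrs X" "tgt X (g \<cdot>\<^bsub>X\<^esub> h) = src X f"
      and fgh: "(f \<cdot>\<^bsub>X\<^esub> g) \<cdot>\<^bsub>X\<^esub> h = f \<cdot>\<^bsub>X\<^esub> (g \<cdot>\<^bsub>X\<^esub> h)"
      using g h sieve[OF f] by simp_all
    note d = dar[OF f g] dar[OF fg[OF f g] h(1) h', unfolded fgh] dar[OF f gh]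
    have "e f \<cdot>\<^bsub>Y\<^esub> far F (dar f g \<cdot>\<^bsub>Z\<^esub> dar (f \<cdot>\<^bsub>X\<^esub> g) h) = (e f \<cdot>\<^bsub>Y\<^esub> far F (dar f g)) \<cdot>\<^bsub>Y\<^esub> far F (dar (f \<cdot>\<^bsub>X\<^esub> g) h)"
      using d(1-4,6-9) e f dob by simp
    also have "\<dots> = e f \<cdot>\<^bsub>Y\<^esub> far F (dar f (g \<cdot>\<^bsub>X\<^esub> h))"
      using d(5,10,15) by simp
    finally show "dar f (g \<cdot>\<^bsub>X\<^esub> h) = dar f g \<cdot>\<^bsub>Z\<^esub> dar (f \<cdot>\<^bsub>X\<^esub> g) h"
      by (intro dar_unique[OF f]) (use d in simp_all)
  qed
  from Z.objects_glue[OF U S this]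
  obtain z k where z: "z \<in> objs Z" "pobj Z z = ?U"
    and k0: "\<forall>f \<in> ?R. k f \<in> arrows_over Z f (dob f) z \<and>
      (\<forall>g \<in> arrs X. tgt X g = src X f \<longrightarrow> k f \<cdot>\<^bsub>Z\<^esub> dar f g = k (f \<cdot>\<^bsub>X\<^esub> g))"
    by (auto simp: effective_def objs_over_iff)
  have k: "k f \<in> arrs Z" "src Z (k f) = dob f" "tgt Z (k f) = z" "parr Z (k f) = f" if "f \<in> ?R" for f
    using k0 that by (auto simp: arrows_over_iff)
  have k_dar: "far F (k f) \<cdot>\<^bsub>Y\<^esub> far F (dar f g) = far F (k (f \<cdot>\<^bsub>X\<^esub> g))"
    if "f \<in> ?R" "g \<in> arrs X" "tgt X g = src X f" for f g
    using k0 that k dar by (simp flip: far_cmp)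
  have 1: "fob F z \<in> objs Y" "pobj Y (fob F z) = ?U"
    using z by simp_all
  \<comment> \<open>The images of the legs \<open>k f\<close> present \<open>fob F z\<close> as
    glued, and the arrows \<open>e f\<close> into y start at the same objects and respect the same
    transitions, so they induce the comparison arrow.\<close>
  obtain \<epsilon> where "\<epsilon> \<in> arrs Y" "src Y \<epsilon> = fob F z" "tgt Y \<epsilon> = y" "parr Y \<epsilon> = idt X ?U"
    by (rule Y.arrow_glue_descent[OF U S 1 y refl, of "\<lambda>f. far F (k f)" "\<lambda>f g. far F (dar f g)" e])
      (use k k_dar dar e in simp_all)
  then show ?thesis
    by (rule that[OF z(1)])
qed

text \<open>Chosen preimages give H on objects, with \<epsilon> y from F (H y) to y. Factoring a
  preceded by \<epsilon> through \<epsilon> and lifting the factor gives H on arrows, so \<epsilon>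
  is natural by construction. The other 2-isomorphism is obtained by lifting \<epsilon> at F z along
  F.\<close>

theorem inverse_exists:
  "\<exists>H. gerbe_morphism Y Z H \<and> two_isomorphic X Z Z (H \<odot> F) identity_functor \<and>
    two_isomorphic X Y Y (F \<odot> H) identity_functor"
proof -
  have "\<exists>z \<epsilon>. z \<in> objs Z \<and> \<epsilon> \<in> arrs Y \<and> src Y \<epsilon> = fob F z \<and> tgt Y \<epsilon> = y \<and> parr Y \<epsilon> = idt X (pobj Y y)"
    if "y \<in> objs Y" for y
    using essentially_surjective[OF that] by metis
  then obtain ob \<epsilon> where "\<And>y. y \<in> objs Y \<Longrightarrow> ob y \<in> objs Z \<and> \<epsilon> y \<in> arrs Y \<and> src Y (\<epsilon> y) = fob F (ob y) \<and>
      tgt Y (\<epsilon> y) = y \<and> parr Y (\<epsilon> y) = idt X (pobj Y y)"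
    by metis
  then have ob: "\<And>y. y \<in> objs Y \<Longrightarrow> ob y \<in> objs Z" and \<epsilon>: "\<And>y. y \<in> objs Y \<Longrightarrow> \<epsilon> y \<in> arrs Y"
      "\<And>y. y \<in> objs Y \<Longrightarrow> src Y (\<epsilon> y) = fob F (ob y)" "\<And>y. y \<in> objs Y \<Longrightarrow> tgt Y (\<epsilon> y) = y"
      "\<And>y. y \<in> objs Y \<Longrightarrow> parr Y (\<epsilon> y) = idt X (pobj Y y)"
    by auto
  have pobj_ob: "pobj Z (ob y) = pobj Y y" if "y \<in> objs Y" for y
    using Y.src_parr[OF \<epsilon>(1)[OF that]] \<epsilon> ob that by simp
  have transport: "\<exists>c. c \<in> arrs Z \<and> src Z c = x \<and> tgt Z c = ob (tgt Y a) \<and> parr Z c = parr Y a \<and>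
      \<epsilon> (tgt Y a) \<cdot>\<^bsub>Y\<^esub> far F c = a" if a: "a \<in> arrs Y" "src Y a = fob F x" and x: "x \<in> objs Z" for a x
  proof -
    note t = Y.Y.tgt_objs[OF a(1)]
    have 1: "a \<in> arrs Y" "\<epsilon> (tgt Y a) \<in> arrs Y" "tgt Y a = tgt Y (\<epsilon> (tgt Y a))" "parr Y a \<in> arrs X"
        "src X (parr Y a) = pobj Y (src Y a)" "tgt X (parr Y a) = pobj Y (src Y (\<epsilon> (tgt Y a)))"
        "parr Y (\<epsilon> (tgt Y a)) \<cdot>\<^bsub>X\<^esub> parr Y a = parr Y a"
      using a t \<epsilon> ob pobj_ob by simp_all
    obtain d where d: "d \<in> arrs Y" "src Y d = src Y a" "tgt Y d = src Y (\<epsilon> (tgt Y a))"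
        "parr Y d = parr Y a" "\<epsilon> (tgt Y a) \<cdot>\<^bsub>Y\<^esub> d = a"
      by (rule Y.factor[OF 1])
    have 2: "x \<in> objs Z" "ob (tgt Y a) \<in> objs Z" "d \<in> arrs Y" "src Y d = fob F x" "tgt Y d = fob F (ob (tgt Y a))"
      using a x d t \<epsilon> ob by simp_all
    obtain c where c: "c \<in> arrs Z" "src Z c = x" "tgt Z c = ob (tgt Y a)" "far F c = d"
      by (rule full[OF 2])
    then show ?thesis
      using d parr_far[OF c(1)] by auto
  qed
  \<comment> \<open>Application of F and composition with \<open>\<epsilon> y\<close> determine an
    arrow into \<open>ob y\<close> over a given base arrow, so preservation of identities and
    composites can be tested there.\<close>
  have transport_unique: "c = c'" if y: "y \<in> objs Y" and c: "c \<in> arrs Z" "tgt Z c = ob y" "c' \<in> arrs Z"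
      "tgt Z c' = ob y" "src Z c' = src Z c" "parr Z c' = parr Z c" "\<epsilon> y \<cdot>\<^bsub>Y\<^esub> far F c = \<epsilon> y \<cdot>\<^bsub>Y\<^esub> far F c'"
    for y c c'
  proof -
    have "far F c = far F c'"
      by (rule Y.cancel_left[OF c(7)]) (use c y \<epsilon> in simp_all)
    then show ?thesis
      using faithful[OF c(1) refl c(2) c(3,5,4)] by simp
  qed
  have "\<exists>c. c \<in> arrs Z \<and> src Z c = ob (src Y a) \<and> tgt Z c = ob (tgt Y a) \<and> parr Z c = parr Y a \<and>
      \<epsilon> (tgt Y a) \<cdot>\<^bsub>Y\<^esub> far F c = a \<cdot>\<^bsub>Y\<^esub> \<epsilon> (src Y a)" if a: "a \<in> arrs Y" for a
    using transport[of "a \<cdot>\<^bsub>Y\<^esub> \<epsilon> (src Y a)" "ob (src Y a)"] a \<epsilon> ob by simp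
  then obtain ar where "\<And>a. a \<in> arrs Y \<Longrightarrow> ar a \<in> arrs Z \<and> src Z (ar a) = ob (src Y a) \<and>
      tgt Z (ar a) = ob (tgt Y a) \<and> parr Z (ar a) = parr Y a \<and>
      \<epsilon> (tgt Y a) \<cdot>\<^bsub>Y\<^esub> far F (ar a) = a \<cdot>\<^bsub>Y\<^esub> \<epsilon> (src Y a)"
    by metis
  then have ar: "ar a \<in> arrs Z" "src Z (ar a) = ob (src Y a)" "tgt Z (ar a) = ob (tgt Y a)"
      "parr Z (ar a) = parr Y a" "\<epsilon> (tgt Y a) \<cdot>\<^bsub>Y\<^esub> far F (ar a) = a \<cdot>\<^bsub>Y\<^esub> \<epsilon> (src Y a)"
    if "a \<in> arrs Y" for a
    using that by auto
  let ?H = "\<lparr>fob = ob, far = ar\<rparr>"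
  have "gerbe_morphism Y Z ?H"
    unfolding gerbe_morphism_def
  proof (intro conjI ballI impI)
    fix x assume x: "x \<in> objs Y"
    then show "fob ?H x \<in> objs_over Z (pobj Y x)"
      using ob pobj_ob by (simp add: objs_over_iff)
    have "ar (idt Y x) = idt Z (ob x)"
      by (rule transport_unique[OF x]) (use x ob pobj_ob \<epsilon> ar[of "idt Y x"] in simp_all)
    then show "far ?H (idt Y x) = idt Z (fob ?H x)"
      by simp
  next
    fix a assume a: "a \<in> arrs Y"
    then show "far ?H a \<in> arrows_over Z (parr Y a) (fob ?H (src Y a)) (fob ?H (tgt Y a))"
      using ar by (simp add: arrows_over_iff)
    fix b assume b: "b \<in> arrs Y" "src Y b = tgt Y a"
    have ba: "b \<cdot>\<^bsub>Y\<^esub> a \<in> arrs Y" and tb: "tgt Y b \<in> objs Y" and objs: "tgt Y a \<in> objs Y" "src Y a \<in> objs Y"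
      using a b by simp_all
    have "\<epsilon> (tgt Y b) \<cdot>\<^bsub>Y\<^esub> far F (ar b \<cdot>\<^bsub>Z\<^esub> ar a) = (\<epsilon> (tgt Y b) \<cdot>\<^bsub>Y\<^esub> far F (ar b)) \<cdot>\<^bsub>Y\<^esub> far F (ar a)"
      using ar(1-4)[OF a] ar(1-4)[OF b(1)] b \<epsilon>(1-4)[OF tb] by simp
    also have "\<dots> = b \<cdot>\<^bsub>Y\<^esub> (\<epsilon> (tgt Y a) \<cdot>\<^bsub>Y\<^esub> far F (ar a))"
      using ar(1-4)[OF a] ar(5)[OF b(1)] b \<epsilon>(1-4)[OF objs(1)] ob[OF objs(1)] by simp
    also have "\<dots> = \<epsilon> (tgt Y b) \<cdot>\<^bsub>Y\<^esub> far F (ar (b \<cdot>\<^bsub>Y\<^esub> a))"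
      using ar(5)[OF a] ar(5)[OF ba] a b \<epsilon>(1-4)[OF objs(2)] by simp
    finally have "ar (b \<cdot>\<^bsub>Y\<^esub> a) = ar b \<cdot>\<^bsub>Z\<^esub> ar a"
      by (intro transport_unique[OF tb])
        (use ar(1-4)[OF a] ar(1-4)[OF b(1)] ar(1-4)[OF ba] a b in simp_all)
    then show "far ?H (b \<cdot>\<^bsub>Y\<^esub> a) = far ?H b \<cdot>\<^bsub>Z\<^esub> far ?H a"
      by simp
  qed
  moreover have "two_morphism X Y Y (F \<odot> ?H) identity_functor \<epsilon>"
    unfolding two_morphism_def identity_functor_def using \<epsilon> ar by (simp add: arrows_over_iff)
  moreover have "two_isomorphic X Z Z (?H \<odot> F) identity_functor"
  proof -
    have "\<exists>c. c \<in> arrs Z \<and> src Z c = ob (fob F z) \<and> tgt Z c = z \<and> far F c = \<epsilon> (fob F z)"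
      if z: "z \<in> objs Z" for z
    proof -
      have 1: "ob (fob F z) \<in> objs Z" "z \<in> objs Z" "\<epsilon> (fob F z) \<in> arrs Y"
          "src Y (\<epsilon> (fob F z)) = fob F (ob (fob F z))" "tgt Y (\<epsilon> (fob F z)) = fob F z"
        using z ob \<epsilon> by simp_all
      show ?thesis
        by (rule full[OF 1]) blast
    qed
    then obtain \<eta> where "\<And>z. z \<in> objs Z \<Longrightarrow> \<eta> z \<in> arrs Z \<and> src Z (\<eta> z) = ob (fob F z) \<and>
        tgt Z (\<eta> z) = z \<and> far F (\<eta> z) = \<epsilon> (fob F z)"
      by metis
    then have \<eta>: "\<eta> z \<in> arrs Z" "src Z (\<eta> z) = ob (fob F z)" "tgt Z (\<eta> z) = z" "far F (\<eta> z) = \<epsilon> (fob F z)"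
      if "z \<in> objs Z" for z
      using that by auto
    have "two_morphism X Z Z (?H \<odot> F) identity_functor \<eta>"
      unfolding two_morphism_def
    proof (intro conjI ballI)
      fix z assume z: "z \<in> objs Z"
      have "parr Z (\<eta> z) = idt X (pobj Z z)"
        using \<eta>[OF z] \<epsilon>(4)[of "fob F z"] z parr_far[of "\<eta> z"] by simp
      then show "\<eta> z \<in> arrows_over Z (idt X (pobj Z z)) (fob (?H \<odot> F) z) (fob identity_functor z)"
        using \<eta>[OF z] by (simp add: arrows_over_iff identity_functor_def)
    next
      fix a assume a: "a \<in> arrs Z"
      have objs: "tgt Z a \<in> objs Z" "src Z a \<in> objs Z" and Fa: "far F a \<in> arrs Y"
        using a by simp_all
      have "far F (\<eta> (tgt Z a) \<cdot>\<^bsub>Z\<^esub> ar (far F a)) = far F (a \<cdot>\<^bsub>Z\<^esub> \<eta> (src Z a))"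
        using a \<eta>[OF objs(1)] \<eta>[OF objs(2)] ar[OF Fa] by simp
      then have "\<eta> (tgt Z a) \<cdot>\<^bsub>Z\<^esub> ar (far F a) = a \<cdot>\<^bsub>Z\<^esub> \<eta> (src Z a)"
        using faithful[of "\<eta> (tgt Z a) \<cdot>\<^bsub>Z\<^esub> ar (far F a)" "ob (fob F (src Z a))" "tgt Z a" "a \<cdot>\<^bsub>Z\<^esub> \<eta> (src Z a)"]
          a \<eta>[OF objs(1)] \<eta>[OF objs(2)] ar[OF Fa] by simp
      then show "\<eta> (tgt Z a) \<cdot>\<^bsub>Z\<^esub> far (?H \<odot> F) a = far identity_functor a \<cdot>\<^bsub>Z\<^esub> \<eta> (src Z a)"
        by (simp add: identity_functor_def)
    qed
    then show ?thesis
      unfolding two_isomorphic_def by blast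
  qed
  ultimately show ?thesis
    unfolding two_isomorphic_def by blast
qed

end

section \<open>The gerbe of equivariant objects\<close>

definition underlying :: "('p, 'q, 'o, 'g) eq_obj \<Rightarrow> 'p" where
  "underlying z = fst (snd z)"

definition structure_arrow :: "('p, 'q, 'o, 'g) eq_obj \<Rightarrow> 'g \<Rightarrow> 'q" where
  "structure_arrow z = snd (snd z)"

definition underlying_arrow :: "('p, 'q, 'o, 'm, 'g) eq_arr \<Rightarrow> 'q" where
  "underlying_arrow a = fst (snd (snd a))"

context lifted_gerbe begin

abbreviation E :: "('p, 'q, 'o, 'm, 'g, 'a) eq_gerbe" where
  "E \<equiv> equivariant_objects X G Y F \<alpha>"

text \<open>The base component carries no information beyond the underlying arrow, so arrows of
  \<open>E\<close> are handled as equivariant arrows of \<open>Y\<close> with named ends.\<close>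

definition eq_arrow :: "('p, 'q, 'o, 'g) eq_obj \<Rightarrow> 'q \<Rightarrow> ('p, 'q, 'o, 'g) eq_obj \<Rightarrow> ('p, 'q, 'o, 'm, 'g) eq_arr" where
  "eq_arrow z l z' = (z, parr Y l, l, z')"

lemma eq_arrow_simps [simp]:
  "src E (eq_arrow z l z') = z" "tgt E (eq_arrow z l z') = z'" "parr E (eq_arrow z l z') = parr Y l"
  "underlying_arrow (eq_arrow z l z') = l"
  by (simp_all add: eq_arrow_def equivariant_objects_def underlying_arrow_def)

lemma eq_objs_iff: "z \<in> objs E \<longleftrightarrow> underlying z \<in> objs Y \<and> fst z = pobj Y (underlying z) \<and>
    structure_arrow z \<in> extensional (carrier G) \<and>
    (\<forall>g \<in> carrier G. structure_arrow z g \<in> arrs Y \<and> src Y (structure_arrow z g) = underlying z \<and>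
      tgt Y (structure_arrow z g) = fob (F g) (underlying z) \<and>
      parr Y (structure_arrow z g) = idt X (pobj Y (underlying z))) \<and>
    (\<forall>g \<in> carrier G. \<forall>h \<in> carrier G. \<alpha> g h (underlying z) \<cdot> structure_arrow z (g \<otimes>\<^bsub>G\<^esub> h)
      = far (F g) (structure_arrow z h) \<cdot> structure_arrow z g)"
  by (cases z) (auto simp: equivariant_objects_def eq_objs_def underlying_def structure_arrow_def
      objs_over_iff arrows_over_iff PiE_iff)

lemma eq_obj_simps [simp]:
  assumes "z \<in> objs E"
  shows "underlying z \<in> objs Y" "pobj E z = pobj Y (underlying z)"
    "g \<in> carrier G \<Longrightarrow> structure_arrow z g \<in> arrs Y"
    "g \<in> carrier G \<Longrightarrow> src Y (structure_arrow z g) = underlying z"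
    "g \<in> carrier G \<Longrightarrow> tgt Y (structure_arrow z g) = fob (F g) (underlying z)"
    "g \<in> carrier G \<Longrightarrow> parr Y (structure_arrow z g) = idt X (pobj Y (underlying z))"
  using assms by (auto simp: eq_objs_iff, cases z, simp add: equivariant_objects_def)

lemma eq_obj_cocycle:
  assumes "z \<in> objs E" "g \<in> carrier G" "h \<in> carrier G"
  shows "\<alpha> g h (underlying z) \<cdot> structure_arrow z (g \<otimes>\<^bsub>G\<^esub> h) = far (F g) (structure_arrow z h) \<cdot> structure_arrow z g"
proof -
  have "\<forall>g \<in> carrier G. \<forall>h \<in> carrier G. \<alpha> g h (underlying z) \<cdot> structure_arrow z (g \<otimes>\<^bsub>G\<^esub> h)
      = far (F g) (structure_arrow z h) \<cdot> structure_arrow z g"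
    using assms(1) unfolding eq_objs_iff by (elim conjE)
  from bspec[OF bspec[OF this assms(2)] assms(3)] show ?thesis .
qed

lemma eq_obj_eqI:
  assumes "z \<in> objs E" "z' \<in> objs E" "underlying z = underlying z'"
    "\<And>g. g \<in> carrier G \<Longrightarrow> structure_arrow z g = structure_arrow z' g"
  shows "z = z'"
proof -
  have "structure_arrow z = structure_arrow z'"
    using assms(1,2,4) unfolding eq_objs_iff by (elim conjE) (rule extensionalityI[of _ "carrier G"])
  moreover have "fst z = fst z'"
    using assms(1-3) unfolding eq_objs_iff by (elim conjE) simp
  ultimately show ?thesis
    using assms(3) by (simp add: underlying_def structure_arrow_def prod_eq_iff)
qed

lemma eq_arrs_iff: "a \<in> arrs E \<longleftrightarrow> src E a \<in> objs E \<and> tgt E a \<in> objs E \<and> underlying_arrow a \<in> arrs Y \<and>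
    src Y (underlying_arrow a) = underlying (src E a) \<and> tgt Y (underlying_arrow a) = underlying (tgt E a) \<and>
    parr E a = parr Y (underlying_arrow a) \<and>
    (\<forall>g \<in> carrier G. structure_arrow (tgt E a) g \<cdot> underlying_arrow a
      = far (F g) (underlying_arrow a) \<cdot> structure_arrow (src E a) g)" (is "_ \<longleftrightarrow> ?r")
proof -
  obtain U1 y1 \<psi>1 f l U2 y2 \<psi>2 where a: "a = ((U1, y1, \<psi>1), f, l, (U2, y2, \<psi>2))"
    by (metis prod.exhaust)
  have "f \<in> arrows X U1 U2" if "l \<in> arrs Y" "src Y l = y1" "tgt Y l = y2" "f = parr Y l"
      "U1 = pobj Y y1" "U2 = pobj Y y2"
    using that by (auto simp: arrows_def)
  then show ?thesis
    unfolding a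
    by (auto simp: equivariant_objects_def eq_arrs_def eq_objs_def underlying_def structure_arrow_def
        underlying_arrow_def objs_over_iff arrows_over_iff)
qed

lemma eq_arr_simps [simp]:
  assumes "a \<in> arrs E"
  shows "src E a \<in> objs E" "tgt E a \<in> objs E" "underlying_arrow a \<in> arrs Y"
    "src Y (underlying_arrow a) = underlying (src E a)" "tgt Y (underlying_arrow a) = underlying (tgt E a)"
    "parr E a = parr Y (underlying_arrow a)"
  using assms unfolding eq_arrs_iff by - (elim conjE, assumption)+

lemma eq_arr_equivariant:
  assumes "a \<in> arrs E" "src E a = z" "tgt E a = z'" "g \<in> carrier G"
  shows "structure_arrow z' g \<cdot> underlying_arrow a = far (F g) (underlying_arrow a) \<cdot> structure_arrow z g"
proof -
  have "\<forall>g \<in> carrier G. structure_arrow (tgt E a) g \<cdot> underlying_arrow a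
      = far (F g) (underlying_arrow a) \<cdot> structure_arrow (src E a) g"
    using assms(1) unfolding eq_arrs_iff by (elim conjE)
  from bspec[OF this assms(4)] show ?thesis
    by (simp only: assms(2,3))
qed

lemma eq_arr_eqI:
  assumes "a \<in> arrs E" "b \<in> arrs E" "src E a = src E b" "tgt E a = tgt E b" "underlying_arrow a = underlying_arrow b"
  shows "a = b"
proof -
  obtain z f l z' where a: "a = (z, f, l, z')" by (metis prod.exhaust)
  obtain w g k w' where b: "b = (w, g, k, w')" by (metis prod.exhaust)
  show ?thesis
    using assms eq_arr_simps(6)[OF assms(1)] eq_arr_simps(6)[OF assms(2)] unfolding a b
    by (simp add: equivariant_objects_def underlying_arrow_def)
qed

lemma eq_cmp_simps [simp]:
  "src E (b \<cdot>\<^bsub>E\<^esub> a) = src E a" "tgt E (b \<cdot>\<^bsub>E\<^esub> a) = tgt E b"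
  "underlying_arrow (b \<cdot>\<^bsub>E\<^esub> a) = underlying_arrow b \<cdot> underlying_arrow a"
  "parr E (b \<cdot>\<^bsub>E\<^esub> a) = parr E b \<cdot>\<^bsub>X\<^esub> parr E a"
  by (cases a; cases b; simp add: equivariant_objects_def underlying_arrow_def)+

lemma eq_idt_simps [simp]:
  "src E (idt E z) = z" "tgt E (idt E z) = z" "underlying_arrow (idt E z) = idt Y (underlying z)"
  "parr E (idt E z) = idt X (pobj E z)"
  by (cases z; simp add: equivariant_objects_def underlying_arrow_def underlying_def)+

lemma eq_band_simps [simp]:
  "src E (band E z a) = z" "tgt E (band E z a) = z" "underlying_arrow (band E z a) = band Y (underlying z) a"
  "parr E (band E z a) = idt X (pobj E z)"
  by (cases z; simp add: equivariant_objects_def underlying_arrow_def underlying_def)+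

lemma eq_cmp_arrs:
  assumes a: "a \<in> arrs E" and b: "b \<in> arrs E" and ab: "src E b = tgt E a"
  shows "b \<cdot>\<^bsub>E\<^esub> a \<in> arrs E"
proof -
  have "structure_arrow (tgt E b) g \<cdot> (underlying_arrow b \<cdot> underlying_arrow a)
      = far (F g) (underlying_arrow b \<cdot> underlying_arrow a) \<cdot> structure_arrow (src E a) g"
    if g: "g \<in> carrier G" for g
  proof -
    have "structure_arrow (tgt E b) g \<cdot> (underlying_arrow b \<cdot> underlying_arrow a)
        = (structure_arrow (tgt E b) g \<cdot> underlying_arrow b) \<cdot> underlying_arrow a"
      using a b ab g by simp
    also have "\<dots> = far (F g) (underlying_arrow b) \<cdot> (structure_arrow (tgt E a) g \<cdot> underlying_arrow a)"
      using a b ab g by (simp add: eq_arr_equivariant[OF b ab])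
    also have "\<dots> = far (F g) (underlying_arrow b \<cdot> underlying_arrow a) \<cdot> structure_arrow (src E a) g"
      using a b ab g by (simp add: eq_arr_equivariant[OF a])
    finally show ?thesis .
  qed
  then show ?thesis
    using a b ab by (subst eq_arrs_iff) simp
qed

lemma eq_idt_arrs: "z \<in> objs E \<Longrightarrow> idt E z \<in> arrs E"
  by (subst eq_arrs_iff) simp

lemma eq_category: "category E"
proof
  show "f \<in> arrs E \<Longrightarrow> src E f \<in> objs E \<and> tgt E f \<in> objs E" for f
    by simp
  show "idt E z \<in> arrows E z z" if "z \<in> objs E" for z
    using that by (simp add: arrows_def eq_idt_arrs)
  show "g \<cdot>\<^bsub>E\<^esub> f \<in> arrows E U W" if "f \<in> arrows E U V" "g \<in> arrows E V W" for f g U V W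
    using that eq_cmp_arrs[of f g] by (auto simp: arrows_def)
  show "idt E V \<cdot>\<^bsub>E\<^esub> f = f" if "f \<in> arrows E U V" for f U V
    using that eq_idt_arrs[of V] by (intro eq_arr_eqI eq_cmp_arrs) (auto simp: arrows_def)
  show "f \<cdot>\<^bsub>E\<^esub> idt E U = f" if "f \<in> arrows E U V" for f U V
    using that eq_idt_arrs[of U] by (intro eq_arr_eqI eq_cmp_arrs) (auto simp: arrows_def)
  show "(h \<cdot>\<^bsub>E\<^esub> g) \<cdot>\<^bsub>E\<^esub> f = h \<cdot>\<^bsub>E\<^esub> (g \<cdot>\<^bsub>E\<^esub> f)"
    if "f \<in> arrows E U V" "g \<in> arrows E V W" "h \<in> arrows E W Z" for f g h U V W Z
    using that by (intro eq_arr_eqI eq_cmp_arrs) (auto simp: arrows_def)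
qed

text \<open>Structure arrows pull back along p because \<open>far (F g) p\<close> is cartesian: the
  new arrow at g is the factor of \<open>structure_arrow z g \<cdot> p\<close> through it. With
  \<open>eq_pullback_unique\<close> this says that forgetting the structure is a discrete fibration
  over \<open>Y\<close>.\<close>

lemma eq_pullback:
  assumes z: "z \<in> objs E" and p: "p \<in> arrs Y" "tgt Y p = underlying z"
  obtains P where "P \<in> arrs E" "tgt E P = z" "underlying_arrow P = p"
proof -
  let ?w = "src Y p"
  have "\<exists>\<psi>. g \<in> carrier G \<longrightarrow> \<psi> \<in> arrs Y \<and> src Y \<psi> = ?w \<and> tgt Y \<psi> = fob (F g) ?w \<and>
      parr Y \<psi> = idt X (pobj Y ?w) \<and> far (F g) p \<cdot> \<psi> = structure_arrow z g \<cdot> p" for g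
  proof (cases "g \<in> carrier G")
    case True
    then have 1: "structure_arrow z g \<cdot> p \<in> arrs Y" "far (F g) p \<in> arrs Y"
        "tgt Y (structure_arrow z g \<cdot> p) = tgt Y (far (F g) p)"
        "parr Y (structure_arrow z g \<cdot> p) = parr Y (far (F g) p)"
      using z p by simp_all
    obtain c where "c \<in> arrs Y" "src Y c = src Y (structure_arrow z g \<cdot> p)" "tgt Y c = src Y (far (F g) p)"
        "parr Y c = idt X (pobj Y (src Y (structure_arrow z g \<cdot> p)))" "far (F g) p \<cdot> c = structure_arrow z g \<cdot> p"
      by (rule factor_vertical[OF 1])
    then show ?thesis
      using True z p by (intro exI[of _ c]) simp
  qed simp
  then obtain \<psi> where \<psi>: "\<And>g. g \<in> carrier G \<Longrightarrow> \<psi> g \<in> arrs Y" "\<And>g. g \<in> carrier G \<Longrightarrow> src Y (\<psi> g) = ?w"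
      "\<And>g. g \<in> carrier G \<Longrightarrow> tgt Y (\<psi> g) = fob (F g) ?w"
      "\<And>g. g \<in> carrier G \<Longrightarrow> parr Y (\<psi> g) = idt X (pobj Y ?w)"
      "\<And>g. g \<in> carrier G \<Longrightarrow> far (F g) p \<cdot> \<psi> g = structure_arrow z g \<cdot> p"
    by metis
  let ?z = "(pobj Y ?w, ?w, restrict \<psi> (carrier G))"
  have zs: "underlying ?z = ?w" "structure_arrow ?z = restrict \<psi> (carrier G)" "fst ?z = pobj Y ?w"
    by (simp_all add: underlying_def structure_arrow_def)
  \<comment> \<open>Naturality of \<alpha> along p and the condition at z give equality after
    composition with the image of p under F_h and then F_g, which can be cancelled.\<close>
  have "\<alpha> g h ?w \<cdot> \<psi> (g \<otimes>\<^bsub>G\<^esub> h) = far (F g) (\<psi> h) \<cdot> \<psi> g" if gh: "g \<in> carrier G" "h \<in> carrier G" for g h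
  proof (rule cancel_left[of "far (F g) (far (F h) p)"])
    have "far (F g) (far (F h) p) \<cdot> (\<alpha> g h ?w \<cdot> \<psi> (g \<otimes>\<^bsub>G\<^esub> h))
        = (\<alpha> g h (underlying z) \<cdot> far (F (g \<otimes>\<^bsub>G\<^esub> h)) p) \<cdot> \<psi> (g \<otimes>\<^bsub>G\<^esub> h)"
      using gh p \<psi> z by (simp add: connecting_natural[OF gh p(1) refl p(2)])
    also have "\<dots> = (\<alpha> g h (underlying z) \<cdot> structure_arrow z (g \<otimes>\<^bsub>G\<^esub> h)) \<cdot> p"
      using gh p \<psi> z by simp
    also have "\<dots> = far (F g) (structure_arrow z h) \<cdot> (far (F g) p \<cdot> \<psi> g)"
      using gh p \<psi> z by (simp add: eq_obj_cocycle)
    also have "\<dots> = far (F g) (far (F h) p \<cdot> \<psi> h) \<cdot> \<psi> g"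
      using gh p \<psi>(1-4) z by (simp add: \<psi>(5)[OF gh(2)] del: lift_simps(8)) (simp add: lift_simps)
    finally show "far (F g) (far (F h) p) \<cdot> (\<alpha> g h ?w \<cdot> \<psi> (g \<otimes>\<^bsub>G\<^esub> h))
        = far (F g) (far (F h) p) \<cdot> (far (F g) (\<psi> h) \<cdot> \<psi> g)"
      using gh p \<psi>(1-4) z by simp
  qed (use gh p \<psi>(1-4) in simp_all)
  then have z': "?z \<in> objs E"
    unfolding eq_objs_iff zs using p \<psi> by simp
  have "eq_arrow ?z p z \<in> arrs E"
    unfolding eq_arrs_iff using z z' p \<psi>(5) by (simp add: zs)
  then show ?thesis
    by (rule that) simp_all
qed

text \<open>The structure arrows at the source are forced, because the image of the underlying arrow
  under F_g can be cancelled from the equivariance equation.\<close>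

lemma eq_pullback_unique:
  assumes P: "P \<in> arrs E" "tgt E P = z" and Q: "Q \<in> arrs E" "tgt E Q = z"
    and eq: "underlying_arrow P = underlying_arrow Q"
  shows "P = Q"
proof (rule eq_arr_eqI[OF P(1) Q(1) _ _ eq])
  show "tgt E P = tgt E Q"
    using P Q by simp
  let ?p = "underlying_arrow P"
  have src: "underlying (src E P) = underlying (src E Q)"
    using eq_arr_simps(4)[OF P(1)] eq_arr_simps(4)[OF Q(1)] eq by simp
  show "src E P = src E Q"
  proof (rule eq_obj_eqI[OF _ _ src])
    fix g assume g: "g \<in> carrier G"
    show "structure_arrow (src E P) g = structure_arrow (src E Q) g"
    proof (rule cancel_left[of "far (F g) ?p"])
      show "far (F g) ?p \<cdot> structure_arrow (src E P) g = far (F g) ?p \<cdot> structure_arrow (src E Q) g"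
        using eq_arr_equivariant[OF P(1) refl P(2) g] eq_arr_equivariant[OF Q(1) refl Q(2) g] eq by simp
    qed (use g P Q src in simp_all)
  qed (use P Q in simp_all)
qed

lemma eq_fibred: "fibred_in_groupoids X E"
proof -
  interpret E: category E by (rule eq_category)
  show ?thesis
  proof unfold_locales
    show "pobj E z \<in> objs X" if "z \<in> objs E" for z
      using that by simp
    show "parr E a \<in> arrows X (pobj E x) (pobj E y)" if "a \<in> arrows E x y" for a x y
      using that by (auto simp: arrows_def)
    show "parr E (idt E x) = idt X (pobj E x)" for x
      by simp
    show "parr E (b \<cdot>\<^bsub>E\<^esub> a) = parr E b \<cdot>\<^bsub>X\<^esub> parr E a" for a b
      by simp
  next
    fix f U V z assume f: "f \<in> arrows X U V" and z: "z \<in> objs_over E V"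
    have 1: "f \<in> arrs X" "underlying z \<in> objs Y" "tgt X f = pobj Y (underlying z)" and z': "z \<in> objs E"
      using f z by (auto simp: arrows_def objs_over_iff)
    obtain p where p: "p \<in> arrs Y" "tgt Y p = underlying z" "parr Y p = f" "pobj Y (src Y p) = src X f"
      by (rule pullback[OF 1])
    obtain P where P: "P \<in> arrs E" "tgt E P = z" "underlying_arrow P = p"
      by (rule eq_pullback[OF z' p(1,2)])
    have "src E P \<in> objs_over E U"
      using P p f eq_arr_simps(4)[OF P(1)] by (auto simp: objs_over_iff arrows_def)
    moreover have "P \<in> arrows_over E f (src E P) z"
      using P p by (simp add: arrows_over_iff)
    ultimately show "\<exists>x \<in> objs_over E U. arrows_over E f x z \<noteq> {}"
      by blast
  next
    fix a x z b y f assume "a \<in> arrows E x z" "b \<in> arrows E y z" and f: "f \<in> arrows X (pobj E x) (pobj E y)"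
      and eq: "parr E b \<cdot>\<^bsub>X\<^esub> f = parr E a"
    then have a: "a \<in> arrs E" "src E a = x" "tgt E a = z" and b: "b \<in> arrs E" "src E b = y" "tgt E b = z"
      by (auto simp: arrows_def)
    have xy: "x \<in> objs E" "y \<in> objs E" "z \<in> objs E"
      using a b by auto
    let ?a = "underlying_arrow a" and ?b = "underlying_arrow b"
    have 1: "?a \<in> arrs Y" "?b \<in> arrs Y" "tgt Y ?a = tgt Y ?b" "f \<in> arrs X" "src X f = pobj Y (src Y ?a)"
        "tgt X f = pobj Y (src Y ?b)" "parr Y ?b \<cdot>\<^bsub>X\<^esub> f = parr Y ?a"
      using a b f eq xy by (auto simp: arrows_def)
    obtain c where c: "c \<in> arrs Y" "src Y c = src Y ?a" "tgt Y c = src Y ?b" "parr Y c = f" "?b \<cdot> c = ?a"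
      by (rule factor[OF 1])
    \<comment> \<open>The factor found in \<open>Y\<close> is automatically equivariant: a and b
      are, and \<open>far (F g) ?b\<close> can be cancelled.\<close>
    have "structure_arrow y g \<cdot> c = far (F g) c \<cdot> structure_arrow x g" if g: "g \<in> carrier G" for g
    proof (rule cancel_left[of "far (F g) ?b"])
      have "far (F g) ?b \<cdot> (structure_arrow y g \<cdot> c) = (structure_arrow z g \<cdot> ?b) \<cdot> c"
        using g a b c xy by (simp add: eq_arr_equivariant[OF b g])
      also have "\<dots> = structure_arrow z g \<cdot> ?a"
        using g a b c xy by simp
      also have "\<dots> = far (F g) (?b \<cdot> c) \<cdot> structure_arrow x g"
        using eq_arr_equivariant[OF a g] c(5) by simp
      finally show "far (F g) ?b \<cdot> (structure_arrow y g \<cdot> c) = far (F g) ?b \<cdot> (far (F g) c \<cdot> structure_arrow x g)"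
        using g a b c(1-4) xy by simp
    qed (use g a b c(1-4) 1(4-6) xy in simp_all)
    then have C: "eq_arrow x c y \<in> arrs E"
      unfolding eq_arrs_iff using a b c xy by simp
    show "\<exists>!c. c \<in> arrows_over E f x y \<and> b \<cdot>\<^bsub>E\<^esub> c = a"
    proof (rule ex1I[of _ "eq_arrow x c y"])
      have "b \<cdot>\<^bsub>E\<^esub> eq_arrow x c y = a"
        by (rule eq_arr_eqI) (use C a b c in \<open>auto intro!: eq_cmp_arrs\<close>)
      then show "eq_arrow x c y \<in> arrows_over E f x y \<and> b \<cdot>\<^bsub>E\<^esub> eq_arrow x c y = a"
        using C c by (simp add: arrows_over_iff)
    next
      fix d assume d: "d \<in> arrows_over E f x y \<and> b \<cdot>\<^bsub>E\<^esub> d = a"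
      then have d': "d \<in> arrs E" "src E d = x" "tgt E d = y" "parr E d = f" "?b \<cdot> underlying_arrow d = ?a"
        by (auto simp: arrows_over_iff)
      have "underlying_arrow d = c"
        by (rule cancel_left[of ?b]) (use d' c a b in \<open>auto\<close>)
      then show "d = eq_arrow x c y"
        using d' C by (intro eq_arr_eqI) auto
    qed
  qed
qed

section \<open>Descent for equivariant objects and their arrows\<close>

lemma eq_arrow_separation:
  assumes U: "U \<in> objs X" and S: "S \<in> cov X U"
    and t: "t \<in> arrs E" "parr E t = idt X U" and t': "t' \<in> arrs E" "src E t' = src E t" "tgt E t' = tgt E t"
      "parr E t' = idt X U"
    and eq: "\<And>P. \<lbrakk>P \<in> arrs E; tgt E P = src E t; parr E P \<in> S\<rbrakk> \<Longrightarrow> t \<cdot>\<^bsub>E\<^esub> P = t' \<cdot>\<^bsub>E\<^esub> P"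
  shows "t = t'"
proof (rule eq_arr_eqI[OF t(1) t'(1) t'(2,3)[symmetric]])
  let ?x = "src E t"
  have x: "?x \<in> objs E" "underlying ?x \<in> objs Y"
    using t by simp_all
  have pobj: "pobj Y (underlying ?x) = U"
    using t U src_parr[of "underlying_arrow t"] by simp
  show "underlying_arrow t = underlying_arrow t'"
  proof (rule arrow_separation[OF U S])
    fix u assume u: "u \<in> S"
    have 1: "u \<in> arrs X" "underlying ?x \<in> objs Y" "tgt X u = pobj Y (underlying ?x)"
      using cov_arrs[OF U S u] x pobj by simp_all
    obtain p where p: "p \<in> arrs Y" "tgt Y p = underlying ?x" "parr Y p = u"
      by (rule pullback[OF 1])
    obtain P where P: "P \<in> arrs E" "tgt E P = ?x" "underlying_arrow P = p"
      by (rule eq_pullback[OF x(1) p(1,2)])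
    have "underlying_arrow (t \<cdot>\<^bsub>E\<^esub> P) = underlying_arrow (t' \<cdot>\<^bsub>E\<^esub> P)"
      using eq[OF P(1,2)] P p u by simp
    then show "\<exists>p \<in> arrs Y. tgt Y p = src Y (underlying_arrow t) \<and> parr Y p = u \<and>
        underlying_arrow t \<cdot> p = underlying_arrow t' \<cdot> p"
      using P p t by (intro bexI[of _ p]) simp_all
  qed (use t t' in simp_all)
qed

text \<open>The underlying arrows are glued in \<open>Y\<close>, and equivariance of the result is
  checked on the cover. The given family is indexed by arrows of \<open>E\<close>, gluing in
  \<open>Y\<close> by arrows of \<open>Y\<close>; unique lifting of the latter translates between
  the two.\<close>

lemma eq_morphisms_glue:
  assumes U: "U \<in> objs X" and S: "S \<in> cov X U" and x: "x \<in> objs_over E U" and y: "y \<in> objs_over E U"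
    and a: "compatible_morphisms E (sieve X S) x y a"
  shows "\<exists>!t. t \<in> arrows_over E (idt X U) x y \<and>
    (\<forall>p \<in> arrs E. tgt E p = x \<and> parr E p \<in> sieve X S \<longrightarrow> t \<cdot>\<^bsub>E\<^esub> p = a p)"
proof -
  interpret E: fibred_in_groupoids X E by (rule eq_fibred)
  have x': "x \<in> objs E" "underlying x \<in> objs Y" "pobj Y (underlying x) = U"
    and y': "y \<in> objs E" "underlying y \<in> objs Y" "pobj Y (underlying y) = U"
    using x y by (auto simp: objs_over_iff)
  let ?R = "sieve X S"
  have a1: "a P \<in> arrs E" "src E (a P) = src E P" "tgt E (a P) = y"
      "parr Y (underlying_arrow (a P)) = parr Y (underlying_arrow P)"
    if P: "P \<in> arrs E" "tgt E P = x" "parr E P \<in> ?R" for P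
  proof -
    have "a P \<in> arrows_over E (parr E P) (src E P) y"
      using a P unfolding compatible_morphisms_def by blast
    then have "a P \<in> arrs E \<and> src E (a P) = src E P \<and> tgt E (a P) = y \<and> parr E (a P) = parr E P"
      by (simp add: arrows_over_iff)
    then show "a P \<in> arrs E" "src E (a P) = src E P" "tgt E (a P) = y"
      "parr Y (underlying_arrow (a P)) = parr Y (underlying_arrow P)"
      using P eq_arr_simps(6)[of "a P"] eq_arr_simps(6)[of P] by simp_all
  qed
  have a2: "a (P \<cdot>\<^bsub>E\<^esub> Q) = a P \<cdot>\<^bsub>E\<^esub> Q"
    if "P \<in> arrs E" "tgt E P = x" "parr E P \<in> ?R" "Q \<in> arrs E" "tgt E Q = src E P" for P Q
    using a that unfolding compatible_morphisms_def by blast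
  define Q where "Q p r \<longleftrightarrow> (\<exists>P \<in> arrs E. tgt E P = x \<and> underlying_arrow P = p \<and> underlying_arrow (a P) = r)"
    for p r
  have lift: "\<exists>P \<in> arrs E. tgt E P = x \<and> underlying_arrow P = p" if "p \<in> arrs Y" "tgt Y p = underlying x" for p
    by (rule eq_pullback[OF x'(1) that]) blast
  have ex: "\<exists>p \<in> arrs Y. \<exists>r \<in> arrs Y. tgt Y p = underlying x \<and> parr Y p = u \<and> src Y r = src Y p \<and>
      tgt Y r = underlying y \<and> parr Y r = u \<and> Q p r" if u: "u \<in> S" for u
  proof -
    have 1: "u \<in> arrs X" "underlying x \<in> objs Y" "tgt X u = pobj Y (underlying x)"
      using cov_arrs[OF U S u] x' by simp_all
    obtain p where p: "p \<in> arrs Y" "tgt Y p = underlying x" "parr Y p = u"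
      by (rule pullback[OF 1])
    obtain P where P: "P \<in> arrs E" "tgt E P = x" "underlying_arrow P = p"
      using lift[OF p(1,2)] by blast
    have R: "parr E P \<in> ?R"
      using P p cov_in_sieve[OF U S u] by simp
    note aP = a1[OF P(1,2) R]
    have "Q p (underlying_arrow (a P))"
      using P unfolding Q_def by blast
    moreover have "src Y (underlying_arrow (a P)) = src Y p"
      using aP P eq_arr_simps(4)[OF aP(1)] eq_arr_simps(4)[OF P(1)] by simp
    ultimately show ?thesis
      using p aP(1,3,4) P by - (rule bexI[of _ p], rule bexI[of _ "underlying_arrow (a P)"], simp_all)
  qed
  have stable: "Q (p \<cdot> q) (r \<cdot> q)"
    if p: "parr Y p \<in> ?R" and q: "q \<in> arrs Y" "tgt Y q = src Y p" and Q: "Q p r" for p q r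
  proof -
    obtain P where P: "P \<in> arrs E" "tgt E P = x" "underlying_arrow P = p" "underlying_arrow (a P) = r"
      using Q unfolding Q_def by blast
    have 1: "src E P \<in> objs E" "tgt Y q = underlying (src E P)"
      using q P eq_arr_simps(4)[OF P(1)] by simp_all
    obtain q' where q': "q' \<in> arrs E" "tgt E q' = src E P" "underlying_arrow q' = q"
      by (rule eq_pullback[OF 1(1) q(1) 1(2)])
    have "parr E P \<in> ?R"
      using p P by simp
    then show ?thesis
      unfolding Q_def using a2[OF P(1,2) _ q'(1,2)] P q' eq_cmp_arrs[OF q'(1) P(1) q'(2)[symmetric]]
      by (intro bexI[of _ "P \<cdot>\<^bsub>E\<^esub> q'"]) simp_all
  qed
  have unique: "r = r'" if "Q p r" "Q p r'" for p r r'
    using that eq_pullback_unique unfolding Q_def by metis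
  obtain t where t: "t \<in> arrs Y" "src Y t = underlying x" "tgt Y t = underlying y" "parr Y t = idt X U"
      and Qt: "\<And>p. \<lbrakk>p \<in> arrs Y; tgt Y p = underlying x; parr Y p \<in> ?R\<rbrakk> \<Longrightarrow> Q p (t \<cdot> p)"
    by (rule arrow_glue[OF U S x'(2,3) y'(2,3), of Q, OF ex stable unique]) (assumption+, rule that)
  have t_a: "t \<cdot> underlying_arrow P = underlying_arrow (a P)"
    if P: "P \<in> arrs E" "tgt E P = x" "parr E P \<in> ?R" for P
  proof -
    have "Q (underlying_arrow P) (t \<cdot> underlying_arrow P)"
      using Qt P by simp
    moreover have "Q (underlying_arrow P) (underlying_arrow (a P))"
      using P unfolding Q_def by blast
    ultimately show ?thesis
      by (rule unique)
  qed
  have "structure_arrow y g \<cdot> t = far (F g) t \<cdot> structure_arrow x g" if g: "g \<in> carrier G" for g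
  proof (rule arrow_separation[OF U S])
    fix u assume u: "u \<in> S"
    have 1: "u \<in> arrs X" "underlying x \<in> objs Y" "tgt X u = pobj Y (underlying x)"
      using cov_arrs[OF U S u] x' by simp_all
    obtain p where p: "p \<in> arrs Y" "tgt Y p = underlying x" "parr Y p = u"
      by (rule pullback[OF 1])
    obtain P where P: "P \<in> arrs E" "tgt E P = x" "underlying_arrow P = p"
      using lift[OF p(1,2)] by blast
    have R: "parr E P \<in> ?R"
      using P p cov_in_sieve[OF U S u] by simp
    note aP = a1[OF P(1,2) R] and tP = t_a[OF P(1,2) R]
    let ?z = "src E P"
    have z: "?z \<in> objs E" "underlying ?z = src Y p"
      using P eq_arr_simps(4)[OF P(1)] by simp_all
    have "(structure_arrow y g \<cdot> t) \<cdot> p = structure_arrow y g \<cdot> underlying_arrow (a P)"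
      using tP P g t x' y' p by simp
    also have "\<dots> = far (F g) (underlying_arrow (a P)) \<cdot> structure_arrow ?z g"
      by (rule eq_arr_equivariant[OF aP(1-3) g])
    also have "\<dots> = far (F g) t \<cdot> (far (F g) p \<cdot> structure_arrow ?z g)"
      using P g t p z by (simp flip: tP)
    also have "far (F g) p \<cdot> structure_arrow ?z g = structure_arrow x g \<cdot> p"
      using eq_arr_equivariant[OF P(1) refl P(2) g] P by simp
    also have "far (F g) t \<cdot> \<dots> = (far (F g) t \<cdot> structure_arrow x g) \<cdot> p"
      using g t x' y' p by simp
    finally show "\<exists>p \<in> arrs Y. tgt Y p = src Y (structure_arrow y g \<cdot> t) \<and> parr Y p = u \<and>
        (structure_arrow y g \<cdot> t) \<cdot> p = (far (F g) t \<cdot> structure_arrow x g) \<cdot> p"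
      using p g t x' y' by (intro bexI[of _ p]) simp_all
  qed (use g t x' y' U in simp_all)
  then have T: "eq_arrow x t y \<in> arrs E"
    unfolding eq_arrs_iff using x' y' t by simp
  show ?thesis
  proof (rule ex1I[of _ "eq_arrow x t y"])
    have "eq_arrow x t y \<cdot>\<^bsub>E\<^esub> P = a P" if P: "P \<in> arrs E" "tgt E P = x" "parr E P \<in> ?R" for P
      by (rule eq_arr_eqI) (use T P a1[OF P] t_a[OF P] in \<open>simp_all add: eq_cmp_arrs\<close>)
    then show "eq_arrow x t y \<in> arrows_over E (idt X U) x y \<and>
        (\<forall>p \<in> arrs E. tgt E p = x \<and> parr E p \<in> ?R \<longrightarrow> eq_arrow x t y \<cdot>\<^bsub>E\<^esub> p = a p)"
      using T t by (simp add: arrows_over_iff)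
    then have T_a: "eq_arrow x t y \<cdot>\<^bsub>E\<^esub> P = a P" if "P \<in> arrs E" "tgt E P = x" "parr E P \<in> ?R" for P
      using that by blast
    fix s assume "s \<in> arrows_over E (idt X U) x y \<and>
        (\<forall>p \<in> arrs E. tgt E p = x \<and> parr E p \<in> ?R \<longrightarrow> s \<cdot>\<^bsub>E\<^esub> p = a p)"
    then have s: "s \<in> arrs E" "src E s = x" "tgt E s = y" "parr E s = idt X U"
      and s_a: "\<And>P. \<lbrakk>P \<in> arrs E; tgt E P = x; parr E P \<in> ?R\<rbrakk> \<Longrightarrow> s \<cdot>\<^bsub>E\<^esub> P = a P"
      unfolding arrows_over_iff by blast+
    show "s = eq_arrow x t y"
    proof (rule eq_arrow_separation[OF U S s(1,4) T])
      fix P assume P: "P \<in> arrs E" "tgt E P = src E s" "parr E P \<in> S"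
      show "s \<cdot>\<^bsub>E\<^esub> P = eq_arrow x t y \<cdot>\<^bsub>E\<^esub> P"
        using s_a[of P] T_a[of P] P s cov_in_sieve[OF U S P(3)] by metis
    qed (use s t in simp_all)
  qed
qed

text \<open>The underlying object is glued in \<open>Y\<close>. Its structure arrow at g is glued,
  as an arrow to its image under F_g, from those of the local objects; compatibility with \<alpha>
  holds because it holds locally.\<close>

lemma eq_objects_glue:
  assumes U: "U \<in> objs X" and S: "S \<in> cov X U" and d: "descent_datum X E (sieve X S) dob dar"
  shows "effective X E U (sieve X S) dob dar"
proof -
  interpret E: fibred_in_groupoids X E by (rule eq_fibred)
  let ?R = "sieve X S"
  note sieve = sieve_arrs[OF U S] and fg = sieve_cmp[OF U S]
  have dob: "dob f \<in> objs E" "pobj Y (underlying (dob f)) = src X f" if "f \<in> ?R" for f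
    using d that by (auto simp: descent_datum_def objs_over_iff)
  have dar0: "dar f g \<in> arrows_over E g (dob (f \<cdot>\<^bsub>X\<^esub> g)) (dob f)" if "f \<in> ?R" "g \<in> arrs X" "tgt X g = src X f" for f g
    using d that unfolding descent_datum_def by blast
  have dar: "dar f g \<in> arrs E" "src E (dar f g) = dob (f \<cdot>\<^bsub>X\<^esub> g)" "tgt E (dar f g) = dob f"
      "parr Y (underlying_arrow (dar f g)) = g" if fg: "f \<in> ?R" "g \<in> arrs X" "tgt X g = src X f" for f g
  proof -
    have 1: "dar f g \<in> arrs E \<and> src E (dar f g) = dob (f \<cdot>\<^bsub>X\<^esub> g) \<and> tgt E (dar f g) = dob f \<and> parr E (dar f g) = g"
      using dar0[OF fg] by (simp add: arrows_over_iff)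
    then show "dar f g \<in> arrs E" "src E (dar f g) = dob (f \<cdot>\<^bsub>X\<^esub> g)" "tgt E (dar f g) = dob f"
      by auto
    show "parr Y (underlying_arrow (dar f g)) = g"
      using 1 eq_arr_simps(6)[of "dar f g"] by simp
  qed
  let ?o = "\<lambda>f. underlying (dob f)" and ?d = "\<lambda>f g. underlying_arrow (dar f g)"
  have "descent_datum X Y ?R ?o ?d"
    unfolding descent_datum_def
  proof (intro ballI conjI impI)
    fix f assume f: "f \<in> ?R"
    show "?o f \<in> objs_over Y (src X f)"
      using dob[OF f] by (simp add: objs_over_iff)
    have "dar f (idt X (src X f)) = idt E (dob f)"
      using d f by (simp add: descent_datum_def)
    then show "?d f (idt X (src X f)) = idt Y (?o f)"
      by simp
    fix g assume g: "g \<in> arrs X" "tgt X g = src X f"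
    show "?d f g \<in> arrows_over Y g (?o (f \<cdot>\<^bsub>X\<^esub> g)) (?o f)"
      using dar[OF f g] by (simp add: arrows_over_iff)
    fix h assume h: "h \<in> arrs X" "tgt X h = src X g"
    have "dar f (g \<cdot>\<^bsub>X\<^esub> h) = dar f g \<cdot>\<^bsub>E\<^esub> dar (f \<cdot>\<^bsub>X\<^esub> g) h"
      using d f g h unfolding descent_datum_def by blast
    then show "?d f (g \<cdot>\<^bsub>X\<^esub> h) = ?d f g \<cdot> ?d (f \<cdot>\<^bsub>X\<^esub> g) h"
      by simp
  qed
  from objects_glue[OF U S this]
  obtain y k where y: "y \<in> objs Y" "pobj Y y = U" and k0: "\<forall>f \<in> ?R. k f \<in> arrows_over Y f (?o f) y \<and>
      (\<forall>g \<in> arrs X. tgt X g = src X f \<longrightarrow> k f \<cdot> ?d f g = k (f \<cdot>\<^bsub>X\<^esub> g))"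
    by (auto simp: effective_def objs_over_iff)
  have k: "k f \<in> arrs Y" "src Y (k f) = ?o f" "tgt Y (k f) = y" "parr Y (k f) = f" if "f \<in> ?R" for f
    using k0 that by (auto simp: arrows_over_iff)
  have kd: "k f \<cdot> ?d f g = k (f \<cdot>\<^bsub>X\<^esub> g)" if "f \<in> ?R" "g \<in> arrs X" "tgt X g = src X f" for f g
    using k0 that by blast
  have "\<exists>\<psi>. g \<in> carrier G \<longrightarrow> \<psi> \<in> arrs Y \<and> src Y \<psi> = y \<and> tgt Y \<psi> = fob (F g) y \<and> parr Y \<psi> = idt X U \<and>
      (\<forall>f \<in> ?R. \<psi> \<cdot> k f = far (F g) (k f) \<cdot> structure_arrow (dob f) g)" for g
  proof (cases "g \<in> carrier G")
    case g: True
    have 1: "fob (F g) y \<in> objs Y" "pobj Y (fob (F g) y) = U"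
      using g y by simp_all
    \<comment> \<open>The value that the structure arrow must take on the leg \<open>k f\<close> for
      that leg to become equivariant. These values respect the transitions because the transitions
      are equivariant.\<close>
    let ?r = "\<lambda>f. far (F g) (k f) \<cdot> structure_arrow (dob f) g"
    have rd: "?r f \<cdot> ?d f h = ?r (f \<cdot>\<^bsub>X\<^esub> h)"
      if f: "f \<in> ?R" and h: "h \<in> arrs X" "tgt X h = src X f" for f h
    proof -
      note d = dar[OF f h] and kf = k[OF f] and o = dob(1)[OF f] dob(1)[OF fg[OF f h]]
      have "?r f \<cdot> ?d f h = far (F g) (k f) \<cdot> (structure_arrow (dob f) g \<cdot> ?d f h)"
        using d kf o g by simp
      also have "\<dots> = far (F g) (k f \<cdot> ?d f h) \<cdot> structure_arrow (dob (f \<cdot>\<^bsub>X\<^esub> h)) g"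
        using d kf o g by (simp add: eq_arr_equivariant[OF d(1-3) g])
      finally show ?thesis
        by (simp only: kd[OF f h])
    qed
    obtain t where "t \<in> arrs Y" "src Y t = y" "tgt Y t = fob (F g) y" "parr Y t = idt X U"
        "\<And>f. f \<in> ?R \<Longrightarrow> t \<cdot> k f = ?r f"
    proof (rule arrow_glue_descent[OF U S y 1, of k ?d ?r])
      fix f assume f: "f \<in> ?R"
      note kf = k[OF f] and o = dob[OF f]
      show "k f \<in> arrs Y" "tgt Y (k f) = y" "parr Y (k f) = f"
        by (fact kf)+
      show "?r f \<in> arrs Y" "src Y (?r f) = src Y (k f)" "tgt Y (?r f) = fob (F g) y" "parr Y (?r f) = f"
        using kf o g sieve[OF f] by simp_all
      fix h assume h: "h \<in> arrs X" "tgt X h = src X f"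
      show "?d f h \<in> arrs Y" "tgt Y (?d f h) = src Y (k f)" "parr Y (?d f h) = h"
          "k f \<cdot> ?d f h = k (f \<cdot>\<^bsub>X\<^esub> h)" "?r f \<cdot> ?d f h = ?r (f \<cdot>\<^bsub>X\<^esub> h)"
        using dar[OF f h] kf kd[OF f h] rd[OF f h] by simp_all
    qed (rule that)
    then show ?thesis
      by blast
  qed simp
  then obtain \<psi> where \<psi>: "\<And>g. g \<in> carrier G \<Longrightarrow> \<psi> g \<in> arrs Y" "\<And>g. g \<in> carrier G \<Longrightarrow> src Y (\<psi> g) = y"
      "\<And>g. g \<in> carrier G \<Longrightarrow> tgt Y (\<psi> g) = fob (F g) y" "\<And>g. g \<in> carrier G \<Longrightarrow> parr Y (\<psi> g) = idt X U"
      and \<psi>k: "\<And>g f. \<lbrakk>g \<in> carrier G; f \<in> ?R\<rbrakk> \<Longrightarrow> \<psi> g \<cdot> k f = far (F g) (k f) \<cdot> structure_arrow (dob f) g"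
    by metis
  let ?z = "(U, y, restrict \<psi> (carrier G))"
  have zs: "underlying ?z = y" "structure_arrow ?z = restrict \<psi> (carrier G)" "fst ?z = U"
    by (simp_all add: underlying_def structure_arrow_def)
  have "\<alpha> g h y \<cdot> \<psi> (g \<otimes>\<^bsub>G\<^esub> h) = far (F g) (\<psi> h) \<cdot> \<psi> g" if gh: "g \<in> carrier G" "h \<in> carrier G" for g h
  proof (rule arrow_separation[OF U S])
    fix u assume "u \<in> S"
    then have u: "u \<in> ?R"
      by (rule cov_in_sieve[OF U S])
    note ku = k[OF u] and o = dob(1)[OF u]
    have gh': "g \<otimes>\<^bsub>G\<^esub> h \<in> carrier G"
      using gh by simp
    have "(\<alpha> g h y \<cdot> \<psi> (g \<otimes>\<^bsub>G\<^esub> h)) \<cdot> k u = \<alpha> g h y \<cdot> (\<psi> (g \<otimes>\<^bsub>G\<^esub> h) \<cdot> k u)"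
      using gh y \<psi> ku by simp
    also have "\<dots> = (\<alpha> g h y \<cdot> far (F (g \<otimes>\<^bsub>G\<^esub> h)) (k u)) \<cdot> structure_arrow (dob u) (g \<otimes>\<^bsub>G\<^esub> h)"
      using gh y ku o by (simp add: \<psi>k[OF gh' u])
    also have "\<dots> = far (F g) (far (F h) (k u)) \<cdot> (\<alpha> g h (?o u) \<cdot> structure_arrow (dob u) (g \<otimes>\<^bsub>G\<^esub> h))"
      using gh y ku o by (simp add: connecting_natural[OF gh ku(1-3)])
    also have "\<dots> = far (F g) (far (F h) (k u) \<cdot> structure_arrow (dob u) h) \<cdot> structure_arrow (dob u) g"
      using gh y ku o by (simp add: eq_obj_cocycle)
    also have "\<dots> = far (F g) (\<psi> h) \<cdot> (far (F g) (k u) \<cdot> structure_arrow (dob u) g)"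
      using gh y ku o \<psi> by (simp flip: \<psi>k[OF gh(2) u])
    also have "\<dots> = (far (F g) (\<psi> h) \<cdot> \<psi> g) \<cdot> k u"
      using gh y ku o \<psi> by (simp flip: \<psi>k[OF gh(1) u])
    finally show "\<exists>p \<in> arrs Y. tgt Y p = src Y (\<alpha> g h y \<cdot> \<psi> (g \<otimes>\<^bsub>G\<^esub> h)) \<and> parr Y p = u \<and>
        (\<alpha> g h y \<cdot> \<psi> (g \<otimes>\<^bsub>G\<^esub> h)) \<cdot> p = (far (F g) (\<psi> h) \<cdot> \<psi> g) \<cdot> p"
      using gh y ku \<psi> by (intro bexI[of _ "k u"]) simp_all
  qed (use gh y \<psi> U in simp_all)
  then have z: "?z \<in> objs E"
    unfolding eq_objs_iff zs using y \<psi> by simp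
  have K: "eq_arrow (dob f) (k f) ?z \<in> arrs E" if f: "f \<in> ?R" for f
    unfolding eq_arrs_iff using z dob[OF f] k[OF f] \<psi>k f by (simp add: zs)
  show ?thesis
    unfolding effective_def
  proof (rule bexI[of _ ?z], rule exI[of _ "\<lambda>f. eq_arrow (dob f) (k f) ?z"], intro ballI conjI impI)
    show "?z \<in> objs_over E U"
      using z y by (simp add: objs_over_iff zs)
    fix f assume f: "f \<in> ?R"
    show "eq_arrow (dob f) (k f) ?z \<in> arrows_over E f (dob f) ?z"
      using K[OF f] k[OF f] by (simp add: arrows_over_iff)
    fix g assume g: "g \<in> arrs X" "tgt X g = src X f"
    show "eq_arrow (dob f) (k f) ?z \<cdot>\<^bsub>E\<^esub> dar f g = eq_arrow (dob (f \<cdot>\<^bsub>X\<^esub> g)) (k (f \<cdot>\<^bsub>X\<^esub> g)) ?z"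
      by (rule eq_arr_eqI) (use dar[OF f g] K[OF f] K[OF fg[OF f g]] kd[OF f g] in \<open>simp_all add: eq_cmp_arrs\<close>)
  qed
qed

lemma eq_stack: "stack_in_groupoids X E"
  by (intro stack_in_groupoids.intro stack_in_groupoids_axioms.intro eq_fibred)
    (rule eq_morphisms_glue eq_objects_glue; assumption)+

end

section \<open>Band and local structure of the gerbe of equivariant objects\<close>

lemma (in sheaf_action) invariants_comm_group:
  assumes U: "U \<in> objs X"
  shows "comm_group (grp (invariants G A \<phi>) U)"
proof -
  interpret M: comm_group "grp A U" by (simp add: U)
  have "subgroup (carrier (grp (invariants G A \<phi>) U)) (grp A U)"
    by (rule M.subgroupI) (use U M.one_closed in \<open>auto simp: action_one action_inv action_prod\<close>)
  from M.subgroup_imp_group[OF this] have "Group.group (grp (invariants G A \<phi>) U)"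
    by (simp add: invariants_def)
  then show ?thesis
    by (rule group.group_comm_groupI) (simp add: M.m_comm)
qed

context lifted_gerbe begin

text \<open>F_g turns the band element of a into that of \<phi>_g(a), and band elements pass through
  the structure arrow, so for invariant a both sides of the equivariance equation agree.\<close>

lemma eq_band_arrs:
  assumes z: "z \<in> objs E" and a: "a \<in> carrier (grp (invariants G A \<phi>) (pobj Y (underlying z)))"
  shows "band E z a \<in> arrs E"
proof -
  let ?y = "underlying z"
  have y: "?y \<in> objs Y"
    using z by simp
  have a': "a \<in> carrier (grp A (pobj Y ?y))" "\<And>g. g \<in> carrier G \<Longrightarrow> \<phi> g (pobj Y ?y) a = a"
    using a by auto
  have "structure_arrow z g \<cdot> band Y ?y a = far (F g) (band Y ?y a) \<cdot> structure_arrow z g"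
    if g: "g \<in> carrier G" for g
    using band_move_vertical[of "structure_arrow z g" "fob (F g) ?y" "pobj Y ?y" a] z y a' g by simp
  then show ?thesis
    using z y a' by (subst eq_arrs_iff) simp
qed

text \<open>This is where the invariants arise: an automorphism has a band element of some a as its
  underlying arrow, and equivariance at g, after moving coefficients past the structure arrow, says
  \<phi>_g(a) = a.\<close>

lemma eq_band_iso:
  assumes z: "z \<in> objs E"
  shows "band E z \<in> iso (grp (invariants G A \<phi>) (pobj E z)) (aut_group X E z)"
proof -
  let ?y = "underlying z"
  let ?U = "pobj Y ?y"
  have y: "?y \<in> objs Y" "pobj E z = ?U"
    using z by simp_all
  let ?I = "carrier (grp (invariants G A \<phi>) ?U)"
  have I: "?I = {a \<in> carrier (grp A ?U). \<forall>g \<in> carrier G. \<phi> g ?U a = a}"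
    by simp
  have mem: "band E z a \<in> carrier (aut_group X E z)" if "a \<in> ?I" for a
    using eq_band_arrs[OF z that] y by (simp add: aut_group_def arrows_over_iff)
  have "band E z (a \<otimes>\<^bsub>grp A ?U\<^esub> b) = band E z a \<cdot>\<^bsub>E\<^esub> band E z b" if ab: "a \<in> ?I" "b \<in> ?I" for a b
  proof (rule eq_arr_eqI)
    interpret N: comm_group "grp (invariants G A \<phi>) ?U"
      by (rule invariants_comm_group) (use y in simp)
    have "a \<otimes>\<^bsub>grp A ?U\<^esub> b \<in> ?I"
      using N.m_closed[OF ab] by simp
    then show "band E z (a \<otimes>\<^bsub>grp A ?U\<^esub> b) \<in> arrs E"
      by (rule eq_band_arrs[OF z])
    show "band E z a \<cdot>\<^bsub>E\<^esub> band E z b \<in> arrs E"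
      using ab by (intro eq_cmp_arrs eq_band_arrs z) simp_all
  qed (use ab y in \<open>simp_all add: band_mult\<close>)
  then have hom: "band E z \<in> hom (grp (invariants G A \<phi>) ?U) (aut_group X E z)"
    using mem by (intro homI) (simp_all add: aut_group_def del: carrier_invariants)
  have inj: "inj_on (band E z) ?I"
  proof (rule inj_onI)
    fix a b assume ab: "a \<in> ?I" "b \<in> ?I" and "band E z a = band E z b"
    then have "underlying_arrow (band E z a) = underlying_arrow (band E z b)"
      by simp
    then have "band Y ?y a = band Y ?y b"
      by simp
    then show "a = b"
      using band_inj[of ?y a b] ab y by simp
  qed
  have "p \<in> band E z ` ?I" if p: "p \<in> carrier (aut_group X E z)" for p
  proof -
    have p': "p \<in> arrs E" "src E p = z" "tgt E p = z" "parr E p = idt X ?U"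
      using p y by (auto simp: aut_group_def arrows_over_iff)
    have 1: "underlying_arrow p \<in> arrs Y" "src Y (underlying_arrow p) = ?y" "tgt Y (underlying_arrow p) = ?y"
        "parr Y (underlying_arrow p) = idt X ?U"
      using p' eq_arr_simps(6)[OF p'(1)] by simp_all
    obtain a where a: "a \<in> carrier (grp A ?U)" "underlying_arrow p = band Y ?y a"
      by (rule band_surj[OF 1])
    have "\<phi> g ?U a = a" if g: "g \<in> carrier G" for g
    proof (rule band_cancel[of "structure_arrow z g" ?y])
      have "structure_arrow z g \<cdot> band Y ?y (\<phi> g ?U a) = band Y (fob (F g) ?y) (\<phi> g ?U a) \<cdot> structure_arrow z g"
        using band_move_vertical[of "structure_arrow z g" "fob (F g) ?y" ?U "\<phi> g ?U a"] z y a(1) g by simp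
      also have "\<dots> = structure_arrow z g \<cdot> band Y ?y a"
        using eq_arr_equivariant[OF p'(1-3) g] a y g by simp
      finally show "structure_arrow z g \<cdot> band Y ?y (\<phi> g ?U a) = structure_arrow z g \<cdot> band Y ?y a" .
    qed (use z y a(1) g in simp_all)
    then have aI: "a \<in> ?I"
      using a by simp
    have "p = band E z a"
      by (rule eq_arr_eqI[OF p'(1) eq_band_arrs[OF z aI]]) (use p' a in simp_all)
    then show ?thesis
      using aI by blast
  qed
  then have "band E z ` ?I = carrier (aut_group X E z)"
    using mem by blast
  then show ?thesis
    using hom inj y unfolding iso_def bij_betw_def by simp
qed

lemma eq_aut_abelian:
  assumes z: "z \<in> objs E"
  shows "comm_group (aut_group X E z)"
proof -
  let ?I = "grp (invariants G A \<phi>) (pobj E z)"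
  have U: "pobj E z \<in> objs X"
    using z by simp
  interpret N: comm_group ?I
    by (rule invariants_comm_group[OF U])
  \<comment> \<open>The group structure transported along the band has the image of the unit as its
    unit, which must be identified with the identity arrow.\<close>
  have "band E z \<one>\<^bsub>?I\<^esub> = idt E z"
    by (rule eq_arr_eqI)
      (use z N.one_closed eq_band_arrs[OF z, of "\<one>\<^bsub>?I\<^esub>"] eq_idt_arrs[OF z] in simp_all)
  moreover have "comm_group ((aut_group X E z)\<lparr>one := band E z \<one>\<^bsub>?I\<^esub>\<rparr>)"
    by (rule N.iso_imp_img_comm_group[OF eq_band_iso[OF z]])
  ultimately show ?thesis
    by (simp add: aut_group_def)
qed

lemma eq_band_compatible:
  assumes p: "p \<in> arrows E z' z" and a: "a \<in> carrier (grp (invariants G A \<phi>) (pobj E z))"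
  shows "p \<cdot>\<^bsub>E\<^esub> band E z' (gres (invariants G A \<phi>) (parr E p) a) = band E z a \<cdot>\<^bsub>E\<^esub> p"
proof -
  have p': "p \<in> arrs E" "src E p = z'" "tgt E p = z" and z: "z \<in> objs E" "z' \<in> objs E"
    using p by (auto simp: arrows_def)
  let ?p = "underlying_arrow p"
  have P: "?p \<in> arrs Y" "src Y ?p = underlying z'" "tgt Y ?p = underlying z" "parr E p = parr Y ?p"
    using p' by (simp_all add: eq_arr_simps)
  have aI: "a \<in> carrier (grp (invariants G A \<phi>) (pobj Y (underlying z)))"
    using a z by simp
  have a': "a \<in> carrier (grp A (pobj Y (underlying z)))" "\<And>g. g \<in> carrier G \<Longrightarrow> \<phi> g (pobj Y (underlying z)) a = a"
    using aI by auto
  let ?r = "gres A (parr Y ?p) a"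
  have "\<phi> g (pobj Y (underlying z')) ?r = ?r" if g: "g \<in> carrier G" for g
    using action_gres[OF g, of "parr Y ?p" "pobj Y (underlying z')" "pobj Y (underlying z)" a] a' g P z by simp
  then have r: "?r \<in> carrier (grp (invariants G A \<phi>) (pobj Y (underlying z')))"
    using a' P z by simp
  show ?thesis
  proof (rule eq_arr_eqI)
    show "p \<cdot>\<^bsub>E\<^esub> band E z' (gres (invariants G A \<phi>) (parr E p) a) \<in> arrs E"
      using eq_cmp_arrs[OF eq_band_arrs[OF z(2) r] p'(1)] p' P by simp
    show "band E z a \<cdot>\<^bsub>E\<^esub> p \<in> arrs E"
      using eq_cmp_arrs[OF p'(1) eq_band_arrs[OF z(1) aI]] p' by simp
    show "underlying_arrow (p \<cdot>\<^bsub>E\<^esub> band E z' (gres (invariants G A \<phi>) (parr E p) a))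
        = underlying_arrow (band E z a \<cdot>\<^bsub>E\<^esub> p)"
      using band_move[OF P(1,3) a'(1)] P by simp
  qed (use p' in simp_all)
qed

text \<open>The comparison is moved to a single object: after a local isomorphism of the underlying
  objects both structures live on the same w and differ by coefficients k(g). Where k(g) =
  \<phi>_g(a) a^-1, the automorphism a of the underlying object carries one structure to the
  other.\<close>

lemma eq_locally_isomorphic:
  assumes van: "classes_locally_vanish X G A \<phi> 1"
    and U: "U \<in> objs X" and x: "x \<in> objs_over E U" and y: "y \<in> objs_over E U"
  shows "\<exists>S \<in> cov X U. \<forall>u \<in> S. \<exists>x' y'. arrows_over E u x' x \<noteq> {} \<and> arrows_over E u y' y \<noteq> {} \<and>
    arrows_over E (idt X (src X u)) x' y' \<noteq> {}"
proof -
  have x': "x \<in> objs E" "underlying x \<in> objs Y" "pobj Y (underlying x) = U"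
    and y': "y \<in> objs E" "underlying y \<in> objs Y" "pobj Y (underlying y) = U"
    using x y by (auto simp: objs_over_iff)
  obtain S where S: "S \<in> cov X U" and loc: "\<forall>u \<in> S. \<exists>a b. arrows_over Y u a (underlying x) \<noteq> {} \<and>
      arrows_over Y u b (underlying y) \<noteq> {} \<and> arrows_over Y (idt X (src X u)) a b \<noteq> {}"
    using objects_locally_isomorphic[OF U, of "underlying x" "underlying y"] x' y'
    by (auto simp: objs_over_iff)
  show ?thesis
  proof (rule local_compose[OF U S])
    fix u assume u: "u \<in> S"
    note cov = cov_arrs[OF U S u]
    let ?V = "src X u"
    interpret M: comm_group "grp A ?V" by (simp add: cov)
    obtain w b p q c where "p \<in> arrows_over Y u w (underlying x)" "q \<in> arrows_over Y u b (underlying y)"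
        "c \<in> arrows_over Y (idt X ?V) w b"
      using loc u by blast
    then have p: "p \<in> arrs Y" "src Y p = w" "tgt Y p = underlying x" "parr Y p = u"
      and q: "q \<cdot> c \<in> arrs Y" "src Y (q \<cdot> c) = w" "tgt Y (q \<cdot> c) = underlying y" "parr Y (q \<cdot> c) = u"
      using cov by (auto simp: arrows_over_iff)
    have w: "w \<in> objs Y" "pobj Y w = ?V"
      using p src_parr[OF p(1)] by auto
    obtain P where P: "P \<in> arrs E" "tgt E P = x" "underlying_arrow P = p"
      by (rule eq_pullback[OF x'(1) p(1,3)])
    \<comment> \<open>Lifting \<open>q \<cdot> c\<close> rather than q makes w the underlying object
      here too, as it is for P.\<close>
    obtain Q where Q: "Q \<in> arrs E" "tgt E Q = y" "underlying_arrow Q = q \<cdot> c"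
      by (rule eq_pullback[OF y'(1) q(1,3)])
    define s where "s = src E P"
    define t where "t = src E Q"
    have st: "s \<in> objs E" "t \<in> objs E" "underlying s = w" "underlying t = w"
      using eq_arr_simps(1,4)[OF P(1)] eq_arr_simps(1,4)[OF Q(1)] P Q p q by (simp_all add: s_def t_def)
    let ?s = "structure_arrow s" and ?t = "structure_arrow t"
    have sg: "?s g \<in> arrs Y" "src Y (?s g) = w" "tgt Y (?s g) = fob (F g) w" "parr Y (?s g) = idt X ?V"
      and tg: "?t g \<in> arrs Y" "src Y (?t g) = w" "tgt Y (?t g) = fob (F g) w" "parr Y (?t g) = idt X ?V"
      if "g \<in> carrier G" for g
      using eq_obj_simps(3-6)[OF st(1) that] eq_obj_simps(3-6)[OF st(2) that] st w by simp_all
    have "\<exists>a. g \<in> carrier G \<longrightarrow> a \<in> carrier (grp A ?V) \<and> ?t g = ?s g \<cdot> band Y w a" for g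
    proof (cases "g \<in> carrier G")
      case True
      have 1: "?s g \<in> arrs Y" "?t g \<in> arrs Y" "src Y (?t g) = src Y (?s g)" "tgt Y (?t g) = tgt Y (?s g)"
          "parr Y (?t g) = parr Y (?s g)" "pobj Y (src Y (?s g)) = ?V"
        using sg[OF True] tg[OF True] w by simp_all
      obtain a where "a \<in> carrier (grp A ?V)" "?t g = ?s g \<cdot> band Y (src Y (?s g)) a"
        by (rule arrow_difference[OF 1])
      then show ?thesis
        using sg(2)[OF True] by auto
    qed simp
    then obtain k where k: "\<And>g. g \<in> carrier G \<Longrightarrow> k g \<in> carrier (grp A ?V)"
        "\<And>g. g \<in> carrier G \<Longrightarrow> ?t g = ?s g \<cdot> band Y w (k g)"
      by metis
    \<comment> \<open>Both structures satisfy the condition with the same \<alpha>; subtracting its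
      two instances leaves the cocycle identity.\<close>
    have cocycle: "k (g \<otimes>\<^bsub>G\<^esub> h) = \<phi> g ?V (k h) \<otimes>\<^bsub>grp A ?V\<^esub> k g" if gh: "g \<in> carrier G" "h \<in> carrier G" for g h
    proof -
      have gh': "g \<otimes>\<^bsub>G\<^esub> h \<in> carrier G"
        using gh by simp
      note s1 = sg[OF gh(1)] sg[OF gh(2)] sg[OF gh'] and k1 = k(1)[OF gh(1)] k(1)[OF gh(2)] k(1)[OF gh']
      have \<phi>k: "\<phi> g ?V (k h) \<in> carrier (grp A ?V)"
        using gh k1 cov by simp
      have "(\<alpha> g h w \<cdot> ?s (g \<otimes>\<^bsub>G\<^esub> h)) \<cdot> band Y w (k (g \<otimes>\<^bsub>G\<^esub> h)) = \<alpha> g h w \<cdot> ?t (g \<otimes>\<^bsub>G\<^esub> h)"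
        using gh s1 k1 w by (simp add: k(2)[OF gh'])
      also have "\<dots> = far (F g) (?t h) \<cdot> ?t g"
        using eq_obj_cocycle[OF st(2) gh] st by simp
      also have "\<dots> = far (F g) (?s h) \<cdot> (band Y (fob (F g) w) (\<phi> g ?V (k h)) \<cdot> ?s g) \<cdot> band Y w (k g)"
        using gh s1 k1 w \<phi>k by (simp add: k(2)[OF gh(1)] k(2)[OF gh(2)])
      also have "band Y (fob (F g) w) (\<phi> g ?V (k h)) \<cdot> ?s g = ?s g \<cdot> band Y w (\<phi> g ?V (k h))"
        using gh s1 \<phi>k w cov by (simp add: band_move_vertical[of "?s g" _ ?V])
      also have "far (F g) (?s h) \<cdot> \<dots> \<cdot> band Y w (k g)
          = (far (F g) (?s h) \<cdot> ?s g) \<cdot> band Y w (\<phi> g ?V (k h) \<otimes>\<^bsub>grp A ?V\<^esub> k g)"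
        using gh s1 k1 w \<phi>k by (simp add: band_mult[of w ?V])
      also have "far (F g) (?s h) \<cdot> ?s g = \<alpha> g h w \<cdot> ?s (g \<otimes>\<^bsub>G\<^esub> h)"
        using eq_obj_cocycle[OF st(1) gh] st by simp
      finally show ?thesis
        by (rule band_cancel) (use gh s1 k1 w \<phi>k in simp_all)
    qed
    obtain R where R: "R \<in> cov X ?V" and vanish: "\<forall>v \<in> R. \<exists>a \<in> carrier (grp A (src X v)).
        \<forall>g \<in> carrier G. gres A v (k g) = \<phi> g (src X v) a \<otimes>\<^bsub>grp A (src X v)\<^esub> inv\<^bsub>grp A (src X v)\<^esub> a"
      using vanish_1[OF van cov(3) k(1) cocycle] by blast
    have "\<exists>x' y'. arrows_over E (u \<cdot>\<^bsub>X\<^esub> v) x' x \<noteq> {} \<and> arrows_over E (u \<cdot>\<^bsub>X\<^esub> v) y' y \<noteq> {} \<and>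
        arrows_over E (idt X (src X (u \<cdot>\<^bsub>X\<^esub> v))) x' y' \<noteq> {}" if v: "v \<in> R" for v
    proof -
      note cv = cov_arrs[OF cov(3) R v]
      let ?W = "src X v"
      interpret N: comm_group "grp A ?W" by (simp add: cv)
      obtain a where a: "a \<in> carrier (grp A ?W)" and ka: "\<And>g. g \<in> carrier G \<Longrightarrow>
          gres A v (k g) = \<phi> g ?W a \<otimes>\<^bsub>grp A ?W\<^esub> inv\<^bsub>grp A ?W\<^esub> a"
        using vanish v by blast
      have 1: "v \<in> arrs X" "w \<in> objs Y" "tgt X v = pobj Y w"
        using cv w by simp_all
      obtain j where j: "j \<in> arrs Y" "tgt Y j = w" "parr Y j = v" "pobj Y (src Y j) = ?W"
        by (rule pullback[OF 1])
      have js: "tgt Y j = underlying s" and jt: "tgt Y j = underlying t"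
        using j st by simp_all
      obtain I where I: "I \<in> arrs E" "tgt E I = s" "underlying_arrow I = j"
        by (rule eq_pullback[OF st(1) j(1) js])
      obtain J where J: "J \<in> arrs E" "tgt E J = t" "underlying_arrow J = j"
        by (rule eq_pullback[OF st(2) j(1) jt])
      let ?x = "src E I" and ?y = "src E J" and ?n = "src Y j"
      have xy: "?x \<in> objs E" "?y \<in> objs E" "underlying ?x = ?n" "underlying ?y = ?n"
        using eq_arr_simps(1,4)[OF I(1)] eq_arr_simps(1,4)[OF J(1)] I J by simp_all
      let ?sx = "structure_arrow ?x" and ?sy = "structure_arrow ?y"
      have xg: "?sx g \<in> arrs Y" "src Y (?sx g) = ?n" "tgt Y (?sx g) = fob (F g) ?n" "parr Y (?sx g) = idt X ?W"
        and yg: "?sy g \<in> arrs Y" "src Y (?sy g) = ?n" "tgt Y (?sy g) = fob (F g) ?n" "parr Y (?sy g) = idt X ?W"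
        if "g \<in> carrier G" for g
        using eq_obj_simps(3-6)[OF xy(1) that] eq_obj_simps(3-6)[OF xy(2) that] xy j by simp_all
      have n: "?n \<in> objs Y"
        using j by simp
      \<comment> \<open>Restricted along j, the structures differ by the restriction of k(g).
        Multiplied by a this is \<phi>_g(a), which moves across the structure arrow and becomes the
        image of a under F_g.\<close>
      have "?sy g \<cdot> band Y ?n a = far (F g) (band Y ?n a) \<cdot> ?sx g" if g: "g \<in> carrier G" for g
      proof -
        note xg' = xg[OF g] and yg' = yg[OF g] and sg' = sg[OF g] and k' = k(1)[OF g]
        have r: "gres A v (k g) \<in> carrier (grp A ?W)"
          using k' cv by simp
        have \<phi>a: "\<phi> g ?W a \<in> carrier (grp A ?W)"
          using a g cv by simp
        have "?sy g = ?sx g \<cdot> band Y ?n (gres A v (k g))"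
        proof (rule cancel_left[of "far (F g) j"])
          have "far (F g) j \<cdot> ?sy g = ?t g \<cdot> j"
            using eq_arr_equivariant[OF J(1) refl J(2) g] J(3) by simp
          also have "\<dots> = ?s g \<cdot> (band Y w (k g) \<cdot> j)"
            using sg' k' w j by (simp add: k(2)[OF g])
          also have "band Y w (k g) \<cdot> j = j \<cdot> band Y ?n (gres A v (k g))"
            using j k' w by (simp add: band_move)
          also have "?s g \<cdot> \<dots> = (?s g \<cdot> j) \<cdot> band Y ?n (gres A v (k g))"
            using sg' r n j by simp
          also have "?s g \<cdot> j = far (F g) j \<cdot> ?sx g"
            using eq_arr_equivariant[OF I(1) refl I(2) g] I(3) by simp
          finally show "far (F g) j \<cdot> ?sy g = far (F g) j \<cdot> (?sx g \<cdot> band Y ?n (gres A v (k g)))"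
            using g xg' r n j by simp
        qed (use g xg' yg' r n j cv in simp_all)
        then have "?sy g \<cdot> band Y ?n a = ?sx g \<cdot> band Y ?n (gres A v (k g) \<otimes>\<^bsub>grp A ?W\<^esub> a)"
          using xg' r n j a by (simp add: band_mult[of ?n ?W])
        also have "gres A v (k g) \<otimes>\<^bsub>grp A ?W\<^esub> a = \<phi> g ?W a"
          using a \<phi>a g by (simp add: ka N.m_assoc)
        also have "?sx g \<cdot> band Y ?n (\<phi> g ?W a) = far (F g) (band Y ?n a) \<cdot> ?sx g"
          using xg' \<phi>a n j a g cv by (simp add: band_move_vertical[of "?sx g" _ ?W])
        finally show ?thesis .
      qed
      then have B: "eq_arrow ?x (band Y ?n a) ?y \<in> arrs E"
        using xy n a j by (subst eq_arrs_iff) simp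
      have W: "src X (u \<cdot>\<^bsub>X\<^esub> v) = ?W"
        using cov cv by simp
      have "P \<cdot>\<^bsub>E\<^esub> I \<in> arrows_over E (u \<cdot>\<^bsub>X\<^esub> v) ?x x"
        using eq_cmp_arrs[OF I(1) P(1)] I P p j by (simp add: arrows_over_iff s_def)
      moreover have "Q \<cdot>\<^bsub>E\<^esub> J \<in> arrows_over E (u \<cdot>\<^bsub>X\<^esub> v) ?y y"
        using eq_cmp_arrs[OF J(1) Q(1)] J Q q j by (simp add: arrows_over_iff t_def)
      moreover have "eq_arrow ?x (band Y ?n a) ?y \<in> arrows_over E (idt X (src X (u \<cdot>\<^bsub>X\<^esub> v))) ?x ?y"
        using B W n a j by (simp add: arrows_over_iff)
      ultimately show ?thesis
        by blast
    qed
    then show "\<exists>R \<in> cov X (src X u). \<forall>v \<in> R. \<exists>x' y'. arrows_over E (u \<cdot>\<^bsub>X\<^esub> v) x' x \<noteq> {} \<and>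
        arrows_over E (u \<cdot>\<^bsub>X\<^esub> v) y' y \<noteq> {} \<and> arrows_over E (idt X (src X (u \<cdot>\<^bsub>X\<^esub> v))) x' y' \<noteq> {}"
      using R by blast
  qed
qed

text \<open>Local existence of objects is left as a hypothesis because it has two sources: local
  vanishing in degree two with corrected connecting 2-morphisms, or a given gerbe banded by the
  invariants whose objects provide equivariant ones.\<close>

lemma eq_banded_gerbe:
  assumes van: "classes_locally_vanish X G A \<phi> 1"
    and local_objs: "\<And>U. U \<in> objs X \<Longrightarrow> \<exists>S \<in> cov X U. \<forall>u \<in> S. objs_over E (src X u) \<noteq> {}"
  shows "banded_gerbe X (invariants G A \<phi>) E"
  by (intro banded_gerbe.intro banded_gerbe_axioms.intro abelian_gerbe.intro abelian_gerbe_axioms.intro eq_stack)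
    (rule local_objs eq_locally_isomorphic[OF van] eq_aut_abelian eq_band_iso eq_band_compatible; assumption)+

text \<open>An object and its image under F_g are locally isomorphic, on a cover that depends on g.
  Induction over a finite set of group elements refines these covers to a common one; this is how
  finiteness of G enters.\<close>

lemma locally_all_structure_arrows:
  assumes "finite B" "B \<subseteq> carrier G" "y \<in> objs Y"
  shows "\<exists>S \<in> cov X (pobj Y y). \<forall>u \<in> S. \<exists>p \<in> arrs Y. tgt Y p = y \<and> parr Y p = u \<and>
    (\<forall>g \<in> B. \<exists>\<psi> \<in> arrs Y. src Y \<psi> = src Y p \<and> tgt Y \<psi> = fob (F g) (src Y p) \<and> parr Y \<psi> = idt X (src X u))"
  using assms
proof (induction B rule: finite_induct)
  case empty
  then show ?case
    by (intro local_trivial) (auto intro!: bexI[of _ "idt Y y"])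
next
  case (insert h B)
  let ?U = "pobj Y y"
  have U: "?U \<in> objs X" and h: "h \<in> carrier G" and BG: "B \<subseteq> carrier G"
    using insert.prems by auto
  obtain S where S: "S \<in> cov X ?U" and loc: "\<forall>u \<in> S. \<exists>p \<in> arrs Y. tgt Y p = y \<and> parr Y p = u \<and>
    (\<forall>g \<in> B. \<exists>\<psi> \<in> arrs Y. src Y \<psi> = src Y p \<and> tgt Y \<psi> = fob (F g) (src Y p) \<and> parr Y \<psi> = idt X (src X u))"
    using insert.IH[OF BG insert.prems(2)] by blast
  show ?case
  proof (rule local_compose[OF U S])
    fix u assume u: "u \<in> S"
    note cov = cov_arrs[OF U S u]
    obtain p where p: "p \<in> arrs Y" "tgt Y p = y" "parr Y p = u" and Bp: "\<forall>g \<in> B. \<exists>\<psi> \<in> arrs Y.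
        src Y \<psi> = src Y p \<and> tgt Y \<psi> = fob (F g) (src Y p) \<and> parr Y \<psi> = idt X (src X u)"
      using loc u by blast
    let ?x = "src Y p"
    have x: "?x \<in> objs Y" "pobj Y ?x = src X u"
      using p src_parr[OF p(1)] by simp_all
    obtain R where R: "R \<in> cov X (src X u)" and loc': "\<forall>v \<in> R. \<exists>a b. arrows_over Y v a ?x \<noteq> {} \<and>
        arrows_over Y v b (fob (F h) ?x) \<noteq> {} \<and> arrows_over Y (idt X (src X v)) a b \<noteq> {}"
      using objects_locally_isomorphic[OF cov(3), of ?x "fob (F h) ?x"] x h by (auto simp: objs_over_iff)
    have "\<exists>p \<in> arrs Y. tgt Y p = y \<and> parr Y p = u \<cdot>\<^bsub>X\<^esub> v \<and> (\<forall>g \<in> insert h B. \<exists>\<psi> \<in> arrs Y.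
        src Y \<psi> = src Y p \<and> tgt Y \<psi> = fob (F g) (src Y p) \<and> parr Y \<psi> = idt X (src X (u \<cdot>\<^bsub>X\<^esub> v)))"
      if v: "v \<in> R" for v
    proof -
      note cv = cov_arrs[OF cov(3) R v]
      obtain a b i j c where "i \<in> arrows_over Y v a ?x" "j \<in> arrows_over Y v b (fob (F h) ?x)"
          "c \<in> arrows_over Y (idt X (src X v)) a b"
        using loc' v by blast
      then have i: "i \<in> arrs Y" "src Y i = a" "tgt Y i = ?x" "parr Y i = v"
        and j: "j \<in> arrs Y" "src Y j = b" "tgt Y j = fob (F h) ?x" "parr Y j = v"
        and c: "c \<in> arrs Y" "src Y c = a" "tgt Y c = b" "parr Y c = idt X (src X v)"
        by (auto simp: arrows_over_iff)
      have a: "pobj Y a = src X v"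
        using i src_parr[OF i(1)] by simp
      have W: "src X (u \<cdot>\<^bsub>X\<^esub> v) = src X v"
        using cov cv by simp
      \<comment> \<open>The target of r is the image of \<open>?x\<close>; dividing by the pullback
        arrow \<open>far (F g) i\<close> replaces it by the image of a.\<close>
      have factor_i: "\<exists>\<psi> \<in> arrs Y. src Y \<psi> = a \<and> tgt Y \<psi> = fob (F g) a \<and> parr Y \<psi> = idt X (src X v)"
        if g: "g \<in> carrier G" and r: "r \<in> arrs Y" "src Y r = a" "tgt Y r = fob (F g) ?x" "parr Y r = v" for g r
      proof -
        have 1: "r \<in> arrs Y" "far (F g) i \<in> arrs Y" "tgt Y r = tgt Y (far (F g) i)" "parr Y r = parr Y (far (F g) i)"
          using g r i by simp_all
        obtain d where "d \<in> arrs Y" "src Y d = src Y r" "tgt Y d = src Y (far (F g) i)"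
            "parr Y d = idt X (pobj Y (src Y r))"
          by (rule factor_vertical[OF 1])
        then show ?thesis
          using g r i a by (intro bexI[of _ d]) simp_all
      qed
      have "\<exists>\<psi> \<in> arrs Y. src Y \<psi> = a \<and> tgt Y \<psi> = fob (F g) a \<and> parr Y \<psi> = idt X (src X v)"
        if "g \<in> insert h B" for g
      \<comment> \<open>The new element uses the local isomorphism just found, the old ones the
        restriction of the arrow already available.\<close>
      proof (cases "g = h")
        case True
        show ?thesis
          by (rule factor_i[of g "j \<cdot> c"]) (use True h j c cv in simp_all)
      next
        case False
        then have gB: "g \<in> B" "g \<in> carrier G"
          using that BG by auto
        obtain \<psi> where \<psi>: "\<psi> \<in> arrs Y" "src Y \<psi> = ?x" "tgt Y \<psi> = fob (F g) ?x" "parr Y \<psi> = idt X (src X u)"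
          using Bp gB(1) by blast
        show ?thesis
          by (rule factor_i[of g "\<psi> \<cdot> i"]) (use gB \<psi> i cv in simp_all)
      qed
      then show ?thesis
        using p i cov cv x by (intro bexI[of _ "p \<cdot> i"]) (simp_all add: W)
    qed
    then show "\<exists>R \<in> cov X (src X u). \<forall>v \<in> R. \<exists>p \<in> arrs Y. tgt Y p = y \<and> parr Y p = u \<cdot>\<^bsub>X\<^esub> v \<and>
        (\<forall>g \<in> insert h B. \<exists>\<psi> \<in> arrs Y. src Y \<psi> = src Y p \<and> tgt Y \<psi> = fob (F g) (src Y p) \<and>
          parr Y \<psi> = idt X (src X (u \<cdot>\<^bsub>X\<^esub> v)))"
      using R by blast
  qed
qed

text \<open>The defect c of the arbitrary vertical arrows s_g is defined by F_g(s_h) s_g =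
  \<alpha>(g,h) s_gh c(g,h). Strictness of \<alpha> makes c a 2-cocycle, and where c = d b the
  arrows s_g b(g)^-1 have no defect.\<close>

lemma structure_locally_exists:
  assumes van: "classes_locally_vanish X G A \<phi> 2"
    and strict: "\<And>g h k x. \<lbrakk>g \<in> carrier G; h \<in> carrier G; k \<in> carrier G; x \<in> objs Y\<rbrakk> \<Longrightarrow>
      \<alpha> g h (fob (F k) x) \<cdot> \<alpha> (g \<otimes>\<^bsub>G\<^esub> h) k x = far (F g) (\<alpha> h k x) \<cdot> \<alpha> g (h \<otimes>\<^bsub>G\<^esub> k) x"
    and y: "y \<in> objs Y" "pobj Y y = U"
    and s: "\<And>g. g \<in> carrier G \<Longrightarrow> s g \<in> arrs Y" "\<And>g. g \<in> carrier G \<Longrightarrow> src Y (s g) = y"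
      "\<And>g. g \<in> carrier G \<Longrightarrow> tgt Y (s g) = fob (F g) y" "\<And>g. g \<in> carrier G \<Longrightarrow> parr Y (s g) = idt X U"
  shows "\<exists>S \<in> cov X U. \<forall>u \<in> S. objs_over E (src X u) \<noteq> {}"
proof -
  have U: "U \<in> objs X"
    using y by auto
  interpret M: comm_group "grp A U" by (simp add: U)
  have "\<exists>a. g \<in> carrier G \<longrightarrow> h \<in> carrier G \<longrightarrow> a \<in> carrier (grp A U) \<and>
      far (F g) (s h) \<cdot> s g = (\<alpha> g h y \<cdot> s (g \<otimes>\<^bsub>G\<^esub> h)) \<cdot> band Y y a" for g h
  proof (cases "g \<in> carrier G \<and> h \<in> carrier G")
    case True
    let ?a = "\<alpha> g h y \<cdot> s (g \<otimes>\<^bsub>G\<^esub> h)" and ?b = "far (F g) (s h) \<cdot> s g"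
    have 1: "?a \<in> arrs Y" "?b \<in> arrs Y" "src Y ?b = src Y ?a" "tgt Y ?b = tgt Y ?a" "parr Y ?b = parr Y ?a"
        "pobj Y (src Y ?a) = U"
      using True y U s by simp_all
    obtain a where "a \<in> carrier (grp A U)" "?b = ?a \<cdot> band Y (src Y ?a) a"
      by (rule arrow_difference[OF 1])
    moreover have "src Y ?a = y"
      using True y s by simp
    ultimately show ?thesis
      by metis
  qed blast
  then obtain c where c: "\<And>g h. \<lbrakk>g \<in> carrier G; h \<in> carrier G\<rbrakk> \<Longrightarrow> c g h \<in> carrier (grp A U)"
    and sc: "\<And>g h. \<lbrakk>g \<in> carrier G; h \<in> carrier G\<rbrakk> \<Longrightarrow>
      far (F g) (s h) \<cdot> s g = (\<alpha> g h y \<cdot> s (g \<otimes>\<^bsub>G\<^esub> h)) \<cdot> band Y y (c g h)"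
    by metis
  \<comment> \<open>The composite of F_g(F_h(s_k)), F_g(s_h) and s_g is evaluated in two ways;
    \<open>strict\<close> identifies the two resulting composites of \<alpha>.\<close>
  have cocycle: "c g (h \<otimes>\<^bsub>G\<^esub> k) \<otimes>\<^bsub>grp A U\<^esub> \<phi> g U (c h k) = c (g \<otimes>\<^bsub>G\<^esub> h) k \<otimes>\<^bsub>grp A U\<^esub> c g h"
    if g: "g \<in> carrier G" "h \<in> carrier G" "k \<in> carrier G" for g h k
  proof -
    have gs: "g \<otimes>\<^bsub>G\<^esub> h \<in> carrier G" "h \<otimes>\<^bsub>G\<^esub> k \<in> carrier G" "g \<otimes>\<^bsub>G\<^esub> h \<otimes>\<^bsub>G\<^esub> k \<in> carrier G"
        "g \<otimes>\<^bsub>G\<^esub> (h \<otimes>\<^bsub>G\<^esub> k) = g \<otimes>\<^bsub>G\<^esub> h \<otimes>\<^bsub>G\<^esub> k"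
      using g by (simp_all add: m_assoc)
    let ?p = "far (F g) (\<alpha> h k y) \<cdot> (\<alpha> g (h \<otimes>\<^bsub>G\<^esub> k) y \<cdot> s (g \<otimes>\<^bsub>G\<^esub> h \<otimes>\<^bsub>G\<^esub> k))"
    note cl = c[OF g(1,2)] c[OF g(2,3)] c[OF gs(1) g(3)] c[OF g(1) gs(2)]
    have \<phi>c: "\<phi> g U (c h k) \<in> carrier (grp A U)"
      using cl g U by simp
    have "?p \<cdot> band Y y (c g (h \<otimes>\<^bsub>G\<^esub> k) \<otimes>\<^bsub>grp A U\<^esub> \<phi> g U (c h k))
        = far (F g) (\<alpha> h k y) \<cdot> ((\<alpha> g (h \<otimes>\<^bsub>G\<^esub> k) y \<cdot> s (g \<otimes>\<^bsub>G\<^esub> (h \<otimes>\<^bsub>G\<^esub> k))) \<cdot> band Y y (c g (h \<otimes>\<^bsub>G\<^esub> k)))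
          \<cdot> band Y y (\<phi> g U (c h k))"
      using g gs y s cl \<phi>c by (simp add: band_mult[of y U])
    also have "\<dots> = far (F g) (\<alpha> h k y) \<cdot> (far (F g) (s (h \<otimes>\<^bsub>G\<^esub> k)) \<cdot> (s g \<cdot> band Y y (\<phi> g U (c h k))))"
      by (subst sc[OF g(1) gs(2), symmetric]) (use g gs y s \<phi>c in simp)
    also have "s g \<cdot> band Y y (\<phi> g U (c h k)) = band Y (fob (F g) y) (\<phi> g U (c h k)) \<cdot> s g"
      using g y s \<phi>c U by (simp add: band_move_vertical[of "s g" _ U])
    also have "far (F g) (\<alpha> h k y) \<cdot> (far (F g) (s (h \<otimes>\<^bsub>G\<^esub> k)) \<cdot> \<dots>)
        = far (F g) ((\<alpha> h k y \<cdot> s (h \<otimes>\<^bsub>G\<^esub> k)) \<cdot> band Y y (c h k)) \<cdot> s g"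
      using g gs y s cl \<phi>c by simp
    also have "\<dots> = far (F g) (far (F h) (s k)) \<cdot> (far (F g) (s h) \<cdot> s g)"
      by (subst sc[OF g(2,3), symmetric]) (use g gs y s in simp)
    also have "\<dots> = (far (F g) (far (F h) (s k)) \<cdot> \<alpha> g h y) \<cdot> s (g \<otimes>\<^bsub>G\<^esub> h) \<cdot> band Y y (c g h)"
      using g gs y s cl by (simp add: sc[OF g(1,2)])
    also have "far (F g) (far (F h) (s k)) \<cdot> \<alpha> g h y = \<alpha> g h (fob (F k) y) \<cdot> far (F (g \<otimes>\<^bsub>G\<^esub> h)) (s k)"
      using g y s by (simp add: connecting_natural[OF g(1,2), of "s k" y "fob (F k) y"])
    also have "\<dots> \<cdot> s (g \<otimes>\<^bsub>G\<^esub> h) \<cdot> band Y y (c g h)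
        = \<alpha> g h (fob (F k) y) \<cdot> (far (F (g \<otimes>\<^bsub>G\<^esub> h)) (s k) \<cdot> s (g \<otimes>\<^bsub>G\<^esub> h)) \<cdot> band Y y (c g h)"
      using g gs y s cl by simp
    also have "\<dots> = (\<alpha> g h (fob (F k) y) \<cdot> \<alpha> (g \<otimes>\<^bsub>G\<^esub> h) k y) \<cdot>
        (s (g \<otimes>\<^bsub>G\<^esub> h \<otimes>\<^bsub>G\<^esub> k) \<cdot> band Y y (c (g \<otimes>\<^bsub>G\<^esub> h) k \<otimes>\<^bsub>grp A U\<^esub> c g h))"
      using g gs y s cl by (simp add: sc[OF gs(1) g(3)] band_mult[of y U])
    also have "\<dots> = ?p \<cdot> band Y y (c (g \<otimes>\<^bsub>G\<^esub> h) k \<otimes>\<^bsub>grp A U\<^esub> c g h)"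
      using g gs y s cl by (simp add: strict[OF g y(1)])
    finally show ?thesis
      by (rule band_cancel) (use g gs y s cl \<phi>c in simp_all)
  qed
  obtain S where S: "S \<in> cov X U" and vanish: "\<forall>u \<in> S. \<exists>b. (\<forall>g \<in> carrier G. b g \<in> carrier (grp A (src X u))) \<and>
    (\<forall>g \<in> carrier G. \<forall>h \<in> carrier G. gres A u (c g h) =
      \<phi> g (src X u) (b h) \<otimes>\<^bsub>grp A (src X u)\<^esub> inv\<^bsub>grp A (src X u)\<^esub> (b (g \<otimes>\<^bsub>G\<^esub> h)) \<otimes>\<^bsub>grp A (src X u)\<^esub> b g)"
    using vanish_2[OF van U c cocycle] by blast
  have "objs_over E (src X u) \<noteq> {}" if u: "u \<in> S" for u
  proof -
    note cov = cov_arrs[OF U S u]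
    let ?V = "src X u"
    interpret N: comm_group "grp A ?V" by (simp add: cov)
    obtain b where b: "\<And>g. g \<in> carrier G \<Longrightarrow> b g \<in> carrier (grp A ?V)" and cb: "\<And>g h. \<lbrakk>g \<in> carrier G; h \<in> carrier G\<rbrakk> \<Longrightarrow>
        gres A u (c g h) = \<phi> g ?V (b h) \<otimes>\<^bsub>grp A ?V\<^esub> inv\<^bsub>grp A ?V\<^esub> (b (g \<otimes>\<^bsub>G\<^esub> h)) \<otimes>\<^bsub>grp A ?V\<^esub> b g"
      using vanish u by blast
    have 1: "u \<in> arrs X" "y \<in> objs Y" "tgt X u = pobj Y y"
      using cov y by simp_all
    obtain p where p: "p \<in> arrs Y" "tgt Y p = y" "parr Y p = u" "pobj Y (src Y p) = ?V"
      by (rule pullback[OF 1])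
    let ?w = "src Y p"
    have w: "?w \<in> objs Y"
      using p by simp
    have "\<exists>r. g \<in> carrier G \<longrightarrow> r \<in> arrs Y \<and> src Y r = ?w \<and> tgt Y r = fob (F g) ?w \<and> parr Y r = idt X ?V \<and>
        far (F g) p \<cdot> r = s g \<cdot> p" for g
    proof (cases "g \<in> carrier G")
      case True
      then have 2: "s g \<cdot> p \<in> arrs Y" "far (F g) p \<in> arrs Y" "tgt Y (s g \<cdot> p) = tgt Y (far (F g) p)"
          "parr Y (s g \<cdot> p) = parr Y (far (F g) p)"
        using p s y cov by simp_all
      obtain r where "r \<in> arrs Y" "src Y r = src Y (s g \<cdot> p)" "tgt Y r = src Y (far (F g) p)"
          "parr Y r = idt X (pobj Y (src Y (s g \<cdot> p)))" "far (F g) p \<cdot> r = s g \<cdot> p"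
        by (rule factor_vertical[OF 2])
      then show ?thesis
        using True p s y by (intro exI[of _ r]) simp
    qed simp
    then obtain r where r: "\<And>g. g \<in> carrier G \<Longrightarrow> r g \<in> arrs Y" "\<And>g. g \<in> carrier G \<Longrightarrow> src Y (r g) = ?w"
        "\<And>g. g \<in> carrier G \<Longrightarrow> tgt Y (r g) = fob (F g) ?w" "\<And>g. g \<in> carrier G \<Longrightarrow> parr Y (r g) = idt X ?V"
      and pr: "\<And>g. g \<in> carrier G \<Longrightarrow> far (F g) p \<cdot> r g = s g \<cdot> p"
      by metis
    \<comment> \<open>Pulling the arrows back along p restricts their defect, as composition with
      the image of p under F_h and then F_g shows.\<close>
    have rc: "far (F g) (r h) \<cdot> r g = (\<alpha> g h ?w \<cdot> r (g \<otimes>\<^bsub>G\<^esub> h)) \<cdot> band Y ?w (gres A u (c g h))"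
      if g: "g \<in> carrier G" "h \<in> carrier G" for g h
    proof -
      have gh: "g \<otimes>\<^bsub>G\<^esub> h \<in> carrier G"
        using g by simp
      have c': "gres A u (c g h) \<in> carrier (grp A ?V)"
        using c g cov by simp
      have "far (F g) (far (F h) p) \<cdot> (far (F g) (r h) \<cdot> r g) = far (F g) (far (F h) p \<cdot> r h) \<cdot> r g"
        using g p r by simp
      also have "\<dots> = far (F g) (s h) \<cdot> (far (F g) p \<cdot> r g)"
        using g p r s y by (simp add: pr[OF g(2)])
      also have "\<dots> = (far (F g) (s h) \<cdot> s g) \<cdot> p"
        using g p s y by (simp add: pr[OF g(1)])
      also have "\<dots> = \<alpha> g h y \<cdot> s (g \<otimes>\<^bsub>G\<^esub> h) \<cdot> (band Y y (c g h) \<cdot> p)"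
        using g gh p s y c by (simp add: sc[OF g])
      also have "band Y y (c g h) \<cdot> p = p \<cdot> band Y ?w (gres A u (c g h))"
        using p y c g by (simp add: band_move)
      also have "\<alpha> g h y \<cdot> s (g \<otimes>\<^bsub>G\<^esub> h) \<cdot> \<dots> = \<alpha> g h y \<cdot> (s (g \<otimes>\<^bsub>G\<^esub> h) \<cdot> p) \<cdot> band Y ?w (gres A u (c g h))"
        using g gh p s y c' w by simp
      also have "\<dots> = (\<alpha> g h y \<cdot> far (F (g \<otimes>\<^bsub>G\<^esub> h)) p) \<cdot> r (g \<otimes>\<^bsub>G\<^esub> h) \<cdot> band Y ?w (gres A u (c g h))"
        using g gh p r y c' w by (simp flip: pr[OF gh])
      also have "\<alpha> g h y \<cdot> far (F (g \<otimes>\<^bsub>G\<^esub> h)) p = far (F g) (far (F h) p) \<cdot> \<alpha> g h ?w"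
        by (rule connecting_natural[OF g p(1) refl p(2)])
      finally have "far (F g) (far (F h) p) \<cdot> (far (F g) (r h) \<cdot> r g)
          = far (F g) (far (F h) p) \<cdot> ((\<alpha> g h ?w \<cdot> r (g \<otimes>\<^bsub>G\<^esub> h)) \<cdot> band Y ?w (gres A u (c g h)))"
        using g gh p r c' w by simp
      then show ?thesis
        by (rule cancel_left) (use g gh p r c' w cov in simp_all)
    qed
    \<comment> \<open>Division by b contributes \<phi>_g(b(h))^-1 b(g)^-1 to one side of the
      condition and b(gh)^-1 to the other; the restricted defect makes up for the
      difference.\<close>
    define \<psi> where "\<psi> g = r g \<cdot> band Y ?w (inv\<^bsub>grp A ?V\<^esub> (b g))" for g
    have \<psi>: "\<psi> g \<in> arrs Y" "src Y (\<psi> g) = ?w" "tgt Y (\<psi> g) = fob (F g) ?w" "parr Y (\<psi> g) = idt X ?V"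
      if "g \<in> carrier G" for g
      using that r[OF that] b[OF that] w p cov by (simp_all add: \<psi>_def)
    have \<psi>_cocycle: "\<alpha> g h ?w \<cdot> \<psi> (g \<otimes>\<^bsub>G\<^esub> h) = far (F g) (\<psi> h) \<cdot> \<psi> g" if g: "g \<in> carrier G" "h \<in> carrier G" for g h
    proof -
      have gh: "g \<otimes>\<^bsub>G\<^esub> h \<in> carrier G"
        using g by simp
      note bs = b[OF g(1)] b[OF g(2)] b[OF gh]
      have c': "gres A u (c g h) \<in> carrier (grp A ?V)"
        using c g cov by simp
      let ?x = "\<phi> g ?V (b h)" and ?y = "inv\<^bsub>grp A ?V\<^esub> (b g)"
      have xy: "?x \<in> carrier (grp A ?V)" "?y \<in> carrier (grp A ?V)"
        using bs g cov by simp_all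
      have "far (F g) (\<psi> h) \<cdot> \<psi> g
          = far (F g) (r h) \<cdot> (band Y (fob (F g) ?w) (inv\<^bsub>grp A ?V\<^esub> ?x) \<cdot> r g) \<cdot> band Y ?w ?y"
        using g r bs xy w p cov by (simp add: \<psi>_def action_inv)
      also have "band Y (fob (F g) ?w) (inv\<^bsub>grp A ?V\<^esub> ?x) \<cdot> r g = r g \<cdot> band Y ?w (inv\<^bsub>grp A ?V\<^esub> ?x)"
        using g r xy cov by (simp add: band_move_vertical[of "r g" _ ?V])
      also have "far (F g) (r h) \<cdot> \<dots> \<cdot> band Y ?w ?y
          = (far (F g) (r h) \<cdot> r g) \<cdot> band Y ?w (inv\<^bsub>grp A ?V\<^esub> ?x \<otimes>\<^bsub>grp A ?V\<^esub> ?y)"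
        using g r xy w p cov by (simp add: band_mult[of ?w ?V])
      also have "\<dots> = (\<alpha> g h ?w \<cdot> r (g \<otimes>\<^bsub>G\<^esub> h)) \<cdot>
          band Y ?w (gres A u (c g h) \<otimes>\<^bsub>grp A ?V\<^esub> (inv\<^bsub>grp A ?V\<^esub> ?x \<otimes>\<^bsub>grp A ?V\<^esub> ?y))"
        using g gh r xy c' w p cov by (simp add: rc[OF g] band_mult[of ?w ?V])
      also have "gres A u (c g h) \<otimes>\<^bsub>grp A ?V\<^esub> (inv\<^bsub>grp A ?V\<^esub> ?x \<otimes>\<^bsub>grp A ?V\<^esub> ?y) = inv\<^bsub>grp A ?V\<^esub> (b (g \<otimes>\<^bsub>G\<^esub> h))"
      proof -
        let ?z = "inv\<^bsub>grp A ?V\<^esub> (b (g \<otimes>\<^bsub>G\<^esub> h))"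
        have z: "?z \<in> carrier (grp A ?V)"
          using bs cov by simp
        have "?x \<otimes>\<^bsub>grp A ?V\<^esub> ?z \<otimes>\<^bsub>grp A ?V\<^esub> b g \<otimes>\<^bsub>grp A ?V\<^esub> (inv\<^bsub>grp A ?V\<^esub> ?x \<otimes>\<^bsub>grp A ?V\<^esub> ?y)
            = ?z \<otimes>\<^bsub>grp A ?V\<^esub> (?x \<otimes>\<^bsub>grp A ?V\<^esub> inv\<^bsub>grp A ?V\<^esub> ?x) \<otimes>\<^bsub>grp A ?V\<^esub> (b g \<otimes>\<^bsub>grp A ?V\<^esub> ?y)"
          using xy z bs by (simp only: N.m_ac N.m_closed N.inv_closed)
        then show ?thesis
          using xy z bs cb[OF g] by simp
      qed
      finally show ?thesis
        using g gh r bs w p by (simp add: \<psi>_def)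
    qed
    let ?z = "(?V, ?w, restrict \<psi> (carrier G))"
    have zs: "underlying ?z = ?w" "structure_arrow ?z = restrict \<psi> (carrier G)" "fst ?z = ?V"
      by (simp_all add: underlying_def structure_arrow_def)
    have "?z \<in> objs E"
      unfolding eq_objs_iff zs using w p \<psi> \<psi>_cocycle by simp
    then have "?z \<in> objs_over E ?V"
      using p by (simp add: objs_over_iff zs)
    then show ?thesis
      by blast
  qed
  then show ?thesis
    using S by blast
qed

text \<open>Three successive refinements are used: for objects of \<open>Y\<close>, for vertical
  arrows to all their translates, and for triviality of the defect.\<close>

lemma eq_objects_exist_locally:
  assumes van: "classes_locally_vanish X G A \<phi> 2" and fin: "finite (carrier G)"
    and strict: "\<And>g h k x. \<lbrakk>g \<in> carrier G; h \<in> carrier G; k \<in> carrier G; x \<in> objs Y\<rbrakk> \<Longrightarrow>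
      \<alpha> g h (fob (F k) x) \<cdot> \<alpha> (g \<otimes>\<^bsub>G\<^esub> h) k x = far (F g) (\<alpha> h k x) \<cdot> \<alpha> g (h \<otimes>\<^bsub>G\<^esub> k) x"
    and U: "U \<in> objs X"
  shows "\<exists>S \<in> cov X U. \<forall>u \<in> S. objs_over E (src X u) \<noteq> {}"
proof -
  obtain S where S: "S \<in> cov X U" "\<forall>u \<in> S. objs_over Y (src X u) \<noteq> {}"
    using objects_exist_locally[OF U] by blast
  show ?thesis
  proof (rule local_compose[OF U S(1)])
    fix u assume u: "u \<in> S"
    note cov = cov_arrs[OF U S(1) u]
    obtain y where y: "y \<in> objs Y" "pobj Y y = src X u"
      using S(2) u by (auto simp: objs_over_def)
    obtain R where R: "R \<in> cov X (src X u)" and loc: "\<forall>v \<in> R. \<exists>p \<in> arrs Y. tgt Y p = y \<and> parr Y p = v \<and>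
        (\<forall>g \<in> carrier G. \<exists>\<psi> \<in> arrs Y. src Y \<psi> = src Y p \<and> tgt Y \<psi> = fob (F g) (src Y p) \<and>
          parr Y \<psi> = idt X (src X v))"
      using locally_all_structure_arrows[OF fin subset_refl y(1)] y(2) by auto
    have "\<exists>Q \<in> cov X (src X u). \<forall>w \<in> Q. objs_over E (src X w) \<noteq> {}"
    proof (rule local_compose[OF cov(3) R])
      fix v assume v: "v \<in> R"
      note cv = cov_arrs[OF cov(3) R v]
      obtain p where p: "p \<in> arrs Y" "parr Y p = v" and ex: "\<forall>g \<in> carrier G. \<exists>\<psi> \<in> arrs Y.
          src Y \<psi> = src Y p \<and> tgt Y \<psi> = fob (F g) (src Y p) \<and> parr Y \<psi> = idt X (src X v)"
        using loc v by blast
      then obtain s where s: "\<And>g. g \<in> carrier G \<Longrightarrow> s g \<in> arrs Y" "\<And>g. g \<in> carrier G \<Longrightarrow> src Y (s g) = src Y p"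
          "\<And>g. g \<in> carrier G \<Longrightarrow> tgt Y (s g) = fob (F g) (src Y p)"
          "\<And>g. g \<in> carrier G \<Longrightarrow> parr Y (s g) = idt X (src X v)"
        by metis
      have "src Y p \<in> objs Y" "pobj Y (src Y p) = src X v"
        using p src_parr[OF p(1)] by simp_all
      from structure_locally_exists[OF van strict this s]
      obtain Q where Q: "Q \<in> cov X (src X v)" "\<forall>w \<in> Q. objs_over E (src X w) \<noteq> {}"
        by blast
      have "objs_over E (src X (v \<cdot>\<^bsub>X\<^esub> w)) \<noteq> {}" if "w \<in> Q" for w
        using Q(2) that cov_arrs[OF cv(3) Q(1) that] cv by simp
      then show "\<exists>Q \<in> cov X (src X v). \<forall>w \<in> Q. objs_over E (src X (v \<cdot>\<^bsub>X\<^esub> w)) \<noteq> {}"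
        using Q(1) by blast
    qed
    then obtain Q where Q: "Q \<in> cov X (src X u)" "\<forall>w \<in> Q. objs_over E (src X w) \<noteq> {}"
      by blast
    have "objs_over E (src X (u \<cdot>\<^bsub>X\<^esub> w)) \<noteq> {}" if "w \<in> Q" for w
      using Q(2) that cov_arrs[OF cov(3) Q(1) that] cov by simp
    then show "\<exists>Q \<in> cov X (src X u). \<forall>w \<in> Q. objs_over E (src X (u \<cdot>\<^bsub>X\<^esub> w)) \<noteq> {}"
      using Q(1) by blast
  qed
qed

end

text \<open>F intertwines the two isomorphisms from the sections of B to the automorphism groups,
  hence is bijective on automorphisms, and the criterion for equivalences applies.\<close>

lemma equivariant_morphism_isomorphism:
  assumes Z: "banded_gerbe X B Z" and Y: "banded_gerbe X B Y"
    and F: "equivariant_gerbe_morphism B inclusion Z Y F"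
  shows "equivariant_gerbe_isomorphism X B Z Y F"
proof -
  interpret Z: banded_gerbe X B Z by (rule Z)
  interpret Y: banded_gerbe X B Y by (rule Y)
  have band: "far F (band Z x a) = band Y (fob F x) a" if "x \<in> objs Z" "a \<in> carrier (grp B (pobj Z x))" for x a
    using F that by (auto simp: equivariant_gerbe_morphism_def inclusion_def)
  have bijZ: "bij_betw (band Z x) (carrier (grp B (pobj Z x))) (carrier (aut_group X Z x))" if "x \<in> objs Z" for x
    using Z.band_iso[OF that] by (simp add: iso_def)
  have bijY: "bij_betw (band Y x) (carrier (grp B (pobj Y x))) (carrier (aut_group X Y x))" if "x \<in> objs Y" for x
    using Y.band_iso[OF that] by (simp add: iso_def)
  have mor: "gerbe_morphism Z Y F"
    using F by (simp add: equivariant_gerbe_morphism_def)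
  note s = gerbe_morphism_simps[OF mor]
  have from_band: "\<exists>b \<in> carrier (grp B (pobj Z x)). a = band Z x b"
    if x: "x \<in> objs Z" and a: "a \<in> arrs Z" "src Z a = x" "tgt Z a = x" "parr Z a = idt X (pobj Z x)" for x a
  proof -
    have "a \<in> carrier (aut_group X Z x)"
      using a by (simp add: aut_group_def arrows_over_iff)
    then show ?thesis
      using bijZ[OF x] by (auto simp: bij_betw_def)
  qed
  interpret gerbe_equivalence X Z Y F
  proof
    show "gerbe_morphism Z Y F" by (rule mor)
  next
    fix a x assume a: "a \<in> arrs Z" "src Z a = x" "tgt Z a = x" "parr Z a = idt X (pobj Z x)"
      and eq: "far F a = idt Y (fob F x)"
    have x: "x \<in> objs Z"
      using a by auto
    obtain b where b: "b \<in> carrier (grp B (pobj Z x))" "a = band Z x b"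
      using from_band[OF x a] by blast
    \<comment> \<open>The identity is written as a band element as well, so that injectivity of
      \<open>band Y\<close> can compare b with c.\<close>
    obtain c where c: "c \<in> carrier (grp B (pobj Z x))" "idt Z x = band Z x c"
      using from_band[OF x, of "idt Z x"] x by auto
    have "far F (band Z x b) = far F (band Z x c)"
      using eq b(2) s(3)[OF x] c(2) by simp
    then have "band Y (fob F x) b = band Y (fob F x) c"
      using band x b(1) c(1) by simp
    then have "b = c"
      using bijY[OF s(1)[OF x]] b(1) c(1) s(2)[OF x] by (auto simp: bij_betw_def dest: inj_onD)
    then show "a = idt Z x"
      using b c by simp
  next
    fix x b assume x: "x \<in> objs Z" and b: "b \<in> arrs Y" "src Y b = fob F x" "tgt Y b = fob F x"
      "parr Y b = idt X (pobj Z x)"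
    have "b \<in> carrier (aut_group X Y (fob F x))"
      using b x by (simp add: aut_group_def arrows_over_iff s)
    then obtain a where a: "a \<in> carrier (grp B (pobj Z x))" "b = band Y (fob F x) a"
      using bijY[OF s(1)[OF x]] s(2)[OF x] by (auto simp: bij_betw_def)
    have "band Z x a \<in> carrier (aut_group X Z x)"
      using bijZ[OF x] a(1) by (auto simp: bij_betw_def)
    then show "\<exists>a \<in> arrs Z. src Z a = x \<and> tgt Z a = x \<and> far F a = b"
      using band[OF x a(1)] a(2) by (auto simp: aut_group_def arrows_over_iff intro!: bexI[of _ "band Z x a"])
  qed
  show ?thesis
    using F inverse_exists by (simp add: equivariant_gerbe_isomorphism_def)
qed

section \<open>The forgetful morphism, and comparison with a given gerbe banded by the
  invariants\<close>

definition forgetful_functor ::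
  "(('p, 'q, 'o, 'g) eq_obj, ('p, 'q, 'o, 'm, 'g) eq_arr, 'p, 'q) functor_data" where
  "forgetful_functor = \<lparr>fob = underlying, far = underlying_arrow\<rparr>"

context lifted_gerbe begin

lemma forgetful_equivariant:
  "equivariant_gerbe_morphism (invariants G A \<phi>) inclusion E Y forgetful_functor"
  unfolding equivariant_gerbe_morphism_def gerbe_morphism_def forgetful_functor_def
  by (simp add: objs_over_iff arrows_over_iff inclusion_def)

text \<open>The structure arrows at g are the components, and the equation imposed on arrows of
  \<open>E\<close> is their naturality.\<close>

lemma forgetful_two_isomorphic:
  assumes g: "g \<in> carrier G"
  shows "two_isomorphic X E Y forgetful_functor (F g \<odot> forgetful_functor)"
proof -
  have "two_morphism X E Y forgetful_functor (F g \<odot> forgetful_functor) (\<lambda>z. structure_arrow z g)"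
    unfolding two_morphism_def forgetful_functor_def functor_comp_simps
    using g eq_arr_equivariant[OF _ refl refl g] by (simp add: arrows_over_iff)
  then show ?thesis
    unfolding two_isomorphic_def by blast
qed

text \<open>The condition compares two 2-morphisms from \<Theta> to F_g F_h \<Theta>. Their
  difference is a section over T, so it can be absorbed into \<alpha>(g,h) on all of
  \<open>Y\<close> and not only on the image of \<Theta>.\<close>

lemma adapted_connecting:
  assumes T: "final_object X T" and Z: "abelian_gerbe X Z" and \<Theta>: "gerbe_morphism Z Y \<Theta>"
    and \<eta>: "\<And>g. g \<in> carrier G \<Longrightarrow> two_morphism X Z Y \<Theta> (F g \<odot> \<Theta>) (\<eta> g)"
  obtains \<alpha>' where "connecting X G Y F \<alpha>'"
    "\<And>g h x. \<lbrakk>g \<in> carrier G; h \<in> carrier G; x \<in> objs Z\<rbrakk> \<Longrightarrow>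
      \<alpha>' g h (fob \<Theta> x) \<cdot> \<eta> (g \<otimes>\<^bsub>G\<^esub> h) x = far (F g) (\<eta> h x) \<cdot> \<eta> g x"
proof -
  interpret Z: abelian_gerbe X Z by (rule Z)
  note s = gerbe_morphism_simps[OF \<Theta>]
  note e = two_morphism_simps[OF \<eta>]
  have "\<exists>k. g \<in> carrier G \<longrightarrow> h \<in> carrier G \<longrightarrow> k \<in> carrier (grp A T) \<and>
      (\<forall>x \<in> objs Z. (\<alpha> g h (fob \<Theta> x) \<cdot> \<eta> (g \<otimes>\<^bsub>G\<^esub> h) x) \<cdot> band Y (fob \<Theta> x) (global_res T (pobj Z x) k)
        = far (F g) (\<eta> h x) \<cdot> \<eta> g x)" for g h
  proof (cases "g \<in> carrier G \<and> h \<in> carrier G")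
    case True
    then have g: "g \<in> carrier G" "h \<in> carrier G" "g \<otimes>\<^bsub>G\<^esub> h \<in> carrier G"
      by auto
    let ?H = "F g \<odot> (F h \<odot> \<Theta>)"
    note el = e(1-4)[OF g(1)] e(1-4)[OF g(2)] e(1-4)[OF g(3)]
    have H: "gerbe_morphism Z Y ?H"
      using g by (intro gerbe_morphism_comp[OF gerbe_morphism_comp[OF \<Theta> lift_morphism] lift_morphism])
    have 1: "two_morphism X Z Y \<Theta> ?H (\<lambda>x. \<alpha> g h (fob \<Theta> x) \<cdot> \<eta> (g \<otimes>\<^bsub>G\<^esub> h) x)"
      unfolding two_morphism_def functor_comp_simps
    proof (intro conjI ballI)
      fix x assume "x \<in> objs Z"
      then show "\<alpha> g h (fob \<Theta> x) \<cdot> \<eta> (g \<otimes>\<^bsub>G\<^esub> h) x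
          \<in> arrows_over Y (idt X (pobj Z x)) (fob \<Theta> x) (fob (F g) (fob (F h) (fob \<Theta> x)))"
        using g by (simp add: arrows_over_iff el s)
    next
      fix a assume a: "a \<in> arrs Z"
      let ?x = "src Z a" and ?y = "tgt Z a"
      have "(\<alpha> g h (fob \<Theta> ?y) \<cdot> \<eta> (g \<otimes>\<^bsub>G\<^esub> h) ?y) \<cdot> far \<Theta> a
          = \<alpha> g h (fob \<Theta> ?y) \<cdot> (\<eta> (g \<otimes>\<^bsub>G\<^esub> h) ?y \<cdot> far \<Theta> a)"
        using g a by (simp add: el s)
      also have "\<eta> (g \<otimes>\<^bsub>G\<^esub> h) ?y \<cdot> far \<Theta> a = far (F (g \<otimes>\<^bsub>G\<^esub> h)) (far \<Theta> a) \<cdot> \<eta> (g \<otimes>\<^bsub>G\<^esub> h) ?x"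
        using e(5)[OF g(3) a] by simp
      also have "\<alpha> g h (fob \<Theta> ?y) \<cdot> \<dots> = (\<alpha> g h (fob \<Theta> ?y) \<cdot> far (F (g \<otimes>\<^bsub>G\<^esub> h)) (far \<Theta> a)) \<cdot> \<eta> (g \<otimes>\<^bsub>G\<^esub> h) ?x"
        using g a by (simp add: el s)
      also have "\<dots> = far (F g) (far (F h) (far \<Theta> a)) \<cdot> (\<alpha> g h (fob \<Theta> ?x) \<cdot> \<eta> (g \<otimes>\<^bsub>G\<^esub> h) ?x)"
        using g a connecting_natural[OF g(1,2), of "far \<Theta> a" "fob \<Theta> ?x" "fob \<Theta> ?y"] by (simp add: el s)
      finally show "(\<alpha> g h (fob \<Theta> ?y) \<cdot> \<eta> (g \<otimes>\<^bsub>G\<^esub> h) ?y) \<cdot> far \<Theta> a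
          = far (F g) (far (F h) (far \<Theta> a)) \<cdot> (\<alpha> g h (fob \<Theta> ?x) \<cdot> \<eta> (g \<otimes>\<^bsub>G\<^esub> h) ?x)" .
    qed
    have 2: "two_morphism X Z Y \<Theta> ?H (\<lambda>x. far (F g) (\<eta> h x) \<cdot> \<eta> g x)"
      unfolding two_morphism_def functor_comp_simps
    proof (intro conjI ballI)
      fix x assume "x \<in> objs Z"
      then show "far (F g) (\<eta> h x) \<cdot> \<eta> g x
          \<in> arrows_over Y (idt X (pobj Z x)) (fob \<Theta> x) (fob (F g) (fob (F h) (fob \<Theta> x)))"
        using g by (simp add: arrows_over_iff el s)
    next
      fix a assume a: "a \<in> arrs Z"
      let ?x = "src Z a" and ?y = "tgt Z a"
      have "(far (F g) (\<eta> h ?y) \<cdot> \<eta> g ?y) \<cdot> far \<Theta> a = far (F g) (\<eta> h ?y) \<cdot> (\<eta> g ?y \<cdot> far \<Theta> a)"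
        using g a by (simp add: el s)
      also have "\<eta> g ?y \<cdot> far \<Theta> a = far (F g) (far \<Theta> a) \<cdot> \<eta> g ?x"
        using e(5)[OF g(1) a] by simp
      also have "far (F g) (\<eta> h ?y) \<cdot> \<dots> = far (F g) (\<eta> h ?y \<cdot> far \<Theta> a) \<cdot> \<eta> g ?x"
        using g a by (simp add: el s)
      also have "\<eta> h ?y \<cdot> far \<Theta> a = far (F h) (far \<Theta> a) \<cdot> \<eta> h ?x"
        using e(5)[OF g(2) a] by simp
      also have "far (F g) \<dots> \<cdot> \<eta> g ?x = far (F g) (far (F h) (far \<Theta> a)) \<cdot> (far (F g) (\<eta> h ?x) \<cdot> \<eta> g ?x)"
        using g a by (simp add: el s)
      finally show "(far (F g) (\<eta> h ?y) \<cdot> \<eta> g ?y) \<cdot> far \<Theta> a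
          = far (F g) (far (F h) (far \<Theta> a)) \<cdot> (far (F g) (\<eta> h ?x) \<cdot> \<eta> g ?x)" .
    qed
    show ?thesis
      using two_morphism_difference[OF T \<Theta> H Z 1 2] by blast
  qed blast
  then obtain k where k: "\<And>g h. \<lbrakk>g \<in> carrier G; h \<in> carrier G\<rbrakk> \<Longrightarrow> k g h \<in> carrier (grp A T)"
    and k_eq: "\<And>g h x. \<lbrakk>g \<in> carrier G; h \<in> carrier G; x \<in> objs Z\<rbrakk> \<Longrightarrow>
      (\<alpha> g h (fob \<Theta> x) \<cdot> \<eta> (g \<otimes>\<^bsub>G\<^esub> h) x) \<cdot> band Y (fob \<Theta> x) (global_res T (pobj Z x) (k g h))
        = far (F g) (\<eta> h x) \<cdot> \<eta> g x"
    by metis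
  \<comment> \<open>The correction acts at the image of \<Theta> x under F_gh and reaches \<Theta> x
    by passing through the vertical component of \<eta> at gh.\<close>
  have adapted: "(\<alpha> g h (fob \<Theta> x) \<cdot> band Y (fob (F (g \<otimes>\<^bsub>G\<^esub> h)) (fob \<Theta> x)) (global_res T (pobj Y (fob \<Theta> x)) (k g h)))
      \<cdot> \<eta> (g \<otimes>\<^bsub>G\<^esub> h) x = far (F g) (\<eta> h x) \<cdot> \<eta> g x"
    if g: "g \<in> carrier G" "h \<in> carrier G" and x: "x \<in> objs Z" for g h x
  proof -
    have gh: "g \<otimes>\<^bsub>G\<^esub> h \<in> carrier G"
      using g by simp
    note el = e(1-4)[OF gh x]
    have r: "global_res T (pobj Z x) (k g h) \<in> carrier (grp A (pobj Z x))"
      using T x k[OF g] by simp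
    have "band Y (fob (F (g \<otimes>\<^bsub>G\<^esub> h)) (fob \<Theta> x)) (global_res T (pobj Z x) (k g h)) \<cdot> \<eta> (g \<otimes>\<^bsub>G\<^esub> h) x
        = \<eta> (g \<otimes>\<^bsub>G\<^esub> h) x \<cdot> band Y (fob \<Theta> x) (global_res T (pobj Z x) (k g h))"
      using band_move_vertical[of "\<eta> (g \<otimes>\<^bsub>G\<^esub> h) x" _ "pobj Z x"] el r x by simp
    then have "(\<alpha> g h (fob \<Theta> x) \<cdot> band Y (fob (F (g \<otimes>\<^bsub>G\<^esub> h)) (fob \<Theta> x)) (global_res T (pobj Z x) (k g h)))
        \<cdot> \<eta> (g \<otimes>\<^bsub>G\<^esub> h) x = (\<alpha> g h (fob \<Theta> x) \<cdot> \<eta> (g \<otimes>\<^bsub>G\<^esub> h) x) \<cdot> band Y (fob \<Theta> x) (global_res T (pobj Z x) (k g h))"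
      using g gh x el r by (simp add: s)
    then show ?thesis
      using k_eq[OF g x] x by (simp add: s)
  qed
  have "connecting X G Y F (\<lambda>g h x. \<alpha> g h x \<cdot> band Y (fob (F (g \<otimes>\<^bsub>G\<^esub> h)) x) (global_res T (pobj Y x) (k g h)))"
    by (rule modified_connecting[OF T k])
  from that[OF this adapted] show ?thesis .
qed

text \<open>
  An object \<^term>\<open>x\<close> of \<^term>\<open>Z\<close> is sent to \<open>\<Theta> x\<close> with the structure arrows \<open>\<eta> g x\<close>, which is an
  equivariant object because \<open>\<alpha>\<close> is adapted to \<open>\<eta>\<close>.
\<close>

lemma induced_gerbe_isomorphic:
  assumes van: "classes_locally_vanish X G A \<phi> 1"
    and Z: "banded_gerbe X (invariants G A \<phi>) Z"
    and \<Theta>: "equivariant_gerbe_morphism (invariants G A \<phi>) inclusion Z Y \<Theta>"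
    and \<eta>: "\<And>g. g \<in> carrier G \<Longrightarrow> two_morphism X Z Y \<Theta> (F g \<odot> \<Theta>) (\<eta> g)"
    and adapted: "\<And>g h x. \<lbrakk>g \<in> carrier G; h \<in> carrier G; x \<in> objs Z\<rbrakk> \<Longrightarrow>
      \<alpha> g h (fob \<Theta> x) \<cdot> \<eta> (g \<otimes>\<^bsub>G\<^esub> h) x = far (F g) (\<eta> h x) \<cdot> \<eta> g x"
  shows "banded_gerbe X (invariants G A \<phi>) E"
    and "\<exists>\<Phi>. equivariant_gerbe_isomorphism X (invariants G A \<phi>) Z E \<Phi>"
proof -
  interpret Z: banded_gerbe X "invariants G A \<phi>" Z by (rule Z)
  have mor: "gerbe_morphism Z Y \<Theta>"
    using \<Theta> by (simp add: equivariant_gerbe_morphism_def)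
  note s = gerbe_morphism_simps[OF mor]
  note e = two_morphism_simps[OF \<eta>]
  define ob where "ob x = (pobj Z x, fob \<Theta> x, \<lambda>g \<in> carrier G. \<eta> g x)" for x
  have ob_simps: "underlying (ob x) = fob \<Theta> x" "structure_arrow (ob x) = (\<lambda>g \<in> carrier G. \<eta> g x)"
      "fst (ob x) = pobj Z x" for x
    by (simp_all add: ob_def underlying_def structure_arrow_def)
  have ob: "ob x \<in> objs E" if x: "x \<in> objs Z" for x
    unfolding eq_objs_iff ob_simps using x e adapted by (simp add: s)
  have pobj_ob: "pobj E (ob x) = pobj Z x" if "x \<in> objs Z" for x
    using ob[OF that] that by (simp add: ob_simps s)
  define ar where "ar a = eq_arrow (ob (src Z a)) (far \<Theta> a) (ob (tgt Z a))" for a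
  have ar: "ar a \<in> arrs E" if a: "a \<in> arrs Z" for a
  proof -
    have "\<eta> g (tgt Z a) \<cdot> far \<Theta> a = far (F g) (far \<Theta> a) \<cdot> \<eta> g (src Z a)" if "g \<in> carrier G" for g
      using e(5)[OF that a] by simp
    then show ?thesis
      unfolding eq_arrs_iff ar_def using a ob by (simp add: s ob_simps)
  qed
  have ar_simps: "src E (ar a) = ob (src Z a)" "tgt E (ar a) = ob (tgt Z a)" "underlying_arrow (ar a) = far \<Theta> a"
      "parr E (ar a) = parr Y (far \<Theta> a)" for a
    by (simp_all add: ar_def)
  show gerbe: "banded_gerbe X (invariants G A \<phi>) E"
  proof (rule eq_banded_gerbe[OF van])
    fix U assume "U \<in> objs X"
    then obtain S where S: "S \<in> cov X U" "\<forall>u \<in> S. objs_over Z (src X u) \<noteq> {}"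
      using Z.objects_exist_locally by blast
    \<comment> \<open>Local objects are supplied by \<open>Z\<close>, since \<open>ob\<close> keeps
      the base object.\<close>
    have "objs_over E V \<noteq> {}" if V: "objs_over Z V \<noteq> {}" for V
    proof -
      obtain x where "x \<in> objs Z" "pobj Z x = V"
        using V by (auto simp: objs_over_def)
      then have "ob x \<in> objs_over E V"
        using ob pobj_ob unfolding objs_over_iff by blast
      then show ?thesis
        by blast
    qed
    then show "\<exists>S \<in> cov X U. \<forall>u \<in> S. objs_over E (src X u) \<noteq> {}"
      using S(2) by (intro bexI[OF _ S(1)] ballI) simp
  qed
  let ?\<Phi> = "\<lparr>fob = ob, far = ar\<rparr>"
  have "equivariant_gerbe_morphism (invariants G A \<phi>) inclusion Z E ?\<Phi>"
    unfolding equivariant_gerbe_morphism_def gerbe_morphism_def functor_data.simps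
  proof (intro conjI ballI impI)
    fix x assume x: "x \<in> objs Z"
    show "ob x \<in> objs_over E (pobj Z x)"
      using ob[OF x] pobj_ob[OF x] unfolding objs_over_iff by blast
    show "ar (idt Z x) = idt E (ob x)"
      by (rule eq_arr_eqI) (use x ar[of "idt Z x"] eq_idt_arrs[OF ob[OF x]] in \<open>simp_all add: ar_simps ob_simps s\<close>)
  next
    fix a assume a: "a \<in> arrs Z"
    show "ar a \<in> arrows_over E (parr Z a) (ob (src Z a)) (ob (tgt Z a))"
      using ar[OF a] s(7)[OF a] by (simp add: arrows_over_iff ar_simps)
    fix b assume b: "b \<in> arrs Z" "src Z b = tgt Z a"
    have "ar b \<cdot>\<^bsub>E\<^esub> ar a \<in> arrs E"
      by (rule eq_cmp_arrs[OF ar[OF a] ar[OF b(1)]]) (simp add: ar_simps b)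
    then show "ar (b \<cdot>\<^bsub>Z\<^esub> a) = ar b \<cdot>\<^bsub>E\<^esub> ar a"
      by (rule eq_arr_eqI[rotated]) (use a b ar[of "b \<cdot>\<^bsub>Z\<^esub> a"] in \<open>simp_all add: ar_simps s\<close>)
  next
    fix x a assume x: "x \<in> objs Z" and a: "a \<in> carrier (grp (invariants G A \<phi>) (pobj Z x))"
    have band: "band Z x a \<in> arrs Z" "src Z (band Z x a) = x" "tgt Z (band Z x a) = x"
      using Z.band_iso[OF x] a by (auto simp: iso_def hom_def Pi_iff aut_group_def arrows_over_iff simp del: carrier_invariants)
    have "far \<Theta> (band Z x a) = band Y (fob \<Theta> x) a"
      using \<Theta> x a unfolding equivariant_gerbe_morphism_def inclusion_def by blast
    moreover have "band E (ob x) a \<in> arrs E"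
      by (rule eq_band_arrs[OF ob[OF x]]) (use a x in \<open>simp add: ob_simps s\<close>)
    ultimately show "ar (band Z x a) = band E (ob x) (inclusion (pobj Z x) a)"
      using ar[OF band(1)] band by (intro eq_arr_eqI) (simp_all add: ar_simps ob_simps inclusion_def)
  qed
  from equivariant_morphism_isomorphism[OF Z gerbe this]
  show "\<exists>\<Phi>. equivariant_gerbe_isomorphism X (invariants G A \<phi>) Z E \<Phi>"
    by blast
qed

end

section \<open>Existence and classification for gerbes, existence for torsors\<close>

lemma gerbe_lift_connecting:
  assumes "gerbe_lift X G A \<phi> Y F"
  shows "\<exists>\<alpha>. connecting X G Y F \<alpha>"
proof -
  have "\<forall>g h. \<exists>\<eta>. g \<in> carrier G \<longrightarrow> h \<in> carrier G \<longrightarrow> two_morphism X Y Y (F (g \<otimes>\<^bsub>G\<^esub> h)) (F g \<odot> F h) \<eta>"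
    using assms by (auto simp: gerbe_lift_def gerbe_action_def two_isomorphic_def)
  then obtain \<alpha> where "\<forall>g h. g \<in> carrier G \<longrightarrow> h \<in> carrier G \<longrightarrow> two_morphism X Y Y (F (g \<otimes>\<^bsub>G\<^esub> h)) (F g \<odot> F h) (\<alpha> g h)"
    by metis
  then show ?thesis
    unfolding connecting_def by blast
qed

context sheaf_action begin

lemma lifted_gerbeI:
  assumes "banded_gerbe X A Y" "gerbe_lift X G A \<phi> Y F" "connecting X G Y F \<alpha>"
  shows "lifted_gerbe X G A \<phi> Y F \<alpha>"
  using assms by (intro lifted_gerbe.intro sheaf_banded_gerbe.intro lifted_gerbe_axioms.intro
      sheaf_action_axioms abelian_sheaf_axioms)

lemma gerbe_induced:
  fixes Y :: "('p, 'q, 'o, 'm, 'a) gerbe"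
  assumes T: "final_object X T" and fin: "finite (carrier G)"
    and van: "classes_locally_vanish X G A \<phi> 1" "classes_locally_vanish X G A \<phi> 2"
    and Y: "banded_gerbe X A Y" and lift: "gerbe_lift X G A \<phi> Y F"
    and trivial: "gerbe_obstruction X T G A \<phi> Y F = \<one>\<^bsub>section_cohomology G A \<phi> 3 T\<^esub>"
  shows "\<exists>(Z :: ('p, 'q, 'o, 'm, 'g, 'a) eq_gerbe) \<Theta>. banded_gerbe X (invariants G A \<phi>) Z \<and>
    equivariant_gerbe_morphism (invariants G A \<phi>) inclusion Z Y \<Theta> \<and>
    (\<forall>g \<in> carrier G. two_isomorphic X Z Y \<Theta> (F g \<odot> \<Theta>))"
proof -
  \<comment> \<open>The obstruction class is computed from this particular choice, so the correction
    has to start from it.\<close>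
  define \<alpha> where "\<alpha> = (SOME \<alpha>. connecting X G Y F \<alpha>)"
  have "connecting X G Y F \<alpha>"
    unfolding \<alpha>_def by (rule someI_ex[OF gerbe_lift_connecting[OF lift]])
  then interpret L: lifted_gerbe X G A \<phi> Y F \<alpha>
    by (rule lifted_gerbeI[OF Y lift])
  have "cohomology_class G (grp A T) (\<lambda>g. \<phi> g T) 3
       (\<lambda>gs \<in> tuples G 3. gerbe_cocycle X T G A Y F \<alpha> (gs ! 0) (gs ! 1) (gs ! 2))
       = \<one>\<^bsub>section_cohomology G A \<phi> 3 T\<^esub>"
    using trivial by (simp add: gerbe_obstruction_def \<alpha>_def Let_def)
  from L.strict_connecting[OF T this] obtain \<alpha>' where \<alpha>': "connecting X G Y F \<alpha>'"
    "\<And>g h k x. \<lbrakk>g \<in> carrier G; h \<in> carrier G; k \<in> carrier G; x \<in> objs Y\<rbrakk> \<Longrightarrow>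
      \<alpha>' g h (fob (F k) x) \<cdot>\<^bsub>Y\<^esub> \<alpha>' (g \<otimes>\<^bsub>G\<^esub> h) k x = far (F g) (\<alpha>' h k x) \<cdot>\<^bsub>Y\<^esub> \<alpha>' g (h \<otimes>\<^bsub>G\<^esub> k) x"
    by metis
  \<comment> \<open>The connecting 2-morphisms are a parameter of the locale, so the equivariant
    objects are now formed with the corrected ones.\<close>
  interpret L': lifted_gerbe X G A \<phi> Y F \<alpha>'
    by (rule lifted_gerbeI[OF Y lift \<alpha>'(1)])
  have "banded_gerbe X (invariants G A \<phi>) L'.E"
    by (rule L'.eq_banded_gerbe[OF van(1)]) (rule L'.eq_objects_exist_locally[OF van(2) fin \<alpha>'(2)])
  then show ?thesis
    using L'.forgetful_equivariant L'.forgetful_two_isomorphic by blast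
qed

text \<open>Any connecting 2-morphisms serve as a start. The correction is dictated by the
  2-isomorphisms chosen for \<open>Z\<close>, and the resulting \<alpha> depends on them.\<close>

lemma gerbe_classification:
  assumes T: "final_object X T"
    and van: "classes_locally_vanish X G A \<phi> 1"
    and Y: "banded_gerbe X A Y" and lift: "gerbe_lift X G A \<phi> Y F"
    and Z: "banded_gerbe X (invariants G A \<phi>) Z"
    and \<Theta>: "equivariant_gerbe_morphism (invariants G A \<phi>) inclusion Z Y \<Theta>"
    and iso: "\<forall>g \<in> carrier G. two_isomorphic X Z Y \<Theta> (F g \<odot> \<Theta>)"
  shows "\<exists>\<alpha>. connecting X G Y F \<alpha> \<and>
    banded_gerbe X (invariants G A \<phi>) (equivariant_objects X G Y F \<alpha>) \<and>
    (\<exists>\<Phi>. equivariant_gerbe_isomorphism X (invariants G A \<phi>) Z (equivariant_objects X G Y F \<alpha>) \<Phi>)"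
proof -
  obtain \<alpha> where "connecting X G Y F \<alpha>"
    using gerbe_lift_connecting[OF lift] by blast
  then interpret L: lifted_gerbe X G A \<phi> Y F \<alpha>
    by (rule lifted_gerbeI[OF Y lift])
  interpret Z: banded_gerbe X "invariants G A \<phi>" Z by (rule Z)
  obtain \<eta> where \<eta>: "\<And>g. g \<in> carrier G \<Longrightarrow> two_morphism X Z Y \<Theta> (F g \<odot> \<Theta>) (\<eta> g)"
    using iso unfolding two_isomorphic_def by metis
  have mor: "gerbe_morphism Z Y \<Theta>"
    using \<Theta> by (simp add: equivariant_gerbe_morphism_def)
  obtain \<alpha>' where \<alpha>': "connecting X G Y F \<alpha>'"
    "\<And>g h x. \<lbrakk>g \<in> carrier G; h \<in> carrier G; x \<in> objs Z\<rbrakk> \<Longrightarrow>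
      \<alpha>' g h (fob \<Theta> x) \<cdot>\<^bsub>Y\<^esub> \<eta> (g \<otimes>\<^bsub>G\<^esub> h) x = far (F g) (\<eta> h x) \<cdot>\<^bsub>Y\<^esub> \<eta> g x"
    using L.adapted_connecting[OF T Z.abelian_gerbe_axioms mor \<eta>] by metis
  interpret L': lifted_gerbe X G A \<phi> Y F \<alpha>'
    by (rule lifted_gerbeI[OF Y lift \<alpha>'(1)])
  show ?thesis
    using \<alpha>'(1) L'.induced_gerbe_isomorphic[OF van Z \<Theta> \<eta> \<alpha>'(2)] by blast
qed

lemma torsor_induced:
  fixes y :: "('o, 'm, 's, 'a) torsor"
  assumes van: "classes_locally_vanish X G A \<phi> 1" and y: "torsor X A y" and lift: "torsor_lift X G A \<phi> y l"
    and strict: "\<And>g h U s. \<lbrakk>g \<in> carrier G; h \<in> carrier G; U \<in> objs X; s \<in> sec y U\<rbrakk>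
      \<Longrightarrow> l g U (l h U s) = l (g \<otimes>\<^bsub>G\<^esub> h) U s"
  shows "\<exists>(z :: ('o, 'm, 's, 'a) torsor) f. torsor X (invariants G A \<phi>) z \<and>
    equivariant_torsor_morphism X (invariants G A \<phi>) inclusion z y f \<and>
    (\<forall>g \<in> carrier G. \<forall>U \<in> objs X. \<forall>s \<in> sec z U. l g U (f U s) = f U s)"
  by (intro exI[of _ "fixed_subsheaf y l"] exI[of _ inclusion] conjI fixed_subsheaf_inclusion
      fixed_subsheaf_torsor[OF van y lift strict]) (auto simp: inclusion_def)

lemma trivial_torsor_cocycle:
  assumes T: "final_object X T" and y: "torsor X A y" and lift: "torsor_lift X G A \<phi> y l"
    and trivial: "\<forall>g \<in> carrier G. \<forall>h \<in> carrier G. torsor_cocycle X T G A y l g h = \<one>\<^bsub>grp A T\<^esub>"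
    and g: "g \<in> carrier G" "h \<in> carrier G" and U: "U \<in> objs X" and s: "s \<in> sec y U"
  shows "l g U (l h U s) = l (g \<otimes>\<^bsub>G\<^esub> h) U s"
proof -
  interpret y: torsor X A y by (rule y)
  have "gres A (to_final X T U) \<one>\<^bsub>grp A T\<^esub> = \<one>\<^bsub>grp A U\<^esub>"
    using final_arr[OF T U] by (simp add: gres_one)
  moreover have "l (g \<otimes>\<^bsub>G\<^esub> h) U s \<in> sec y U"
    using torsor_lift_simps(1)[OF lift _ U s] g by simp
  ultimately show ?thesis
    using torsor_cocycle(2)[OF T y lift g U s] trivial g U by (simp add: y.smul_one)
qed

end

text \<open>The competing torsors and gerbes have type variables of their own, so that uniqueness
  and classification are not confined to the types on which the witnesses live.\<close>

theorem theorem4p35: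
  fixes X :: "('o, 'm) site" and T :: 'o
    and G :: "'g monoid" and A :: "('o, 'm, 'a) abelian_sheaf"
    and \<phi> :: "'g \<Rightarrow> 'o \<Rightarrow> 'a \<Rightarrow> 'a"
  assumes site: "site X" and final: "final_object X T"
    and group: "group G" and finite: "finite (carrier G)"
    and sheaf: "abelian_sheaf X A" and action: "sheaf_action X G A \<phi>"
  shows
    "\<comment> \<open>(I)\<close>
     (\<forall>y :: ('o, 'm, 's, 'a) torsor. torsor X A y \<longrightarrow>
        (\<exists>l. torsor_lift X G A \<phi> y l \<and>
          torsor_obstruction X T G A \<phi> y l = \<one>\<^bsub>section_cohomology G A \<phi> 2 T\<^esub>) \<longrightarrow>
        classes_locally_vanish X G A \<phi> 1 \<longrightarrow>
        torsor_induced_from_invariants X G A \<phi> y) \<and>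
    \<comment> \<open>(II)\<close>
     (\<forall>Y :: ('p, 'q, 'o, 'm, 'a) gerbe. banded_gerbe X A Y \<longrightarrow>
        (\<exists>F. gerbe_lift X G A \<phi> Y F \<and>
          gerbe_obstruction X T G A \<phi> Y F = \<one>\<^bsub>section_cohomology G A \<phi> 3 T\<^esub>) \<longrightarrow>
        classes_locally_vanish X G A \<phi> 1 \<longrightarrow> classes_locally_vanish X G A \<phi> 2 \<longrightarrow>
        gerbe_induced_from_invariants X G A \<phi> Y) \<and>
    \<comment> \<open>(1)\<close>
     (classes_locally_vanish X G A \<phi> 1 \<longrightarrow>
      (\<forall>(y :: ('o, 'm, 's, 'a) torsor) l. torsor X A y \<longrightarrow> torsor_lift X G A \<phi> y l \<longrightarrow>
        (\<forall>g \<in> carrier G. \<forall>h \<in> carrier G. torsor_cocycle X T G A y l g h = \<one>\<^bsub>grp A T\<^esub>) \<longrightarrow>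
        (\<exists>(z :: ('o, 'm, 's, 'a) torsor) f. torsor X (invariants G A \<phi>) z \<and>
          equivariant_torsor_morphism X (invariants G A \<phi>) inclusion z y f \<and>
          (\<forall>g \<in> carrier G. \<forall>U \<in> objs X. \<forall>s \<in> sec z U. l g U (f U s) = f U s)) \<and>
        (\<forall>(z\<^sub>1 :: ('o, 'm, 't, 'a) torsor) (z\<^sub>2 :: ('o, 'm, 'u, 'a) torsor) f\<^sub>1 f\<^sub>2.
          torsor X (invariants G A \<phi>) z\<^sub>1 \<and>
          equivariant_torsor_morphism X (invariants G A \<phi>) inclusion z\<^sub>1 y f\<^sub>1 \<and>
          (\<forall>g \<in> carrier G. \<forall>U \<in> objs X. \<forall>s \<in> sec z\<^sub>1 U. l g U (f\<^sub>1 U s) = f\<^sub>1 U s) \<and>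
          torsor X (invariants G A \<phi>) z\<^sub>2 \<and>
          equivariant_torsor_morphism X (invariants G A \<phi>) inclusion z\<^sub>2 y f\<^sub>2 \<and>
          (\<forall>g \<in> carrier G. \<forall>U \<in> objs X. \<forall>s \<in> sec z\<^sub>2 U. l g U (f\<^sub>2 U s) = f\<^sub>2 U s) \<longrightarrow>
          (\<exists>k. equivariant_torsor_isomorphism X (invariants G A \<phi>) z\<^sub>1 z\<^sub>2 k)))) \<and>
    \<comment> \<open>(2)\<close>
     (classes_locally_vanish X G A \<phi> 1 \<longrightarrow> classes_locally_vanish X G A \<phi> 2 \<longrightarrow>
      (\<forall>(Y :: ('p, 'q, 'o, 'm, 'a) gerbe) F. banded_gerbe X A Y \<longrightarrow> gerbe_lift X G A \<phi> Y F \<longrightarrow>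
        gerbe_obstruction X T G A \<phi> Y F = \<one>\<^bsub>section_cohomology G A \<phi> 3 T\<^esub> \<longrightarrow>
        (\<exists>(Z :: ('p, 'q, 'o, 'm, 'g, 'a) eq_gerbe) \<Theta>. banded_gerbe X (invariants G A \<phi>) Z \<and>
          equivariant_gerbe_morphism (invariants G A \<phi>) inclusion Z Y \<Theta> \<and>
          (\<forall>g \<in> carrier G. two_isomorphic X Z Y \<Theta> (F g \<odot> \<Theta>))) \<and>
        (\<forall>(Z :: ('v, 'w, 'o, 'm, 'a) gerbe) \<Theta>. banded_gerbe X (invariants G A \<phi>) Z \<and>
          equivariant_gerbe_morphism (invariants G A \<phi>) inclusion Z Y \<Theta> \<and>
          (\<forall>g \<in> carrier G. two_isomorphic X Z Y \<Theta> (F g \<odot> \<Theta>)) \<longrightarrow>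
          (\<exists>\<alpha>. connecting X G Y F \<alpha> \<and>
            banded_gerbe X (invariants G A \<phi>) (equivariant_objects X G Y F \<alpha>) \<and>
            (\<exists>\<Phi>. equivariant_gerbe_isomorphism X (invariants G A \<phi>) Z
              (equivariant_objects X G Y F \<alpha>) \<Phi>)))))"
proof -
  interpret sheaf_action X G A \<phi> by (rule action)
  show ?thesis
  proof (intro conjI allI impI)
    fix y :: "('o, 'm, 's, 'a) torsor"
    assume y: "torsor X A y" and van: "classes_locally_vanish X G A \<phi> 1"
    assume "\<exists>l. torsor_lift X G A \<phi> y l \<and>
      torsor_obstruction X T G A \<phi> y l = \<one>\<^bsub>section_cohomology G A \<phi> 2 T\<^esub>"
    then obtain l where l: "torsor_lift X G A \<phi> y l"
        "torsor_obstruction X T G A \<phi> y l = \<one>\<^bsub>section_cohomology G A \<phi> 2 T\<^esub>"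
      by blast
    obtain l' where l': "torsor_lift X G A \<phi> y l'"
        "\<And>g h U s. \<lbrakk>g \<in> carrier G; h \<in> carrier G; U \<in> objs X; s \<in> sec y U\<rbrakk>
          \<Longrightarrow> l' g U (l' h U s) = l' (g \<otimes>\<^bsub>G\<^esub> h) U s"
      using strict_lift[OF final y l] by metis
    show "torsor_induced_from_invariants X G A \<phi> y"
      using torsor_induced[OF van y l'] unfolding torsor_induced_from_invariants_def by blast
  next
    fix Y :: "('p, 'q, 'o, 'm, 'a) gerbe"
    assume Y: "banded_gerbe X A Y" and van: "classes_locally_vanish X G A \<phi> 1" "classes_locally_vanish X G A \<phi> 2"
    assume "\<exists>F. gerbe_lift X G A \<phi> Y F \<and>
      gerbe_obstruction X T G A \<phi> Y F = \<one>\<^bsub>section_cohomology G A \<phi> 3 T\<^esub>"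
    then show "gerbe_induced_from_invariants X G A \<phi> Y"
      using gerbe_induced[OF final finite van Y] unfolding gerbe_induced_from_invariants_def by blast
  next
    fix y :: "('o, 'm, 's, 'a) torsor" and l
    assume van: "classes_locally_vanish X G A \<phi> 1" and y: "torsor X A y" and l: "torsor_lift X G A \<phi> y l"
      and trivial: "\<forall>g \<in> carrier G. \<forall>h \<in> carrier G. torsor_cocycle X T G A y l g h = \<one>\<^bsub>grp A T\<^esub>"
    show "\<exists>(z :: ('o, 'm, 's, 'a) torsor) f. torsor X (invariants G A \<phi>) z \<and>
        equivariant_torsor_morphism X (invariants G A \<phi>) inclusion z y f \<and>
        (\<forall>g \<in> carrier G. \<forall>U \<in> objs X. \<forall>s \<in> sec z U. l g U (f U s) = f U s)"
      by (rule torsor_induced[OF van y l trivial_torsor_cocycle[OF final y l trivial]])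
  next
    fix y :: "('o, 'm, 's, 'a) torsor" and l
      and z1 :: "('o, 'm, 't, 'a) torsor" and z2 :: "('o, 'm, 'u, 'a) torsor" and f1 f2
    assume y: "torsor X A y" and l: "torsor_lift X G A \<phi> y l"
    assume "torsor X (invariants G A \<phi>) z1 \<and>
      equivariant_torsor_morphism X (invariants G A \<phi>) inclusion z1 y f1 \<and>
      (\<forall>g \<in> carrier G. \<forall>U \<in> objs X. \<forall>s \<in> sec z1 U. l g U (f1 U s) = f1 U s) \<and>
      torsor X (invariants G A \<phi>) z2 \<and>
      equivariant_torsor_morphism X (invariants G A \<phi>) inclusion z2 y f2 \<and>
      (\<forall>g \<in> carrier G. \<forall>U \<in> objs X. \<forall>s \<in> sec z2 U. l g U (f2 U s) = f2 U s)"
    then show "\<exists>k. equivariant_torsor_isomorphism X (invariants G A \<phi>) z1 z2 k"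
      using equivariant_inclusion_unique[OF y l] by blast
  next
    fix Y :: "('p, 'q, 'o, 'm, 'a) gerbe" and F
    assume van: "classes_locally_vanish X G A \<phi> 1" "classes_locally_vanish X G A \<phi> 2"
      and Y: "banded_gerbe X A Y" and F: "gerbe_lift X G A \<phi> Y F"
        "gerbe_obstruction X T G A \<phi> Y F = \<one>\<^bsub>section_cohomology G A \<phi> 3 T\<^esub>"
    show "\<exists>(Z :: ('p, 'q, 'o, 'm, 'g, 'a) eq_gerbe) \<Theta>. banded_gerbe X (invariants G A \<phi>) Z \<and>
        equivariant_gerbe_morphism (invariants G A \<phi>) inclusion Z Y \<Theta> \<and>
        (\<forall>g \<in> carrier G. two_isomorphic X Z Y \<Theta> (F g \<odot> \<Theta>))"
      by (rule gerbe_induced[OF final finite van Y F])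
  next
    fix Y :: "('p, 'q, 'o, 'm, 'a) gerbe" and F and Z :: "('v, 'w, 'o, 'm, 'a) gerbe" and \<Theta>
    assume van: "classes_locally_vanish X G A \<phi> 1"
      and Y: "banded_gerbe X A Y" and F: "gerbe_lift X G A \<phi> Y F"
    assume "banded_gerbe X (invariants G A \<phi>) Z \<and>
      equivariant_gerbe_morphism (invariants G A \<phi>) inclusion Z Y \<Theta> \<and>
      (\<forall>g \<in> carrier G. two_isomorphic X Z Y \<Theta> (F g \<odot> \<Theta>))"
    then show "\<exists>\<alpha>. connecting X G Y F \<alpha> \<and>
        banded_gerbe X (invariants G A \<phi>) (equivariant_objects X G Y F \<alpha>) \<and>
        (\<exists>\<Phi>. equivariant_gerbe_isomorphism X (invariants G A \<phi>) Z (equivariant_objects X G Y F \<alpha>) \<Phi>)"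
      using gerbe_classification[OF final van Y F] by blast
  qed
qed

end
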